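(* Let $L$ be a self-adjoint realisation of $\ell$ in $L^2(a,b;w)$ with separated boundary conditions, each endpoint being of lim-2, lim-3 or lim-4 type, and let $L_j$ be the regular truncated operators on $[a_j,b_j]$, $a_j\to a$, $b_j\to b$, constructed as described in the context. Then the sequence $(L_j)$ is spectrally inclusive for $L$: for every $\lambda\in\mathrm{Sp}(L)$ there is a sequence $(\lambda^{(j)})$ with $\lambda^{(j)}\in\mathrm{Sp}(L_j)$ and $\lim_{j\to\infty}\lambda^{(j)}=\lambda$.
   Context: Let $-\infty\le a<b\le\infty$, and let $p,s,q,w$ be real-valued on $(a,b)$ with $1/p,s,q,w\in L^1_{loc}(a,b)$ and $p,w>0$ a.e. Quasi-derivatives: $y^{[0]}=y$, $y^{[1]}=y'$, $y^{[2]}=py''$, $y^{[3]}=-(py'')'+sy'$; $u_y=(y^{[0]},y^{[1]})^T$, $v_y=(y^{[3]},y^{[2]})^T$. $\ell y=\frac1w\{[(py'')'-sy']'+qy\}=\frac1w\{-(y^{[3]})'+qy\}$. $L^2(a,b;w)$ has inner product $\int_a^b f\overline g\,w\,dx$. An endpoint is regular if it is finite and $1/p,s,q,w$ are integrable up to it; otherwise singular. An endpoint is of lim-$p$ type if the space of solutions of $\ell y=iy$ square integrable (with weight $w$) near that endpoint has dimension $p\in\{2,3,4\}$; regular endpoints are lim-4. $D_{max}$: all $y$ with $y^{[0]},\dots,y^{[3]}$ locally absolutely continuous on $(a,b)$ and $y,\ell y\in L^2(a,b;w)$. $D_{min}$: closure, in the graph norm $(\|y\|^2+\|\ell y\|^2)^{1/2}$,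 of the set of functions in $D_{max}$ with compact support in $(a,b)$. $[f,g](x)=u_f^T\overline{v_g}-v_f^T\overline{u_g}$ at $x$; for $f,g\in D_{max}$ the limits at $a$ and $b$ exist. $L$ is $y\mapsto\ell y$ on the set of $y\in D_{max}$ satisfying the boundary conditions below. Self-adjoint boundary conditions at a regular point $c$ are conditions $A_1u_y(c)+A_2v_y(c)=0$ with $A_1,A_2$ $2\times2$ matrices, $(A_1\ A_2)$ of rank 2, $A_1A_2^*$ Hermitian. Boundary conditions and truncation, for each endpoint $e\in\{a,b\}$ with truncation point $e_j$ ($a_j$ or $b_j$; $a_j<b_j$, and $a_j\to a+$, $b_j\to b-$ with points in $(a,b)$ at singular endpoints): - $e$ regular: $e_j=e$, and $L$, $L_j$ have the same self-adjoint boundary conditions there. - $e$ singular lim-2: no boundary condition for $L$; $L_j$ has $y(e_j)=0=y'(e_j)$. - $e$ singular lim-3: $L$ has the condition $[y,\chi](e)=0$, where $\chi\in D_{max}\setminus D_{min}$ is real-valued and vanishes near the other endpoint; $L_j$ has $[y,\chi](e_j)=0$ plus one other condition, together forming self-adjoint boundary conditions at $e_j$ (necessarily satisfied by $\chi$). - $e$ singular lim-4: $L$ has the conditions $[y,\chi_1](e)=0=[y,\chi_2](e)$, where $\chi_1,\chi_2\in D_{max}$ vanish near the other endpoint, have no nontrivial linear combination in $D_{min}$, satisfy $[\chi_1,\chi_1](e)=[\chi_1,\chi_2](e)=[\chi_2,\chi_2](e)=0$, and near $e$ are solutions of $\ell y=\lambda_0 y$ for some real $\lambda_0$; $L_j$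 has $[y,\chi_1](e_j)=0=[y,\chi_2](e_j)$ (for $j$ large enough that $e_j$ lies where $\chi_1,\chi_2$ are solutions). *)

theory Defs
  imports "HOL-Analysis.Analysis" "HOL-Library.Function_Algebras"
begin

section \<open>The differential expression and its quasi-derivatives\<close>

record coeffs =
  coef_p :: "real \<Rightarrow> real"
  coef_s :: "real \<Rightarrow> real"
  coef_q :: "real \<Rightarrow> real"
  coef_w :: "real \<Rightarrow> real"

definition locally_integrable :: "ereal \<Rightarrow> ereal \<Rightarrow> (real \<Rightarrow> real) \<Rightarrow> bool" where
  "locally_integrable a b f \<longleftrightarrow>
     (\<forall>c d. {c..d} \<subseteq> einterval a b \<longrightarrow> set_integrable lebesgue {c..d} f)"

definition admissible :: "coeffs \<Rightarrow> ereal \<Rightarrow> ereal \<Rightarrow> bool" where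
  "admissible K a b \<longleftrightarrow> a < b \<and>
     locally_integrable a b (\<lambda>x. 1 / coef_p K x) \<and> locally_integrable a b (coef_s K) \<and>
     locally_integrable a b (coef_q K) \<and> locally_integrable a b (coef_w K) \<and>
     (AE x in lebesgue. x \<in> einterval a b \<longrightarrow> coef_p K x > 0 \<and> coef_w K x > 0)"

definition abs_continuous_on :: "real \<Rightarrow> real \<Rightarrow> (real \<Rightarrow> complex) \<Rightarrow> bool" where
  "abs_continuous_on c d f \<longleftrightarrow>
     (\<forall>\<epsilon>>0. \<exists>\<delta>>0. \<forall>(n::nat) u v.
        (\<forall>i<n. c \<le> u i \<and> u i \<le> v i \<and> v i \<le> d) \<and>
        (\<forall>i<n. \<forall>j<n. i \<noteq> j \<longrightarrow> {u i<..<v i} \<inter> {u j<..<v j} = {}) \<and>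
        (\<Sum>i<n. v i - u i) < \<delta>
        \<longrightarrow> (\<Sum>i<n. dist (f (v i)) (f (u i))) < \<epsilon>)"

definition locally_ac :: "ereal \<Rightarrow> ereal \<Rightarrow> (real \<Rightarrow> complex) \<Rightarrow> bool" where
  "locally_ac a b f \<longleftrightarrow> (\<forall>c d. {c..d} \<subseteq> einterval a b \<longrightarrow> abs_continuous_on c d f)"

text \<open>
  The formulas for the quasi-derivatives \<open>y\<^sup>[\<^sup>1\<^sup>]\<close>, \<open>y\<^sup>[\<^sup>2\<^sup>]\<close>, \<open>y\<^sup>[\<^sup>3\<^sup>]\<close> make sense only almost
  everywhere, so \<open>Y k\<close> is the locally absolutely continuous representative of the \<open>k\<close>-th
  quasi-derivative; it is uniquely determined on the open interval.
\<close>

definition is_quasi_derivs ::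
    "coeffs \<Rightarrow> ereal \<Rightarrow> ereal \<Rightarrow> (real \<Rightarrow> complex) \<Rightarrow> (nat \<Rightarrow> real \<Rightarrow> complex) \<Rightarrow> bool" where
  "is_quasi_derivs K a b y Y \<longleftrightarrow>
     Y 0 = y \<and> (\<forall>k\<le>3. locally_ac a b (Y k)) \<and>
     (AE x in lebesgue. x \<in> einterval a b \<longrightarrow>
        Y 1 x = vector_derivative (Y 0) (at x) \<and>
        Y 2 x = coef_p K x *\<^sub>R vector_derivative (Y 1) (at x) \<and>
        Y 3 x = - vector_derivative (Y 2) (at x) + coef_s K x *\<^sub>R Y 1 x)"

definition has_quasi_derivs :: "coeffs \<Rightarrow> ereal \<Rightarrow> ereal \<Rightarrow> (real \<Rightarrow> complex) \<Rightarrow> bool" where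
  "has_quasi_derivs K a b y \<longleftrightarrow> (\<exists>Y. is_quasi_derivs K a b y Y)"

definition qd :: "coeffs \<Rightarrow> ereal \<Rightarrow> ereal \<Rightarrow> (real \<Rightarrow> complex) \<Rightarrow> nat \<Rightarrow> real \<Rightarrow> complex" where
  "qd K a b y = (SOME Y. is_quasi_derivs K a b y Y)"

definition ell :: "coeffs \<Rightarrow> ereal \<Rightarrow> ereal \<Rightarrow> (real \<Rightarrow> complex) \<Rightarrow> real \<Rightarrow> complex" where
  "ell K a b y x =
     (1 / coef_w K x) *\<^sub>R (- vector_derivative (qd K a b y 3) (at x) + coef_q K x *\<^sub>R y x)"

definition uvec :: "(nat \<Rightarrow> real \<Rightarrow> complex) \<Rightarrow> real \<Rightarrow> complex^2" where
  "uvec Y x = vector [Y 0 x, Y 1 x]"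

definition vvec :: "(nat \<Rightarrow> real \<Rightarrow> complex) \<Rightarrow> real \<Rightarrow> complex^2" where
  "vvec Y x = vector [Y 3 x, Y 2 x]"

definition bracket ::
    "(nat \<Rightarrow> real \<Rightarrow> complex) \<Rightarrow> (nat \<Rightarrow> real \<Rightarrow> complex) \<Rightarrow> real \<Rightarrow> complex" where
  "bracket Y Z x = (\<Sum>i\<in>UNIV. uvec Y x $ i * cnj (vvec Z x $ i))
                 - (\<Sum>i\<in>UNIV. vvec Y x $ i * cnj (uvec Z x $ i))"


section \<open>The space \<open>L\<^sup>2(a,b;w)\<close>, and the maximal and minimal domains\<close>

text \<open>
  Elements of \<open>L\<^sup>2(a,b;w)\<close> are represented by functions on the whole line of which only the
  values on \<open>(a,b)\<close>, up to almost everywhere equality, are relevant.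
\<close>

definition ae_eq :: "ereal \<Rightarrow> ereal \<Rightarrow> (real \<Rightarrow> complex) \<Rightarrow> (real \<Rightarrow> complex) \<Rightarrow> bool" where
  "ae_eq a b f g \<longleftrightarrow> (AE x in lebesgue. x \<in> einterval a b \<longrightarrow> f x = g x)"

definition L2w :: "coeffs \<Rightarrow> ereal \<Rightarrow> ereal \<Rightarrow> (real \<Rightarrow> complex) set" where
  "L2w K a b = {f. set_borel_measurable lebesgue (einterval a b) f \<and>
     set_integrable lebesgue (einterval a b) (\<lambda>x. (cmod (f x))\<^sup>2 * coef_w K x)}"

definition inner_w ::
    "coeffs \<Rightarrow> ereal \<Rightarrow> ereal \<Rightarrow> (real \<Rightarrow> complex) \<Rightarrow> (real \<Rightarrow> complex) \<Rightarrow> complex" where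
  "inner_w K a b f g =
     set_lebesgue_integral lebesgue (einterval a b) (\<lambda>x. coef_w K x *\<^sub>R (f x * cnj (g x)))"

definition norm_w :: "coeffs \<Rightarrow> ereal \<Rightarrow> ereal \<Rightarrow> (real \<Rightarrow> complex) \<Rightarrow> real" where
  "norm_w K a b f = sqrt (Re (inner_w K a b f f))"

definition D_max :: "coeffs \<Rightarrow> ereal \<Rightarrow> ereal \<Rightarrow> (real \<Rightarrow> complex) set" where
  "D_max K a b = {y. has_quasi_derivs K a b y \<and> y \<in> L2w K a b \<and> ell K a b y \<in> L2w K a b}"

definition graph_norm :: "coeffs \<Rightarrow> ereal \<Rightarrow> ereal \<Rightarrow> (real \<Rightarrow> complex) \<Rightarrow> real" where
  "graph_norm K a b y = sqrt ((norm_w K a b y)\<^sup>2 + (norm_w K a b (ell K a b y))\<^sup>2)"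

definition compactly_supported :: "ereal \<Rightarrow> ereal \<Rightarrow> (real \<Rightarrow> complex) \<Rightarrow> bool" where
  "compactly_supported a b y \<longleftrightarrow>
     (\<exists>S. compact S \<and> S \<subseteq> einterval a b \<and> (\<forall>x \<in> einterval a b - S. y x = 0))"

text \<open>The closure is taken inside \<open>D_max\<close>, which is complete in the graph norm.\<close>

definition D_min :: "coeffs \<Rightarrow> ereal \<Rightarrow> ereal \<Rightarrow> (real \<Rightarrow> complex) set" where
  "D_min K a b = {y \<in> D_max K a b. \<forall>\<epsilon>>0. \<exists>\<phi> \<in> D_max K a b.
     compactly_supported a b \<phi> \<and> graph_norm K a b (\<lambda>x. y x - \<phi> x) < \<epsilon>}"


section \<open>Self-adjointness and spectrum\<close>

text \<open>
  Both notions concern the operator \<open>y \<mapsto> ell K a b y\<close> in \<open>L\<^sup>2(a,b;w)\<close> with domain \<open>D\<close>; the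
  equivalence below says that the operator coincides with its adjoint.
\<close>

definition self_adjoint :: "coeffs \<Rightarrow> ereal \<Rightarrow> ereal \<Rightarrow> (real \<Rightarrow> complex) set \<Rightarrow> bool" where
  "self_adjoint K a b D \<longleftrightarrow>
     (\<forall>f \<in> L2w K a b. \<forall>\<epsilon>>0. \<exists>y \<in> D. norm_w K a b (\<lambda>x. f x - y x) < \<epsilon>) \<and>
     (\<forall>f \<in> L2w K a b. \<forall>g \<in> L2w K a b.
        (\<forall>y \<in> D. inner_w K a b (ell K a b y) f = inner_w K a b y g) \<longleftrightarrow>
        (\<exists>z \<in> D. ae_eq a b z f \<and> ae_eq a b (ell K a b z) g))"

text \<open>
  In the resolvent set, \<open>L - \<lambda>\<close> maps \<open>D\<close> onto \<open>L\<^sup>2(a,b;w)\<close>; the estimate expresses that it is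
  injective with bounded inverse.
\<close>

definition resolvent_set :: "coeffs \<Rightarrow> ereal \<Rightarrow> ereal \<Rightarrow> (real \<Rightarrow> complex) set \<Rightarrow> complex set" where
  "resolvent_set K a b D = {z.
     (\<forall>f \<in> L2w K a b. \<exists>y \<in> D. ae_eq a b (\<lambda>x. ell K a b y x - z * y x) f) \<and>
     (\<exists>C. \<forall>y \<in> D. norm_w K a b y \<le> C * norm_w K a b (\<lambda>x. ell K a b y x - z * y x))}"

definition Sp :: "coeffs \<Rightarrow> ereal \<Rightarrow> ereal \<Rightarrow> (real \<Rightarrow> complex) set \<Rightarrow> complex set" where
  "Sp K a b D = - resolvent_set K a b D"


section \<open>Classification of endpoints\<close>

text \<open>
  An endpoint is represented by the filter of its one-sided neighbourhoods in the real line, which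
  also covers infinite endpoints.
\<close>

definition lower_end :: "ereal \<Rightarrow> real filter" where
  "lower_end a = filtercomap ereal (at_right a)"

definition upper_end :: "ereal \<Rightarrow> real filter" where
  "upper_end b = filtercomap ereal (at_left b)"

definition integrable_near :: "real filter \<Rightarrow> (real \<Rightarrow> real) \<Rightarrow> bool" where
  "integrable_near F f \<longleftrightarrow> (\<exists>S. eventually (\<lambda>x. x \<in> S) F \<and> set_integrable lebesgue S f)"

definition regular_end :: "coeffs \<Rightarrow> ereal \<Rightarrow> real filter \<Rightarrow> bool" where
  "regular_end K e F \<longleftrightarrow> \<bar>e\<bar> \<noteq> \<infinity> \<and>
     integrable_near F (\<lambda>x. 1 / coef_p K x) \<and> integrable_near F (coef_s K) \<and>
     integrable_near F (coef_q K) \<and> integrable_near F (coef_w K)"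

lemma vector_space_complex_fun:
  "vector_space (\<lambda>(c::complex) (f::real \<Rightarrow> complex) x. c * f x)"
  by unfold_locales (auto simp: fun_eq_iff algebra_simps)

text \<open>
  Solutions are set to zero outside \<open>(a,b)\<close>, so that the space below is isomorphic to a space of
  functions on \<open>(a,b)\<close> and its dimension is the right one.
\<close>

definition lim_type :: "coeffs \<Rightarrow> ereal \<Rightarrow> ereal \<Rightarrow> real filter \<Rightarrow> nat \<Rightarrow> bool" where
  "lim_type K a b F k \<longleftrightarrow>
     vector_space.dim (\<lambda>(c::complex) (f::real \<Rightarrow> complex) x. c * f x)
       {y. has_quasi_derivs K a b y \<and> ae_eq a b (ell K a b y) (\<lambda>x. \<i> * y x) \<and>
           (\<forall>x. x \<notin> einterval a b \<longrightarrow> y x = 0) \<and>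
           integrable_near F (\<lambda>x. (cmod (y x))\<^sup>2 * coef_w K x)} = k"


section \<open>Boundary conditions and their truncations\<close>

definition conj_transpose :: "complex^2^2 \<Rightarrow> complex^2^2" where
  "conj_transpose A = (\<chi> i j. cnj (A $ j $ i))"

definition block_row :: "complex^2^2 \<Rightarrow> complex^2^2 \<Rightarrow> complex^(2 + 2)^2" where
  "block_row A1 A2 = (\<chi> i k. case k of Inl j \<Rightarrow> A1 $ i $ j | Inr j \<Rightarrow> A2 $ i $ j)"

definition self_adjoint_bc :: "complex^2^2 \<Rightarrow> complex^2^2 \<Rightarrow> bool" where
  "self_adjoint_bc A1 A2 \<longleftrightarrow> rank (block_row A1 A2) = 2 \<and>
     conj_transpose (A1 ** conj_transpose A2) = A1 ** conj_transpose A2"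

text \<open>
  Boundary values at a regular endpoint are the limits of the quasi-derivatives there.
\<close>

definition bc_matrix ::
    "complex^2^2 \<Rightarrow> complex^2^2 \<Rightarrow> real filter \<Rightarrow> (nat \<Rightarrow> real \<Rightarrow> complex) \<Rightarrow> bool" where
  "bc_matrix A1 A2 F Y \<longleftrightarrow> A1 *v Lim F (uvec Y) + A2 *v Lim F (vvec Y) = 0"

text \<open>
  \<open>[y,h](c) = row_u H c \<bullet> u\<^sub>y(c) + row_v H c \<bullet> v\<^sub>y(c)\<close> (bilinear product), where \<open>H\<close> consists of
  the quasi-derivatives of \<open>h\<close>.
\<close>

definition row_u :: "(nat \<Rightarrow> real \<Rightarrow> complex) \<Rightarrow> real \<Rightarrow> complex^2" where
  "row_u H c = (\<chi> i. cnj (vvec H c $ i))"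

definition row_v :: "(nat \<Rightarrow> real \<Rightarrow> complex) \<Rightarrow> real \<Rightarrow> complex^2" where
  "row_v H c = (\<chi> i. - cnj (uvec H c $ i))"

text \<open>
  \<open>endpoint_setting K a b e F F' t Ft N B Bt\<close>: at the endpoint \<open>e\<close> of \<open>(a,b)\<close>, with filter \<open>F\<close>
  (\<open>F'\<close> is the filter of the other endpoint) and truncation points \<open>t j\<close>, the operator \<open>L\<close> has the
  boundary condition \<open>B\<close>, and for \<open>j \<ge> N\<close> the truncated operator \<open>L\<^sub>j\<close> has the boundary condition
  \<open>Bt j\<close> at its endpoint \<open>t j\<close>, with filter \<open>Ft j\<close>.  Conditions are predicates on the
  quasi-derivatives \<open>Y\<close> of \<open>y\<close>; those of \<open>h\<close>, \<open>h1\<close>, \<open>h2\<close> always refer to the whole of \<open>(a,b)\<close>.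

  In case \<open>lim3\<close>, the first row of the pair of matrices is \<open>[y,h](t j) = 0\<close> and the second row
  \<open>(\<alpha> j, \<beta> j)\<close> is the additional condition.  In case \<open>lim4\<close>, \<open>U\<close> is the region next to \<open>e\<close> in
  which \<open>h1\<close> and \<open>h2\<close> are solutions, and \<open>[y,h1](t j)\<close> is evaluated as a limit from inside the
  truncated interval, where \<open>y\<close> is defined.
\<close>

inductive endpoint_setting ::
    "coeffs \<Rightarrow> ereal \<Rightarrow> ereal \<Rightarrow> ereal \<Rightarrow> real filter \<Rightarrow> real filter \<Rightarrow>
     (nat \<Rightarrow> real) \<Rightarrow> (nat \<Rightarrow> real filter) \<Rightarrow> nat \<Rightarrow>
     ((nat \<Rightarrow> real \<Rightarrow> complex) \<Rightarrow> bool) \<Rightarrow> (nat \<Rightarrow> (nat \<Rightarrow> real \<Rightarrow> complex) \<Rightarrow> bool) \<Rightarrow> bool"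
  for K a b e F F' t Ft N where
  regular:
    "regular_end K e F \<Longrightarrow> (\<And>j. ereal (t j) = e) \<Longrightarrow> self_adjoint_bc A1 A2 \<Longrightarrow>
     endpoint_setting K a b e F F' t Ft N (bc_matrix A1 A2 F) (\<lambda>j. bc_matrix A1 A2 (Ft j))"
| lim2:
    "\<not> regular_end K e F \<Longrightarrow> lim_type K a b F 2 \<Longrightarrow>
     (\<And>j. t j \<in> einterval a b) \<Longrightarrow> (\<lambda>j. ereal (t j)) \<longlonglongrightarrow> e \<Longrightarrow>
     endpoint_setting K a b e F F' t Ft N
       (\<lambda>Y. True) (\<lambda>j Y. Lim (Ft j) (Y 0) = 0 \<and> Lim (Ft j) (Y 1) = 0)"
| lim3:
    "\<not> regular_end K e F \<Longrightarrow> lim_type K a b F 3 \<Longrightarrow>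
     (\<And>j. t j \<in> einterval a b) \<Longrightarrow> (\<lambda>j. ereal (t j)) \<longlonglongrightarrow> e \<Longrightarrow>
     h \<in> D_max K a b - D_min K a b \<Longrightarrow> (\<And>x. x \<in> einterval a b \<Longrightarrow> h x \<in> \<real>) \<Longrightarrow>
     eventually (\<lambda>x. h x = 0) F' \<Longrightarrow> H = qd K a b h \<Longrightarrow>
     (\<And>j. A1 j = vector [row_u H (t j), \<alpha> j]) \<Longrightarrow>
     (\<And>j. A2 j = vector [row_v H (t j), \<beta> j]) \<Longrightarrow>
     (\<And>j. j \<ge> N \<Longrightarrow> self_adjoint_bc (A1 j) (A2 j)) \<Longrightarrow>
     endpoint_setting K a b e F F' t Ft N
       (\<lambda>Y. (bracket Y H \<longlongrightarrow> 0) F) (\<lambda>j. bc_matrix (A1 j) (A2 j) (Ft j))"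
| lim4:
    "\<not> regular_end K e F \<Longrightarrow> lim_type K a b F 4 \<Longrightarrow>
     (\<And>j. t j \<in> einterval a b) \<Longrightarrow> (\<lambda>j. ereal (t j)) \<longlonglongrightarrow> e \<Longrightarrow>
     h1 \<in> D_max K a b \<Longrightarrow> h2 \<in> D_max K a b \<Longrightarrow>
     eventually (\<lambda>x. h1 x = 0 \<and> h2 x = 0) F' \<Longrightarrow>
     (\<And>c1 c2. (\<lambda>x. c1 * h1 x + c2 * h2 x) \<in> D_min K a b \<Longrightarrow> c1 = 0 \<and> c2 = 0) \<Longrightarrow>
     H1 = qd K a b h1 \<Longrightarrow> H2 = qd K a b h2 \<Longrightarrow>
     (bracket H1 H1 \<longlongrightarrow> 0) F \<Longrightarrow> (bracket H1 H2 \<longlongrightarrow> 0) F \<Longrightarrow> (bracket H2 H2 \<longlongrightarrow> 0) F \<Longrightarrow>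
     open U \<Longrightarrow> connected U \<Longrightarrow> U \<subseteq> einterval a b \<Longrightarrow> eventually (\<lambda>x. x \<in> U) F \<Longrightarrow>
     (AE x in lebesgue. x \<in> U \<longrightarrow>
        ell K a b h1 x = complex_of_real r * h1 x \<and>
        ell K a b h2 x = complex_of_real r * h2 x) \<Longrightarrow>
     (\<And>j. j \<ge> N \<Longrightarrow> t j \<in> U) \<Longrightarrow>
     endpoint_setting K a b e F F' t Ft N
       (\<lambda>Y. (bracket Y H1 \<longlongrightarrow> 0) F \<and> (bracket Y H2 \<longlongrightarrow> 0) F)
       (\<lambda>j Y. (bracket Y H1 \<longlongrightarrow> 0) (Ft j) \<and> (bracket Y H2 \<longlongrightarrow> 0) (Ft j))"

definition op_domain ::
    "coeffs \<Rightarrow> ereal \<Rightarrow> ereal \<Rightarrow> ((nat \<Rightarrow> real \<Rightarrow> complex) \<Rightarrow> bool) \<Rightarrow>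
     ((nat \<Rightarrow> real \<Rightarrow> complex) \<Rightarrow> bool) \<Rightarrow> (real \<Rightarrow> complex) set" where
  "op_domain K a b Ba Bb = {y \<in> D_max K a b. Ba (qd K a b y) \<and> Bb (qd K a b y)}"

end

theory Submission
  imports Defs
begin

text \<open>
  At each endpoint let \<open>P\<close> be the following space of germs: functions vanishing near a lim-2
  endpoint, multiples of \<open>\<chi>\<close> at a lim-3 endpoint, combinations of \<open>\<chi>\<^sub>1\<close> and \<open>\<chi>\<^sub>2\<close> at a lim-4
  endpoint, and functions satisfying the boundary conditions at a regular one.  Near a lim-4
  endpoint \<open>\<chi>\<^sub>1\<close> and \<open>\<chi>\<^sub>2\<close> solve the same equation with real \<open>\<lambda>\<^sub>0\<close>, so their brackets are constant,
  hence zero, there; near a lim-3 endpoint \<open>[\<chi>,\<chi>](e\<^sub>j) = 0\<close> by self-adjointness of the truncated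
  conditions.  Therefore every function in the set \<open>C\<close> of those \<open>y \<in> D\<^sub>m\<^sub>a\<^sub>x\<close> which have germs in
  \<open>P\<close> at both ends restricts to the domain of \<open>L\<^sub>j\<close> for all large \<open>j\<close>.

  \<open>C\<close> is a core of \<open>L\<close>: an element \<open>z\<close> of the domain of the adjoint of \<open>L\<close> restricted to \<open>C\<close> is a weak
  solution, hence in \<open>D\<^sub>m\<^sub>a\<^sub>x\<close>, and testing with the germs in \<open>P\<close> shows by Green's formula that
  \<open>[y,z]\<close> vanishes at both ends for every \<open>y\<close> in the domain of \<open>L\<close>, so that \<open>z\<close> is in the domain
  of \<open>L\<^sup>* = L\<close>.  Thus \<open>\<lambda> \<in> Sp(L)\<close>, which is real, has approximate eigenvectors in \<open>C\<close>.  Restricted to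
  \<open>(a\<^sub>j,b\<^sub>j)\<close> they are approximate eigenvectors of \<open>L\<^sub>j\<close>.  As \<open>L\<^sub>j\<close> is symmetric, it then has a point of
  its spectrum close to \<open>\<lambda>\<close>.
\<close>

section \<open>Absolutely continuous functions\<close>

text \<open>Quasi-derivatives are absolutely continuous in the epsilon-delta sense, while every
  estimate needs the integrated first-order system; passing between the two (differentiation almost
  everywhere, Radon-Nikodym densities) makes up much of the analysis. The spectral obstacle is that
  an element of the domain of L meets its conditions only in the limit at e, so its restriction
  misses those of L_j, and at a lim-3 endpoint the extra condition of L_j may change with j. Hence
  the detour over germs that satisfy the truncated conditions exactly. Shrinking the domain is
  harmless at each end for one of two reasons: nothing was removed, or the remaining test functions
  still force the condition of L on elements of the adjoint domain. The boundary spaces of L_j enter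
  only as isotropic subspaces of C^4, which gives symmetry; a spectral point near an approximate
  eigenvalue is then extracted from the two clauses of the resolvent set. The same argument shows
  that each L_j has nonempty spectrum, which covers the indices j for which no good approximate
  eigenvector is available yet.\<close>

lemma negligible_indefinite_integral_bad_set:
  fixes f :: "real \<Rightarrow> 'a::euclidean_space"
  assumes f: "f integrable_on {c..d}" and e: "e > 0"
  shows "negligible {x \<in> {c..d}. \<forall>\<delta>>0. \<exists>u\<in>{c..d}. \<bar>u - x\<bar> < \<delta> \<and>
      norm (integral {c..u} f - integral {c..x} f - (u - x) *\<^sub>R f x) > e * \<bar>u - x\<bar>}"
    (is "negligible ?N")
  unfolding negligible_outer_le
proof (intro allI impI)
  fix \<eta> :: real assume "\<eta> > 0"
  define F where "F u = integral {c..u} f" for u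
  define N where "N = ?N"
  have Nsub: "N \<subseteq> {c..d}" by (auto simp: N_def)
  \<comment> \<open>Vitali balls get enlarged to radius \<open>5 * r x\<close> and so to length
    \<open>10 * r x\<close>; with this tolerance Henstock's lemma forces the sum of the radii below
    \<open>\<eta> / 10\<close>.\<close>
  have "e * \<eta> / 10 > 0" using e \<open>\<eta> > 0\<close> by simp
  then obtain \<gamma> where \<gamma>: "gauge \<gamma>"
    "\<And>p. p tagged_partial_division_of (cbox c d) \<Longrightarrow> \<gamma> fine p \<Longrightarrow>
       (\<Sum>(x,K)\<in>p. norm (measure lborel K *\<^sub>R f x - integral K f)) < e * \<eta> / 10"
    using Henstock_lemma[of f c d "e * \<eta> / 10"] f unfolding interval_cbox[symmetric] by blast
  have "\<exists>u. u \<in> {c..d} \<and> closed_segment x u \<subseteq> \<gamma> x \<and> norm (F u - F x - (u - x) *\<^sub>R f x) > e * \<bar>u - x\<bar>"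
    if "x \<in> N" for x
  proof -
    from gaugeD[OF \<gamma>(1), of x] obtain \<delta> where \<delta>: "\<delta> > 0" "ball x \<delta> \<subseteq> \<gamma> x"
      using openE by blast
    with that[unfolded N_def] obtain u where u: "u \<in> {c..d}" "\<bar>u - x\<bar> < \<delta>"
      "norm (F u - F x - (u - x) *\<^sub>R f x) > e * \<bar>u - x\<bar>"
      unfolding F_def by blast
    have "closed_segment x u \<subseteq> ball x \<delta>"
      by (rule closed_segment_subset) (use u \<delta> in \<open>auto simp: dist_real_def\<close>)
    with u \<delta> show ?thesis by blast
  qed
  then have "\<forall>x\<in>N. \<exists>u. u \<in> {c..d} \<and> closed_segment x u \<subseteq> \<gamma> x \<and>
      norm (F u - F x - (u - x) *\<^sub>R f x) > e * \<bar>u - x\<bar>"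
    by (rule ballI)
  from bchoice[OF this] obtain u where u: "\<And>x. x \<in> N \<Longrightarrow> u x \<in> {c..d}"
      "\<And>x. x \<in> N \<Longrightarrow> closed_segment x (u x) \<subseteq> \<gamma> x"
      "\<And>x. x \<in> N \<Longrightarrow> norm (F (u x) - F x - (u x - x) *\<^sub>R f x) > e * \<bar>u x - x\<bar>"
    by auto
  define r where "r x = \<bar>u x - x\<bar>" for x
  have rpos: "r x > 0" if "x \<in> N" for x
    using u(3)[OF that] by (cases "u x = x") (auto simp: r_def)
  have rb: "0 < r x \<and> r x \<le> d - c" if "x \<in> N" for x
    using rpos[OF that] u(1)[OF that] subsetD[OF Nsub that] by (auto simp: r_def)
  have cov: "N \<subseteq> (\<Union>x\<in>N. cball x (r x))"
    using rpos by (force simp: less_imp_le)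
  obtain C where C: "countable C" "C \<subseteq> N"
      "pairwise (\<lambda>i j. disjnt (cball i (r i)) (cball j (r j))) C"
      "N \<subseteq> (\<Union>i\<in>C. cball i (5 * r i))"
    by (rule Vitali_covering_lemma_cballs[OF cov rb])
  \<comment> \<open>Each segment from a tag \<open>x\<close> to its witness \<open>u x\<close> lies
    in \<open>cball x (r x)\<close>. Disjointness of the Vitali balls thus makes finitely many
    segments a fine tagged partial division, and the Henstock error on \<open>I x\<close> is exactly
    the large increment error at \<open>x\<close>.\<close>
  define I where "I x = closed_segment x (u x)" for x
  have I_ball: "I x \<subseteq> cball x (r x)" for x
    unfolding I_def by (rule closed_segment_subset) (auto simp: r_def dist_real_def)
  have bound: "measure lebesgue (\<Union>x\<in>C'. cball x (5 * r x)) \<le> \<eta>" if C': "C' \<subseteq> C" "finite C'" for C'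
  proof -
    define p where "p = (\<lambda>x. (x, I x)) ` C'"
    have inN: "x \<in> N" if "x \<in> C'" for x using that C' C(2) by blast
    have "p tagged_partial_division_of (cbox c d)"
      unfolding tagged_partial_division_of_def
    proof (intro conjI allI impI)
      show "finite p" using C' by (simp add: p_def)
    next
      fix x K assume "(x, K) \<in> p"
      then have x: "x \<in> C'" and K: "K = I x" by (auto simp: p_def)
      show "x \<in> K" by (simp add: K I_def)
      show "K \<subseteq> cbox c d" unfolding K I_def
        by (rule closed_segment_subset) (use inN[OF x] u(1)[OF inN[OF x]] Nsub in auto)
      show "\<exists>a b. K = cbox a b"
        unfolding K I_def closed_segment_eq_real_ivl by (metis interval_cbox)
    next
      fix x1 K1 x2 K2 assume "(x1, K1) \<in> p \<and> (x2, K2) \<in> p \<and> (x1, K1) \<noteq> (x2, K2)"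
      then have "x1 \<in> C" "x2 \<in> C" "K1 = I x1" "K2 = I x2" "x1 \<noteq> x2"
        using C' by (auto simp: p_def)
      then have "disjnt (cball x1 (r x1)) (cball x2 (r x2))"
        using C(3) by (auto simp: pairwise_def)
      with I_ball have "K1 \<inter> K2 = {}"
        unfolding \<open>K1 = I x1\<close> \<open>K2 = I x2\<close> disjnt_def by blast
      then show "interior K1 \<inter> interior K2 = {}"
        using interior_subset by blast
    qed
    moreover have "\<gamma> fine p"
      using u(2) inN by (auto simp: p_def fine_def I_def)
    ultimately have "(\<Sum>(x,K)\<in>p. norm (measure lborel K *\<^sub>R f x - integral K f)) < e * \<eta> / 10"
      by (rule \<gamma>(2))
    moreover have "(\<Sum>(x,K)\<in>p. norm (measure lborel K *\<^sub>R f x - integral K f))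
        = (\<Sum>x\<in>C'. norm (measure lborel (I x) *\<^sub>R f x - integral (I x) f))"
      unfolding p_def by (subst sum.reindex) (auto simp: inj_on_def)
    moreover have "norm (measure lborel (I x) *\<^sub>R f x - integral (I x) f) \<ge> e * r x" if "x \<in> C'" for x
    proof -
      have x: "x \<in> {c..d}" "u x \<in> {c..d}" using inN[OF that] u(1) Nsub by auto
      have "norm (measure lborel (I x) *\<^sub>R f x - integral (I x) f) = norm (F (u x) - F x - (u x - x) *\<^sub>R f x)"
      proof (cases "x \<le> u x")
        case True
        have fi: "f integrable_on {c..u x}"
          by (rule integrable_on_subinterval[OF f]) (use x in auto)
        have "integral {c..x} f + integral {x..u x} f = integral {c..u x} f"
          by (rule Henstock_Kurzweil_Integration.integral_combine) (use x True fi in auto)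
        then have *: "F (u x) - F x = integral (I x) f"
          using True by (simp add: F_def I_def closed_segment_eq_real_ivl algebra_simps)
        show ?thesis unfolding * using True
          by (simp add: I_def closed_segment_eq_real_ivl norm_minus_commute)
      next
        case False
        have fi: "f integrable_on {c..x}"
          by (rule integrable_on_subinterval[OF f]) (use x in auto)
        have "integral {c..u x} f + integral {u x..x} f = integral {c..x} f"
          by (rule Henstock_Kurzweil_Integration.integral_combine) (use x False fi in auto)
        then have *: "F (u x) - F x = - integral (I x) f"
          using False by (simp add: F_def I_def closed_segment_eq_real_ivl algebra_simps)
        have cI: "u x - x = - measure lborel (I x)"
          using False by (simp add: I_def closed_segment_eq_real_ivl)
        show ?thesis unfolding * cI
          using norm_minus_commute[of "measure lborel (I x) *\<^sub>R f x" "integral (I x) f"]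
          by simp
      qed
      then show ?thesis using u(3)[OF inN[OF that]] by (simp add: r_def)
    qed
    then have "(\<Sum>x\<in>C'. e * r x) \<le> (\<Sum>x\<in>C'. norm (measure lborel (I x) *\<^sub>R f x - integral (I x) f))"
      by (rule sum_mono)
    ultimately have "(\<Sum>x\<in>C'. e * r x) < e * \<eta> / 10"
      by linarith
    then have "e * (\<Sum>x\<in>C'. r x) < e * (\<eta> / 10)"
      by (simp add: sum_distrib_left)
    then have s: "(\<Sum>x\<in>C'. r x) < \<eta> / 10"
      using e by (simp only: mult_less_cancel_left_pos)
    have "measure lebesgue (\<Union>x\<in>C'. cball x (5 * r x)) \<le> (\<Sum>x\<in>C'. measure lebesgue (cball x (5 * r x)))"
      by (rule measure_UNION_le) (use C' in auto)
    also have "\<dots> = (\<Sum>x\<in>C'. 10 * r x)"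
    proof (rule sum.cong[OF refl])
      fix x assume "x \<in> C'"
      with rpos[OF inN[OF this]] show "measure lebesgue (cball x (5 * r x)) = 10 * r x"
        by (simp add: cball_eq_atLeastAtMost)
    qed
    also have "\<dots> \<le> \<eta>" using s by (simp add: sum_distrib_left[symmetric])
    finally show ?thesis .
  qed
  have "\<exists>T. N \<subseteq> T \<and> T \<in> lmeasurable \<and> measure lebesgue T \<le> \<eta>"
  proof (intro exI conjI)
    show "N \<subseteq> (\<Union>i\<in>C. cball i (5 * r i))" by (rule C(4))
    show "(\<Union>i\<in>C. cball i (5 * r i)) \<in> lmeasurable"
      by (rule fmeasurable_UN_bound[OF \<open>countable C\<close> _ bound]) auto
    show "measure lebesgue (\<Union>i\<in>C. cball i (5 * r i)) \<le> \<eta>"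
      by (rule measure_UN_bound[OF \<open>countable C\<close> _ bound]) auto
  qed
  then show "\<exists>T. ?N \<subseteq> T \<and> T \<in> lmeasurable \<and> measure lebesgue T \<le> \<eta>"
    unfolding N_def .
qed

text \<open>Lebesgue's differentiation theorem: a point where the derivative is not
  \<open>f x\<close> is bad for some tolerance \<open>1 / real (Suc n)\<close>, and these are
  countably many.\<close>

lemma AE_has_vector_derivative_integral:
  fixes f :: "real \<Rightarrow> 'a::euclidean_space"
  assumes f: "f integrable_on {c..d}"
  shows "AE x in lebesgue. x \<in> {c<..<d} \<longrightarrow>
           ((\<lambda>u. integral {c..u} f) has_vector_derivative f x) (at x)"
proof -
  define F where "F u = integral {c..u} f" for u
  define N where "N e = {x \<in> {c..d}. \<forall>\<delta>>0. \<exists>u\<in>{c..d}. \<bar>u - x\<bar> < \<delta> \<and>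
      norm (F u - F x - (u - x) *\<^sub>R f x) > e * \<bar>u - x\<bar>}" for e :: real
  have "negligible (\<Union>n. N (1 / real (Suc n)))"
  proof (rule negligible_countable_Union)
    show "countable (range (\<lambda>n. N (1 / real (Suc n))))" by simp
    fix S assume "S \<in> range (\<lambda>n. N (1 / real (Suc n)))"
    then obtain n where "S = N (1 / real (Suc n))" by blast
    moreover have "negligible (N (1 / real (Suc n)))"
      unfolding N_def F_def by (rule negligible_indefinite_integral_bad_set[OF f]) simp
    ultimately show "negligible S" by simp
  qed
  moreover have "(F has_vector_derivative f x) (at x)"
    if x: "x \<in> {c<..<d}" "x \<notin> (\<Union>n. N (1 / real (Suc n)))" for x
    unfolding has_vector_derivative_def has_derivative_at_alt
  proof (intro conjI allI impI)
    show "bounded_linear (\<lambda>h. h *\<^sub>R f x)" by (rule bounded_linear_scaleR_left)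
    fix e :: real assume "e > 0"
    then obtain n where n: "1 / real (Suc n) < e" by (meson nat_approx_posE)
    from x have "x \<notin> N (1 / real (Suc n))" "x \<in> {c..d}" by auto
    then obtain \<delta> where \<delta>: "\<delta> > 0" "\<And>u. u \<in> {c..d} \<Longrightarrow> \<bar>u - x\<bar> < \<delta> \<Longrightarrow>
        norm (F u - F x - (u - x) *\<^sub>R f x) \<le> (1 / real (Suc n)) * \<bar>u - x\<bar>"
      unfolding N_def mem_Collect_eq not_less by (meson not_less)
    show "\<exists>d>0. \<forall>y. norm (y - x) < d \<longrightarrow> norm (F y - F x - (y - x) *\<^sub>R f x) \<le> e * norm (y - x)"
    proof (intro exI[of _ "min \<delta> (min (x - c) (d - x))"] conjI allI impI)
      show "min \<delta> (min (x - c) (d - x)) > 0" using \<delta> x by auto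
      fix y assume "norm (y - x) < min \<delta> (min (x - c) (d - x))"
      then have y: "y \<in> {c..d}" "\<bar>y - x\<bar> < \<delta>" by (auto simp: abs_if split: if_splits)
      have "norm (F y - F x - (y - x) *\<^sub>R f x) \<le> (1 / real (Suc n)) * \<bar>y - x\<bar>"
        by (rule \<delta>(2)[OF y])
      also have "\<dots> \<le> e * \<bar>y - x\<bar>" using n by (intro mult_right_mono) auto
      finally show "norm (F y - F x - (y - x) *\<^sub>R f x) \<le> e * norm (y - x)" by simp
    qed
  qed
  ultimately show ?thesis
    unfolding F_def negligible_iff_null_sets
    by (auto intro!: AE_I'[of "\<Union>n. N (1 / real (Suc n))"])
qed

text \<open>Any finite index set is allowed because later families are indexed by pairs or by the
  intervals themselves.\<close>

definition interval_family :: "real \<Rightarrow> real \<Rightarrow> real \<Rightarrow> 'i set \<Rightarrow> ('i \<Rightarrow> real) \<Rightarrow> ('i \<Rightarrow> real) \<Rightarrow> bool" where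
  "interval_family c d \<delta> I u v \<longleftrightarrow> finite I \<and> (\<forall>i\<in>I. c \<le> u i \<and> u i \<le> v i \<and> v i \<le> d) \<and>
     (\<forall>i\<in>I. \<forall>j\<in>I. i \<noteq> j \<longrightarrow> {u i<..<v i} \<inter> {u j<..<v j} = {}) \<and> (\<Sum>i\<in>I. v i - u i) < \<delta>"

lemma abs_continuous_on_iff:
  "abs_continuous_on c d f \<longleftrightarrow> (\<forall>\<epsilon>>0. \<exists>\<delta>>0. \<forall>n u v.
     interval_family c d \<delta> {..<n::nat} u v \<longrightarrow> (\<Sum>i<n. dist (f (v i)) (f (u i))) < \<epsilon>)"
  unfolding abs_continuous_on_def interval_family_def by (simp add: Ball_def)

lemma abs_continuous_on_finite:
  assumes "abs_continuous_on c d f" "\<epsilon> > 0"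
  shows "\<exists>\<delta>>0. \<forall>(I :: 'i set) u v. interval_family c d \<delta> I u v \<longrightarrow> (\<Sum>i\<in>I. dist (f (v i)) (f (u i))) < \<epsilon>"
proof -
  from assms obtain \<delta> where \<delta>: "\<delta> > 0"
    "\<And>(n::nat) u v. interval_family c d \<delta> {..<n} u v \<Longrightarrow> (\<Sum>i<n. dist (f (v i)) (f (u i))) < \<epsilon>"
    unfolding abs_continuous_on_iff by blast
  show ?thesis
  proof (intro exI[of _ \<delta>] conjI allI impI \<delta>(1))
    fix I :: "'i set" and u v
    assume "interval_family c d \<delta> I u v"
    then have fin: "finite I" and 1: "\<And>i. i \<in> I \<Longrightarrow> c \<le> u i \<and> u i \<le> v i \<and> v i \<le> d"
      and 2: "\<And>i j. i \<in> I \<Longrightarrow> j \<in> I \<Longrightarrow> i \<noteq> j \<Longrightarrow> {u i<..<v i} \<inter> {u j<..<v j} = {}"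
      and 3: "(\<Sum>i\<in>I. v i - u i) < \<delta>"
      by (simp_all add: interval_family_def)
    obtain h where h: "bij_betw h {..<card I} I"
      using ex_bij_betw_nat_finite[OF fin] by (auto simp: atLeast0LessThan)
    have hI: "h k \<in> I" if "k < card I" for k
      using h that by (auto simp: bij_betw_def)
    have hne: "h k \<noteq> h l" if "k < card I" "l < card I" "k \<noteq> l" for k l
      using h that by (auto simp: bij_betw_def inj_on_def)
    have "interval_family c d \<delta> {..<card I} (\<lambda>k. u (h k)) (\<lambda>k. v (h k))"
      unfolding interval_family_def
    proof (intro conjI ballI impI)
      show "(\<Sum>k<card I. v (h k) - u (h k)) < \<delta>"
        using sum.reindex_bij_betw[OF h, of "\<lambda>i. v i - u i"] 3 by simp
    next
      fix i j assume "i \<in> {..<card I}" "j \<in> {..<card I}" "i \<noteq> j"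
      then show "{u (h i)<..<v (h i)} \<inter> {u (h j)<..<v (h j)} = {}"
        by (intro 2 hI hne) auto
    qed (use 1 hI in auto)
    then have "(\<Sum>k<card I. dist (f (v (h k))) (f (u (h k)))) < \<epsilon>" by (rule \<delta>(2))
    then show "(\<Sum>i\<in>I. dist (f (v i)) (f (u i))) < \<epsilon>"
      using sum.reindex_bij_betw[OF h, of "\<lambda>i. dist (f (v i)) (f (u i))"] by simp
  qed
qed

lemma interval_family_mem:
  assumes "interval_family c d \<delta> I u v" "i \<in> I"
  shows "u i \<in> {c..d}" "v i \<in> {c..d}" "u i \<le> v i"
  using assms by (auto simp: interval_family_def)

text \<open>A pointwise Lipschitz bound by two absolutely continuous functions survives summation
  over a family. Differences, products, real and imaginary parts and compositions with locally
  Lipschitz functions are all instances.\<close>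

lemma abs_continuous_on_combine:
  assumes f: "abs_continuous_on c d f" and g: "abs_continuous_on c d g"
    and h: "\<And>x y. x \<in> {c..d} \<Longrightarrow> y \<in> {c..d} \<Longrightarrow>
      dist (h x) (h y) \<le> M * (dist (f x) (f y) + dist (g x) (g y))"
  shows "abs_continuous_on c d h"
  unfolding abs_continuous_on_iff
proof (intro allI impI)
  fix \<epsilon> :: real assume "\<epsilon> > 0"
  \<comment> \<open>\<open>M\<close> may be zero or negative; a positive constant is needed to
    divide by.\<close>
  define M' where "M' = \<bar>M\<bar> + 1"
  have M': "M' > 0" by (simp add: M'_def add_nonneg_pos)
  with \<open>\<epsilon> > 0\<close> have e': "\<epsilon> / (2 * M') > 0" by simp
  obtain \<delta>1 where 1: "\<delta>1 > 0"
    "\<And>(I :: nat set) u v. interval_family c d \<delta>1 I u v \<Longrightarrow> (\<Sum>i\<in>I. dist (f (v i)) (f (u i))) < \<epsilon> / (2 * M')"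
    using abs_continuous_on_finite[where 'i=nat, OF f e'] by blast
  obtain \<delta>2 where 2: "\<delta>2 > 0"
    "\<And>(I :: nat set) u v. interval_family c d \<delta>2 I u v \<Longrightarrow> (\<Sum>i\<in>I. dist (g (v i)) (g (u i))) < \<epsilon> / (2 * M')"
    using abs_continuous_on_finite[where 'i=nat, OF g e'] by blast
  show "\<exists>\<delta>>0. \<forall>n u v. interval_family c d \<delta> {..<n::nat} u v \<longrightarrow> (\<Sum>i<n. dist (h (v i)) (h (u i))) < \<epsilon>"
  proof (intro exI[of _ "min \<delta>1 \<delta>2"] conjI allI impI)
    show "0 < min \<delta>1 \<delta>2" using 1 2 by simp
    fix n :: nat and u v :: "nat \<Rightarrow> real"
    assume *: "interval_family c d (min \<delta>1 \<delta>2) {..<n} u v"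
    have "(\<Sum>i<n. dist (h (v i)) (h (u i))) \<le> (\<Sum>i<n. M' * (dist (f (v i)) (f (u i)) + dist (g (v i)) (g (u i))))"
    proof (rule sum_mono)
      fix i assume i: "i \<in> {..<n}"
      have "dist (h (v i)) (h (u i)) \<le> M * (dist (f (v i)) (f (u i)) + dist (g (v i)) (g (u i)))"
        by (rule h) (use interval_family_mem[OF * i] in auto)
      also have "\<dots> \<le> M' * (dist (f (v i)) (f (u i)) + dist (g (v i)) (g (u i)))"
        by (intro mult_right_mono) (auto simp: M'_def)
      finally show "dist (h (v i)) (h (u i)) \<le> M' * (dist (f (v i)) (f (u i)) + dist (g (v i)) (g (u i)))" .
    qed
    also have "\<dots> = M' * ((\<Sum>i<n. dist (f (v i)) (f (u i))) + (\<Sum>i<n. dist (g (v i)) (g (u i))))"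
      by (simp add: sum.distrib sum_distrib_left distrib_left)
    also have "\<dots> < M' * (\<epsilon> / (2 * M') + \<epsilon> / (2 * M'))"
    proof -
      have "interval_family c d \<delta>1 {..<n} u v" "interval_family c d \<delta>2 {..<n} u v"
        using * by (auto simp: interval_family_def)
      from 1(2)[OF this(1)] 2(2)[OF this(2)] M' show ?thesis
        by (intro mult_strict_left_mono) auto
    qed
    also have "\<dots> = \<epsilon>" using M' by simp
    finally show "(\<Sum>i<n. dist (h (v i)) (h (u i))) < \<epsilon>" .
  qed
qed

lemma abs_continuous_on_imp_continuous_on:
  assumes "abs_continuous_on c d f"
  shows "continuous_on {c..d} f"
  unfolding continuous_on_iff
proof (intro ballI allI impI)
  fix x \<epsilon> :: real assume x: "x \<in> {c..d}" and "\<epsilon> > 0"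
  obtain \<delta> where \<delta>: "\<delta> > 0"
    "\<And>(I :: nat set) u v. interval_family c d \<delta> I u v \<Longrightarrow> (\<Sum>i\<in>I. dist (f (v i)) (f (u i))) < \<epsilon>"
    using abs_continuous_on_finite[where 'i=nat, OF assms \<open>\<epsilon> > 0\<close>] by blast
  show "\<exists>\<delta>>0. \<forall>x'\<in>{c..d}. dist x' x < \<delta> \<longrightarrow> dist (f x') (f x) < \<epsilon>"
  proof (intro exI[of _ \<delta>] conjI ballI impI \<delta>(1))
    fix y assume y: "y \<in> {c..d}" "dist y x < \<delta>"
    have "interval_family c d \<delta> {0::nat} (\<lambda>_. min x y) (\<lambda>_. max x y)"
      using x y by (auto simp: interval_family_def dist_real_def)
    from \<delta>(2)[OF this]
    show "dist (f y) (f x) < \<epsilon>"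
      by (cases "x \<le> y") (auto simp: max_def min_def dist_commute)
  qed
qed

section \<open>Positive variation of an absolutely continuous function\<close>

definition chain :: "real \<Rightarrow> real \<Rightarrow> nat \<Rightarrow> (nat \<Rightarrow> real) \<Rightarrow> bool" where
  "chain x y n s \<longleftrightarrow> mono s \<and> s 0 = x \<and> s n = y"

definition chain_var :: "(real \<Rightarrow> real) \<Rightarrow> nat \<Rightarrow> (nat \<Rightarrow> real) \<Rightarrow> real" where
  "chain_var F n s = (\<Sum>i<n. max 0 (F (s (Suc i)) - F (s i)))"

lemma chain_bounds: "chain x y n s \<Longrightarrow> i \<le> n \<Longrightarrow> x \<le> s i \<and> s i \<le> y"
  unfolding chain_def mono_def by (metis le0)

text \<open>Clipping with \<open>min\<close> and \<open>max\<close> keeps the length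
  \<open>n\<close>, since repeated points are allowed in a chain. Only the step that crosses
  \<open>m\<close> is really divided, and the positive part of an increment is subadditive
  there.\<close>

lemma chain_split:
  assumes "chain x y n s" "x \<le> m" "m \<le> y"
  shows "chain x m n (\<lambda>i. min (s i) m)" "chain m y n (\<lambda>i. max (s i) m)"
    "chain_var F n s \<le> chain_var F n (\<lambda>i. min (s i) m) + chain_var F n (\<lambda>i. max (s i) m)"
proof -
  show "chain x m n (\<lambda>i. min (s i) m)" "chain m y n (\<lambda>i. max (s i) m)"
    using assms by (auto simp: chain_def intro!: monoI min.mono max.mono elim: monoD)
  have "max 0 (F (s (Suc i)) - F (s i)) \<le> max 0 (F (min (s (Suc i)) m) - F (min (s i) m))
      + max 0 (F (max (s (Suc i)) m) - F (max (s i) m))" for i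
  proof -
    have "s i \<le> s (Suc i)" using assms(1) by (auto simp: chain_def mono_def)
    then show ?thesis
      by (cases "s (Suc i) \<le> m"; cases "m \<le> s i") (auto simp: min_def max_def)
  qed
  then show "chain_var F n s \<le> chain_var F n (\<lambda>i. min (s i) m) + chain_var F n (\<lambda>i. max (s i) m)"
    unfolding chain_var_def sum.distrib[symmetric] by (intro sum_mono) auto
qed

lemma chain_append:
  assumes "chain x y n s" "y \<le> z"
  shows "chain x z (Suc n) (\<lambda>i. if i \<le> n then s i else z)"
    "chain_var F (Suc n) (\<lambda>i. if i \<le> n then s i else z) = chain_var F n s + max 0 (F z - F y)"
proof -
  show "chain x z (Suc n) (\<lambda>i. if i \<le> n then s i else z)"
    using assms chain_bounds[OF assms(1)] by (auto simp: chain_def mono_def intro: order_trans)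
  show "chain_var F (Suc n) (\<lambda>i. if i \<le> n then s i else z) = chain_var F n s + max 0 (F z - F y)"
    using assms(1) by (auto simp: chain_var_def chain_def intro!: sum.cong)
qed

locale ac_real =
  fixes c d :: real and F :: "real \<Rightarrow> real"
  assumes ac: "abs_continuous_on c d (\<lambda>x. complex_of_real (F x))" and cd: "c \<le> d"
begin

text \<open>The steps of all chains together form one family indexed by pairs, with the same total
  length as the original intervals; absolute continuity applies to that family directly.\<close>

lemma chains_small:
  assumes "\<epsilon> > 0"
  shows "\<exists>\<delta>>0. \<forall>(I :: nat set) u v n s. interval_family c d \<delta> I u v \<longrightarrow>
       (\<forall>i\<in>I. chain (u i) (v i) (n i) (s i)) \<longrightarrow> (\<Sum>i\<in>I. chain_var F (n i) (s i)) < \<epsilon>"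
proof -
  obtain \<delta> where \<delta>: "\<delta> > 0"
    "\<And>(I :: (nat \<times> nat) set) u v. interval_family c d \<delta> I u v \<Longrightarrow> (\<Sum>i\<in>I. dist (complex_of_real (F (v i))) (complex_of_real (F (u i)))) < \<epsilon>"
    using abs_continuous_on_finite[where 'i="nat \<times> nat", OF ac assms] by blast
  show ?thesis
  proof (intro exI[of _ \<delta>] conjI allI impI \<delta>(1))
    fix I :: "nat set" and u v n s
    assume fam: "interval_family c d \<delta> I u v" and "\<forall>i\<in>I. chain (u i) (v i) (n i) (s i)"
    then have 4: "\<And>i. i \<in> I \<Longrightarrow> chain (u i) (v i) (n i) (s i)" by blast
    from fam have fin: "finite I" and 1: "\<And>i. i \<in> I \<Longrightarrow> c \<le> u i \<and> u i \<le> v i \<and> v i \<le> d"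
      and 2: "\<And>i j. i \<in> I \<Longrightarrow> j \<in> I \<Longrightarrow> i \<noteq> j \<Longrightarrow> {u i<..<v i} \<inter> {u j<..<v j} = {}"
      and 3: "(\<Sum>i\<in>I. v i - u i) < \<delta>"
      by (simp_all add: interval_family_def)
    let ?J = "Sigma I (\<lambda>i. {..<n i})"
    let ?u = "\<lambda>(i,k). s i k" and ?v = "\<lambda>(i,k). s i (Suc k)"
    have m: "s i k \<le> s i l" if "i \<in> I" "k \<le> l" for i k l
      using 4[OF that(1)] that(2) by (auto simp: chain_def mono_def)
    have b: "u i \<le> s i k" "s i k \<le> v i" if "i \<in> I" "k \<le> n i" for i k
      using chain_bounds[OF 4[OF that(1)] that(2)] by auto
    have "(\<Sum>p\<in>?J. dist (complex_of_real (F (?v p))) (complex_of_real (F (?u p)))) < \<epsilon>"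
    proof (rule \<delta>(2), unfold interval_family_def, intro conjI ballI impI)
      show "finite ?J" using fin by auto
    next
      fix p assume "p \<in> ?J"
      then obtain i k where p: "p = (i,k)" "i \<in> I" "k < n i" by auto
      with 1[of i] b[of i k] b[of i "Suc k"] m[of i k "Suc k"]
      show "c \<le> ?u p" "?u p \<le> ?v p" "?v p \<le> d" by auto
    next
      fix p q assume "p \<in> ?J" "q \<in> ?J" "p \<noteq> q"
      then obtain i k j l where p: "p = (i,k)" "i \<in> I" "k < n i" "q = (j,l)" "j \<in> I" "l < n j"
        "i \<noteq> j \<or> (i = j \<and> k \<noteq> l)" by auto
      show "{?u p<..<?v p} \<inter> {?u q<..<?v q} = {}"
      proof (cases "i = j")
        case False
        have "{?u p<..<?v p} \<subseteq> {u i<..<v i}" "{?u q<..<?v q} \<subseteq> {u j<..<v j}"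
          using b[of i k] b[of i "Suc k"] b[of j l] b[of j "Suc l"] p by auto
        with 2[of i j] False p show ?thesis by blast
      next
        case True
        with p consider "k < l" | "l < k" by linarith
        then show ?thesis
        proof cases
          case 1
          then show ?thesis using m[of i "Suc k" l] p True by auto
        next
          case 2
          then show ?thesis using m[of i "Suc l" k] p True by auto
        qed
      qed
    next
      have "(\<Sum>p\<in>?J. ?v p - ?u p) = (\<Sum>i\<in>I. \<Sum>k<n i. s i (Suc k) - s i k)"
        by (subst sum.Sigma) (use fin in \<open>auto simp: case_prod_beta\<close>)
      also have "\<dots> = (\<Sum>i\<in>I. v i - u i)"
        by (rule sum.cong[OF refl]) (use 4 in \<open>auto simp: sum_lessThan_telescope chain_def\<close>)
      finally show "(\<Sum>p\<in>?J. ?v p - ?u p) < \<delta>" using 3 by simp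
    qed
    moreover have "(\<Sum>i\<in>I. chain_var F (n i) (s i)) \<le> (\<Sum>p\<in>?J. dist (complex_of_real (F (?v p))) (complex_of_real (F (?u p))))"
    proof -
      have "(\<Sum>i\<in>I. chain_var F (n i) (s i)) = (\<Sum>p\<in>?J. max 0 (F (?v p) - F (?u p)))"
        unfolding chain_var_def by (subst sum.Sigma) (use fin in \<open>auto simp: case_prod_beta\<close>)
      also have "\<dots> \<le> (\<Sum>p\<in>?J. dist (complex_of_real (F (?v p))) (complex_of_real (F (?u p))))"
      proof (rule sum_mono)
        fix p
        show "max 0 (F (?v p) - F (?u p)) \<le> dist (complex_of_real (F (?v p))) (complex_of_real (F (?u p)))"
          unfolding dist_of_real by (simp add: dist_real_def)
      qed
      finally show ?thesis .
    qed
    ultimately show "(\<Sum>i\<in>I. chain_var F (n i) (s i)) < \<epsilon>" by linarith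
  qed
qed

lemma chain_var_bounded: "\<exists>B. \<forall>n s x. x \<in> {c..d} \<longrightarrow> chain c x n s \<longrightarrow> chain_var F n s \<le> B"
proof -
  obtain \<delta> where \<delta>: "\<delta> > 0"
    "\<And>(I :: nat set) u v n s. interval_family c d \<delta> I u v \<Longrightarrow> (\<And>i. i \<in> I \<Longrightarrow> chain (u i) (v i) (n i) (s i)) \<Longrightarrow>
       (\<Sum>i\<in>I. chain_var F (n i) (s i)) < 1"
    using chains_small[of 1, OF zero_less_one] by auto
  have small: "chain_var F n s \<le> 1" if "c \<le> x" "x \<le> y" "y \<le> d" "y - x < \<delta>" "chain x y n s" for x y n s
  proof -
    have "(\<Sum>i\<in>{0::nat}. chain_var F n s) < 1"
      by (rule \<delta>(2)[of "{0}" "\<lambda>_. x" "\<lambda>_. y" "\<lambda>_. n" "\<lambda>_. s"]) (use that in \<open>auto simp: interval_family_def\<close>)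
    then show ?thesis by simp
  qed
  \<comment> \<open>Induction on the number of pieces of length \<open>\<delta> / 2\<close> needed
    to cover \<open>[x,y]\<close>: the piece cut off at the right end contributes at most 1.\<close>
  have *: "chain_var F n s \<le> real M + 1"
    if "c \<le> x" "x \<le> y" "y \<le> d" "y - x \<le> real M * (\<delta> / 2)" "chain x y n s" for M x y n s
    using that
  proof (induction M arbitrary: x y n s)
    case 0
    then show ?case using small[of x y n s] \<delta>(1) by simp
  next
    case (Suc M)
    define m where "m = max x (y - \<delta> / 2)"
    have m: "x \<le> m" "m \<le> y" using Suc.prems \<delta>(1) by (auto simp: m_def)
    note sp = chain_split[OF Suc.prems(5) m]
    have "m - x \<le> real M * (\<delta> / 2)"
      using Suc.prems(4) \<delta>(1) by (auto simp: m_def max_def algebra_simps)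
    then have "chain_var F n (\<lambda>i. min (s i) m) \<le> real M + 1"
      using Suc.IH[of x m] m Suc.prems sp(1) by simp
    moreover have "y - m < \<delta>" using \<delta>(1) by (auto simp: m_def)
    then have "chain_var F n (\<lambda>i. max (s i) m) \<le> 1"
      using small[of m y] m Suc.prems sp(2) by simp
    ultimately show ?case using sp(3)[of F] by simp
  qed
  obtain M :: nat where M: "d - c \<le> real M * (\<delta> / 2)"
    using \<delta>(1) reals_Archimedean3[of "\<delta> / 2"] by (meson half_gt_zero less_imp_le)
  have "chain_var F n s \<le> real M + 1" if "x \<in> {c..d}" "chain c x n s" for n s x
    by (rule *[of c x]) (use that M in auto)
  then show ?thesis by blast
qed

text \<open>The positive variation of \<open>F\<close> on \<open>[c,x]\<close>. Both
  \<open>pvar\<close> and \<open>pvar - F\<close> turn out increasing and absolutely continuous,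
  which is the Jordan decomposition used for densities.\<close>

definition pvar :: "real \<Rightarrow> real" where
  "pvar x = Sup {chain_var F n s | n s. chain c x n s}"

lemma chain_var_le_pvar: "x \<in> {c..d} \<Longrightarrow> chain c x n s \<Longrightarrow> chain_var F n s \<le> pvar x"
  unfolding pvar_def using chain_var_bounded
  by (intro cSup_upper) (auto simp: bdd_above_def)

lemma chain_ex: "x \<le> y \<Longrightarrow> chain x y 1 (\<lambda>i. if i = 0 then x else y)"
  by (auto simp: chain_def mono_def)

lemma pvar_approx:
  assumes "x \<in> {c..d}" "\<eta> > 0"
  obtains n s where "chain c x n s" "chain_var F n s > pvar x - \<eta>"
proof -
  have "{chain_var F n s | n s. chain c x n s} \<noteq> {}"
    using chain_ex[of c x] assms by auto
  then have "\<exists>v\<in>{chain_var F n s | n s. chain c x n s}. pvar x - \<eta> < v"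
    unfolding pvar_def using chain_var_bounded assms
    by (subst less_cSup_iff[symmetric]) (auto simp: bdd_above_def)
  then show ?thesis using that by auto
qed

text \<open>Append the single step from \<open>x\<close> to \<open>y\<close> to a nearly optimal
  chain ending at \<open>x\<close>.\<close>

lemma pvar_increment_ge:
  assumes "c \<le> x" "x \<le> y" "y \<le> d"
  shows "max 0 (F y - F x) \<le> pvar y - pvar x"
proof (rule field_le_epsilon)
  fix e :: real assume "e > 0"
  obtain n s where ns: "chain c x n s" "chain_var F n s > pvar x - e"
    by (rule pvar_approx[of x e]) (use assms \<open>e > 0\<close> in auto)
  have "chain_var F n s + max 0 (F y - F x) \<le> pvar y"
    using chain_append[OF ns(1) assms(2)] chain_var_le_pvar[of y] assms by (metis atLeastAtMost_iff order_trans)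
  then show "max 0 (F y - F x) \<le> pvar y - pvar x + e" using ns(2) by linarith
qed

text \<open>Cut a nearly optimal chain ending at \<open>y\<close> in two at \<open>x\<close>; the
  left half is bounded by \<open>pvar x\<close>, so the right half nearly exhausts the
  increment.\<close>

lemma pvar_increment_approx:
  assumes "c \<le> x" "x \<le> y" "y \<le> d" "\<eta> > 0"
  obtains n s where "chain x y n s" "pvar y - pvar x < chain_var F n s + \<eta>"
proof -
  obtain n s where ns: "chain c y n s" "chain_var F n s > pvar y - \<eta>"
    by (rule pvar_approx[of y \<eta>]) (use assms in auto)
  note sp = chain_split[OF ns(1) assms(1,2)]
  have "chain_var F n (\<lambda>i. min (s i) x) \<le> pvar x"
    by (rule chain_var_le_pvar) (use assms sp(1) in auto)
  then have "pvar y - pvar x < chain_var F n (\<lambda>i. max (s i) x) + \<eta>"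
    using sp(3)[of F] ns(2) by linarith
  with sp(2) show ?thesis by (rule that)
qed

lemma pvar_ac: "abs_continuous_on c d (\<lambda>x. complex_of_real (pvar x))"
  unfolding abs_continuous_on_iff
proof (intro allI impI)
  fix \<epsilon> :: real assume "\<epsilon> > 0"
  then have "\<epsilon> / 2 > 0" by simp
  then obtain \<delta> where \<delta>: "\<delta> > 0"
    "\<And>(I :: nat set) u v n s. interval_family c d \<delta> I u v \<Longrightarrow> (\<And>i. i \<in> I \<Longrightarrow> chain (u i) (v i) (n i) (s i)) \<Longrightarrow>
       (\<Sum>i\<in>I. chain_var F (n i) (s i)) < \<epsilon> / 2"
    using chains_small[of "\<epsilon> / 2"] by blast
  show "\<exists>\<delta>>0. \<forall>n u v. interval_family c d \<delta> {..<n::nat} u v \<longrightarrow>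
        (\<Sum>i<n. dist (complex_of_real (pvar (v i))) (complex_of_real (pvar (u i)))) < \<epsilon>"
  proof (intro exI[of _ \<delta>] conjI allI impI \<delta>(1))
    fix n :: nat and u v :: "nat \<Rightarrow> real"
    assume *: "interval_family c d \<delta> {..<n} u v"
    \<comment> \<open>The suprema on \<open>n\<close> intervals are each missed by
      \<open>\<eta>\<close>; this choice keeps the total error at most
      \<open>\<epsilon> / 2\<close>, also for \<open>n = 0\<close>.\<close>
    define \<eta> where "\<eta> = \<epsilon> / (2 * (real n + 1))"
    have "\<eta> > 0" using \<open>\<epsilon> > 0\<close> by (simp add: \<eta>_def add_nonneg_pos)
    have "\<exists>m s. i < n \<longrightarrow> chain (u i) (v i) m s \<and> pvar (v i) - pvar (u i) < chain_var F m s + \<eta>" for i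
    proof (cases "i < n")
      case True
      then have "c \<le> u i" "u i \<le> v i" "v i \<le> d" using interval_family_mem[OF *, of i] by auto
      from pvar_increment_approx[OF this \<open>\<eta> > 0\<close>] show ?thesis by metis
    qed auto
    then obtain m s where ms: "\<And>i. i < n \<Longrightarrow> chain (u i) (v i) (m i) (s i)"
       "\<And>i. i < n \<Longrightarrow> pvar (v i) - pvar (u i) < chain_var F (m i) (s i) + \<eta>" by metis
    have "(\<Sum>i<n. dist (complex_of_real (pvar (v i))) (complex_of_real (pvar (u i))))
       \<le> (\<Sum>i<n. chain_var F (m i) (s i) + \<eta>)"
    proof (rule sum_mono)
      fix i assume "i \<in> {..<n}"
      then have i: "i < n" by simp
      have "pvar (u i) \<le> pvar (v i)" using pvar_increment_ge[of "u i" "v i"] interval_family_mem[OF *, of i] i by auto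
      then show "dist (complex_of_real (pvar (v i))) (complex_of_real (pvar (u i))) \<le> chain_var F (m i) (s i) + \<eta>"
        using ms(2)[OF i] unfolding dist_of_real by (simp add: dist_real_def)
    qed
    also have "\<dots> = (\<Sum>i<n. chain_var F (m i) (s i)) + real n * \<eta>" by (simp add: sum.distrib)
    also have "\<dots> < \<epsilon> / 2 + \<epsilon> / 2"
    proof (rule add_less_le_mono)
      show "(\<Sum>i<n. chain_var F (m i) (s i)) < \<epsilon> / 2"
        by (rule \<delta>(2)[of _ u v]) (use * ms in auto)
      show "real n * \<eta> \<le> \<epsilon> / 2" using \<open>\<epsilon> > 0\<close> by (simp add: \<eta>_def field_simps)
    qed
    finally show "(\<Sum>i<n. dist (complex_of_real (pvar (v i))) (complex_of_real (pvar (u i)))) < \<epsilon>" by simp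
  qed
qed

end

section \<open>Densities of absolutely continuous functions\<close>

lemma absolutely_integrable_subinterval:
  fixes f :: "real \<Rightarrow> 'a::euclidean_space"
  assumes "f absolutely_integrable_on {c..d}" "{x..y} \<subseteq> {c..d}"
  shows "f absolutely_integrable_on {x..y}" "f integrable_on {x..y}"
proof -
  show "f absolutely_integrable_on {x..y}"
    by (rule set_integrable_subset[OF assms(1) _ assms(2)]) auto
  then show "f integrable_on {x..y}" by (rule set_lebesgue_integral_eq_integral(1))
qed

text \<open>The Stieltjes measure of \<open>G\<close> is absolutely continuous with respect to
  Lebesgue measure, and its Radon-Nikodym derivative is the density.\<close>

lemma mono_ac_has_density:
  fixes G :: "real \<Rightarrow> real"
  assumes ac: "abs_continuous_on c d (\<lambda>x. complex_of_real (G x))" and cd: "c < d"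
    and mono: "\<And>x y. c \<le> x \<Longrightarrow> x \<le> y \<Longrightarrow> y \<le> d \<Longrightarrow> G x \<le> G y"
  shows "\<exists>f. f absolutely_integrable_on {c..d} \<and> (\<forall>x\<in>{c..d}. integral {c..x} f = G x - G c)"
proof -
  \<comment> \<open>Clamping the argument extends \<open>G\<close> to the line by constants, so the
    Stieltjes measure has no mass outside \<open>[c,d]\<close>.\<close>
  define cl where "cl x = max c (min d x)" for x
  define G' where "G' x = G (cl x)" for x
  have cl: "cl x \<in> {c..d}" for x using cd by (auto simp: cl_def)
  have clid: "cl x = x" if "x \<in> {c..d}" for x using that by (auto simp: cl_def)
  have clmono: "x \<le> y \<Longrightarrow> cl x \<le> cl y" for x y by (auto simp: cl_def)
  have mono': "x \<le> y \<Longrightarrow> G' x \<le> G' y" for x y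
    unfolding G'_def using cl[of x] cl[of y] clmono by (intro mono) auto
  have "continuous_on {c..d} (\<lambda>x. complex_of_real (G x))"
    by (rule abs_continuous_on_imp_continuous_on[OF ac])
  then have "continuous_on {c..d} (\<lambda>x. Re (complex_of_real (G x)))"
    by (rule continuous_on_Re)
  then have contG: "continuous_on {c..d} G" by (simp only: Re_complex_of_real)
  have "continuous_on UNIV cl" unfolding cl_def by (intro continuous_intros)
  then have cont': "continuous_on UNIV G'"
    unfolding G'_def using cl by (intro continuous_on_compose2[OF contG]) auto
  have rc: "continuous (at_right x) G'" for x
    using cont' by (simp add: continuous_on_eq_continuous_at continuous_at_imp_continuous_at_within)
  define \<mu> where "\<mu> = interval_measure G'"
  have sets\<mu> [simp]: "sets \<mu> = sets borel" by (simp add: \<mu>_def)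
  have Ioc: "x \<le> y \<Longrightarrow> emeasure \<mu> {x<..y} = ennreal (G' y - G' x)" for x y
    unfolding \<mu>_def by (rule emeasure_interval_measure_Ioc[OF _ mono' rc])
  have Icc: "x \<le> y \<Longrightarrow> emeasure \<mu> {x..y} = ennreal (G' y - G' x)" for x y
    unfolding \<mu>_def by (rule emeasure_interval_measure_Icc[OF _ mono' cont'])
  have low: "{..c} \<in> null_sets \<mu>"
  proof -
    have "{..c} = (\<Union>n::nat. {c - real n..c})"
    proof (intro set_eqI iffI)
      fix x assume "x \<in> {..c}"
      moreover obtain n :: nat where "c - x \<le> real n" using real_arch_simple by blast
      ultimately show "x \<in> (\<Union>n::nat. {c - real n..c})" by (auto intro!: exI[of _ n])
    qed auto
    moreover have "{c - real n..c} \<in> null_sets \<mu>" for n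
      using Icc[of "c - real n" c] cd by (auto simp: null_sets_def G'_def cl_def)
    ultimately show ?thesis by (metis null_sets_UN)
  qed
  have high: "{d<..} \<in> null_sets \<mu>"
  proof -
    have "{d<..} = (\<Union>n::nat. {d<..d + real n})"
    proof (intro set_eqI iffI)
      fix x assume "x \<in> {d<..}"
      moreover obtain n :: nat where "x - d \<le> real n" using real_arch_simple by blast
      ultimately show "x \<in> (\<Union>n::nat. {d<..d + real n})" by (auto intro!: exI[of _ n])
    qed auto
    moreover have "{d<..d + real n} \<in> null_sets \<mu>" for n
      using Ioc[of d "d + real n"] cd by (auto simp: null_sets_def G'_def cl_def)
    ultimately show ?thesis by (metis null_sets_UN)
  qed
  have "absolutely_continuous lborel \<mu>"
    unfolding absolutely_continuous_def
  proof
    fix N :: "real set" assume N: "N \<in> null_sets lborel"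
    define N0 where "N0 = N \<inter> {c..d}"
    have N0b: "N0 \<in> sets borel" using N by (auto simp: N0_def null_sets_def)
    have N0n: "N0 \<in> null_sets lebesgue" and N0l: "N0 \<in> sets lebesgue"
      using N by (auto simp: N0_def null_sets_def)
        (metis (no_types, lifting) Int_lower1 N null_sets_completion_iff null_sets_subset null_setsD1 null_setsD2 sets.Int sets_completionI_sets sets_lborel atLeastAtMost_borel emeasure_completion null_set_Int2)+
    have small: "emeasure \<mu> N0 \<le> ennreal \<epsilon>" if "\<epsilon> > 0" for \<epsilon>
    proof -
      \<comment> \<open>Nonoverlapping intervals of total length below \<open>\<delta>\<close> have
        \<open>\<mu>\<close>-measure below \<open>\<epsilon>\<close>. The null set is covered by
        such intervals inside an open set of measure below \<open>\<delta>\<close>.\<close>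
      obtain \<delta> where \<delta>: "\<delta> > 0"
        "\<And>(I :: (real set) set) u v. interval_family c d \<delta> I u v \<Longrightarrow>
           (\<Sum>i\<in>I. dist (complex_of_real (G (v i))) (complex_of_real (G (u i)))) < \<epsilon>"
        using abs_continuous_on_finite[where 'i="real set", OF ac \<open>\<epsilon> > 0\<close>] by blast
      obtain U where U: "open U" "N0 \<subseteq> U" "U - N0 \<in> lmeasurable" "emeasure lebesgue (U - N0) < ennreal \<delta>"
        using sets_lebesgue_outer_open[OF N0l \<delta>(1)] by metis
      have eU: "emeasure lebesgue U < ennreal \<delta>"
      proof -
        have "U = (U - N0) \<union> N0" using U(2) by blast
        then have "emeasure lebesgue U = emeasure lebesgue (U - N0)"
          using N0n U(3) by (metis emeasure_Un_null_set fmeasurableD)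
        with U(4) show ?thesis by simp
      qed
      \<comment> \<open>As every tag lies in \<open>N0\<close>, hence in \<open>U\<close>, fineness
        with respect to this gauge just says that the covering intervals stay inside
        \<open>U\<close>.\<close>
      define g where "g x = (if x \<in> U then U else UNIV)" for x
      have "gauge g" using U(1) by (auto simp: gauge_def g_def)
      moreover have Ncb: "N0 \<subseteq> cbox c d" and bne: "box c d \<noteq> {}" using cd by (auto simp: N0_def box_real)
      ultimately obtain \<D> where D: "countable \<D>" "\<Union>\<D> \<subseteq> cbox c d"
        "\<And>K. K \<in> \<D> \<Longrightarrow> interior K \<noteq> {} \<and> (\<exists>c d. K = cbox c d)"
        "pairwise (\<lambda>A B. interior A \<inter> interior B = {}) \<D>"
        "\<And>K. K \<in> \<D> \<Longrightarrow> \<exists>x \<in> N0 \<inter> K. K \<subseteq> g x" "N0 \<subseteq> \<Union>\<D>"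
        using covering_lemma[OF Ncb bne] by force
      have "\<forall>K\<in>\<D>. \<exists>u v. u < v \<and> K = {u..v} \<and> c \<le> u \<and> v \<le> d \<and> K \<subseteq> U"
      proof
        fix K assume K: "K \<in> \<D>"
        obtain u v where uv: "K = cbox u v" "interior K \<noteq> {}" using D(3)[OF K] by blast
        then have "u < v" by (simp add: interior_cbox box_real)
        moreover have "K \<subseteq> {c..d}" using D(2) K by auto
        moreover have "K \<subseteq> U" using D(5)[OF K] U(2) by (metis Int_iff g_def subsetD)
        ultimately show "\<exists>u v. u < v \<and> K = {u..v} \<and> c \<le> u \<and> v \<le> d \<and> K \<subseteq> U"
          using uv by (intro exI[of _ u] exI[of _ v]) auto
      qed
      then obtain u v where uv: "\<And>K. K \<in> \<D> \<Longrightarrow> u K < v K" "\<And>K. K \<in> \<D> \<Longrightarrow> K = {u K..v K}"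
         "\<And>K. K \<in> \<D> \<Longrightarrow> c \<le> u K" "\<And>K. K \<in> \<D> \<Longrightarrow> v K \<le> d" "\<And>K. K \<in> \<D> \<Longrightarrow> K \<subseteq> U"
        by metis
      have int: "interior K = {u K<..<v K}" if "K \<in> \<D>" for K
        using uv(2)[OF that] by (metis interior_atLeastAtMost_real)
      have DM: "K \<in> sets \<mu>" if "K \<in> \<D>" for K using uv(2)[OF that] by (metis atLeastAtMost_borel sets\<mu>)
      have mK: "emeasure \<mu> K = ennreal (G (v K) - G (u K))" if "K \<in> \<D>" for K
      proof -
        have "emeasure \<mu> {u K..v K} = ennreal (G' (v K) - G' (u K))"
          by (rule Icc) (use uv(1)[OF that] in auto)
        moreover have "u K \<in> {c..d}" "v K \<in> {c..d}" using uv(1,3,4)[OF that] by auto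
        ultimately show ?thesis using uv(2)[OF that] clid by (metis G'_def)
      qed
      \<comment> \<open>Absolute continuity speaks of finite families; the countable cover is
        reached afterwards by continuity from below.\<close>
      have fin: "emeasure \<mu> (\<Union>D') \<le> ennreal \<epsilon>" if D': "D' \<subseteq> \<D>" "finite D'" for D'
      proof -
        have disj: "{u K<..<v K} \<inter> {u L<..<v L} = {}" if "K \<in> D'" "L \<in> D'" "K \<noteq> L" for K L
        proof -
          have "K \<in> \<D>" "L \<in> \<D>" using that D'(1) by auto
          then show ?thesis using D(4) that(3) int by (auto simp: pairwise_def)
        qed
        have "(\<Sum>K\<in>D'. v K - u K) = (\<Sum>K\<in>D'. measure lebesgue {u K<..<v K})"
          by (rule sum.cong[OF refl]) (use uv(1) D'(1) in \<open>auto simp: less_imp_le\<close>)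
        also have "\<dots> = measure lebesgue (\<Union>K\<in>D'. {u K<..<v K})"
          by (rule measure_finite_Union[symmetric]) (use D' disj emeasure_lborel_box_finite[of "u _" "v _"] in \<open>auto simp: disjoint_family_on_def box_real less_top[symmetric]\<close>)
        also have "\<dots> < \<delta>"
        proof -
          have "emeasure lebesgue (\<Union>K\<in>D'. {u K<..<v K}) \<le> emeasure lebesgue U"
          proof (rule emeasure_mono)
            show "(\<Union>K\<in>D'. {u K<..<v K}) \<subseteq> U"
            proof
              fix x assume "x \<in> (\<Union>K\<in>D'. {u K<..<v K})"
              then obtain K where "K \<in> D'" "x \<in> {u K<..<v K}" by blast
              then have "x \<in> K" "K \<subseteq> U" using uv(2,5) D'(1) by (metis greaterThanLessThan_subseteq_atLeastAtMost_iff subsetD order_refl)+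
              then show "x \<in> U" by blast
            qed
            show "U \<in> sets lebesgue" using U(1) by simp
          qed
          with eU have "emeasure lebesgue (\<Union>K\<in>D'. {u K<..<v K}) < ennreal \<delta>" by simp
          moreover from this have "emeasure lebesgue (\<Union>K\<in>D'. {u K<..<v K})
              = ennreal (measure lebesgue (\<Union>K\<in>D'. {u K<..<v K}))"
            by (intro emeasure_eq_ennreal_measure) auto
          ultimately show ?thesis by (simp add: ennreal_less_iff)
        qed
        finally have "(\<Sum>K\<in>D'. v K - u K) < \<delta>" .
        moreover have "c \<le> u K \<and> u K \<le> v K \<and> v K \<le> d" if "K \<in> D'" for K
        proof -
          have "K \<in> \<D>" using that D'(1) by blast
          from uv(1,3,4)[OF this] show ?thesis by simp
        qed
        ultimately have "interval_family c d \<delta> D' u v"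
          unfolding interval_family_def using D'(2) disj by blast
        then have s: "(\<Sum>i\<in>D'. dist (complex_of_real (G (v i))) (complex_of_real (G (u i)))) < \<epsilon>"
          by (rule \<delta>(2))
        have "emeasure \<mu> (\<Union>D') \<le> (\<Sum>K\<in>D'. emeasure \<mu> K)"
          using emeasure_subadditive_finite[of D' "\<lambda>K. K" \<mu>] D' DM by auto
        also have "\<dots> = (\<Sum>K\<in>D'. ennreal (G (v K) - G (u K)))"
          by (rule sum.cong[OF refl]) (use mK D'(1) in auto)
        also have "\<dots> = ennreal (\<Sum>K\<in>D'. G (v K) - G (u K))"
          by (rule sum_ennreal) (use D'(1) uv(1,3,4) mono in \<open>force simp: less_imp_le\<close>)
        also have "\<dots> \<le> ennreal \<epsilon>"
        proof (rule ennreal_leI)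
          have "(\<Sum>K\<in>D'. G (v K) - G (u K)) \<le> (\<Sum>i\<in>D'. dist (complex_of_real (G (v i))) (complex_of_real (G (u i))))"
            unfolding dist_of_real by (intro sum_mono) (simp add: dist_real_def)
          with s show "(\<Sum>K\<in>D'. G (v K) - G (u K)) \<le> \<epsilon>" by linarith
        qed
        finally show ?thesis .
      qed
      have "emeasure \<mu> N0 \<le> emeasure \<mu> (\<Union>\<D>)"
        using D(6) DM D(1) by (intro emeasure_mono sets.countable_Union) auto
      also have "\<dots> \<le> ennreal \<epsilon>"
      proof (cases "\<D> = {}")
        case False
        define h where "h = from_nat_into \<D>"
        have h: "range h = \<D>" unfolding h_def by (rule range_from_nat_into[OF False D(1)])
        have "(\<lambda>n. emeasure \<mu> (\<Union>i\<le>n. h i)) \<longlonglongrightarrow> emeasure \<mu> (\<Union>n. \<Union>i\<le>n. h i)"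
        proof (rule Lim_emeasure_incseq)
          show "incseq (\<lambda>n. \<Union>i\<le>n. h i)" by (rule incseq_SucI) (auto intro: le_SucI)
          show "range (\<lambda>n. \<Union>i\<le>n. h i) \<subseteq> sets \<mu>"
          proof clarify
            fix n
            have "h i \<in> sets \<mu>" for i using DM h by blast
            then show "(\<Union>i\<le>n. h i) \<in> sets \<mu>" by (intro sets.finite_UN) auto
          qed
        qed
        moreover have "(\<Union>n. \<Union>i\<le>n. h i) = \<Union>\<D>" using h by blast
        moreover have "emeasure \<mu> (\<Union>i\<le>n. h i) \<le> ennreal \<epsilon>" for n
          by (rule fin) (use h in auto)
        ultimately show ?thesis by (metis LIMSEQ_le_const2)
      qed simp
      finally show ?thesis .
    qed
    have "emeasure \<mu> N0 = 0"
    proof (rule ccontr)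
      assume "emeasure \<mu> N0 \<noteq> 0"
      moreover have "emeasure \<mu> N0 \<le> ennreal 1" using small[of 1] by simp
      ultimately obtain r where r: "emeasure \<mu> N0 = ennreal r" "r > 0"
        by (metis ennreal_cases ennreal_eq_0_iff infinity_ennreal_def ennreal_le_iff not_le neq_top_trans ennreal_neq_top)
      then show False using small[of "r / 2"] by (simp add: ennreal_le_iff2)
    qed
    then have "N0 \<in> null_sets \<mu>" using N0b by (simp add: null_sets_def)
    then have "N0 \<union> {..c} \<union> {d<..} \<in> null_sets \<mu>" using low high by auto
    moreover have "N \<subseteq> N0 \<union> {..c} \<union> {d<..}" by (auto simp: N0_def)
    moreover have "N \<in> sets \<mu>" using N by (auto simp: null_sets_def)
    ultimately show "N \<in> null_sets \<mu>" using null_sets_subset by blast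
  qed
  then obtain f where f: "f \<in> borel_measurable lborel" "density lborel f = \<mu>"
    using sigma_finite_measure.Radon_Nikodym[OF sigma_finite_lborel, of \<mu>] by auto
  \<comment> \<open>The Radon-Nikodym derivative may be infinite on a null set, where
    \<open>enn2real\<close> returns 0.\<close>
  define f' where "f' = (\<lambda>x. enn2real (f x) * indicator {c..d} x)"
  have f'm [measurable]: "f' \<in> borel_measurable borel" using f(1) by (simp add: f'_def)
  have emf: "emeasure \<mu> A = (\<integral>\<^sup>+x. f x * indicator A x \<partial>lborel)" if "A \<in> sets borel" for A
    using f(1) that by (subst f(2)[symmetric]) (simp add: emeasure_density)
  have "(\<integral>\<^sup>+x. f x * indicator {c..d} x \<partial>lborel) \<noteq> \<infinity>"
    using emf[of "{c..d}"] Icc[of c d] cd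
    by (metis atLeastAtMost_borel ennreal_neq_top infinity_ennreal_def less_imp_le)
  then have "AE x in lborel. f x * indicator {c..d} x \<noteq> \<infinity>"
    using f(1) by (intro nn_integral_PInf_AE) auto
  then have fAE: "AE x in lborel. x \<in> {c..d} \<longrightarrow> ennreal (f' x) = f x"
    by eventually_elim (auto simp: f'_def less_top)
  have hi: "(f' has_integral (G x - G c)) {c..x}" if x: "x \<in> {c..d}" for x
  proof -
    have "(\<integral>\<^sup>+t. ennreal (f' t * indicator {c..x} t) \<partial>lborel) = (\<integral>\<^sup>+t. f t * indicator {c..x} t \<partial>lborel)"
      by (rule nn_integral_cong_AE) (use fAE x in \<open>auto elim!: eventually_mono simp: indicator_def\<close>)
    also have "\<dots> = ennreal (G x - G c)"
      using emf[of "{c..x}"] Icc[of c x] x cd clid by (simp add: G'_def)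
    finally have "((\<lambda>t. f' t * indicator {c..x} t) has_integral (G x - G c)) UNIV"
    proof (rule nn_integral_has_integral[rotated 2])
      show "(\<lambda>t. f' t * indicator {c..x} t) \<in> borel_measurable borel" by measurable
      show "0 \<le> f' t * indicator {c..x} t" for t by (simp add: f'_def)
      show "0 \<le> G x - G c" using mono[of c x] x by simp
    qed
    moreover have "(\<lambda>t. f' t * indicator {c..x} t) = (\<lambda>t. if t \<in> {c..x} then f' t else 0)"
      by (auto simp: indicator_def)
    ultimately show ?thesis by (simp only: has_integral_restrict_UNIV)
  qed
  have "f' absolutely_integrable_on {c..d}"
    using hi[of d] cd by (intro nonnegative_absolutely_integrable_1) (auto simp: f'_def integrable_on_def)
  with hi show ?thesis by (auto intro!: exI[of _ f'] integral_unique)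
qed

text \<open>Real and imaginary parts are handled separately; each is the difference of the
  increasing functions \<open>pvar\<close> and \<open>pvar - G\<close>, which have
  densities.\<close>

lemma abs_continuous_on_imp_integral:
  assumes ac: "abs_continuous_on c d F" and less: "c < d"
  shows "\<exists>f. f absolutely_integrable_on {c..d} \<and> (\<forall>x\<in>{c..d}. F x = F c + integral {c..x} f)"
proof -
  have real_case: "\<exists>f. f absolutely_integrable_on {c..d} \<and> (\<forall>x\<in>{c..d}. integral {c..x} f = G x - G c)"
    if G: "abs_continuous_on c d (\<lambda>x. complex_of_real (G x))" for G
  proof -
    interpret ac_real c d G by unfold_locales (use G less in auto)
    obtain f1 where f1: "f1 absolutely_integrable_on {c..d}"
      "\<And>x. x \<in> {c..d} \<Longrightarrow> integral {c..x} f1 = pvar x - pvar c"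
      using mono_ac_has_density[OF pvar_ac less] pvar_increment_ge by (metis diff_ge_0_iff_ge max.boundedE)
    have "abs_continuous_on c d (\<lambda>x. complex_of_real (pvar x - G x))"
    proof (rule abs_continuous_on_combine[OF pvar_ac G, where M = 1])
      fix x y
      show "dist (complex_of_real (pvar x - G x)) (complex_of_real (pvar y - G y)) \<le>
          1 * (dist (complex_of_real (pvar x)) (complex_of_real (pvar y)) + dist (complex_of_real (G x)) (complex_of_real (G y)))"
        unfolding dist_of_real by (simp add: dist_real_def)
    qed
    moreover have "pvar x - G x \<le> pvar y - G y" if "c \<le> x" "x \<le> y" "y \<le> d" for x y
      using pvar_increment_ge[OF that] by linarith
    ultimately obtain f2 where f2: "f2 absolutely_integrable_on {c..d}"
      "\<And>x. x \<in> {c..d} \<Longrightarrow> integral {c..x} f2 = (pvar x - G x) - (pvar c - G c)"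
      using mono_ac_has_density[OF _ less, of "\<lambda>x. pvar x - G x"] by blast
    show ?thesis
    proof (intro exI[of _ "\<lambda>x. f1 x - f2 x"] conjI ballI)
      show "(\<lambda>x. f1 x - f2 x) absolutely_integrable_on {c..d}"
        by (rule set_integral_diff(1)[OF f1(1) f2(1)])
      fix x assume x: "x \<in> {c..d}"
      have "f1 integrable_on {c..x}" "f2 integrable_on {c..x}"
        using absolutely_integrable_subinterval(2)[OF f1(1)] absolutely_integrable_subinterval(2)[OF f2(1)] x by auto
      then show "integral {c..x} (\<lambda>x. f1 x - f2 x) = G x - G c"
        using f1(2)[OF x] f2(2)[OF x] by (simp add: Henstock_Kurzweil_Integration.integral_diff)
    qed
  qed
  have "abs_continuous_on c d (\<lambda>x. complex_of_real (Re (F x)))"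
  proof (rule abs_continuous_on_combine[OF ac ac, where M = 1])
    fix x y
    show "dist (complex_of_real (Re (F x))) (complex_of_real (Re (F y))) \<le> 1 * (dist (F x) (F y) + dist (F x) (F y))"
      unfolding dist_of_real using abs_Re_le_cmod[of "F x - F y"] norm_ge_zero[of "F x - F y"]
      by (simp add: dist_norm)
  qed
  from real_case[OF this] obtain f where f: "f absolutely_integrable_on {c..d}"
    "\<And>x. x \<in> {c..d} \<Longrightarrow> integral {c..x} f = Re (F x) - Re (F c)"
    by blast
  have "abs_continuous_on c d (\<lambda>x. complex_of_real (Im (F x)))"
  proof (rule abs_continuous_on_combine[OF ac ac, where M = 1])
    fix x y
    show "dist (complex_of_real (Im (F x))) (complex_of_real (Im (F y))) \<le> 1 * (dist (F x) (F y) + dist (F x) (F y))"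
      unfolding dist_of_real using abs_Im_le_cmod[of "F x - F y"] norm_ge_zero[of "F x - F y"]
      by (simp add: dist_norm)
  qed
  from real_case[OF this] obtain g where g: "g absolutely_integrable_on {c..d}"
    "\<And>x. x \<in> {c..d} \<Longrightarrow> integral {c..x} g = Im (F x) - Im (F c)"
    by blast
  define h where "h x = complex_of_real (f x) + \<i> * complex_of_real (g x)" for x
  have lin: "bounded_linear complex_of_real" "bounded_linear (\<lambda>x. \<i> * complex_of_real x)"
    by (auto intro!: bounded_linear_intros bounded_linear_of_real)
  show ?thesis
  proof (intro exI[of _ h] conjI ballI)
    show "h absolutely_integrable_on {c..d}"
      unfolding h_def
      using absolutely_integrable_linear[OF f(1) lin(1)] absolutely_integrable_linear[OF g(1) lin(2)]
      by (intro set_integral_add(1)) (auto simp: o_def)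
    fix x assume x: "x \<in> {c..d}"
    have i: "f integrable_on {c..x}" "g integrable_on {c..x}"
      using absolutely_integrable_subinterval(2)[OF f(1)] absolutely_integrable_subinterval(2)[OF g(1)] x by auto
    have "((\<lambda>x. complex_of_real (f x)) has_integral complex_of_real (Re (F x) - Re (F c))) {c..x}"
      using has_integral_linear[OF integrable_integral[OF i(1)] lin(1)] f(2)[OF x] by (simp add: o_def)
    moreover have "((\<lambda>x. \<i> * complex_of_real (g x)) has_integral \<i> * complex_of_real (Im (F x) - Im (F c))) {c..x}"
      using has_integral_linear[OF integrable_integral[OF i(2)] lin(2)] g(2)[OF x] by (simp add: o_def)
    ultimately have "(h has_integral complex_of_real (Re (F x) - Re (F c)) + \<i> * complex_of_real (Im (F x) - Im (F c))) {c..x}"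
      unfolding h_def by (rule has_integral_add)
    then show "F x = F c + integral {c..x} h"
      by (simp add: integral_unique complex_eq_iff)
  qed
qed

section \<open>Calculus of indefinite integrals\<close>

text \<open>The working form of absolute continuity with derivative \<open>f\<close>. In integrated
  form it restricts, glues and tolerates changes of \<open>f\<close> on null sets without any
  bookkeeping of exceptional points.\<close>

definition prim :: "real \<Rightarrow> real \<Rightarrow> (real \<Rightarrow> 'a::euclidean_space) \<Rightarrow> (real \<Rightarrow> 'a) \<Rightarrow> bool" where
  "prim c d F f \<longleftrightarrow> f absolutely_integrable_on {c..d} \<and> (\<forall>x\<in>{c..d}. F x = F c + integral {c..x} f)"

lemma prim_absolutely_integrable: "prim c d F f \<Longrightarrow> f absolutely_integrable_on {c..d}"
  unfolding prim_def by blast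

lemma prim_eq: "prim c d F f \<Longrightarrow> x \<in> {c..d} \<Longrightarrow> F c + integral {c..x} f = F x"
  unfolding prim_def by (metis (no_types))

lemma prim_integrable:
  assumes "prim c d F f" "{x..y} \<subseteq> {c..d}"
  shows "f absolutely_integrable_on {x..y}" "f integrable_on {x..y}"
  using absolutely_integrable_subinterval[OF prim_absolutely_integrable[OF assms(1)] assms(2)] by auto

lemma prim_diff_eq:
  assumes "prim c d F f" "c \<le> x" "x \<le> y" "y \<le> d"
  shows "F y - F x = integral {x..y} f"
proof -
  have "integral {c..x} f + integral {x..y} f = integral {c..y} f"
    by (rule Henstock_Kurzweil_Integration.integral_combine) (use assms prim_integrable[OF assms(1), of c y] in auto)
  then show ?thesis
    using prim_eq[OF assms(1), of x] prim_eq[OF assms(1), of y] assms(2-4)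
    by (simp add: algebra_simps) (metis add.assoc add.commute)
qed

lemma primI:
  assumes "f absolutely_integrable_on {c..d}"
    and "\<And>x y. c \<le> x \<Longrightarrow> x \<le> y \<Longrightarrow> y \<le> d \<Longrightarrow> F y - F x = integral {x..y} f"
  shows "prim c d F f"
  unfolding prim_def
proof (intro conjI ballI assms(1))
  fix x assume "x \<in> {c..d}"
  then show "F x = F c + integral {c..x} f" using assms(2)[of c x] by (simp add: algebra_simps)
qed

lemma prim_subinterval:
  assumes "prim c d F f" "c \<le> c'" "d' \<le> d"
  shows "prim c' d' F f"
  by (rule primI) (use assms prim_diff_eq[OF assms(1)] prim_integrable(1)[OF assms(1), of c' d'] in auto)

lemma prim_join:
  assumes f: "prim c m F f" and g: "prim m d F f" and "c \<le> m" "m \<le> d"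
  shows "prim c d F f"
proof (rule primI)
  have "f absolutely_integrable_on ({c..m} \<union> {m..d})"
    by (rule set_integrable_Un) (use prim_absolutely_integrable[OF f] prim_absolutely_integrable[OF g] in auto)
  moreover have "{c..m} \<union> {m..d} = {c..d}" using assms by auto
  ultimately show fi: "f absolutely_integrable_on {c..d}" by simp
  fix x y assume xy: "c \<le> x" "x \<le> y" "y \<le> d"
  consider "y \<le> m" | "m \<le> x" | "x \<le> m" "m \<le> y" by linarith
  then show "F y - F x = integral {x..y} f"
  proof cases
    case 1 then show ?thesis using prim_diff_eq[OF f] xy by auto
  next
    case 2 then show ?thesis using prim_diff_eq[OF g] xy by auto
  next
    case 3
    have "integral {x..m} f + integral {m..y} f = integral {x..y} f"
      by (rule Henstock_Kurzweil_Integration.integral_combine)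
         (use 3 xy absolutely_integrable_subinterval(2)[OF fi, of x y] in auto)
    moreover have "F m - F x = integral {x..m} f" "F y - F m = integral {m..y} f"
      using prim_diff_eq[OF f, of x m] prim_diff_eq[OF g, of m y] 3 xy by auto
    ultimately show ?thesis by (smt (verit) add_diff_eq diff_add_cancel add.commute)
  qed
qed

lemma prim_cong:
  assumes F: "prim c d F f" and FG: "\<And>x. x \<in> {c..d} \<Longrightarrow> F x = G x"
  shows "prim c d G f"
proof (rule primI)
  show "f absolutely_integrable_on {c..d}" by (rule prim_absolutely_integrable[OF F])
  fix x y assume xy: "c \<le> x" "x \<le> y" "y \<le> d"
  then have "F x = G x" "F y = G y" using FG by auto
  with prim_diff_eq[OF F xy] show "G y - G x = integral {x..y} f" by simp
qed

lemma AE_interval_negligible: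
  fixes c d :: real
  assumes "AE x in lebesgue. x \<in> {c<..<d} \<longrightarrow> P x"
  obtains N where "negligible N" "\<And>x. x \<in> {c..d} - N \<Longrightarrow> P x"
proof -
  obtain N where N: "N \<in> null_sets lebesgue" "{x \<in> space lebesgue. \<not> (x \<in> {c<..<d} \<longrightarrow> P x)} \<subseteq> N"
    using AE_E[OF assms] by (metis (no_types, lifting) null_setsI)
  have "negligible (N \<union> {c, d})"
    using N(1) by (auto simp: negligible_iff_null_sets[symmetric])
  then show ?thesis
  proof (rule that)
    fix x assume "x \<in> {c..d} - (N \<union> {c, d})"
    then have "c \<le> x" "x \<le> d" "x \<noteq> c" "x \<noteq> d" "x \<notin> N" by auto
    then have "x \<in> {c<..<d}" "x \<notin> N" by auto
    then show "P x" using N(2) by (auto simp: subset_iff)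
  qed
qed

lemma absolutely_integrable_cong_AE:
  fixes f g :: "real \<Rightarrow> 'a::euclidean_space"
  assumes "f absolutely_integrable_on {c..d}" "AE x in lebesgue. x \<in> {c<..<d} \<longrightarrow> f x = g x"
  shows "g absolutely_integrable_on {c..d}"
proof -
  obtain N where N: "negligible N" "\<And>x. x \<in> {c..d} - N \<Longrightarrow> f x = g x"
    by (rule AE_interval_negligible[OF assms(2)]) blast
  show ?thesis by (rule absolutely_integrable_spike[OF assms(1) N(1)]) (use N in auto)
qed

lemma integral_cong_AE_interval:
  fixes f g :: "real \<Rightarrow> 'a::euclidean_space"
  assumes "AE x in lebesgue. x \<in> {c<..<d} \<longrightarrow> f x = g x"
  shows "integral {c..d} f = integral {c..d} g"
proof -
  obtain N where N: "negligible N" "\<And>x. x \<in> {c..d} - N \<Longrightarrow> f x = g x"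
    by (rule AE_interval_negligible[OF assms]) blast
  show ?thesis by (rule integral_spike[OF N(1)]) (use N in auto)
qed

lemma prim_cong_AE:
  assumes F: "prim c d F f" and fg: "AE x in lebesgue. x \<in> {c<..<d} \<longrightarrow> f x = g x"
  shows "prim c d F g"
proof (rule primI)
  show "g absolutely_integrable_on {c..d}"
    by (rule absolutely_integrable_cong_AE[OF _ fg]) (rule prim_absolutely_integrable[OF F])
  fix x y assume xy: "c \<le> x" "x \<le> y" "y \<le> d"
  have "AE t in lebesgue. t \<in> {x<..<y} \<longrightarrow> f t = g t"
    using fg by eventually_elim (use xy in auto)
  then show "F y - F x = integral {x..y} g"
    using prim_diff_eq[OF F xy] integral_cong_AE_interval[where c = x and d = y and f = f and g = g] by simp
qed

lemma prim_has_vector_derivative: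
  assumes F: "prim c d F f"
  shows "AE x in lebesgue. x \<in> {c<..<d} \<longrightarrow> (F has_vector_derivative f x) (at x)"
proof (cases "c \<le> d")
  case True
  have "AE x in lebesgue. x \<in> {c<..<d} \<longrightarrow> ((\<lambda>u. integral {c..u} f) has_vector_derivative f x) (at x)"
    by (rule AE_has_vector_derivative_integral) (use prim_integrable(2)[OF F, of c d] in auto)
  then show ?thesis
  proof eventually_elim
    case (elim x)
    show ?case
    proof
      assume x: "x \<in> {c<..<d}"
      with elim have "((\<lambda>u. F c + integral {c..u} f) has_vector_derivative f x) (at x)"
        by (auto intro!: derivative_eq_intros)
      then show "(F has_vector_derivative f x) (at x)"
        by (rule has_vector_derivative_transform_within_open[where S = "{c<..<d}"])
           (use x prim_eq[OF F] in auto)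
    qed
  qed
qed (auto intro!: AE_I2)

lemma prim_deriv_unique:
  assumes "prim c d F f" "prim c d G g" "\<And>x. x \<in> {c..d} \<Longrightarrow> F x = G x"
  shows "AE x in lebesgue. x \<in> {c<..<d} \<longrightarrow> f x = g x"
  using prim_has_vector_derivative[OF assms(1)] prim_has_vector_derivative[OF assms(2)]
proof eventually_elim
  case (elim x)
  show ?case
  proof
    assume x: "x \<in> {c<..<d}"
    with elim have d: "(F has_vector_derivative f x) (at x)" "(G has_vector_derivative g x) (at x)" by blast+
    have "(G has_vector_derivative f x) (at x)"
      by (rule has_vector_derivative_transform_within_open[OF d(1), where S = "{c<..<d}"])
         (use x assms(3) in auto)
    then show "f x = g x" using d(2) by (rule vector_derivative_unique_at)
  qed
qed

lemma prim_continuous_on: "prim c d F f \<Longrightarrow> continuous_on {c..d} F"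
proof -
  assume F: "prim c d F f"
  have "continuous_on {c..d} (\<lambda>x. F c + integral {c..x} f)"
    by (intro continuous_intros indefinite_integral_continuous_1) (use prim_integrable(2)[OF F, of c d] in auto)
  then show ?thesis by (rule continuous_on_eq) (use prim_eq[OF F] in auto)
qed

lemma sum_integral_disjoint_le:
  fixes h :: "real \<Rightarrow> real"
  assumes fam: "interval_family c d \<delta> I u v" and h: "h integrable_on {c..d}"
    and nn: "\<And>x. x \<in> {c..d} \<Longrightarrow> h x \<ge> 0"
  shows "(\<Sum>i\<in>I. integral {u i..v i} h) \<le> integral {c..d} h"
proof -
  let ?k = "\<lambda>i x. if x \<in> {u i<..<v i} then h x else 0"
  have fin: "finite I" using fam by (simp add: interval_family_def)
  have k: "(?k i has_integral integral {u i..v i} h) {c..d}" if "i \<in> I" for i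
  proof -
    have "h integrable_on {u i..v i}"
      by (rule integrable_on_subinterval[OF h]) (use interval_family_mem[OF fam that] in auto)
    then have "(h has_integral integral {u i..v i} h) {u i<..<v i}"
      by (metis box_real(1) box_real(2) has_integral_Icc_iff_Ioo integrable_integral)
    then show ?thesis
      by (subst has_integral_restrict) (use interval_family_mem[OF fam that] in auto)
  qed
  then have s: "((\<lambda>x. \<Sum>i\<in>I. ?k i x) has_integral (\<Sum>i\<in>I. integral {u i..v i} h)) {c..d}"
    by (rule has_integral_sum[OF fin])
  show ?thesis
  proof (rule has_integral_le[OF s integrable_integral[OF h]])
    fix x assume x: "x \<in> {c..d}"
    show "(\<Sum>i\<in>I. ?k i x) \<le> h x"
    proof (cases "\<exists>i\<in>I. x \<in> {u i<..<v i}")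
      case True
      then obtain i where i: "i \<in> I" "x \<in> {u i<..<v i}" by blast
      have "?k j x = 0" if "j \<in> I - {i}" for j
      proof -
        have "{u i<..<v i} \<inter> {u j<..<v j} = {}"
          using fam that i(1) unfolding interval_family_def by blast
        then have "x \<notin> {u j<..<v j}" using i(2) by blast
        then show ?thesis by (rule if_not_P)
      qed
      then have "(\<Sum>j\<in>I. ?k j x) = ?k i x"
        by (subst sum.remove[OF fin i(1)]) simp
      then show ?thesis using i nn[OF x] by simp
    next
      case False
      then have "(\<Sum>i\<in>I. ?k i x) = 0" by (intro sum.neutral) auto
      then show ?thesis using nn[OF x] by simp
    qed
  qed
qed

text \<open>Cut the norm of \<open>f\<close> off at a height \<open>n\<close>: the excess
  \<open>h\<close> has small integral, and the bounded rest contributes at most \<open>n\<close>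
  times the total length.\<close>

lemma prim_imp_abs_continuous_on:
  fixes F :: "real \<Rightarrow> complex"
  assumes F: "prim c d F f"
  shows "abs_continuous_on c d F"
  unfolding abs_continuous_on_iff
proof (intro allI impI)
  fix \<epsilon> :: real assume "\<epsilon> > 0"
  define k where "k x = norm (f x)" for x
  have ka: "k absolutely_integrable_on {c..d}"
    using absolutely_integrable_norm[OF prim_absolutely_integrable[OF F]] by (simp add: k_def[abs_def] o_def)
  then have ki: "k integrable_on {c..d}" by (rule set_lebesgue_integral_eq_integral(1))
  have ga: "(\<lambda>x. min (k x) (real n)) absolutely_integrable_on {c..d}" for n
    by (rule absolutely_integrable_min_1[OF ka]) (auto intro: absolutely_integrable_on_const)
  then have gi: "(\<lambda>x. min (k x) (real n)) integrable_on {c..d}" for n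
    by (rule set_lebesgue_integral_eq_integral(1))
  have "(\<lambda>n. integral {c..d} (\<lambda>x. min (k x) (real n))) \<longlonglongrightarrow> integral {c..d} k"
  proof (rule dominated_convergence(2)[OF gi ki])
    fix n x show "norm (min (k x) (real n)) \<le> k x" by (auto simp: k_def)
  next
    fix x
    obtain N :: nat where N: "k x \<le> real N" using real_arch_simple by blast
    have "eventually (\<lambda>n. min (k x) (real n) = k x) sequentially"
      using eventually_ge_at_top[of N] by eventually_elim (use N in auto)
    then show "(\<lambda>n. min (k x) (real n)) \<longlonglongrightarrow> k x"
      by (rule tendsto_eventually)
  qed
  from LIMSEQ_D[OF this, of "\<epsilon> / 2"] \<open>\<epsilon> > 0\<close>
  obtain n where "norm (integral {c..d} (\<lambda>x. min (k x) (real n)) - integral {c..d} k) < \<epsilon> / 2" by auto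
  then have n: "integral {c..d} k - integral {c..d} (\<lambda>x. min (k x) (real n)) < \<epsilon> / 2"
    unfolding real_norm_def by linarith
  define h where "h x = k x - min (k x) (real n)" for x
  have hi: "h integrable_on {c..d}" and hI: "integral {c..d} h < \<epsilon> / 2"
    using n ki gi[of n] unfolding h_def
    by (auto simp: Henstock_Kurzweil_Integration.integral_diff intro: integrable_diff)
  \<comment> \<open>Makes \<open>real n * \<delta> \<le> \<epsilon> / 2\<close>; the added 1 takes
    care of \<open>n = 0\<close>.\<close>
  define \<delta> where "\<delta> = \<epsilon> / (2 * (real n + 1))"
  have \<delta>: "\<delta> > 0" using \<open>\<epsilon> > 0\<close> by (simp add: \<delta>_def add_nonneg_pos)
  show "\<exists>\<delta>>0. \<forall>m u v. interval_family c d \<delta> {..<m::nat} u v \<longrightarrow> (\<Sum>i<m. dist (F (v i)) (F (u i))) < \<epsilon>"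
  proof (intro exI[of _ \<delta>] conjI allI impI \<delta>)
    fix m :: nat and u v :: "nat \<Rightarrow> real"
    assume fam: "interval_family c d \<delta> {..<m} u v"
    have "(\<Sum>i<m. dist (F (v i)) (F (u i))) \<le> (\<Sum>i<m. integral {u i..v i} h + real n * (v i - u i))"
    proof (rule sum_mono)
      fix i assume i: "i \<in> {..<m}"
      note uv = interval_family_mem[OF fam i]
      have sub: "{u i..v i} \<subseteq> {c..d}" using uv by auto
      have kiu: "k integrable_on {u i..v i}" by (rule integrable_on_subinterval[OF ki sub])
      have giu: "(\<lambda>x. min (k x) (real n)) integrable_on {u i..v i}" by (rule integrable_on_subinterval[OF gi sub])
      have hiu: "h integrable_on {u i..v i}" by (rule integrable_on_subinterval[OF hi sub])
      have "dist (F (v i)) (F (u i)) = norm (integral {u i..v i} f)"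
        using prim_diff_eq[OF F, of "u i" "v i"] uv by (simp add: dist_norm)
      also have "\<dots> \<le> integral {u i..v i} k"
        by (rule integral_norm_bound_integral[OF _ kiu]) (use prim_integrable(2)[OF F sub] in \<open>auto simp: k_def\<close>)
      also have "\<dots> \<le> integral {u i..v i} (\<lambda>x. h x + real n)"
      proof (rule integral_le[OF kiu])
        show "(\<lambda>x. h x + real n) integrable_on {u i..v i}"
          by (intro integrable_add hiu integrable_const_ivl)
      qed (simp add: h_def)
      also have "\<dots> = integral {u i..v i} h + real n * (v i - u i)"
        using hiu uv by (subst Henstock_Kurzweil_Integration.integral_add) auto
      finally show "dist (F (v i)) (F (u i)) \<le> integral {u i..v i} h + real n * (v i - u i)" .
    qed
    also have "\<dots> = (\<Sum>i<m. integral {u i..v i} h) + real n * (\<Sum>i<m. v i - u i)"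
      by (simp add: sum.distrib sum_distrib_left)
    also have "\<dots> < \<epsilon> / 2 + \<epsilon> / 2"
    proof (rule add_less_le_mono)
      have "(\<Sum>i<m. integral {u i..v i} h) \<le> integral {c..d} h"
        by (rule sum_integral_disjoint_le[OF fam hi]) (auto simp: h_def)
      with hI show "(\<Sum>i<m. integral {u i..v i} h) < \<epsilon> / 2" by simp
      have "real n * (\<Sum>i<m. v i - u i) \<le> real n * \<delta>"
        using fam by (intro mult_left_mono) (auto simp: interval_family_def)
      also have "\<dots> \<le> \<epsilon> / 2" using \<open>\<epsilon> > 0\<close> by (simp add: \<delta>_def field_simps)
      finally show "real n * (\<Sum>i<m. v i - u i) \<le> \<epsilon> / 2" .
    qed
    finally show "(\<Sum>i<m. dist (F (v i)) (F (u i))) < \<epsilon>" by simp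
  qed
qed

lemma abs_continuous_on_imp_prim:
  assumes "abs_continuous_on c d F" "c < d"
  shows "prim c d F (\<lambda>x. vector_derivative F (at x))"
proof -
  obtain f where f: "prim c d F f"
    using abs_continuous_on_imp_integral[OF assms] by (auto simp: prim_def)
  have "AE x in lebesgue. x \<in> {c<..<d} \<longrightarrow> f x = vector_derivative F (at x)"
    using prim_has_vector_derivative[OF f] by eventually_elim (auto simp: vector_derivative_at)
  then show ?thesis by (rule prim_cong_AE[OF f])
qed

text \<open>The product is absolutely continuous because both factors are bounded, so it is the
  integral of its own derivative, which the pointwise product rule identifies almost everywhere.
  This replaces an integration by parts.\<close>

lemma prim_mult:
  fixes F G :: "real \<Rightarrow> complex"
  assumes F: "prim c d F f" and G: "prim c d G g" and "c < d"
  shows "prim c d (\<lambda>x. F x * G x) (\<lambda>x. f x * G x + F x * g x)"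
proof -
  obtain B1 where B1: "\<And>x. x \<in> {c..d} \<Longrightarrow> norm (F x) \<le> B1"
    using compact_imp_bounded[OF compact_continuous_image[OF prim_continuous_on[OF F] compact_Icc]]
    unfolding bounded_iff by blast
  obtain B2 where B2: "\<And>x. x \<in> {c..d} \<Longrightarrow> norm (G x) \<le> B2"
    using compact_imp_bounded[OF compact_continuous_image[OF prim_continuous_on[OF G] compact_Icc]]
    unfolding bounded_iff by blast
  have "abs_continuous_on c d (\<lambda>x. F x * G x)"
  proof (rule abs_continuous_on_combine[OF prim_imp_abs_continuous_on[OF F] prim_imp_abs_continuous_on[OF G]])
    fix x y assume xy: "x \<in> {c..d}" "y \<in> {c..d}"
    have "F x * G x - F y * G y = (F x - F y) * G x + F y * (G x - G y)" by (simp add: algebra_simps)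
    then have "dist (F x * G x) (F y * G y) \<le> norm (F x - F y) * norm (G x) + norm (F y) * norm (G x - G y)"
      by (metis dist_norm norm_mult norm_triangle_ineq)
    also have "\<dots> \<le> norm (F x - F y) * max B1 B2 + max B1 B2 * norm (G x - G y)"
      by (intro add_mono mult_left_mono mult_right_mono) (use B1[OF xy(2)] B2[OF xy(1)] in auto)
    finally show "dist (F x * G x) (F y * G y) \<le> max B1 B2 * (dist (F x) (F y) + dist (G x) (G y))"
      by (simp add: dist_norm algebra_simps)
  qed
  then have P: "prim c d (\<lambda>x. F x * G x) (\<lambda>x. vector_derivative (\<lambda>x. F x * G x) (at x))"
    by (rule abs_continuous_on_imp_prim[OF _ \<open>c < d\<close>])
  show ?thesis
  proof (rule prim_cong_AE[OF P])
    show "AE x in lebesgue. x \<in> {c<..<d} \<longrightarrow> vector_derivative (\<lambda>x. F x * G x) (at x) = f x * G x + F x * g x"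
      using prim_has_vector_derivative[OF F] prim_has_vector_derivative[OF G]
    proof eventually_elim
      case (elim x)
      show ?case
      proof
        assume "x \<in> {c<..<d}"
        with elim have "((\<lambda>x. F x * G x) has_vector_derivative (F x * g x + f x * G x)) (at x)"
          by (intro has_vector_derivative_mult) auto
        then show "vector_derivative (\<lambda>x. F x * G x) (at x) = f x * G x + F x * g x"
          by (simp add: vector_derivative_at)
      qed
    qed
  qed
qed

lemma prim_linear:
  fixes F :: "real \<Rightarrow> 'a::euclidean_space" and L :: "'a \<Rightarrow> 'b::euclidean_space"
  assumes F: "prim c d F f" and L: "bounded_linear L"
  shows "prim c d (\<lambda>x. L (F x)) (\<lambda>x. L (f x))"
proof (rule primI)
  interpret bounded_linear L by (rule L)
  show "(\<lambda>x. L (f x)) absolutely_integrable_on {c..d}"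
    using absolutely_integrable_linear[OF prim_absolutely_integrable[OF F] L] by (simp add: o_def)
  fix x y assume xy: "c \<le> x" "x \<le> y" "y \<le> d"
  have "f integrable_on {x..y}" by (rule prim_integrable(2)[OF F]) (use xy in auto)
  then have "integral {x..y} (\<lambda>x. L (f x)) = L (integral {x..y} f)"
    using integral_linear[OF _ L] by (simp add: o_def)
  then show "L (F y) - L (F x) = integral {x..y} (\<lambda>x. L (f x))"
    using prim_diff_eq[OF F xy] by (metis diff)
qed

lemma prim_add:
  assumes F: "prim c d F f" and G: "prim c d G g"
  shows "prim c d (\<lambda>x. F x + G x) (\<lambda>x. f x + g x)"
proof (rule primI)
  show "(\<lambda>x. f x + g x) absolutely_integrable_on {c..d}"
    by (rule set_integral_add(1)) (rule prim_absolutely_integrable[OF F] prim_absolutely_integrable[OF G])+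
  fix x y assume xy: "c \<le> x" "x \<le> y" "y \<le> d"
  have "f integrable_on {x..y}" "g integrable_on {x..y}"
    using prim_integrable(2)[OF F, of x y] prim_integrable(2)[OF G, of x y] xy by auto
  then show "F y + G y - (F x + G x) = integral {x..y} (\<lambda>x. f x + g x)"
    using prim_diff_eq[OF F xy] prim_diff_eq[OF G xy]
    by (simp add: Henstock_Kurzweil_Integration.integral_add algebra_simps)
qed

lemma prim_const: "prim c d (\<lambda>_. k) (\<lambda>_. 0)"
  by (auto simp: prim_def)

lemma prim_minus: "prim c d F f \<Longrightarrow> prim c d (\<lambda>x. - F x) (\<lambda>x. - f x)"
  by (rule prim_linear) (auto intro: bounded_linear_minus bounded_linear_ident)

lemma prim_diff:
  "prim c d F f \<Longrightarrow> prim c d G g \<Longrightarrow> prim c d (\<lambda>x. F x - G x) (\<lambda>x. f x - g x)"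
  using prim_add[of c d F f "\<lambda>x. - G x" "\<lambda>x. - g x"] prim_minus[of c d G g] by simp

lemma prim_cmult:
  fixes F :: "real \<Rightarrow> complex"
  shows "prim c d F f \<Longrightarrow> prim c d (\<lambda>x. k * F x) (\<lambda>x. k * f x)"
  by (rule prim_linear) (auto intro: bounded_linear_mult_right)

lemma prim_cnj: "prim c d F f \<Longrightarrow> prim c d (\<lambda>x. cnj (F x)) (\<lambda>x. cnj (f x))"
  by (rule prim_linear) (auto intro: bounded_linear_cnj)

section \<open>Linear systems with integrable coefficients\<close>

text \<open>
  \<open>E\<close> plays the role of \<open>exp (2 \<integral> k)\<close>: in the sup norm weighted by \<open>1 / E\<close> the Picard operator
  is a contraction on the whole interval.
\<close>

lemma ode_weight:
  fixes k :: "real \<Rightarrow> real"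
  assumes k: "k absolutely_integrable_on {c..d}" and nn: "\<And>t. t \<in> {c..d} \<Longrightarrow> k t \<ge> 0" and cd: "c \<le> d"
  obtains E where "continuous_on {c..d} E" "\<And>x. x \<in> {c..d} \<Longrightarrow> E x > 0"
    "(\<lambda>t. k t * E t) integrable_on {c..d}"
    "\<And>x. x \<in> {c..d} \<Longrightarrow> integral {c..x} (\<lambda>t. k t * E t) \<le> E x / 2"
proof (cases "c < d")
  case False
  then have "c = d" using cd by simp
  then show ?thesis by (intro that[of "\<lambda>_. 1"]) (use set_lebesgue_integral_eq_integral(1)[OF k] in auto)
next
  case True
  define \<kappa> where "\<kappa> x = integral {c..x} k" for x
  \<comment> \<open>Almost everywhere \<open>E' = 2 k E\<close>, so the integral of
    \<open>k E\<close> up to \<open>x\<close> equals \<open>(E x - E c) / 2\<close>. The 2 in the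
    exponent is what produces the contraction factor 1/2.\<close>
  define E where "E x = exp (2 * \<kappa> x)" for x
  have pk: "prim c d \<kappa> k" unfolding prim_def \<kappa>_def using k by auto
  have "prim c d (\<lambda>x. complex_of_real (\<kappa> x)) (\<lambda>x. complex_of_real (k x))"
    by (rule prim_linear[OF pk bounded_linear_of_real])
  then have ac\<kappa>: "abs_continuous_on c d (\<lambda>x. complex_of_real (\<kappa> x))"
    by (rule prim_imp_abs_continuous_on)
  have mono: "\<kappa> x \<le> \<kappa> y" if "c \<le> x" "x \<le> y" "y \<le> d" for x y
  proof -
    have "integral {x..y} k \<ge> 0"
      by (rule integral_nonneg) (use nn that prim_integrable(2)[OF pk] in auto)
    then show ?thesis using prim_diff_eq[OF pk that] by simp
  qed
  have b: "\<kappa> x \<le> \<kappa> d" if "x \<in> {c..d}" for x using mono[of x d] that by auto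
  \<comment> \<open>The exponential is Lipschitz on the range of \<open>\<kappa>\<close>, which lies
    below \<open>\<kappa> d\<close> because \<open>k\<close> is nonnegative; hence \<open>E\<close>
    inherits absolute continuity.\<close>
  have lip: "\<bar>exp (2 * s) - exp (2 * t)\<bar> \<le> 2 * exp (2 * B) * \<bar>s - t\<bar>" if "s \<le> B" "t \<le> B" for s t B :: real
  proof -
    have "norm (exp (2 * s) - exp (2 * t)) \<le> (2 * exp (2 * B)) * norm (s - t)"
    proof (rule field_differentiable_bound[where S = "{..B}" and f' = "\<lambda>x. 2 * exp (2 * x)"])
      fix z assume "z \<in> {..B}"
      show "((\<lambda>x. exp (2 * x)) has_field_derivative 2 * exp (2 * z)) (at z within {..B})"
        by (auto intro!: derivative_eq_intros)
      show "norm (2 * exp (2 * z)) \<le> 2 * exp (2 * B)" using \<open>z \<in> {..B}\<close> by simp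
    qed (use that in auto)
    then show ?thesis by simp
  qed
  have "abs_continuous_on c d (\<lambda>x. complex_of_real (E x))"
  proof (rule abs_continuous_on_combine[OF ac\<kappa> ac\<kappa>, where M = "2 * exp (2 * \<kappa> d)"])
    fix x y assume "x \<in> {c..d}" "y \<in> {c..d}"
    then have "\<bar>E x - E y\<bar> \<le> 2 * exp (2 * \<kappa> d) * \<bar>\<kappa> x - \<kappa> y\<bar>"
      unfolding E_def using b by (intro lip) auto
    also have "\<dots> \<le> 2 * exp (2 * \<kappa> d) * (\<bar>\<kappa> x - \<kappa> y\<bar> + \<bar>\<kappa> x - \<kappa> y\<bar>)"
      by (intro mult_left_mono) auto
    finally show "dist (complex_of_real (E x)) (complex_of_real (E y)) \<le> 2 * exp (2 * \<kappa> d) *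
        (dist (complex_of_real (\<kappa> x)) (complex_of_real (\<kappa> y)) + dist (complex_of_real (\<kappa> x)) (complex_of_real (\<kappa> y)))"
      unfolding dist_of_real by (simp add: dist_real_def)
  qed
  then have "prim c d (\<lambda>x. complex_of_real (E x)) (\<lambda>x. vector_derivative (\<lambda>x. complex_of_real (E x)) (at x))"
    by (rule abs_continuous_on_imp_prim[OF _ True])
  moreover have "AE x in lebesgue. x \<in> {c<..<d} \<longrightarrow>
      vector_derivative (\<lambda>x. complex_of_real (E x)) (at x) = complex_of_real (2 * (k x * E x))"
    using prim_has_vector_derivative[OF pk]
  proof eventually_elim
    case (elim x)
    show ?case
    proof
      assume "x \<in> {c<..<d}"
      with elim have "(\<kappa> has_real_derivative k x) (at x)" by (simp add: has_real_derivative_iff_has_vector_derivative)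
      then have "(E has_real_derivative 2 * (k x * E x)) (at x)"
        unfolding E_def by (auto intro!: derivative_eq_intros)
      then have "((\<lambda>x. complex_of_real (E x)) has_vector_derivative complex_of_real (2 * (k x * E x))) (at x)"
        by (rule has_vector_derivative_of_real)
      then show "vector_derivative (\<lambda>x. complex_of_real (E x)) (at x) = complex_of_real (2 * (k x * E x))"
        by (rule vector_derivative_at)
    qed
  qed
  ultimately have "prim c d (\<lambda>x. complex_of_real (E x)) (\<lambda>x. complex_of_real (2 * (k x * E x)))"
    by (rule prim_cong_AE)
  from prim_linear[OF this bounded_linear_Re] have pE: "prim c d E (\<lambda>x. 2 * (k x * E x))" by simp
  have int: "(\<lambda>t. k t * E t) integrable_on {x..y}" if "{x..y} \<subseteq> {c..d}" for x y
    using integrable_on_cmult_iff[of 2 "\<lambda>t. k t * E t"] prim_integrable(2)[OF pE that] by simp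
  show ?thesis
  proof (rule that)
    show "continuous_on {c..d} E" by (rule prim_continuous_on[OF pE])
    show "E x > 0" for x by (simp add: E_def)
    show "(\<lambda>t. k t * E t) integrable_on {c..d}" by (rule int) simp
    fix x assume x: "x \<in> {c..d}"
    have "E x - E c = integral {c..x} (\<lambda>x. 2 * (k x * E x))"
      using prim_diff_eq[OF pE, of c x] x by simp
    also have "\<dots> = 2 * integral {c..x} (\<lambda>t. k t * E t)" by simp
    finally have "2 * integral {c..x} (\<lambda>t. k t * E t) = E x - E c" ..
    moreover have "E c > 0" by (simp add: E_def)
    ultimately show "integral {c..x} (\<lambda>t. k t * E t) \<le> E x / 2" by linarith
  qed
qed

text \<open>Caratheodory conditions with an integrable Lipschitz bound. Integrability is asked for
  along continuous curves only, which avoids joint measurability of the right-hand side.\<close>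

locale ode =
  fixes c d :: real and A :: "real \<Rightarrow> 'a::euclidean_space \<Rightarrow> 'a" and k :: "real \<Rightarrow> real"
  assumes cd: "c \<le> d"
    and int: "\<And>Y. continuous_on {c..d} Y \<Longrightarrow> (\<lambda>t. A t (Y t)) absolutely_integrable_on {c..d}"
    and lip: "\<And>t y z. t \<in> {c..d} \<Longrightarrow> norm (A t y - A t z) \<le> k t * norm (y - z)"
    and k: "k absolutely_integrable_on {c..d}" and k_nonneg: "\<And>t. t \<in> {c..d} \<Longrightarrow> k t \<ge> 0"
begin

lemma int_sub:
  assumes "continuous_on {c..d} Y" "{x..y} \<subseteq> {c..d}"
  shows "(\<lambda>t. A t (Y t)) integrable_on {x..y}"
  by (rule absolutely_integrable_subinterval(2)[OF int[OF assms(1)] assms(2)])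

text \<open>The contraction estimate behind both uniqueness and existence: a distance bounded by
  \<open>m * E\<close> is halved by one Picard step.\<close>

lemma norm_integral_diff_le:
  assumes Y: "continuous_on {c..d} Y" and Z: "continuous_on {c..d} Z" and x: "x \<in> {c..d}"
    and b: "\<And>t. t \<in> {c..d} \<Longrightarrow> norm (Y t - Z t) \<le> m * E t"
    and E: "(\<lambda>t. k t * E t) integrable_on {c..d}" "integral {c..x} (\<lambda>t. k t * E t) \<le> E x / 2" and m: "m \<ge> 0"
  shows "norm (integral {c..x} (\<lambda>t. A t (Y t)) - integral {c..x} (\<lambda>t. A t (Z t))) \<le> m * E x / 2"
proof -
  have sub: "{c..x} \<subseteq> {c..d}" using x by auto
  have "integral {c..x} (\<lambda>t. A t (Y t)) - integral {c..x} (\<lambda>t. A t (Z t))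
      = integral {c..x} (\<lambda>t. A t (Y t) - A t (Z t))"
    by (rule Henstock_Kurzweil_Integration.integral_diff[symmetric]) (intro int_sub Y Z sub)+
  also have "norm \<dots> \<le> integral {c..x} (\<lambda>t. m * (k t * E t))"
  proof (rule integral_norm_bound_integral)
    show "(\<lambda>t. A t (Y t) - A t (Z t)) integrable_on {c..x}"
      by (intro integrable_diff int_sub Y Z sub)
    show "(\<lambda>t. m * (k t * E t)) integrable_on {c..x}"
      using integrable_cmul[OF integrable_on_subinterval[OF E(1) sub], of m] by simp
    fix t assume "t \<in> {c..x}"
    then have t: "t \<in> {c..d}" using sub by auto
    have "norm (A t (Y t) - A t (Z t)) \<le> k t * norm (Y t - Z t)" by (rule lip[OF t])
    also have "\<dots> \<le> k t * (m * E t)" by (intro mult_left_mono b k_nonneg t)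
    finally show "norm (A t (Y t) - A t (Z t)) \<le> m * (k t * E t)" by (simp add: algebra_simps)
  qed
  also have "\<dots> = m * integral {c..x} (\<lambda>t. k t * E t)" by simp
  also have "\<dots> \<le> m * (E x / 2)" by (rule mult_left_mono[OF E(2) m])
  finally show ?thesis by simp
qed

text \<open>The weighted distance attains its maximum \<open>m\<close> on the compact interval, and
  one Picard step gives \<open>m \<le> m / 2\<close>.\<close>

lemma unique_forward:
  assumes Y: "prim c d Y (\<lambda>t. A t (Y t))" and Z: "prim c d Z (\<lambda>t. A t (Z t))"
    and eq: "Y c = Z c" and x: "x \<in> {c..d}"
  shows "Y x = Z x"
proof -
  obtain E where E: "continuous_on {c..d} E" "\<And>x. x \<in> {c..d} \<Longrightarrow> E x > 0"
    "(\<lambda>t. k t * E t) integrable_on {c..d}"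
    "\<And>x. x \<in> {c..d} \<Longrightarrow> integral {c..x} (\<lambda>t. k t * E t) \<le> E x / 2"
    using ode_weight[OF k k_nonneg cd] by blast
  note cY = prim_continuous_on[OF Y] and cZ = prim_continuous_on[OF Z]
  have "continuous_on {c..d} (\<lambda>x. norm (Y x - Z x) / E x)"
    using E(2) by (intro continuous_intros cY cZ E(1)) force
  from continuous_attains_sup[OF compact_Icc _ this] cd
  obtain x0 where x0: "x0 \<in> {c..d}" "\<And>x. x \<in> {c..d} \<Longrightarrow> norm (Y x - Z x) / E x \<le> norm (Y x0 - Z x0) / E x0"
    by auto
  define m where "m = norm (Y x0 - Z x0) / E x0"
  have m: "m \<ge> 0" using E(2)[OF x0(1)] by (simp add: m_def)
  have b: "norm (Y t - Z t) \<le> m * E t" if "t \<in> {c..d}" for t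
    using x0(2)[OF that] E(2)[OF that] by (simp add: m_def pos_divide_le_eq)
  have "Y x0 - Z x0 = integral {c..x0} (\<lambda>t. A t (Y t)) - integral {c..x0} (\<lambda>t. A t (Z t))"
    using prim_eq[OF Y x0(1)] prim_eq[OF Z x0(1)] eq by (metis add_diff_cancel_left)
  also have "norm \<dots> \<le> m * E x0 / 2"
    by (rule norm_integral_diff_le[OF cY cZ x0(1) b E(3) E(4)[OF x0(1)] m])
  finally have "m \<le> m / 2" using E(2)[OF x0(1)] by (simp add: m_def field_simps)
  with m have "m = 0" by simp
  with b[OF x] show ?thesis by simp
qed

text \<open>Banach's fixed point theorem in the complete space of bounded continuous functions, with
  \<open>Y / E\<close> as the unknown so that the ordinary sup norm is the weighted one.\<close>

lemma exists_forward: "\<exists>Y. prim c d Y (\<lambda>t. A t (Y t)) \<and> Y c = y0"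
proof -
  obtain E where E: "continuous_on {c..d} E" "\<And>x. x \<in> {c..d} \<Longrightarrow> E x > 0"
    "(\<lambda>t. k t * E t) integrable_on {c..d}"
    "\<And>x. x \<in> {c..d} \<Longrightarrow> integral {c..x} (\<lambda>t. k t * E t) \<le> E x / 2"
    using ode_weight[OF k k_nonneg cd] by blast
  \<comment> \<open>The Banach space consists of functions on the whole line; clamping the argument
    extends functions from \<open>[c,d]\<close> to it.\<close>
  define cl where "cl x = max c (min d x)" for x
  have cl: "cl x \<in> {c..d}" for x using cd by (auto simp: cl_def)
  have clid: "cl x = x" if "x \<in> {c..d}" for x using that by (auto simp: cl_def)
  have contcl: "continuous_on UNIV cl" unfolding cl_def by (intro continuous_intros)
  define G where "G Z x = y0 + integral {c..x} (\<lambda>t. A t (E t *\<^sub>R Z t))" for Z :: "real \<Rightarrow> 'a" and x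
  have cEZ: "continuous_on {c..d} (\<lambda>t. E t *\<^sub>R Z t)" if "continuous_on UNIV Z" for Z :: "real \<Rightarrow> 'a"
    by (intro continuous_intros E(1) continuous_on_subset[OF that]) auto
  have contG: "continuous_on {c..d} (G Z)" if "continuous_on UNIV Z" for Z
    unfolding G_def
    by (intro continuous_intros indefinite_integral_continuous_1 int_sub cEZ that) auto
  define T where "T Z x = (1 / E (cl x)) *\<^sub>R G Z (cl x)" for Z x
  have Tb: "T Z \<in> bcontfun" if "continuous_on UNIV Z" for Z
  proof -
    have c0: "continuous_on {c..d} (\<lambda>x. (1 / E x) *\<^sub>R G Z x)"
      using E(2) by (intro continuous_intros E(1) contG that) force
    have "continuous_on UNIV (T Z)" unfolding T_def
      using cl by (intro continuous_on_compose2[OF c0 contcl]) auto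
    moreover have "range (T Z) \<subseteq> (\<lambda>x. (1 / E x) *\<^sub>R G Z x) ` {c..d}"
      using cl by (auto simp: T_def)
    then have "bounded (range (T Z))"
      by (rule bounded_subset[OF compact_imp_bounded[OF compact_continuous_image[OF c0 compact_Icc]]])
    ultimately show ?thesis by (simp add: bcontfun_def)
  qed
  define TT where "TT Z = Bcontfun (T (apply_bcontfun Z))" for Z
  have cont: "continuous_on UNIV (apply_bcontfun Z)" for Z :: "real \<Rightarrow>\<^sub>C 'a"
    using apply_bcontfun[of Z] by (auto simp: bcontfun_def)
  have TT: "apply_bcontfun (TT Z) = T (apply_bcontfun Z)" for Z
    unfolding TT_def by (rule Bcontfun_inverse[OF Tb[OF cont]])
  have "\<forall>Z1 Z2. dist (TT Z1) (TT Z2) \<le> 1 / 2 * dist Z1 Z2"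
  proof (intro allI)
    fix Z1 Z2 :: "real \<Rightarrow>\<^sub>C 'a"
    have "dist (apply_bcontfun (TT Z1) x) (apply_bcontfun (TT Z2) x) \<le> 1 / 2 * dist Z1 Z2" for x
    proof -
      let ?x = "cl x"
      have Ep: "E ?x > 0" by (rule E(2)[OF cl])
      have "norm (integral {c..?x} (\<lambda>t. A t (E t *\<^sub>R Z1 t)) - integral {c..?x} (\<lambda>t. A t (E t *\<^sub>R Z2 t)))
          \<le> dist Z1 Z2 * E ?x / 2"
      proof (rule norm_integral_diff_le[OF cEZ[OF cont] cEZ[OF cont] cl _ E(3) E(4)[OF cl]])
        fix t assume t: "t \<in> {c..d}"
        have "norm (E t *\<^sub>R Z1 t - E t *\<^sub>R Z2 t) = E t * dist (Z1 t) (Z2 t)"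
          using E(2)[OF t] by (simp add: scaleR_diff_right[symmetric] dist_norm)
        also have "\<dots> \<le> E t * dist Z1 Z2"
          using E(2)[OF t] by (intro mult_left_mono dist_bounded) auto
        finally show "norm (E t *\<^sub>R Z1 t - E t *\<^sub>R Z2 t) \<le> dist Z1 Z2 * E t" by (simp add: mult.commute)
      qed simp
      then have "norm (G (apply_bcontfun Z1) ?x - G (apply_bcontfun Z2) ?x) \<le> dist Z1 Z2 * E ?x / 2"
        by (simp add: G_def)
      moreover have "dist (apply_bcontfun (TT Z1) x) (apply_bcontfun (TT Z2) x)
          = (1 / E ?x) * norm (G (apply_bcontfun Z1) ?x - G (apply_bcontfun Z2) ?x)"
        unfolding TT T_def dist_norm scaleR_diff_right[symmetric] using Ep by simp
      ultimately have "dist (apply_bcontfun (TT Z1) x) (apply_bcontfun (TT Z2) x)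
          \<le> (1 / E ?x) * (dist Z1 Z2 * E ?x / 2)"
        using Ep by (metis divide_nonneg_pos mult_left_mono order_less_imp_le zero_le_one)
      then show ?thesis using Ep by simp
    qed
    then show "dist (TT Z1) (TT Z2) \<le> 1 / 2 * dist Z1 Z2" by (rule dist_bound)
  qed
  then have "\<exists>!Z. TT Z = Z" by (intro banach_fix_type[of "1/2"]) auto
  then obtain Z where Z: "TT Z = Z" by blast
  define Y where "Y x = E x *\<^sub>R Z x" for x
  have Yeq: "Y x = y0 + integral {c..x} (\<lambda>t. A t (Y t))" if "x \<in> {c..d}" for x
  proof -
    have "Z x = (1 / E x) *\<^sub>R G (apply_bcontfun Z) x"
      using TT[of Z] Z clid[OF that] by (metis T_def)
    then have "Y x = G (apply_bcontfun Z) x" using E(2)[OF that] by (simp add: Y_def)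
    then show ?thesis by (simp add: G_def Y_def)
  qed
  have "prim c d Y (\<lambda>t. A t (Y t))"
    unfolding prim_def
  proof (intro conjI ballI)
    show "(\<lambda>t. A t (Y t)) absolutely_integrable_on {c..d}"
      unfolding Y_def by (rule int[OF cEZ[OF cont]])
    fix x assume x: "x \<in> {c..d}"
    have "Y c = y0" using Yeq[of c] cd by simp
    then show "Y x = Y c + integral {c..x} (\<lambda>t. A t (Y t))" using Yeq[OF x] by simp
  qed
  moreover have "Y c = y0" using Yeq[of c] cd by simp
  ultimately show ?thesis by blast
qed

lemma ode_subinterval:
  assumes "c \<le> c'" "c' \<le> d'" "d' \<le> d"
  shows "ode c' d' A k"
proof
  fix Y :: "real \<Rightarrow> 'a" assume Y: "continuous_on {c'..d'} Y"
  have "continuous_on {c..d} (\<lambda>t. Y (max c' (min d' t)))"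
    by (rule continuous_on_compose2[OF Y]) (use assms in \<open>auto intro!: continuous_intros\<close>)
  then have "(\<lambda>t. A t (Y (max c' (min d' t)))) absolutely_integrable_on {c..d}" by (rule int)
  then have "(\<lambda>t. A t (Y (max c' (min d' t)))) absolutely_integrable_on {c'..d'}"
    by (rule absolutely_integrable_subinterval) (use assms in auto)
  then show "(\<lambda>t. A t (Y t)) absolutely_integrable_on {c'..d'}"
    by (rule absolutely_integrable_spike[where S = "{}"]) auto
next
  show "k absolutely_integrable_on {c'..d'}"
    by (rule absolutely_integrable_subinterval[OF k]) (use assms in auto)
qed (use assms lip k_nonneg in auto)

text \<open>Time reversal, by which solving to the left of the initial point reduces to solving to
  the right.\<close>

lemma ode_reflect: "ode (-d) (-c) (\<lambda>t y. - A (-t) y) (\<lambda>t. k (-t))"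
proof
  fix Y :: "real \<Rightarrow> 'a" assume Y: "continuous_on {-d..-c} Y"
  have "continuous_on {c..d} (\<lambda>t. Y (-t))"
    by (rule continuous_on_compose2[OF Y]) (auto intro!: continuous_intros)
  then have "(\<lambda>t. A t (Y (-t))) absolutely_integrable_on {c..d}" by (rule int)
  then have "(\<lambda>t. A (-t) (Y t)) absolutely_integrable_on {-d..-c}"
    using absolutely_integrable_reflect_real[where f = "\<lambda>t. A t (Y (-t))"] by simp
  from absolutely_integrable_linear[OF this bounded_linear_minus[OF bounded_linear_ident]]
  show "(\<lambda>t. - A (-t) (Y t)) absolutely_integrable_on {-d..-c}" by (simp add: o_def)
next
  show "(\<lambda>t. k (-t)) absolutely_integrable_on {-d..-c}"
    using absolutely_integrable_reflect_real[where f = k] k by simp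
next
  fix t y z assume "t \<in> {-d..-c}"
  then have "-t \<in> {c..d}" by auto
  from lip[OF this, of y z] show "norm (- A (- t) y - - A (- t) z) \<le> k (- t) * norm (y - z)"
    by (simp add: norm_minus_commute)
qed (use cd k_nonneg in auto)

end

lemma prim_reflect:
  assumes F: "prim c d F f"
  shows "prim (-d) (-c) (\<lambda>t. F (-t)) (\<lambda>t. - f (-t))"
proof (rule primI)
  have "(\<lambda>t. f (-t)) absolutely_integrable_on {-d..-c}"
    using prim_absolutely_integrable[OF F] by simp
  from absolutely_integrable_linear[OF this bounded_linear_minus[OF bounded_linear_ident]]
  show "(\<lambda>t. - f (-t)) absolutely_integrable_on {-d..-c}" by (simp add: o_def)
  fix x y assume xy: "-d \<le> x" "x \<le> y" "y \<le> -c"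
  have "F (-x) - F (-y) = integral {-y..-x} f"
    by (rule prim_diff_eq[OF F]) (use xy in auto)
  also have "\<dots> = integral {x..y} (\<lambda>t. f (-t))"
    using Henstock_Kurzweil_Integration.integral_reflect_real[where f = f and a = "-y" and b = "-x"] by simp
  finally show "F (-y) - F (-x) = integral {x..y} (\<lambda>t. - f (-t))"
    by (simp add: algebra_simps)
qed

context ode
begin

lemma unique:
  assumes Y: "prim c d Y (\<lambda>t. A t (Y t))" and Z: "prim c d Z (\<lambda>t. A t (Z t))"
    and x0: "x0 \<in> {c..d}" and eq: "Y x0 = Z x0" and x: "x \<in> {c..d}"
  shows "Y x = Z x"
proof (cases "x0 \<le> x")
  case True
  interpret r: ode x0 d A k by (rule ode_subinterval) (use x0 in auto)
  show ?thesis
    by (rule r.unique_forward[OF prim_subinterval[OF Y] prim_subinterval[OF Z] eq]) (use x0 x True in auto)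
next
  case False
  interpret l: ode c x0 A k by (rule ode_subinterval) (use x0 in auto)
  interpret m: ode "-x0" "-c" "\<lambda>t y. - A (-t) y" "\<lambda>t. k (-t)" by (rule l.ode_reflect)
  have "prim c x0 Y (\<lambda>t. A t (Y t))" "prim c x0 Z (\<lambda>t. A t (Z t))"
    using prim_subinterval[OF Y] prim_subinterval[OF Z] x0 by auto
  from m.unique_forward[OF prim_reflect[OF this(1)] prim_reflect[OF this(2)], of "-x"]
  show ?thesis using eq x False by simp
qed

lemma exists_solution:
  assumes x0: "x0 \<in> {c..d}"
  shows "\<exists>Y. prim c d Y (\<lambda>t. A t (Y t)) \<and> Y x0 = y0"
proof -
  interpret r: ode x0 d A k by (rule ode_subinterval) (use x0 in auto)
  interpret l: ode c x0 A k by (rule ode_subinterval) (use x0 in auto)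
  interpret m: ode "-x0" "-c" "\<lambda>t y. - A (-t) y" "\<lambda>t. k (-t)" by (rule l.ode_reflect)
  obtain Y1 where Y1: "prim x0 d Y1 (\<lambda>t. A t (Y1 t))" "Y1 x0 = y0" using r.exists_forward by blast
  obtain Y2 where Y2: "prim (-x0) (-c) Y2 (\<lambda>t. - A (-t) (Y2 t))" "Y2 (-x0) = y0" using m.exists_forward by blast
  have Y3: "prim c x0 (\<lambda>t. Y2 (-t)) (\<lambda>t. A t (Y2 (-t)))"
    using prim_reflect[OF Y2(1)] by simp
  define Y where "Y t = (if t \<le> x0 then Y2 (-t) else Y1 t)" for t
  have "prim c x0 Y (\<lambda>t. A t (Y2 (-t)))"
    by (rule prim_cong[OF Y3]) (auto simp: Y_def)
  then have l: "prim c x0 Y (\<lambda>t. A t (Y t))"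
    by (rule prim_cong_AE) (auto simp: Y_def)
  have "prim x0 d Y (\<lambda>t. A t (Y1 t))"
    by (rule prim_cong[OF Y1(1)]) (use Y1(2) Y2(2) in \<open>auto simp: Y_def\<close>)
  then have r: "prim x0 d Y (\<lambda>t. A t (Y t))"
    by (rule prim_cong_AE) (auto simp: Y_def)
  have "prim c d Y (\<lambda>t. A t (Y t))" by (rule prim_join[OF l r]) (use x0 in auto)
  moreover have "Y x0 = y0" using Y2(2) by (simp add: Y_def)
  ultimately show ?thesis by blast
qed

end

section \<open>Quasi-derivatives as a first-order system\<close>

lemma prim_Pair:
  assumes F: "prim c d F f" and G: "prim c d G g"
  shows "prim c d (\<lambda>x. (F x, G x)) (\<lambda>x. (f x, g x))"
proof -
  have "prim c d (\<lambda>x. (F x, 0) + (0, G x)) (\<lambda>x. (f x, 0) + (0, g x))"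
    by (intro prim_add prim_linear[OF F, where L = "\<lambda>x. (x, 0)"] prim_linear[OF G, where L = "\<lambda>x. (0, x)"])
       (auto intro!: bounded_linear_Pair bounded_linear_ident bounded_linear_zero)
  then show ?thesis by simp
qed

lemma prim_fst: "prim c d F f \<Longrightarrow> prim c d (\<lambda>x. fst (F x)) (\<lambda>x. fst (f x))"
  by (rule prim_linear) (auto intro: bounded_linear_fst)

lemma prim_snd: "prim c d F f \<Longrightarrow> prim c d (\<lambda>x. snd (F x)) (\<lambda>x. snd (f x))"
  by (rule prim_linear) (auto intro: bounded_linear_snd)

lemma absolutely_integrable_Pair:
  fixes f :: "real \<Rightarrow> 'a::euclidean_space" and g :: "real \<Rightarrow> 'b::euclidean_space"
  assumes f: "f absolutely_integrable_on S" and g: "g absolutely_integrable_on S"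
  shows "(\<lambda>x. (f x, g x)) absolutely_integrable_on S"
proof -
  have L: "bounded_linear (\<lambda>x::'a. (x, 0::'b))" "bounded_linear (\<lambda>x::'b. (0::'a, x))"
    by (auto intro!: bounded_linear_Pair bounded_linear_ident bounded_linear_zero)
  have "(\<lambda>x. (f x, 0) + (0, g x)) absolutely_integrable_on S"
    using absolutely_integrable_linear[OF f L(1)] absolutely_integrable_linear[OF g L(2)]
    by (intro set_integral_add(1)) (auto simp: o_def)
  then show ?thesis by simp
qed

lemma absolutely_integrable_scaleR_continuous:
  fixes Y :: "real \<Rightarrow> complex"
  assumes g: "g absolutely_integrable_on {c..d}" and Y: "continuous_on {c..d} Y"
  shows "(\<lambda>t. g t *\<^sub>R Y t) absolutely_integrable_on {c..d}"
proof -
  have "bilinear (\<lambda>(y::complex) (r::real). r *\<^sub>R y)"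
    by (auto simp: bilinear_def linear_iff scaleR_add_left scaleR_add_right)
  moreover have "Y \<in> borel_measurable (lebesgue_on {c..d})"
    by (rule continuous_imp_measurable_on_sets_lebesgue[OF Y]) auto
  moreover have "bounded (Y ` {c..d})"
    by (rule compact_imp_bounded[OF compact_continuous_image[OF Y compact_Icc]])
  ultimately show ?thesis
    using absolutely_integrable_bounded_measurable_product[OF _ _ _ _ g, where f = Y and h = "\<lambda>y r. r *\<^sub>R y"]
    by simp
qed

text \<open>The subset of the open interval where the functions differ is open and negligible, hence
  empty; continuity adds the two endpoints.\<close>

lemma continuous_AE_eq:
  fixes F G :: "real \<Rightarrow> complex"
  assumes F: "continuous_on {c..d} F" and G: "continuous_on {c..d} G" and cd: "c < d"
    and ae: "AE x in lebesgue. x \<in> {c<..<d} \<longrightarrow> F x = G x" and x: "x \<in> {c..d}"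
  shows "F x = G x"
proof -
  have eq: "F y = G y" if y: "y \<in> {c<..<d}" for y
  proof (rule ccontr)
    assume "F y \<noteq> G y"
    let ?S = "{z \<in> {c<..<d}. F z - G z \<in> - {0}}"
    have "continuous_on {c<..<d} (\<lambda>z. F z - G z)"
      by (intro continuous_intros continuous_on_subset[OF F] continuous_on_subset[OF G]) auto
    then have "open ?S"
      using continuous_open_preimage[of "{c<..<d}" "\<lambda>z. F z - G z" "- {0}"]
      by (simp add: open_Compl vimage_def Int_def)
    moreover have "negligible ?S"
    proof -
      obtain N where N: "negligible N" "\<And>x. x \<in> {c..d} - N \<Longrightarrow> F x = G x"
        by (rule AE_interval_negligible[OF ae]) blast
      show ?thesis by (rule negligible_subset[OF N(1)]) (use N(2) in force)
    qed
    ultimately have "?S = {}" using open_not_negligible by blast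
    with y \<open>F y \<noteq> G y\<close> show False by auto
  qed
  have "closed {z \<in> {c..d}. F z - G z = 0}"
    by (intro continuous_closed_preimage_constant continuous_intros F G)
  then have "closure {c<..<d} \<subseteq> {z \<in> {c..d}. F z - G z = 0}"
    by (rule closure_minimal[rotated]) (use eq in auto)
  moreover have "closure {c<..<d} = {c..d}" using cd by simp
  ultimately show ?thesis using x by auto
qed

section \<open>The quasi-derivatives as a system in C^4\<close>

type_synonym quad = "complex \<times> complex \<times> complex \<times> complex"

text \<open>Nested pairs realise C^4 as a Euclidean space of real dimension 8, to which the
  integration theory, the fixed point argument and dimension counts apply.\<close>

definition quad :: "(nat \<Rightarrow> real \<Rightarrow> complex) \<Rightarrow> real \<Rightarrow> quad" where
  "quad Y x = (Y 0 x, Y 1 x, Y 2 x, Y 3 x)"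

lemma quad_eq_iff:
  "quad Y x = quad Z x' \<longleftrightarrow> Y 0 x = Z 0 x' \<and> Y 1 x = Z 1 x' \<and> Y 2 x = Z 2 x' \<and> Y 3 x = Z 3 x'"
  by (simp add: quad_def)

definition regular_on :: "coeffs \<Rightarrow> real \<Rightarrow> real \<Rightarrow> bool" where
  "regular_on K c d \<longleftrightarrow> c < d \<and> (\<lambda>x. 1 / coef_p K x) absolutely_integrable_on {c..d} \<and>
     coef_s K absolutely_integrable_on {c..d} \<and> coef_q K absolutely_integrable_on {c..d} \<and>
     coef_w K absolutely_integrable_on {c..d} \<and>
     (AE x in lebesgue. x \<in> {c<..<d} \<longrightarrow> coef_p K x > 0 \<and> coef_w K x > 0)"

text \<open>The equation \<open>\<ell> y = f\<close> in integrated form on a compact interval. The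
  last component is \<open>y^{[3]}' = q y - w f\<close>, so no division by \<open>w\<close>
  occurs.\<close>

definition qsys :: "coeffs \<Rightarrow> real \<Rightarrow> real \<Rightarrow> (real \<Rightarrow> complex) \<Rightarrow> (nat \<Rightarrow> real \<Rightarrow> complex) \<Rightarrow> bool" where
  "qsys K c d f Y \<longleftrightarrow> prim c d (Y 0) (Y 1) \<and>
     prim c d (Y 1) (\<lambda>t. (1 / coef_p K t) *\<^sub>R Y 2 t) \<and>
     prim c d (Y 2) (\<lambda>t. coef_s K t *\<^sub>R Y 1 t - Y 3 t) \<and>
     prim c d (Y 3) (\<lambda>t. coef_q K t *\<^sub>R Y 0 t - coef_w K t *\<^sub>R f t)"

text \<open>The right-hand side for \<open>\<ell> y = r y + h\<close>. Forced equations are the case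
  \<open>r = 0\<close>; the term with \<open>r\<close> lets the same uniqueness result serve
  eigenfunctions.\<close>

definition field :: "coeffs \<Rightarrow> complex \<Rightarrow> (real \<Rightarrow> complex) \<Rightarrow> real \<Rightarrow> quad \<Rightarrow> quad" where
  "field K r h t y = (fst (snd y), (1 / coef_p K t) *\<^sub>R fst (snd (snd y)),
      coef_s K t *\<^sub>R fst (snd y) - snd (snd (snd y)),
      coef_q K t *\<^sub>R fst y - coef_w K t *\<^sub>R (r * fst y + h t))"

lemma qsys_iff_prim:
  "qsys K c d (\<lambda>t. r * Y 0 t + h t) Y \<longleftrightarrow> prim c d (quad Y) (\<lambda>t. field K r h t (quad Y t))"
proof
  assume "qsys K c d (\<lambda>t. r * Y 0 t + h t) Y"
  then show "prim c d (quad Y) (\<lambda>t. field K r h t (quad Y t))"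
    unfolding qsys_def quad_def[abs_def] field_def by (auto intro!: prim_Pair)
next
  assume P: "prim c d (quad Y) (\<lambda>t. field K r h t (quad Y t))"
  show "qsys K c d (\<lambda>t. r * Y 0 t + h t) Y"
    using prim_fst[OF P] prim_fst[OF prim_snd[OF P]] prim_fst[OF prim_snd[OF prim_snd[OF P]]]
      prim_snd[OF prim_snd[OF prim_snd[OF P]]]
    unfolding qsys_def by (simp add: quad_def field_def)
qed

lemma qsys_subinterval:
  "qsys K c d f Y \<Longrightarrow> c \<le> c' \<Longrightarrow> d' \<le> d \<Longrightarrow> qsys K c' d' f Y"
  unfolding qsys_def by (auto intro: prim_subinterval)

lemma qsys_join:
  "qsys K c m f Y \<Longrightarrow> qsys K m d f Y \<Longrightarrow> c \<le> m \<Longrightarrow> m \<le> d \<Longrightarrow> qsys K c d f Y"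
  unfolding qsys_def by (auto intro: prim_join)

lemma qsys_continuous_on:
  assumes "qsys K c d f Y"
  shows "continuous_on {c..d} (Y 0)" "continuous_on {c..d} (Y 1)" "continuous_on {c..d} (Y 2)"
    "continuous_on {c..d} (Y 3)"
  using assms by (auto simp: qsys_def intro: prim_continuous_on)

lemma qsys_cong:
  assumes Y: "qsys K c d f Y" and eq: "\<And>x. x \<in> {c..d} \<Longrightarrow> quad Y x = quad Z x"
    and fg: "AE x in lebesgue. x \<in> {c<..<d} \<longrightarrow> f x = g x"
  shows "qsys K c d g Z"
proof -
  have e: "Y 0 x = Z 0 x" "Y 1 x = Z 1 x" "Y 2 x = Z 2 x" "Y 3 x = Z 3 x" if "x \<in> {c..d}" for x
    using eq[OF that] by (auto simp: quad_eq_iff)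
  note e = e e(2)[unfolded One_nat_def]
  note P = Y[unfolded qsys_def]
  show ?thesis unfolding qsys_def
  proof (intro conjI)
    show "prim c d (Z 0) (Z 1)"
      by (rule prim_cong_AE[OF prim_cong[OF conjunct1[OF P]]]) (auto simp: e)
    show "prim c d (Z 1) (\<lambda>t. (1 / coef_p K t) *\<^sub>R Z 2 t)"
      by (rule prim_cong_AE[OF prim_cong[OF conjunct1[OF conjunct2[OF P]]]]) (auto simp: e)
    show "prim c d (Z 2) (\<lambda>t. coef_s K t *\<^sub>R Z 1 t - Z 3 t)"
      by (rule prim_cong_AE[OF prim_cong[OF conjunct1[OF conjunct2[OF conjunct2[OF P]]]]]) (auto simp: e)
    show "prim c d (Z 3) (\<lambda>t. coef_q K t *\<^sub>R Z 0 t - coef_w K t *\<^sub>R g t)"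
    proof (rule prim_cong_AE[OF prim_cong[OF conjunct2[OF conjunct2[OF conjunct2[OF P]]]]])
      show "AE x in lebesgue. x \<in> {c<..<d} \<longrightarrow> coef_q K x *\<^sub>R Y 0 x - coef_w K x *\<^sub>R f x =
             coef_q K x *\<^sub>R Z 0 x - coef_w K x *\<^sub>R g x"
        using fg by eventually_elim (auto simp: e)
    qed (auto simp: e)
  qed
qed

lemma qsys_combine:
  assumes Y: "qsys K c d f Y" and Z: "qsys K c d g Z"
  shows "qsys K c d (\<lambda>x. \<alpha> * f x + \<beta> * g x) (\<lambda>k x. \<alpha> * Y k x + \<beta> * Z k x)"
proof -
  note P = Y[unfolded qsys_def] and Q = Z[unfolded qsys_def]
  show ?thesis unfolding qsys_def
  proof (intro conjI)
    show "prim c d (\<lambda>x. \<alpha> * Y 0 x + \<beta> * Z 0 x) (\<lambda>x. \<alpha> * Y 1 x + \<beta> * Z 1 x)"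
      using P Q by (intro prim_add prim_cmult) auto
    have "prim c d (\<lambda>x. \<alpha> * Y 1 x + \<beta> * Z 1 x) (\<lambda>t. \<alpha> * ((1 / coef_p K t) *\<^sub>R Y 2 t) + \<beta> * ((1 / coef_p K t) *\<^sub>R Z 2 t))"
      using P Q by (intro prim_add prim_cmult) auto
    then show "prim c d (\<lambda>x. \<alpha> * Y 1 x + \<beta> * Z 1 x) (\<lambda>t. (1 / coef_p K t) *\<^sub>R (\<alpha> * Y 2 t + \<beta> * Z 2 t))"
      by (simp add: scaleR_add_right)
    have "prim c d (\<lambda>x. \<alpha> * Y 2 x + \<beta> * Z 2 x) (\<lambda>t. \<alpha> * (coef_s K t *\<^sub>R Y 1 t - Y 3 t) + \<beta> * (coef_s K t *\<^sub>R Z 1 t - Z 3 t))"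
      using P Q by (intro prim_add prim_cmult) auto
    then show "prim c d (\<lambda>x. \<alpha> * Y 2 x + \<beta> * Z 2 x) (\<lambda>t. coef_s K t *\<^sub>R (\<alpha> * Y 1 t + \<beta> * Z 1 t) - (\<alpha> * Y 3 t + \<beta> * Z 3 t))"
      by (simp add: scaleR_conv_of_real algebra_simps)
    have "prim c d (\<lambda>x. \<alpha> * Y 3 x + \<beta> * Z 3 x) (\<lambda>t. \<alpha> * (coef_q K t *\<^sub>R Y 0 t - coef_w K t *\<^sub>R f t) + \<beta> * (coef_q K t *\<^sub>R Z 0 t - coef_w K t *\<^sub>R g t))"
      using P Q by (intro prim_add prim_cmult) auto
    then show "prim c d (\<lambda>x. \<alpha> * Y 3 x + \<beta> * Z 3 x) (\<lambda>t. coef_q K t *\<^sub>R (\<alpha> * Y 0 t + \<beta> * Z 0 t) - coef_w K t *\<^sub>R (\<alpha> * f t + \<beta> * g t))"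
      by (simp add: scaleR_conv_of_real algebra_simps)
  qed
qed

lemma qsys_cnj:
  assumes Y: "qsys K c d f Y"
  shows "qsys K c d (\<lambda>x. cnj (f x)) (\<lambda>k x. cnj (Y k x))"
proof -
  note P = Y[unfolded qsys_def]
  show ?thesis
    unfolding qsys_def
    using prim_cnj[OF conjunct1[OF P]] prim_cnj[OF conjunct1[OF conjunct2[OF P]]]
      prim_cnj[OF conjunct1[OF conjunct2[OF conjunct2[OF P]]]] prim_cnj[OF conjunct2[OF conjunct2[OF conjunct2[OF P]]]]
    by (simp only: complex_cnj_diff complex_cnj_scaleR simp_thms)
qed

lemma qsys_zero: "qsys K c d (\<lambda>x. 0) (\<lambda>k x. 0)"
  unfolding qsys_def by (auto intro: prim_const)

text \<open>Componentwise estimates add up to the Lipschitz bound; its summand 2 comes from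
  \<open>y1\<close> in the first component and \<open>y3\<close> in the third.\<close>

lemma ode_field:
  assumes K: "regular_on K c d" and h: "(\<lambda>t. coef_w K t *\<^sub>R h t) absolutely_integrable_on {c..d}"
  shows "ode c d (field K r h)
    (\<lambda>t. 2 + \<bar>1 / coef_p K t\<bar> + \<bar>coef_s K t\<bar> + \<bar>coef_q K t\<bar> + cmod r * \<bar>coef_w K t\<bar>)"
proof -
  have le: "c \<le> d" using K by (simp add: regular_on_def)
  have ai: "(\<lambda>x. 1 / coef_p K x) absolutely_integrable_on {c..d}" "coef_s K absolutely_integrable_on {c..d}"
      "coef_q K absolutely_integrable_on {c..d}" "coef_w K absolutely_integrable_on {c..d}"
    using K by (auto simp: regular_on_def)
  let ?k = "\<lambda>t. 2 + \<bar>1 / coef_p K t\<bar> + \<bar>coef_s K t\<bar> + \<bar>coef_q K t\<bar> + cmod r * \<bar>coef_w K t\<bar>"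
  have int: "(\<lambda>t. field K r h t (Y t)) absolutely_integrable_on {c..d}"
    if Y: "continuous_on {c..d} Y" for Y :: "real \<Rightarrow> quad"
  proof -
    have cY: "continuous_on {c..d} (\<lambda>t. fst (Y t))" "continuous_on {c..d} (\<lambda>t. fst (snd (Y t)))"
      "continuous_on {c..d} (\<lambda>t. fst (snd (snd (Y t))))" "continuous_on {c..d} (\<lambda>t. snd (snd (snd (Y t))))"
      by (intro continuous_on_fst continuous_on_snd Y)+
    have eq: "field K r h t (Y t) = (fst (snd (Y t)), (1 / coef_p K t) *\<^sub>R fst (snd (snd (Y t))),
      coef_s K t *\<^sub>R fst (snd (Y t)) - snd (snd (snd (Y t))),
      coef_q K t *\<^sub>R fst (Y t) - (coef_w K t *\<^sub>R (r * fst (Y t)) + coef_w K t *\<^sub>R h t))" for t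
      by (simp add: field_def scaleR_add_right)
    have 0: "(\<lambda>t. fst (snd (Y t))) absolutely_integrable_on {c..d}"
      by (rule absolutely_integrable_continuous_real[OF cY(2)])
    have 1: "(\<lambda>t. (1 / coef_p K t) *\<^sub>R fst (snd (snd (Y t)))) absolutely_integrable_on {c..d}"
      by (rule absolutely_integrable_scaleR_continuous[OF ai(1) cY(3)])
    have 2: "(\<lambda>t. coef_s K t *\<^sub>R fst (snd (Y t)) - snd (snd (snd (Y t)))) absolutely_integrable_on {c..d}"
      by (rule set_integral_diff(1)[OF absolutely_integrable_scaleR_continuous[OF ai(2) cY(2)]
            absolutely_integrable_continuous_real[OF cY(4)]])
    have "continuous_on {c..d} (\<lambda>t. r * fst (Y t))" by (intro continuous_on_mult continuous_on_const cY)
    from set_integral_diff(1)[OF absolutely_integrable_scaleR_continuous[OF ai(3) cY(1)]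
           set_integral_add(1)[OF absolutely_integrable_scaleR_continuous[OF ai(4) this] h]]
    show ?thesis
      unfolding eq
      by (rule absolutely_integrable_Pair[OF 0 absolutely_integrable_Pair[OF 1 absolutely_integrable_Pair[OF 2]]])
  qed
  have abs: "(\<lambda>x. \<bar>f x\<bar>) absolutely_integrable_on {c..d}" if "f absolutely_integrable_on {c..d}" for f :: "real \<Rightarrow> real"
    using absolutely_integrable_norm[OF that] by (simp add: o_def)
  have w: "(\<lambda>x. cmod r * \<bar>coef_w K x\<bar>) absolutely_integrable_on {c..d}"
    using abs[OF ai(4)] by (intro set_integrable_mult_right) auto
  have two: "(\<lambda>x. 2 :: real) absolutely_integrable_on {c..d}"
    by (rule absolutely_integrable_continuous_real) simp
  have k: "?k absolutely_integrable_on {c..d}"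
    by (rule set_integral_add(1)[OF set_integral_add(1)[OF set_integral_add(1)[OF set_integral_add(1)[OF two abs[OF ai(1)]] abs[OF ai(2)]] abs[OF ai(3)]] w])
  have lip: "norm (field K r h t y - field K r h t z) \<le> ?k t * norm (y - z)" for t and y z :: quad
  proof -
    obtain y0 y1 y2 y3 where y: "y = (y0, y1, y2, y3)" by (cases y) auto
    obtain z0 z1 z2 z3 where z: "z = (z0, z1, z2, z3)" by (cases z) auto
    let ?n = "norm (y - z)"
    have n2: "norm (b::quad) \<le> norm (fst b) + norm (fst (snd b)) + norm (fst (snd (snd b))) + norm (snd (snd (snd b)))" for b
      using norm_Pair_le[of "fst b" "snd b"] norm_Pair_le[of "fst (snd b)" "snd (snd b)"]
        norm_Pair_le[of "fst (snd (snd b))" "snd (snd (snd b))"] by simp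
    have n: "norm (y0 - z0) \<le> ?n" "norm (y1 - z1) \<le> ?n" "norm (y2 - z2) \<le> ?n" "norm (y3 - z3) \<le> ?n"
    proof -
      have 1: "norm (fst b) \<le> norm b" "norm (snd b) \<le> norm b" for b :: "complex \<times> complex"
        by (metis norm_fst_le norm_snd_le prod.collapse)+
      have 2: "norm (fst b) \<le> norm b" "norm (snd b) \<le> norm b" for b :: "complex \<times> complex \<times> complex"
        by (metis norm_fst_le norm_snd_le prod.collapse)+
      have 3: "norm (fst b) \<le> norm b" "norm (snd b) \<le> norm b" for b :: quad
        by (metis norm_fst_le norm_snd_le prod.collapse)+
      show "norm (y0 - z0) \<le> ?n" using 3(1)[of "y - z"] by (simp add: y z)
      show "norm (y1 - z1) \<le> ?n" using 3(2)[of "y - z"] 2(1)[of "snd (y - z)"] by (simp add: y z)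
      show "norm (y2 - z2) \<le> ?n" using 3(2)[of "y - z"] 2(2)[of "snd (y - z)"] 1(1)[of "snd (snd (y - z))"] by (simp add: y z)
      show "norm (y3 - z3) \<le> ?n" using 3(2)[of "y - z"] 2(2)[of "snd (y - z)"] 1(2)[of "snd (snd (y - z))"] by (simp add: y z)
    qed
    have eq: "field K r h t y - field K r h t z = (y1 - z1, (1 / coef_p K t) *\<^sub>R (y2 - z2),
       coef_s K t *\<^sub>R (y1 - z1) - (y3 - z3), coef_q K t *\<^sub>R (y0 - z0) - coef_w K t *\<^sub>R (r * (y0 - z0)))"
      by (simp add: field_def y z scaleR_conv_of_real algebra_simps diff_divide_distrib)
    have "norm (field K r h t y - field K r h t z) \<le> norm (y1 - z1) + norm ((1 / coef_p K t) *\<^sub>R (y2 - z2)) +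
       norm (coef_s K t *\<^sub>R (y1 - z1) - (y3 - z3)) + norm (coef_q K t *\<^sub>R (y0 - z0) - coef_w K t *\<^sub>R (r * (y0 - z0)))"
      unfolding eq by (rule order_trans[OF n2]) simp
    also have "\<dots> \<le> norm (y1 - z1) + \<bar>1 / coef_p K t\<bar> * norm (y2 - z2) +
       (\<bar>coef_s K t\<bar> * norm (y1 - z1) + norm (y3 - z3)) + (\<bar>coef_q K t\<bar> * norm (y0 - z0) + \<bar>coef_w K t\<bar> * (cmod r * norm (y0 - z0)))"
    proof -
      have "norm (coef_s K t *\<^sub>R (y1 - z1) - (y3 - z3)) \<le> \<bar>coef_s K t\<bar> * norm (y1 - z1) + norm (y3 - z3)"
        by (rule order_trans[OF norm_triangle_ineq4]) simp
      moreover have "norm (coef_q K t *\<^sub>R (y0 - z0) - coef_w K t *\<^sub>R (r * (y0 - z0))) \<le> \<bar>coef_q K t\<bar> * norm (y0 - z0) + \<bar>coef_w K t\<bar> * (cmod r * norm (y0 - z0))"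
        by (rule order_trans[OF norm_triangle_ineq4]) (simp add: norm_mult)
      ultimately show ?thesis by (intro add_mono) auto
    qed
    also have "\<dots> \<le> ?n + \<bar>1 / coef_p K t\<bar> * ?n + (\<bar>coef_s K t\<bar> * ?n + ?n) + (\<bar>coef_q K t\<bar> * ?n + \<bar>coef_w K t\<bar> * (cmod r * ?n))"
      by (intro add_mono mult_left_mono n) auto
    also have "\<dots> = (2 + \<bar>1 / coef_p K t\<bar> + \<bar>coef_s K t\<bar> + \<bar>coef_q K t\<bar> + cmod r * \<bar>coef_w K t\<bar>) * ?n"
      by (simp only: algebra_simps)
    finally show ?thesis .
  qed
  show ?thesis by (rule ode.intro[OF le int lip k]) auto
qed

lemma qsys_exists:
  assumes K: "regular_on K c d" and h: "(\<lambda>t. coef_w K t *\<^sub>R h t) absolutely_integrable_on {c..d}"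
    and x0: "x0 \<in> {c..d}"
  shows "\<exists>Y. qsys K c d h Y \<and> quad Y x0 = v"
proof -
  interpret ode c d "field K 0 h"
      "(\<lambda>t. 2 + \<bar>1 / coef_p K t\<bar> + \<bar>coef_s K t\<bar> + \<bar>coef_q K t\<bar> + cmod 0 * \<bar>coef_w K t\<bar>)"
    by (rule ode_field[OF K h])
  obtain V where V: "prim c d V (\<lambda>t. field K 0 h t (V t))" "V x0 = v"
    using exists_solution[OF x0] by blast
  define Y where "Y k x = (if k = 0 then fst (V x) else if k = 1 then fst (snd (V x))
    else if k = 2 then fst (snd (snd (V x))) else snd (snd (snd (V x))))" for k :: nat and x
  have q: "quad Y = V" by (auto simp: quad_def Y_def)
  then have "qsys K c d (\<lambda>t. 0 * Y 0 t + h t) Y" unfolding qsys_iff_prim using V(1) by simp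
  with q V(2) show ?thesis by auto
qed

lemma qsys_unique:
  assumes K: "regular_on K c d" and h: "(\<lambda>t. coef_w K t *\<^sub>R h t) absolutely_integrable_on {c..d}"
    and Y: "qsys K c d (\<lambda>t. r * Y 0 t + h t) Y" and Z: "qsys K c d (\<lambda>t. r * Z 0 t + h t) Z"
    and x0: "x0 \<in> {c..d}" and eq: "quad Y x0 = quad Z x0" and x: "x \<in> {c..d}"
  shows "quad Y x = quad Z x"
proof -
  interpret ode c d "field K r h"
      "(\<lambda>t. 2 + \<bar>1 / coef_p K t\<bar> + \<bar>coef_s K t\<bar> + \<bar>coef_q K t\<bar> + cmod r * \<bar>coef_w K t\<bar>)"
    by (rule ode_field[OF K h])
  show ?thesis
    by (rule unique[OF Y[unfolded qsys_iff_prim] Z[unfolded qsys_iff_prim] x0 eq x])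
qed

text \<open>Derivatives of equal functions agree almost everywhere, and \<open>1 / coef_p\<close>
  and \<open>coef_w\<close> are nonzero there, so equality climbs from each component to the next.
  Continuity turns it into equality everywhere, except for the forcing at the end of the
  ladder.\<close>

lemma qsys_determined:
  assumes K: "regular_on K c d" and Y: "qsys K c d f Y" and Z: "qsys K c d g Z"
    and eq: "\<And>x. x \<in> {c..d} \<Longrightarrow> Y 0 x = Z 0 x"
  shows "x \<in> {c..d} \<Longrightarrow> quad Y x = quad Z x"
    and "AE x in lebesgue. x \<in> {c<..<d} \<longrightarrow> f x = g x"
proof -
  note P = Y[unfolded qsys_def] and Q = Z[unfolded qsys_def]
  have cd: "c < d" and pos: "AE x in lebesgue. x \<in> {c<..<d} \<longrightarrow> coef_p K x > 0 \<and> coef_w K x > 0"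
    using K by (auto simp: regular_on_def)
  note cY = qsys_continuous_on[OF Y] and cZ = qsys_continuous_on[OF Z]
  have 1: "Y 1 x = Z 1 x" if "x \<in> {c..d}" for x
    by (rule continuous_AE_eq[OF cY(2) cZ(2) cd prim_deriv_unique[OF conjunct1[OF P] conjunct1[OF Q] eq] that])
  have "AE x in lebesgue. x \<in> {c<..<d} \<longrightarrow> (1 / coef_p K x) *\<^sub>R Y 2 x = (1 / coef_p K x) *\<^sub>R Z 2 x"
    using P Q 1 by (intro prim_deriv_unique[of c d "Y 1" _ "Z 1"]) auto
  with pos have "AE x in lebesgue. x \<in> {c<..<d} \<longrightarrow> Y 2 x = Z 2 x" by eventually_elim auto
  then have 2: "Y 2 x = Z 2 x" if "x \<in> {c..d}" for x
    by (rule continuous_AE_eq[OF cY(3) cZ(3) cd _ that])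
  have "AE x in lebesgue. x \<in> {c<..<d} \<longrightarrow> coef_s K x *\<^sub>R Y 1 x - Y 3 x = coef_s K x *\<^sub>R Z 1 x - Z 3 x"
    using P Q 2 by (intro prim_deriv_unique[of c d "Y 2" _ "Z 2"]) auto
  then have "AE x in lebesgue. x \<in> {c<..<d} \<longrightarrow> Y 3 x = Z 3 x" by eventually_elim (auto simp: 1[unfolded One_nat_def])
  then have 3: "Y 3 x = Z 3 x" if "x \<in> {c..d}" for x
    by (rule continuous_AE_eq[OF cY(4) cZ(4) cd _ that])
  show "x \<in> {c..d} \<Longrightarrow> quad Y x = quad Z x" using eq 1 2 3 by (simp add: quad_eq_iff)
  have "AE x in lebesgue. x \<in> {c<..<d} \<longrightarrow> coef_q K x *\<^sub>R Y 0 x - coef_w K x *\<^sub>R f x = coef_q K x *\<^sub>R Z 0 x - coef_w K x *\<^sub>R g x"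
    using P Q 3 by (intro prim_deriv_unique[of c d "Y 3" _ "Z 3"]) auto
  with pos show "AE x in lebesgue. x \<in> {c<..<d} \<longrightarrow> f x = g x" by eventually_elim (auto simp: eq)
qed

lemma bracket_eq:
  "bracket Y Z x = Y 0 x * cnj (Z 3 x) + Y 1 x * cnj (Z 2 x) - (Y 3 x * cnj (Z 0 x) + Y 2 x * cnj (Z 1 x))"
  by (simp add: bracket_def uvec_def vvec_def UNIV_2)

lemma bracket_skew: "bracket Z Y x = - cnj (bracket Y Z x)"
  by (simp add: bracket_eq)

text \<open>Lagrange's identity. The terms with \<open>p\<close>, \<open>s\<close> and
  \<open>q\<close> cancel because the coefficients are real; what remains is the forcing.\<close>

lemma green_prim:
  assumes cd: "c < d" and Y: "qsys K c d f Y" and Z: "qsys K c d g Z"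
  shows "prim c d (bracket Y Z) (\<lambda>t. coef_w K t *\<^sub>R (f t * cnj (Z 0 t) - Y 0 t * cnj (g t)))"
proof -
  note P = Y[unfolded qsys_def] and Q = qsys_cnj[OF Z, unfolded qsys_def]
  let ?b = "\<lambda>t. Y 0 t * cnj (Z 3 t) + Y 1 t * cnj (Z 2 t) - (Y 3 t * cnj (Z 0 t) + Y 2 t * cnj (Z 1 t))"
  have "prim c d ?b (\<lambda>t.
      (Y 1 t * cnj (Z 3 t) + Y 0 t * (coef_q K t *\<^sub>R cnj (Z 0 t) - coef_w K t *\<^sub>R cnj (g t))) +
      ((1 / coef_p K t) *\<^sub>R Y 2 t * cnj (Z 2 t) + Y 1 t * (coef_s K t *\<^sub>R cnj (Z 1 t) - cnj (Z 3 t))) -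
      (((coef_q K t *\<^sub>R Y 0 t - coef_w K t *\<^sub>R f t) * cnj (Z 0 t) + Y 3 t * cnj (Z 1 t)) +
       ((coef_s K t *\<^sub>R Y 1 t - Y 3 t) * cnj (Z 1 t) + Y 2 t * ((1 / coef_p K t) *\<^sub>R cnj (Z 2 t)))))"
    using P Q by (intro prim_add prim_diff prim_mult cd) auto
  then have "prim c d ?b (\<lambda>t. coef_w K t *\<^sub>R (f t * cnj (Z 0 t) - Y 0 t * cnj (g t)))"
    by (rule prim_cong_AE) (auto simp: scaleR_conv_of_real algebra_simps)
  then show ?thesis by (simp add: bracket_eq[abs_def])
qed

section \<open>From compact subintervals to the open interval\<close>

lemma Icc_subset_einterval:
  "c \<le> d \<Longrightarrow> {c..d} \<subseteq> einterval a b \<longleftrightarrow> a < ereal c \<and> ereal d < b"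
  by (auto simp: einterval_def subset_iff intro: less_le_trans le_less_trans)
     (meson ereal_less_eq(3) less_le_trans le_less_trans)+

lemma einterval_nbhd:
  assumes "x \<in> einterval a b"
  obtains c d where "c < x" "x < d" "{c..d} \<subseteq> einterval a b"
proof -
  obtain e where e: "e > 0" "cball x e \<subseteq> einterval a b"
    using open_einterval assms by (meson open_contains_cball)
  show ?thesis by (rule that[of "x - e" "x + e"]) (use e in \<open>auto simp: cball_eq_atLeastAtMost\<close>)
qed

lemma einterval_exhaustion:
  assumes "a < b"
  shows "\<exists>l u :: nat \<Rightarrow> real. einterval a b = (\<Union>i. {l i..u i}) \<and> (\<forall>i. l i < u i) \<and> incseq u \<and> decseq l"
proof (rule einterval_Icc_approximation[OF assms])
  fix u l :: "nat \<Rightarrow> real"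
  assume "einterval a b = (\<Union>i. {l i..u i})" "incseq u" "decseq l" "\<And>i. l i < u i"
  then show ?thesis by blast
qed

text \<open>An exhaustion by countably many compact intervals; their endpoints, at which the
  hypothesis says nothing, form a null set.\<close>

lemma AE_einterval:
  assumes ab: "a < b"
    and P: "\<And>c d. c < d \<Longrightarrow> {c..d} \<subseteq> einterval a b \<Longrightarrow> AE x in lebesgue. x \<in> {c<..<d} \<longrightarrow> P x"
  shows "AE x in lebesgue. x \<in> einterval a b \<longrightarrow> P x"
proof -
  obtain l u :: "nat \<Rightarrow> real" where "einterval a b = (\<Union>i. {l i..u i}) \<and> (\<forall>i. l i < u i) \<and> incseq u \<and> decseq l"
    using einterval_exhaustion[OF ab] by (elim exE)
  then have ul: "einterval a b = (\<Union>i. {l i .. u i})" "\<forall>i. l i < u i" by simp_all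
  have "AE x in lebesgue. x \<in> {l i<..<u i} \<longrightarrow> P x" for i
    by (rule P) (use ul in auto)
  moreover have "AE x in lebesgue. x \<noteq> l i \<and> x \<noteq> u i" for i
    using AE_completion[OF AE_lborel_singleton[of "l i"]] AE_completion[OF AE_lborel_singleton[of "u i"]]
    by eventually_elim auto
  ultimately have "AE x in lebesgue. \<forall>i. (x \<in> {l i<..<u i} \<longrightarrow> P x) \<and> x \<noteq> l i \<and> x \<noteq> u i"
    by (simp add: AE_all_countable)
  then show ?thesis
  proof eventually_elim
    case (elim x)
    show ?case
    proof
      assume "x \<in> einterval a b"
      then obtain i where i: "x \<in> {l i..u i}" using ul(1) by auto
      with elim[rule_format, of i] show "P x" by (auto simp: le_less)
    qed
  qed
qed

lemma einterval_Icc: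
  assumes "a < b"
  obtains c d where "c < d" "{c..d} \<subseteq> einterval a b"
proof -
  obtain l u :: "nat \<Rightarrow> real" where "einterval a b = (\<Union>i. {l i..u i}) \<and> (\<forall>i. l i < u i) \<and> incseq u \<and> decseq l"
    using einterval_exhaustion[OF assms] by (elim exE)
  then have ul: "einterval a b = (\<Union>i. {l i .. u i})" "\<forall>i. l i < u i" by simp_all
  show ?thesis by (rule that[of "l 0" "u 0"]) (use ul in auto)
qed

lemma admissible_regular_on:
  assumes "admissible K a b" "{c..d} \<subseteq> einterval a b" "c < d"
  shows "regular_on K c d"
proof -
  have "AE x in lebesgue. x \<in> einterval a b \<longrightarrow> coef_p K x > 0 \<and> coef_w K x > 0"
    using assms(1) by (simp add: admissible_def)
  then have "AE x in lebesgue. x \<in> {c<..<d} \<longrightarrow> coef_p K x > 0 \<and> coef_w K x > 0"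
  proof eventually_elim
    case (elim x)
    have "{c<..<d} \<subseteq> {c..d}" by auto
    with assms(2) elim show ?case by blast
  qed
  then show ?thesis using assms by (auto simp: regular_on_def admissible_def locally_integrable_def)
qed

lemma admissible_subset:
  assumes K: "admissible K a b" and ab: "a' < b'" and sub: "einterval a' b' \<subseteq> einterval a b"
  shows "admissible K a' b'"
proof -
  have "AE x in lebesgue. x \<in> einterval a b \<longrightarrow> coef_p K x > 0 \<and> coef_w K x > 0"
    using K by (simp add: admissible_def)
  then have "AE x in lebesgue. x \<in> einterval a' b' \<longrightarrow> coef_p K x > 0 \<and> coef_w K x > 0"
    by eventually_elim (use sub in blast)
  moreover have "locally_integrable a b f \<Longrightarrow> locally_integrable a' b' f" for f
    unfolding locally_integrable_def using sub by blast
  ultimately show ?thesis using K ab by (auto simp: admissible_def)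
qed

lemma admissible_less: "admissible K a b \<Longrightarrow> a < b"
  by (simp add: admissible_def)

text \<open>The defining formulas hold almost everywhere and may be solved for the derivatives
  wherever \<open>p\<close> and \<open>w\<close> are positive; the integrated form ignores the
  exceptional null set.\<close>

lemma is_quasi_derivs_imp_qsys:
  assumes Y: "is_quasi_derivs K a b y Y" and K: "regular_on K c d" and cd: "{c..d} \<subseteq> einterval a b"
  shows "qsys K c d (\<lambda>x. (1 / coef_w K x) *\<^sub>R (- vector_derivative (Y 3) (at x) + coef_q K x *\<^sub>R y x)) Y"
proof -
  have less: "c < d" and pos: "AE x in lebesgue. x \<in> {c<..<d} \<longrightarrow> coef_p K x > 0 \<and> coef_w K x > 0"
    using K by (auto simp: regular_on_def)
  have y: "Y 0 = y" using Y by (simp add: is_quasi_derivs_def)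
  have P: "prim c d (Y k) (\<lambda>x. vector_derivative (Y k) (at x))" if "k \<le> 3" for k
    by (rule abs_continuous_on_imp_prim[OF _ less])
       (use Y cd that in \<open>auto simp: is_quasi_derivs_def locally_ac_def\<close>)
  have sub: "{c<..<d} \<subseteq> einterval a b" using cd by (rule order_trans[rotated]) auto
  have ae: "AE x in lebesgue. x \<in> {c<..<d} \<longrightarrow>
        Y 1 x = vector_derivative (Y 0) (at x) \<and>
        Y 2 x = coef_p K x *\<^sub>R vector_derivative (Y 1) (at x) \<and>
        Y 3 x = - vector_derivative (Y 2) (at x) + coef_s K x *\<^sub>R Y 1 x \<and> coef_p K x > 0 \<and> coef_w K x > 0"
    using pos conjunct2[OF conjunct2[OF Y[unfolded is_quasi_derivs_def]]]
    by eventually_elim (use sub in blast)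
  show ?thesis
    unfolding qsys_def
  proof (intro conjI)
    show "prim c d (Y 0) (Y 1)"
      by (rule prim_cong_AE[OF P], simp) (use ae in \<open>eventually_elim, auto\<close>)
    show "prim c d (Y 1) (\<lambda>t. (1 / coef_p K t) *\<^sub>R Y 2 t)"
      by (rule prim_cong_AE[OF P], simp) (use ae in \<open>eventually_elim, auto\<close>)
    show "prim c d (Y 2) (\<lambda>t. coef_s K t *\<^sub>R Y 1 t - Y 3 t)"
      by (rule prim_cong_AE[OF P], simp) (use ae in \<open>eventually_elim, auto\<close>)
    show "prim c d (Y 3) (\<lambda>t. coef_q K t *\<^sub>R Y 0 t - coef_w K t *\<^sub>R
       (1 / coef_w K t) *\<^sub>R (- vector_derivative (Y 3) (at t) + coef_q K t *\<^sub>R y t))"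
      by (rule prim_cong_AE[OF P], simp) (use ae in \<open>eventually_elim, auto simp: y\<close>)
  qed
qed

lemma abs_continuous_on_trivial: "d \<le> c \<Longrightarrow> abs_continuous_on c d f"
  unfolding abs_continuous_on_iff
proof (intro allI impI exI[of _ 1] conjI)
  fix \<epsilon> :: real and n :: nat and u v :: "nat \<Rightarrow> real"
  assume "\<epsilon> > 0" "d \<le> c" and fam: "interval_family c d 1 {..<n} u v"
  have "u i = v i" if "i < n" for i
    using interval_family_mem[OF fam, of i] that \<open>d \<le> c\<close> by auto
  then show "(\<Sum>i<n. dist (f (v i)) (f (u i))) < \<epsilon>" using \<open>\<epsilon> > 0\<close> by simp
qed simp

definition qsys_on :: "coeffs \<Rightarrow> ereal \<Rightarrow> ereal \<Rightarrow> (real \<Rightarrow> complex) \<Rightarrow> (nat \<Rightarrow> real \<Rightarrow> complex) \<Rightarrow> bool" where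
  "qsys_on K a b f Y \<longleftrightarrow> (\<forall>c d. c < d \<longrightarrow> {c..d} \<subseteq> einterval a b \<longrightarrow> qsys K c d f Y)"

lemma qsys_onD: "qsys_on K a b f Y \<Longrightarrow> c < d \<Longrightarrow> {c..d} \<subseteq> einterval a b \<Longrightarrow> qsys K c d f Y"
  by (simp add: qsys_on_def)

lemma qsys_on_imp_is_quasi_derivs:
  assumes K: "admissible K a b" and Y: "qsys_on K a b f Y"
  shows "is_quasi_derivs K a b (Y 0) Y"
  unfolding is_quasi_derivs_def
proof (intro conjI allI impI)
  fix k :: nat assume k: "k \<le> 3"
  show "locally_ac a b (Y k)"
    unfolding locally_ac_def
  proof (intro allI impI)
    fix c d assume cd: "{c..d} \<subseteq> einterval a b"
    show "abs_continuous_on c d (Y k)"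
    proof (cases "c < d")
      case True
      have "k = 0 \<or> k = 1 \<or> k = 2 \<or> k = 3" using k by auto
      then show ?thesis
        using qsys_onD[OF Y True cd] unfolding qsys_def by (auto intro: prim_imp_abs_continuous_on)
    qed (auto intro: abs_continuous_on_trivial)
  qed
next
  show "AE x in lebesgue. x \<in> einterval a b \<longrightarrow> Y 1 x = vector_derivative (Y 0) (at x) \<and>
        Y 2 x = coef_p K x *\<^sub>R vector_derivative (Y 1) (at x) \<and>
        Y 3 x = - vector_derivative (Y 2) (at x) + coef_s K x *\<^sub>R Y 1 x"
  proof (rule AE_einterval[OF admissible_less[OF K]])
    fix c d :: real assume cd: "c < d" "{c..d} \<subseteq> einterval a b"
    note P = qsys_onD[OF Y cd, unfolded qsys_def]
    have "AE x in lebesgue. x \<in> {c<..<d} \<longrightarrow> coef_p K x > 0 \<and> coef_w K x > 0"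
      using admissible_regular_on[OF K cd(2,1)] by (auto simp: regular_on_def)
    with prim_has_vector_derivative[OF conjunct1[OF P]]
      prim_has_vector_derivative[OF conjunct1[OF conjunct2[OF P]]]
      prim_has_vector_derivative[OF conjunct1[OF conjunct2[OF conjunct2[OF P]]]]
    show "AE x in lebesgue. x \<in> {c<..<d} \<longrightarrow> Y 1 x = vector_derivative (Y 0) (at x) \<and>
        Y 2 x = coef_p K x *\<^sub>R vector_derivative (Y 1) (at x) \<and>
        Y 3 x = - vector_derivative (Y 2) (at x) + coef_s K x *\<^sub>R Y 1 x"
    proof eventually_elim
      case (elim x)
      show ?case
      proof
        assume "x \<in> {c<..<d}"
        with elim have "vector_derivative (Y 0) (at x) = Y 1 x"
          "vector_derivative (Y 1) (at x) = (1 / coef_p K x) *\<^sub>R Y 2 x"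
          "vector_derivative (Y 2) (at x) = coef_s K x *\<^sub>R Y 1 x - Y 3 x" "coef_p K x > 0"
          by (blast intro: vector_derivative_at)+
        then show "Y 1 x = vector_derivative (Y 0) (at x) \<and>
          Y 2 x = coef_p K x *\<^sub>R vector_derivative (Y 1) (at x) \<and>
          Y 3 x = - vector_derivative (Y 2) (at x) + coef_s K x *\<^sub>R Y 1 x" by simp
      qed
    qed
  qed
qed simp

lemma qd_qsys_on:
  assumes K: "admissible K a b" and y: "has_quasi_derivs K a b y"
  shows "qsys_on K a b (ell K a b y) (qd K a b y)" "qd K a b y 0 = y"
proof -
  have Y: "is_quasi_derivs K a b y (qd K a b y)"
    using y unfolding has_quasi_derivs_def qd_def by (rule someI_ex)
  show "qsys_on K a b (ell K a b y) (qd K a b y)"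
    unfolding qsys_on_def
  proof (intro allI impI)
    fix c d :: real assume cd: "c < d" "{c..d} \<subseteq> einterval a b"
    have eq: "ell K a b y = (\<lambda>x. (1 / coef_w K x) *\<^sub>R (- vector_derivative (qd K a b y 3) (at x) + coef_q K x *\<^sub>R y x))"
      by (simp add: ell_def[abs_def])
    show "qsys K c d (ell K a b y) (qd K a b y)"
      unfolding eq by (rule is_quasi_derivs_imp_qsys[OF Y admissible_regular_on[OF K cd(2,1)] cd(2)])
  qed
  show "qd K a b y 0 = y" using Y by (simp add: is_quasi_derivs_def)
qed

lemma qsys_on_cong:
  assumes Y: "qsys_on K a b f Y" and eq: "\<And>x. x \<in> einterval a b \<Longrightarrow> quad Y x = quad Z x"
    and fg: "AE x in lebesgue. x \<in> einterval a b \<longrightarrow> f x = g x"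
  shows "qsys_on K a b g Z"
  unfolding qsys_on_def
proof (intro allI impI)
  fix c d :: real assume cd: "c < d" "{c..d} \<subseteq> einterval a b"
  have sub: "{c<..<d} \<subseteq> einterval a b" using cd(2) by (rule order_trans[rotated]) auto
  from fg have "AE x in lebesgue. x \<in> {c<..<d} \<longrightarrow> f x = g x" by eventually_elim (use sub in blast)
  then show "qsys K c d g Z"
    by (rule qsys_cong[OF qsys_onD[OF Y cd], rotated]) (use eq cd(2) in blast)
qed

lemma qsys_on_determined:
  assumes K: "admissible K a b" and Y: "qsys_on K a b f Y" and Z: "qsys_on K a b g Z"
    and eq: "\<And>x. x \<in> einterval a b \<Longrightarrow> Y 0 x = Z 0 x"
  shows "x \<in> einterval a b \<Longrightarrow> quad Y x = quad Z x"
    and "AE x in lebesgue. x \<in> einterval a b \<longrightarrow> f x = g x"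
proof -
  assume "x \<in> einterval a b"
  then obtain c d where cd: "c < x" "x < d" "{c..d} \<subseteq> einterval a b" by (rule einterval_nbhd)
  then have less: "c < d" by simp
  show "quad Y x = quad Z x"
    by (rule qsys_determined(1)[OF admissible_regular_on[OF K cd(3) less] qsys_onD[OF Y less cd(3)] qsys_onD[OF Z less cd(3)]])
       (use cd eq in auto)
next
  show "AE x in lebesgue. x \<in> einterval a b \<longrightarrow> f x = g x"
  proof (rule AE_einterval[OF admissible_less[OF K]])
    fix c d :: real assume cd: "c < d" "{c..d} \<subseteq> einterval a b"
    show "AE x in lebesgue. x \<in> {c<..<d} \<longrightarrow> f x = g x"
      by (rule qsys_determined(2)[OF admissible_regular_on[OF K cd(2,1)] qsys_onD[OF Y cd] qsys_onD[OF Z cd]])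
         (use cd eq in auto)
  qed
qed

text \<open>\<open>qd\<close> is an arbitrary choice of representatives. Any system found by other
  means agrees with it inside \<open>(a,b)\<close>, which is how concrete constructions are brought
  back to \<open>qd\<close> and \<open>ell\<close>.\<close>

lemma qd_eqI:
  assumes K: "admissible K a b" and Y: "qsys_on K a b f Y"
    and eq: "\<And>x. x \<in> einterval a b \<Longrightarrow> Y 0 x = y x"
  shows "has_quasi_derivs K a b y"
    and "x \<in> einterval a b \<Longrightarrow> quad (qd K a b y) x = quad Y x"
    and "ae_eq a b (ell K a b y) f"
proof -
  \<comment> \<open>\<open>is_quasi_derivs\<close> demands equality of component 0 with
    \<open>y\<close> on the whole line, also outside \<open>(a,b)\<close>.\<close>
  define Z where "Z = Y(0 := y)"
  have Z: "qsys_on K a b f Z"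
    by (rule qsys_on_cong[OF Y]) (use eq in \<open>auto simp: Z_def quad_eq_iff\<close>)
  have "is_quasi_derivs K a b (Z 0) Z" by (rule qsys_on_imp_is_quasi_derivs[OF K Z])
  then show h: "has_quasi_derivs K a b y" by (auto simp: has_quasi_derivs_def Z_def)
  note q = qd_qsys_on[OF K h]
  have e: "qd K a b y 0 x = Y 0 x" if "x \<in> einterval a b" for x using q(2) eq[OF that] by simp
  show "x \<in> einterval a b \<Longrightarrow> quad (qd K a b y) x = quad Y x"
    by (rule qsys_on_determined(1)[OF K q(1) Y e])
  show "ae_eq a b (ell K a b y) f"
    unfolding ae_eq_def by (rule qsys_on_determined(2)[OF K q(1) Y e])
qed

lemma qsys_on_subset:
  "qsys_on K a b f Y \<Longrightarrow> einterval a' b' \<subseteq> einterval a b \<Longrightarrow> qsys_on K a' b' f Y"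
  unfolding qsys_on_def by blast

lemma qsys_on_combine:
  "qsys_on K a b f Y \<Longrightarrow> qsys_on K a b g Z \<Longrightarrow>
     qsys_on K a b (\<lambda>x. \<alpha> * f x + \<beta> * g x) (\<lambda>k x. \<alpha> * Y k x + \<beta> * Z k x)"
  unfolding qsys_on_def by (auto intro: qsys_combine)

lemma qd_combine:
  assumes K: "admissible K a b" and y: "has_quasi_derivs K a b y" and z: "has_quasi_derivs K a b z"
  shows "has_quasi_derivs K a b (\<lambda>x. \<alpha> * y x + \<beta> * z x)"
    and "x \<in> einterval a b \<Longrightarrow> quad (qd K a b (\<lambda>x. \<alpha> * y x + \<beta> * z x)) x =
           quad (\<lambda>k x. \<alpha> * qd K a b y k x + \<beta> * qd K a b z k x) x"
    and "ae_eq a b (ell K a b (\<lambda>x. \<alpha> * y x + \<beta> * z x)) (\<lambda>x. \<alpha> * ell K a b y x + \<beta> * ell K a b z x)"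
proof -
  note Q = qsys_on_combine[OF qd_qsys_on(1)[OF K y] qd_qsys_on(1)[OF K z], of \<alpha> \<beta>]
  have e: "\<alpha> * qd K a b y 0 x + \<beta> * qd K a b z 0 x = \<alpha> * y x + \<beta> * z x" for x
    by (simp add: qd_qsys_on(2)[OF K y] qd_qsys_on(2)[OF K z])
  show "has_quasi_derivs K a b (\<lambda>x. \<alpha> * y x + \<beta> * z x)" by (rule qd_eqI(1)[OF K Q e])
  show "x \<in> einterval a b \<Longrightarrow> quad (qd K a b (\<lambda>x. \<alpha> * y x + \<beta> * z x)) x =
           quad (\<lambda>k x. \<alpha> * qd K a b y k x + \<beta> * qd K a b z k x) x" by (rule qd_eqI(2)[OF K Q e])
  show "ae_eq a b (ell K a b (\<lambda>x. \<alpha> * y x + \<beta> * z x)) (\<lambda>x. \<alpha> * ell K a b y x + \<beta> * ell K a b z x)"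
    by (rule qd_eqI(3)[OF K Q e])
qed

text \<open>The representatives on the smaller interval are a separate choice, so even restriction
  needs the uniqueness of the system.\<close>

lemma qd_restrict:
  assumes K: "admissible K a b" and ab: "a' < b'" and sub: "einterval a' b' \<subseteq> einterval a b"
    and y: "has_quasi_derivs K a b y"
  shows "has_quasi_derivs K a' b' y"
    and "x \<in> einterval a' b' \<Longrightarrow> quad (qd K a' b' y) x = quad (qd K a b y) x"
    and "ae_eq a' b' (ell K a' b' y) (ell K a b y)"
proof -
  note K' = admissible_subset[OF K ab sub]
  note Q = qsys_on_subset[OF qd_qsys_on(1)[OF K y] sub]
  have e: "qd K a b y 0 x = y x" for x by (simp add: qd_qsys_on(2)[OF K y])
  show "has_quasi_derivs K a' b' y" by (rule qd_eqI(1)[OF K' Q e])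
  show "x \<in> einterval a' b' \<Longrightarrow> quad (qd K a' b' y) x = quad (qd K a b y) x" by (rule qd_eqI(2)[OF K' Q e])
  show "ae_eq a' b' (ell K a' b' y) (ell K a b y)" by (rule qd_eqI(3)[OF K' Q e])
qed

text \<open>On a compact neighbourhood of \<open>x\<close> both systems have the same component 0,
  and this determines the others there.\<close>

lemma qd_local:
  assumes K: "admissible K a b" and y: "has_quasi_derivs K a b y" and z: "has_quasi_derivs K a b z"
    and eq: "\<And>t. t \<in> S \<Longrightarrow> y t = z t" and S: "open S" "x \<in> S" "S \<subseteq> einterval a b"
  shows "quad (qd K a b y) x = quad (qd K a b z) x"
proof -
  obtain e where e: "e > 0" "cball x e \<subseteq> S" using S(1,2) by (meson open_contains_cball)
  define c d where "c = x - e" and "d = x + e"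
  have cd: "c < d" "{c..d} \<subseteq> S" "x \<in> {c..d}" using e by (auto simp: c_def d_def cball_eq_atLeastAtMost)
  then have cd': "{c..d} \<subseteq> einterval a b" using S(3) by blast
  show ?thesis
    by (rule qsys_determined(1)[OF admissible_regular_on[OF K cd' cd(1)]
         qsys_onD[OF qd_qsys_on(1)[OF K y] cd(1) cd'] qsys_onD[OF qd_qsys_on(1)[OF K z] cd(1) cd']])
       (use cd eq in \<open>auto simp: qd_qsys_on(2)[OF K y] qd_qsys_on(2)[OF K z]\<close>)
qed

section \<open>The weighted Hilbert space\<close>

definition sq_int :: "'x measure \<Rightarrow> ('x \<Rightarrow> complex) \<Rightarrow> bool" where
  "sq_int M F \<longleftrightarrow> F \<in> borel_measurable M \<and> integrable M (\<lambda>x. (cmod (F x))\<^sup>2)"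

lemma borel_measurable_cnj [measurable]: "cnj \<in> borel_measurable borel"
  by (intro borel_measurable_continuous_onI continuous_intros)

lemma sq_int_measurable: "sq_int M F \<Longrightarrow> F \<in> borel_measurable M"
  by (simp add: sq_int_def)

lemma sq_int_mult:
  assumes "sq_int M F" "sq_int M G"
  shows "integrable M (\<lambda>x. F x * cnj (G x))"
proof (rule Bochner_Integration.integrable_bound)
  show "integrable M (\<lambda>x. (cmod (F x))\<^sup>2 + (cmod (G x))\<^sup>2)" using assms by (simp add: sq_int_def)
  note [measurable] = sq_int_measurable[OF assms(1)] sq_int_measurable[OF assms(2)]
  show "(\<lambda>x. F x * cnj (G x)) \<in> borel_measurable M" by measurable
  have "cmod (F x) * cmod (G x) \<le> (cmod (F x))\<^sup>2 + (cmod (G x))\<^sup>2" for x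
    using sum_squares_bound[of "cmod (F x)" "cmod (G x)"]
      mult_nonneg_nonneg[OF norm_ge_zero[of "F x"] norm_ge_zero[of "G x"]] by linarith
  then show "AE x in M. norm (F x * cnj (G x)) \<le> norm ((cmod (F x))\<^sup>2 + (cmod (G x))\<^sup>2)"
    by (simp add: norm_mult)
qed

lemma sq_int_combine:
  assumes "sq_int M F" "sq_int M G"
  shows "sq_int M (\<lambda>x. \<alpha> * F x + \<beta> * G x)"
  unfolding sq_int_def
proof
  note [measurable] = sq_int_measurable[OF assms(1)] sq_int_measurable[OF assms(2)]
  show m: "(\<lambda>x. \<alpha> * F x + \<beta> * G x) \<in> borel_measurable M" by measurable
  show "integrable M (\<lambda>x. (cmod (\<alpha> * F x + \<beta> * G x))\<^sup>2)"
  proof (rule Bochner_Integration.integrable_bound)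
    show "integrable M (\<lambda>x. 2 * (cmod \<alpha>)\<^sup>2 * (cmod (F x))\<^sup>2 + 2 * (cmod \<beta>)\<^sup>2 * (cmod (G x))\<^sup>2)"
      using assms by (simp add: sq_int_def)
    show "(\<lambda>x. (cmod (\<alpha> * F x + \<beta> * G x))\<^sup>2) \<in> borel_measurable M" using m by simp
    have "(cmod (\<alpha> * F x + \<beta> * G x))\<^sup>2 \<le> 2 * (cmod \<alpha>)\<^sup>2 * (cmod (F x))\<^sup>2 + 2 * (cmod \<beta>)\<^sup>2 * (cmod (G x))\<^sup>2" for x
    proof -
      have "(cmod (\<alpha> * F x + \<beta> * G x))\<^sup>2 \<le> (cmod \<alpha> * cmod (F x) + cmod \<beta> * cmod (G x))\<^sup>2"
        by (intro power_mono norm_triangle_le) (auto simp: norm_mult)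
      also have "\<dots> \<le> 2 * (cmod \<alpha> * cmod (F x))\<^sup>2 + 2 * (cmod \<beta> * cmod (G x))\<^sup>2"
        using sum_squares_bound[of "cmod \<alpha> * cmod (F x)" "cmod \<beta> * cmod (G x)"] by (simp add: power2_sum)
      finally show ?thesis by (simp add: power_mult_distrib)
    qed
    then show "AE x in M. norm ((cmod (\<alpha> * F x + \<beta> * G x))\<^sup>2)
        \<le> norm (2 * (cmod \<alpha>)\<^sup>2 * (cmod (F x))\<^sup>2 + 2 * (cmod \<beta>)\<^sup>2 * (cmod (G x))\<^sup>2)" by simp
  qed
qed

text \<open>Minimise the nonnegative quadratic expression over \<open>t\<close>. With
  \<open>A = 0\<close> the same statement also yields orthogonality from minimality of a
  distance.\<close>

lemma cauchy_schwarz_from_positivity: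
  fixes z :: complex and A C :: real
  assumes pos: "\<And>t. 0 \<le> A + 2 * Re (t * z) + (cmod t)\<^sup>2 * C" and C: "C \<ge> 0"
  shows "(cmod z)\<^sup>2 \<le> A * C"
proof (cases "C = 0")
  case True
  have "cmod z = 0"
  proof (rule ccontr)
    assume "cmod z \<noteq> 0"
    then have z: "(cmod z)\<^sup>2 > 0" by simp
    \<comment> \<open>Makes the linear term equal \<open>-(A + 1)\<close>, so the whole expression
      would be \<open>-1\<close>.\<close>
    define s where "s = (A + 1) / (2 * (cmod z)\<^sup>2)"
    have "Re (- complex_of_real s * cnj z * z) = - s * (cmod z)\<^sup>2"
      unfolding cmod_power2 by (simp add: algebra_simps power2_eq_square)
    then have "0 \<le> A + 2 * (- s * (cmod z)\<^sup>2)"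
      using pos[of "- complex_of_real s * cnj z"] unfolding True by (simp only: mult_zero_right add_0_right)
    moreover have "2 * s * (cmod z)\<^sup>2 = A + 1" using z by (simp add: s_def)
    ultimately show False by linarith
  qed
  with True show ?thesis by simp
next
  case False
  with C have C': "C > 0" by simp
  define s where "s = 1 / C"
  have "Re (- complex_of_real s * cnj z * z) = - s * (cmod z)\<^sup>2"
    unfolding cmod_power2 by (simp add: algebra_simps power2_eq_square)
  moreover have "(cmod (- complex_of_real s * cnj z))\<^sup>2 = s\<^sup>2 * (cmod z)\<^sup>2"
    by (simp add: norm_mult power_mult_distrib)
  ultimately have "0 \<le> A - 2 * s * (cmod z)\<^sup>2 + s\<^sup>2 * (cmod z)\<^sup>2 * C"
    using pos[of "- complex_of_real s * cnj z"] by simp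
  also have "\<dots> = A - (cmod z)\<^sup>2 / C" using C' by (simp add: s_def power2_eq_square)
  finally show ?thesis using C' by (simp add: field_simps)
qed

lemma cmod_combine_sq: "(cmod (x + t * y))\<^sup>2 = (cmod x)\<^sup>2 + 2 * Re (t * (y * cnj x)) + (cmod t)\<^sup>2 * (cmod y)\<^sup>2"
proof -
  have "complex_of_real ((cmod (x + t * y))\<^sup>2) = complex_of_real ((cmod x)\<^sup>2) + (t * (y * cnj x) + cnj (t * (y * cnj x))) + complex_of_real ((cmod t)\<^sup>2 * (cmod y)\<^sup>2)"
    unfolding of_real_mult complex_norm_square by (simp add: algebra_simps)
  also have "t * (y * cnj x) + cnj (t * (y * cnj x)) = complex_of_real (2 * Re (t * (y * cnj x)))"
    by (rule complex_add_cnj)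
  finally show ?thesis by (metis (no_types, lifting) of_real_add of_real_eq_iff)
qed

lemma sq_int_cauchy_schwarz:
  assumes F: "sq_int M F" and G: "sq_int M G"
  shows "(cmod (\<integral>x. F x * cnj (G x) \<partial>M))\<^sup>2 \<le> (\<integral>x. (cmod (F x))\<^sup>2 \<partial>M) * (\<integral>x. (cmod (G x))\<^sup>2 \<partial>M)"
proof -
  let ?z = "\<integral>x. F x * cnj (G x) \<partial>M"
  have "0 \<le> (\<integral>x. (cmod (G x))\<^sup>2 \<partial>M) + 2 * Re (t * ?z) + (cmod t)\<^sup>2 * (\<integral>x. (cmod (F x))\<^sup>2 \<partial>M)" for t
  proof -
    have i: "integrable M (\<lambda>x. t * (F x * cnj (G x)))" using sq_int_mult[OF F G] by simp
    have "0 \<le> (\<integral>x. (cmod (G x + t * F x))\<^sup>2 \<partial>M)" by simp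
    also have "\<dots> = (\<integral>x. (cmod (G x))\<^sup>2 + 2 * Re (t * (F x * cnj (G x))) + (cmod t)\<^sup>2 * (cmod (F x))\<^sup>2 \<partial>M)"
      by (simp add: cmod_combine_sq)
    also have "\<dots> = (\<integral>x. (cmod (G x))\<^sup>2 \<partial>M) + 2 * (\<integral>x. Re (t * (F x * cnj (G x))) \<partial>M)
        + (cmod t)\<^sup>2 * (\<integral>x. (cmod (F x))\<^sup>2 \<partial>M)"
      by (intro has_bochner_integral_integral_eq has_bochner_integral_add has_bochner_integral_mult_right
          has_bochner_integral_integrable integrable_Re[OF i]) (use F G in \<open>auto simp: sq_int_def\<close>)
    also have "(\<integral>x. Re (t * (F x * cnj (G x))) \<partial>M) = Re (t * ?z)"
      using integral_Re[OF i] by simp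
    finally show ?thesis .
  qed
  from cauchy_schwarz_from_positivity[OF this] show ?thesis by (simp add: mult.commute)
qed

text \<open>Multiplying by a square integrable function without zeros turns an L2-Cauchy sequence
  into an L1-Cauchy one, which has an almost everywhere convergent subsequence. Fatou's lemma then
  shows that its limit is also the limit in L2.\<close>

lemma sq_int_complete:
  fixes F :: "nat \<Rightarrow> real \<Rightarrow> complex"
  assumes F: "\<And>n. sq_int lebesgue (F n)"
    and cau: "\<And>\<epsilon>. \<epsilon> > 0 \<Longrightarrow> \<exists>N. \<forall>m\<ge>N. \<forall>n\<ge>N. (\<integral>x. (cmod (F m x - F n x))\<^sup>2 \<partial>lebesgue) \<le> \<epsilon>"
  shows "\<exists>G. sq_int lebesgue G \<and> (\<lambda>n. \<integral>x. (cmod (F n x - G x))\<^sup>2 \<partial>lebesgue) \<longlonglongrightarrow> 0"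
proof -
  have Fm [measurable]: "F n \<in> borel_measurable lebesgue" for n using F by (simp add: sq_int_def)
  have D: "sq_int lebesgue (\<lambda>x. F m x - F n x)" for m n
    using sq_int_combine[OF F[of m] F[of n], of 1 "-1"] by simp
  \<comment> \<open>Sigma-finiteness provides a strictly positive finite integrable function;
    \<open>k\<close> is its square root.\<close>
  obtain h :: "real \<Rightarrow> ennreal" where h: "h \<in> borel_measurable lborel" "integral\<^sup>N lborel h \<noteq> \<infinity>" "\<And>x. 0 < h x \<and> h x < \<infinity>"
    using sigma_finite_measure.Ex_finite_integrable_function[OF sigma_finite_lborel] by auto
  define k where "k x = complex_of_real (sqrt (enn2real (h x)))" for x
  have km: "k \<in> borel_measurable lebesgue"
    unfolding k_def[abs_def] using measurable_completion[OF h(1)] by measurable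
  have k2: "ennreal ((cmod (k x))\<^sup>2) = h x" for x
    using h(3)[of x] by (simp add: k_def norm_power[symmetric] less_top)
  have kpos: "k x \<noteq> 0" for x using h(3)[of x] by (simp add: k_def enn2real_eq_0_iff less_top) (metis less_irrefl)
  have ksq: "sq_int lebesgue k"
    unfolding sq_int_def
  proof
    show "integrable lebesgue (\<lambda>x. (cmod (k x))\<^sup>2)"
    proof (rule integrableI_nonneg)
      have "(\<integral>\<^sup>+x. ennreal ((cmod (k x))\<^sup>2) \<partial>lebesgue) = integral\<^sup>N lborel h"
        using h(1) by (simp add: k2 nn_integral_completion)
      then show "(\<integral>\<^sup>+x. ennreal ((cmod (k x))\<^sup>2) \<partial>lebesgue) < \<infinity>" using h(2) by (simp add: less_top)
    qed (use km in auto)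
  qed (rule km)
  define B where "B = (\<integral>x. (cmod (k x))\<^sup>2 \<partial>lebesgue)"
  have B: "B \<ge> 0" by (simp add: B_def)
  have l1: "(\<integral>x. norm (k x * F m x - k x * F n x) \<partial>lebesgue)\<^sup>2 \<le> B * (\<integral>x. (cmod (F m x - F n x))\<^sup>2 \<partial>lebesgue)" for m n
  proof -
    let ?a = "\<lambda>x. complex_of_real (cmod (k x))" and ?b = "\<lambda>x. complex_of_real (cmod (F m x - F n x))"
    have a: "sq_int lebesgue ?a" "sq_int lebesgue ?b" using ksq D[of m n] by (auto simp: sq_int_def)
    have eq: "norm (k x * F m x - k x * F n x) = cmod (k x) * cmod (F m x - F n x)" for x
      by (simp add: norm_mult[symmetric] right_diff_distrib)
    have "(\<integral>x. ?a x * cnj (?b x) \<partial>lebesgue) = complex_of_real (\<integral>x. norm (k x * F m x - k x * F n x) \<partial>lebesgue)"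
      unfolding eq by (simp flip: of_real_mult integral_complex_of_real)
    then show ?thesis using sq_int_cauchy_schwarz[OF a] by (simp add: B_def)
  qed
  obtain r where r: "strict_mono r" "AE x in lebesgue. Cauchy (\<lambda>i. k x * F (r i) x)"
  proof (rule cauchy_L1_AE_cauchy_subseq[of lebesgue "\<lambda>n x. k x * F n x"])
    show "integrable lebesgue (\<lambda>x. k x * F n x)" for n
    proof -
      have "sq_int lebesgue (\<lambda>x. cnj (F n x))" using F[of n] by (auto simp: sq_int_def)
      from sq_int_mult[OF ksq this] show ?thesis by simp
    qed
    fix e :: real assume "e > 0"
    then have "e\<^sup>2 / (2 * (B + 1)) > 0" using B by simp
    then obtain N where N: "\<And>m n. m \<ge> N \<Longrightarrow> n \<ge> N \<Longrightarrow> (\<integral>x. (cmod (F m x - F n x))\<^sup>2 \<partial>lebesgue) \<le> e\<^sup>2 / (2 * (B + 1))"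
      using cau by blast
    have "(\<integral>x. norm (k x * F i x - k x * F j x) \<partial>lebesgue) < e" if "i \<ge> N" "j \<ge> N" for i j
    proof (rule power2_less_imp_less)
      have "(\<integral>x. norm (k x * F i x - k x * F j x) \<partial>lebesgue)\<^sup>2 \<le> B * (e\<^sup>2 / (2 * (B + 1)))"
        using l1[of i j] N[OF that] B by (meson mult_left_mono order_trans)
      also have "\<dots> \<le> e\<^sup>2 / 2"
        using B by (simp add: field_simps)
      also have "\<dots> < e\<^sup>2" using \<open>e > 0\<close> by simp
      finally show "(\<integral>x. norm (k x * F i x - k x * F j x) \<partial>lebesgue)\<^sup>2 < e\<^sup>2" .
    qed (use \<open>e > 0\<close> in simp)
    then show "\<exists>N. \<forall>i\<ge>N. \<forall>j\<ge>N. (\<integral>x. norm (k x * F i x - k x * F j x) \<partial>lebesgue) < e" by blast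
  qed (use that in blast)
  define G where "G x = lim (\<lambda>i. F (r i) x)" for x
  have Gm [measurable]: "G \<in> borel_measurable lebesgue" unfolding G_def[abs_def] by measurable
  have conv: "AE x in lebesgue. (\<lambda>i. F (r i) x) \<longlonglongrightarrow> G x"
    using r(2)
  proof eventually_elim
    case (elim x)
    then have "convergent (\<lambda>i. k x * F (r i) x)" by (rule Cauchy_convergent)
    then have "convergent (\<lambda>i. (1 / k x) * (k x * F (r i) x))" by (rule convergent_mult[OF convergent_const])
    moreover have "(\<lambda>i. (1 / k x) * (k x * F (r i) x)) = (\<lambda>i. F (r i) x)" using kpos[of x] by (simp add: fun_eq_iff)
    ultimately have "convergent (\<lambda>i. F (r i) x)" by (rule back_subst[where P = convergent])
    then show ?case by (simp add: G_def convergent_LIMSEQ_iff)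
  qed
  \<comment> \<open>The index \<open>n\<close> is fixed while the other index runs through the
    subsequence, so the Cauchy bound passes to the distance of \<open>F n\<close> from
    \<open>G\<close>.\<close>
  have fatou: "(\<integral>\<^sup>+x. ennreal ((cmod (F n x - G x))\<^sup>2) \<partial>lebesgue) \<le> ennreal \<epsilon>"
    if "\<epsilon> > 0" "\<And>m. m \<ge> N \<Longrightarrow> (\<integral>x. (cmod (F n x - F m x))\<^sup>2 \<partial>lebesgue) \<le> \<epsilon>" for n N \<epsilon>
  proof -
    have "(\<integral>\<^sup>+x. ennreal ((cmod (F n x - G x))\<^sup>2) \<partial>lebesgue)
        = (\<integral>\<^sup>+x. liminf (\<lambda>i. ennreal ((cmod (F n x - F (r i) x))\<^sup>2)) \<partial>lebesgue)"
    proof (rule nn_integral_cong_AE)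
      show "AE x in lebesgue. ennreal ((cmod (F n x - G x))\<^sup>2) = liminf (\<lambda>i. ennreal ((cmod (F n x - F (r i) x))\<^sup>2))"
        using conv
      proof eventually_elim
        case (elim x)
        then have "(\<lambda>i. ennreal ((cmod (F n x - F (r i) x))\<^sup>2)) \<longlonglongrightarrow> ennreal ((cmod (F n x - G x))\<^sup>2)"
          by (intro tendsto_intros tendsto_ennrealI)
        then show ?case by (rule lim_imp_Liminf[OF sequentially_bot, symmetric])
      qed
    qed
    also have "\<dots> \<le> liminf (\<lambda>i. \<integral>\<^sup>+x. ennreal ((cmod (F n x - F (r i) x))\<^sup>2) \<partial>lebesgue)"
      by (rule nn_integral_liminf) measurable
    also have "\<dots> \<le> ennreal \<epsilon>"
    proof -
      have "eventually (\<lambda>i. (\<integral>\<^sup>+x. ennreal ((cmod (F n x - F (r i) x))\<^sup>2) \<partial>lebesgue) \<le> ennreal \<epsilon>) sequentially"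
        using eventually_ge_at_top[of N]
      proof eventually_elim
        case (elim i)
        then have "r i \<ge> N" using strict_mono_imp_increasing[OF r(1)] by (meson le_trans)
        then have "(\<integral>x. (cmod (F n x - F (r i) x))\<^sup>2 \<partial>lebesgue) \<le> \<epsilon>" by (rule that(2))
        moreover have "(\<integral>\<^sup>+x. ennreal ((cmod (F n x - F (r i) x))\<^sup>2) \<partial>lebesgue) = ennreal (\<integral>x. (cmod (F n x - F (r i) x))\<^sup>2 \<partial>lebesgue)"
          using D[of n "r i"] by (intro nn_integral_eq_integral) (auto simp: sq_int_def)
        ultimately show ?case by (simp add: ennreal_leI)
      qed
      then have "liminf (\<lambda>i. \<integral>\<^sup>+x. ennreal ((cmod (F n x - F (r i) x))\<^sup>2) \<partial>lebesgue) \<le> liminf (\<lambda>i. ennreal \<epsilon>)"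
        by (rule Liminf_mono)
      then show ?thesis by (simp add: Liminf_const)
    qed
    finally show ?thesis .
  qed
  have FG: "sq_int lebesgue (\<lambda>x. F n x - G x) \<and> (\<integral>x. (cmod (F n x - G x))\<^sup>2 \<partial>lebesgue) \<le> \<epsilon>"
    if "\<epsilon> > 0" "\<And>m. m \<ge> N \<Longrightarrow> (\<integral>x. (cmod (F n x - F m x))\<^sup>2 \<partial>lebesgue) \<le> \<epsilon>" for n N \<epsilon>
  proof -
    note le = fatou[of \<epsilon> N n, OF that(1) that(2)]
    have i: "integrable lebesgue (\<lambda>x. (cmod (F n x - G x))\<^sup>2)"
      by (rule integrableI_nonneg) (use le in \<open>auto intro: le_less_trans\<close>)
    have "ennreal (\<integral>x. (cmod (F n x - G x))\<^sup>2 \<partial>lebesgue) \<le> ennreal \<epsilon>"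
      using le by (subst nn_integral_eq_integral[symmetric, OF i]) auto
    then show ?thesis using i \<open>\<epsilon> > 0\<close> by (auto simp: sq_int_def)
  qed
  obtain N1 where N1: "\<And>m n. m \<ge> N1 \<Longrightarrow> n \<ge> N1 \<Longrightarrow> (\<integral>x. (cmod (F m x - F n x))\<^sup>2 \<partial>lebesgue) \<le> 1"
    using cau[of 1] by auto
  have "sq_int lebesgue (\<lambda>x. F N1 x - G x)" using FG[of 1 N1 N1] N1 by auto
  from sq_int_combine[OF F[of N1] this, of 1 "-1"] have G: "sq_int lebesgue G" by simp
  have "(\<lambda>n. \<integral>x. (cmod (F n x - G x))\<^sup>2 \<partial>lebesgue) \<longlonglongrightarrow> 0"
  proof (rule LIMSEQ_I)
    fix e :: real assume "e > 0"
    then obtain N where N: "\<And>m n. m \<ge> N \<Longrightarrow> n \<ge> N \<Longrightarrow> (\<integral>x. (cmod (F m x - F n x))\<^sup>2 \<partial>lebesgue) \<le> e / 2"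
      using cau[of "e / 2"] by auto
    have "norm ((\<integral>x. (cmod (F n x - G x))\<^sup>2 \<partial>lebesgue) - 0) < e" if "n \<ge> N" for n
    proof -
      have "(\<integral>x. (cmod (F n x - G x))\<^sup>2 \<partial>lebesgue) \<le> e / 2"
        using FG[of "e / 2" N n] N[OF that] \<open>e > 0\<close> by auto
      moreover have "(\<integral>x. (cmod (F n x - G x))\<^sup>2 \<partial>lebesgue) \<ge> 0" by simp
      ultimately show ?thesis using \<open>e > 0\<close> unfolding real_norm_def by linarith
    qed
    then show "\<exists>N. \<forall>n\<ge>N. norm ((\<integral>x. (cmod (F n x - G x))\<^sup>2 \<partial>lebesgue) - 0) < e" by blast
  qed
  with G show ?thesis by blast
qed

section \<open>The weighted space and its projection theorem\<close>

locale weighted_l2 =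
  fixes K :: coeffs and a b :: ereal
  assumes adm: "admissible K a b"
begin

abbreviation "E \<equiv> einterval a b"
abbreviation "H \<equiv> L2w K a b"
abbreviation "ip \<equiv> inner_w K a b"
abbreviation "nm \<equiv> norm_w K a b"
abbreviation "L \<equiv> ell K a b"

text \<open>Multiplication by \<open>wt\<close> embeds the weighted space isometrically in the
  unweighted L2 of the line. The \<open>max\<close> guards the null set where \<open>w\<close> may
  be negative, and the indicator hides values outside \<open>(a,b)\<close>.\<close>

definition wt :: "real \<Rightarrow> real" where
  "wt x = indicator E x * sqrt (max 0 (coef_w K x))"

definition phi :: "(real \<Rightarrow> complex) \<Rightarrow> real \<Rightarrow> complex" where
  "phi f x = complex_of_real (wt x) * f x"

lemma w_pos: "AE x in lebesgue. x \<in> E \<longrightarrow> coef_w K x > 0"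
proof -
  have "AE x in lebesgue. x \<in> E \<longrightarrow> coef_p K x > 0 \<and> coef_w K x > 0"
    using adm by (simp add: admissible_def)
  then show ?thesis by eventually_elim blast
qed

lemma E_sets [measurable]: "E \<in> sets lebesgue"
  by (simp add: borel_einterval)

lemma w_measurable: "(\<lambda>x. indicator E x * coef_w K x) \<in> borel_measurable lebesgue"
proof -
  obtain l u :: "nat \<Rightarrow> real" where "E = (\<Union>i. {l i..u i}) \<and> (\<forall>i. l i < u i) \<and> incseq u \<and> decseq l"
    using einterval_exhaustion[OF admissible_less[OF adm]] by (elim exE)
  then have lu: "E = (\<Union>i. {l i..u i})" "incseq u" "decseq l" by simp_all
  have m: "(\<lambda>x. indicator {l i..u i} x * coef_w K x) \<in> borel_measurable lebesgue" for i
  proof -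
    have "{l i..u i} \<subseteq> E" using lu(1) by blast
    then have "set_integrable lebesgue {l i..u i} (coef_w K)"
      using adm unfolding admissible_def locally_integrable_def by blast
    then show ?thesis by (auto simp: set_integrable_def dest: borel_measurable_integrable)
  qed
  show ?thesis
  proof (rule borel_measurable_LIMSEQ_real[OF _ m])
    fix x
    have "(\<lambda>i. indicator {l i..u i} x :: real) \<longlonglongrightarrow> indicator E x"
    proof (cases "x \<in> E")
      case True
      then obtain i where i: "x \<in> {l i..u i}" using lu(1) by blast
      have "x \<in> {l n..u n}" if "n \<ge> i" for n
        using i that incseqD[OF lu(2) that] decseqD[OF lu(3) that] by auto
      then have "eventually (\<lambda>n. indicator {l n..u n} x = (1::real)) sequentially"
        by (auto simp: eventually_sequentially intro!: exI[of _ i])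
      then show ?thesis using True by (simp add: tendsto_eventually)
    next
      case False
      then have "x \<notin> {l i..u i}" for i using lu(1) by blast
      then show ?thesis using False by simp
    qed
    then show "(\<lambda>i. indicator {l i..u i} x * coef_w K x) \<longlonglongrightarrow> indicator E x * coef_w K x"
      by (intro tendsto_intros)
  qed
qed

lemma wt_measurable [measurable]: "wt \<in> borel_measurable lebesgue"
proof -
  have eq: "wt x = sqrt (max 0 (indicator E x * coef_w K x))" for x
    by (simp add: wt_def indicator_def)
  note [measurable] = w_measurable
  show ?thesis unfolding eq[abs_def] by measurable
qed

lemma wt_sq: "AE x in lebesgue. (wt x)\<^sup>2 = indicator E x * coef_w K x \<and> (x \<in> E \<longrightarrow> wt x > 0)"
  using w_pos by eventually_elim (auto simp: wt_def indicator_def)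

lemma set_borel_measurable_phi:
  assumes "set_borel_measurable lebesgue E f"
  shows "phi f \<in> borel_measurable lebesgue"
proof -
  have m [measurable]: "(\<lambda>x. indicator E x *\<^sub>R f x) \<in> borel_measurable lebesgue"
    using assms by (simp add: set_borel_measurable_def)
  have eq: "phi f x = complex_of_real (wt x) * (indicator E x *\<^sub>R f x)" for x
    by (auto simp: phi_def wt_def indicator_def)
  show ?thesis unfolding eq[abs_def] by measurable
qed

lemma cmod_phi_sq: "AE x in lebesgue. indicator E x *\<^sub>R ((cmod (f x))\<^sup>2 * coef_w K x) = (cmod (phi f x))\<^sup>2"
  using wt_sq by eventually_elim (auto simp: phi_def norm_mult power_mult_distrib mult.commute)

lemma H_iff: "f \<in> H \<longleftrightarrow> set_borel_measurable lebesgue E f \<and> sq_int lebesgue (phi f)"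
proof -
  have "set_integrable lebesgue E (\<lambda>x. (cmod (f x))\<^sup>2 * coef_w K x) \<longleftrightarrow> integrable lebesgue (\<lambda>x. (cmod (phi f x))\<^sup>2)"
    if f: "set_borel_measurable lebesgue E f"
    unfolding set_integrable_def
  proof (rule integrable_cong_AE[OF _ _ cmod_phi_sq])
    have [measurable]: "(\<lambda>x. indicator E x *\<^sub>R f x) \<in> borel_measurable lebesgue"
      using f by (simp add: set_borel_measurable_def)
    note [measurable] = w_measurable set_borel_measurable_phi[OF f]
    have eq: "indicator E x *\<^sub>R ((cmod (f x))\<^sup>2 * coef_w K x) = (cmod (indicator E x *\<^sub>R f x))\<^sup>2 * (indicator E x * coef_w K x)" for x
      by (auto simp: indicator_def)
    show "(\<lambda>x. indicator E x *\<^sub>R ((cmod (f x))\<^sup>2 * coef_w K x)) \<in> borel_measurable lebesgue"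
      unfolding eq by measurable
    show "(\<lambda>x. (cmod (phi f x))\<^sup>2) \<in> borel_measurable lebesgue" by measurable
  qed
  then show ?thesis using set_borel_measurable_phi[of f] by (auto simp: L2w_def sq_int_def)
qed

lemma H_set_measurable: "f \<in> H \<Longrightarrow> set_borel_measurable lebesgue E f"
  by (simp add: H_iff)

lemma H_phi: "f \<in> H \<Longrightarrow> sq_int lebesgue (phi f)"
  by (simp add: H_iff)

lemma phi_combine: "phi (\<lambda>x. \<alpha> * f x + \<beta> * g x) = (\<lambda>x. \<alpha> * phi f x + \<beta> * phi g x)"
  by (auto simp: phi_def algebra_simps)

lemma H_combine:
  assumes "f \<in> H" "g \<in> H"
  shows "(\<lambda>x. \<alpha> * f x + \<beta> * g x) \<in> H"
  unfolding H_iff phi_combine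
proof
  have [measurable]: "(\<lambda>x. indicator E x *\<^sub>R f x) \<in> borel_measurable lebesgue"
      "(\<lambda>x. indicator E x *\<^sub>R g x) \<in> borel_measurable lebesgue"
    using H_set_measurable[OF assms(1)] H_set_measurable[OF assms(2)] by (auto simp: set_borel_measurable_def)
  have eq: "indicator E x *\<^sub>R (\<alpha> * f x + \<beta> * g x) = \<alpha> * (indicator E x *\<^sub>R f x) + \<beta> * (indicator E x *\<^sub>R g x)" for x
    by (simp add: scaleR_add_right)
  show "set_borel_measurable lebesgue E (\<lambda>x. \<alpha> * f x + \<beta> * g x)"
    unfolding set_borel_measurable_def eq by measurable
  show "sq_int lebesgue (\<lambda>x. \<alpha> * phi f x + \<beta> * phi g x)"
    by (rule sq_int_combine[OF H_phi[OF assms(1)] H_phi[OF assms(2)]])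
qed

lemma H_scale: "f \<in> H \<Longrightarrow> (\<lambda>x. \<alpha> * f x) \<in> H"
  using H_combine[of f f \<alpha> 0] by simp

lemma H_add: "f \<in> H \<Longrightarrow> g \<in> H \<Longrightarrow> (\<lambda>x. f x + g x) \<in> H"
  using H_combine[of f g 1 1] by simp

lemma H_diff: "f \<in> H \<Longrightarrow> g \<in> H \<Longrightarrow> (\<lambda>x. f x - g x) \<in> H"
  using H_combine[of f g 1 "-1"] by simp

lemma ip_integrable:
  assumes f: "f \<in> H" and g: "g \<in> H"
  shows "set_integrable lebesgue E (\<lambda>x. coef_w K x *\<^sub>R (f x * cnj (g x)))"
    and "ip f g = (\<integral>x. phi f x * cnj (phi g x) \<partial>lebesgue)"
proof -
  note [measurable] = w_measurable
  have fm [measurable]: "(\<lambda>x. indicator E x *\<^sub>R f x) \<in> borel_measurable lebesgue"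
      "(\<lambda>x. indicator E x *\<^sub>R g x) \<in> borel_measurable lebesgue"
    using H_set_measurable[OF f] H_set_measurable[OF g] by (auto simp: set_borel_measurable_def)
  have eq: "indicator E x *\<^sub>R (coef_w K x *\<^sub>R (f x * cnj (g x))) =
      complex_of_real (indicator E x * coef_w K x) * ((indicator E x *\<^sub>R f x) * cnj (indicator E x *\<^sub>R g x))" for x
    by (auto simp: indicator_def scaleR_conv_of_real)
  have m: "(\<lambda>x. indicator E x *\<^sub>R (coef_w K x *\<^sub>R (f x * cnj (g x)))) \<in> borel_measurable lebesgue"
    unfolding eq by measurable
  have i: "integrable lebesgue (\<lambda>x. phi f x * cnj (phi g x))" by (rule sq_int_mult[OF H_phi[OF f] H_phi[OF g]])
  have ae: "AE x in lebesgue. phi f x * cnj (phi g x) = indicator E x *\<^sub>R (coef_w K x *\<^sub>R (f x * cnj (g x)))"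
    using wt_sq
  proof eventually_elim
    case (elim x)
    have "phi f x * cnj (phi g x) = complex_of_real ((wt x)\<^sup>2) * (f x * cnj (g x))"
      by (simp add: phi_def power2_eq_square)
    then show ?case using elim by (simp add: scaleR_conv_of_real)
  qed
  show "set_integrable lebesgue E (\<lambda>x. coef_w K x *\<^sub>R (f x * cnj (g x)))"
    unfolding set_integrable_def by (rule integrable_cong_AE_imp[OF i m]) (use ae in \<open>eventually_elim, simp\<close>)
  show "ip f g = (\<integral>x. phi f x * cnj (phi g x) \<partial>lebesgue)"
    unfolding inner_w_def set_lebesgue_integral_def
    by (rule integral_cong_AE[OF m borel_measurable_integrable[OF i]]) (use ae in \<open>eventually_elim, simp\<close>)
qed

lemma ip_combine_left:
  assumes "f \<in> H" "g \<in> H" "h \<in> H"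
  shows "ip (\<lambda>x. \<alpha> * f x + \<beta> * g x) h = \<alpha> * ip f h + \<beta> * ip g h"
proof -
  note i = sq_int_mult[OF H_phi[OF assms(1)] H_phi[OF assms(3)]] sq_int_mult[OF H_phi[OF assms(2)] H_phi[OF assms(3)]]
  have "ip (\<lambda>x. \<alpha> * f x + \<beta> * g x) h = (\<integral>x. \<alpha> * (phi f x * cnj (phi h x)) + \<beta> * (phi g x * cnj (phi h x)) \<partial>lebesgue)"
    by (simp add: ip_integrable(2)[OF H_combine[OF assms(1,2)] assms(3)] phi_combine algebra_simps)
  also have "\<dots> = \<alpha> * ip f h + \<beta> * ip g h"
    unfolding ip_integrable(2)[OF assms(1,3)] ip_integrable(2)[OF assms(2,3)]
    by (intro has_bochner_integral_integral_eq has_bochner_integral_add has_bochner_integral_mult_right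
        has_bochner_integral_integrable i)
  finally show ?thesis .
qed

lemma ip_cnj: "f \<in> H \<Longrightarrow> g \<in> H \<Longrightarrow> ip g f = cnj (ip f g)"
  by (simp only: ip_integrable(2) Bochner_Integration.integral_cnj[symmetric] complex_cnj_mult complex_cnj_cnj mult.commute)

lemma ip_combine_right:
  assumes "f \<in> H" "g \<in> H" "h \<in> H"
  shows "ip h (\<lambda>x. \<alpha> * f x + \<beta> * g x) = cnj \<alpha> * ip h f + cnj \<beta> * ip h g"
  using ip_combine_left[OF assms, of \<alpha> \<beta>] ip_cnj[OF assms(3,1)] ip_cnj[OF assms(3,2)]
    ip_cnj[OF H_combine[OF assms(1,2)] assms(3), of \<alpha> \<beta>] by simp

lemma nm_nonneg [simp]: "nm f \<ge> 0"
proof -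
  have eq: "indicator E x *\<^sub>R (coef_w K x *\<^sub>R (f x * cnj (f x)))
      = complex_of_real (indicator E x * (coef_w K x * (cmod (f x))\<^sup>2))" for x
    unfolding of_real_mult complex_norm_square scaleR_conv_of_real by simp
  have "ip f f = complex_of_real (\<integral>x. indicator E x * (coef_w K x * (cmod (f x))\<^sup>2) \<partial>lebesgue)"
    unfolding inner_w_def set_lebesgue_integral_def eq by (rule integral_complex_of_real)
  moreover have "(\<integral>x. indicator E x * (coef_w K x * (cmod (f x))\<^sup>2) \<partial>lebesgue) \<ge> 0"
    by (rule integral_nonneg_AE) (use w_pos in \<open>eventually_elim, auto simp: indicator_def\<close>)
  ultimately have "Re (ip f f) \<ge> 0" by simp
  then show ?thesis by (simp add: norm_w_def)
qed

lemma ip_self: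
  assumes "f \<in> H"
  shows "ip f f = complex_of_real ((nm f)\<^sup>2)" "(nm f)\<^sup>2 = (\<integral>x. (cmod (phi f x))\<^sup>2 \<partial>lebesgue)"
proof -
  have eq: "ip f f = complex_of_real (\<integral>x. (cmod (phi f x))\<^sup>2 \<partial>lebesgue)"
    unfolding ip_integrable(2)[OF assms assms] complex_norm_square[symmetric]
    by (rule integral_complex_of_real)
  then show "(nm f)\<^sup>2 = (\<integral>x. (cmod (phi f x))\<^sup>2 \<partial>lebesgue)" by (simp add: norm_w_def)
  with eq show "ip f f = complex_of_real ((nm f)\<^sup>2)" by simp
qed

lemma cauchy_schwarz:
  assumes "f \<in> H" "g \<in> H"
  shows "cmod (ip f g) \<le> nm f * nm g"
proof (rule power2_le_imp_le)
  show "(cmod (ip f g))\<^sup>2 \<le> (nm f * nm g)\<^sup>2"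
    using sq_int_cauchy_schwarz[OF H_phi[OF assms(1)] H_phi[OF assms(2)]]
    by (simp add: ip_integrable(2)[OF assms] power_mult_distrib ip_self(2) assms)
qed simp

lemma nm_combine_sq:
  assumes "f \<in> H" "g \<in> H"
  shows "(nm (\<lambda>x. \<alpha> * f x + \<beta> * g x))\<^sup>2 = (cmod \<alpha>)\<^sup>2 * (nm f)\<^sup>2 + (cmod \<beta>)\<^sup>2 * (nm g)\<^sup>2 + 2 * Re (\<alpha> * cnj \<beta> * ip f g)"
proof -
  note h = H_combine[OF assms, of \<alpha> \<beta>]
  have "complex_of_real ((nm (\<lambda>x. \<alpha> * f x + \<beta> * g x))\<^sup>2) = \<alpha> * cnj \<alpha> * ip f f + \<beta> * cnj \<beta> * ip g g + (\<alpha> * cnj \<beta> * ip f g + cnj (\<alpha> * cnj \<beta> * ip f g))"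
    unfolding ip_self(1)[OF h, symmetric] ip_combine_left[OF assms h] ip_combine_right[OF assms assms(1)] ip_combine_right[OF assms assms(2)]
    by (simp add: ip_cnj[OF assms] algebra_simps)
  also have "\<alpha> * cnj \<beta> * ip f g + cnj (\<alpha> * cnj \<beta> * ip f g) = complex_of_real (2 * Re (\<alpha> * cnj \<beta> * ip f g))"
    by (rule complex_add_cnj)
  also have "\<alpha> * cnj \<alpha> * ip f f + \<beta> * cnj \<beta> * ip g g = complex_of_real ((cmod \<alpha>)\<^sup>2 * (nm f)\<^sup>2 + (cmod \<beta>)\<^sup>2 * (nm g)\<^sup>2)"
    by (simp add: ip_self(1) assms complex_norm_square[symmetric] flip: of_real_mult of_real_power)
  finally show ?thesis by (metis (no_types, lifting) of_real_add of_real_eq_iff)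
qed

lemma nm_scale: "f \<in> H \<Longrightarrow> nm (\<lambda>x. \<alpha> * f x) = cmod \<alpha> * nm f"
proof -
  assume f: "f \<in> H"
  have "(nm (\<lambda>x. \<alpha> * f x))\<^sup>2 = (cmod \<alpha> * nm f)\<^sup>2"
    using nm_combine_sq[OF f f, of \<alpha> 0] by (simp add: power_mult_distrib)
  then show ?thesis by (metis nm_nonneg norm_ge_zero mult_nonneg_nonneg power2_eq_imp_eq)
qed

lemma nm_triangle:
  assumes "f \<in> H" "g \<in> H"
  shows "nm (\<lambda>x. \<alpha> * f x + \<beta> * g x) \<le> cmod \<alpha> * nm f + cmod \<beta> * nm g"
proof (rule power2_le_imp_le)
  have "Re (\<alpha> * cnj \<beta> * ip f g) \<le> cmod \<alpha> * cmod \<beta> * (nm f * nm g)"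
    using complex_Re_le_cmod[of "\<alpha> * cnj \<beta> * ip f g"] mult_left_mono[OF cauchy_schwarz[OF assms], of "cmod \<alpha> * cmod \<beta>"]
    by (simp add: norm_mult)
  then show "(nm (\<lambda>x. \<alpha> * f x + \<beta> * g x))\<^sup>2 \<le> (cmod \<alpha> * nm f + cmod \<beta> * nm g)\<^sup>2"
    unfolding nm_combine_sq[OF assms] power2_sum by (simp add: power_mult_distrib algebra_simps)
qed simp

lemma nm_triangle_add: "f \<in> H \<Longrightarrow> g \<in> H \<Longrightarrow> nm (\<lambda>x. f x + g x) \<le> nm f + nm g"
  using nm_triangle[of f g 1 1] by simp

lemma nm_triangle_diff: "f \<in> H \<Longrightarrow> g \<in> H \<Longrightarrow> nm (\<lambda>x. f x - g x) \<le> nm f + nm g"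
  using nm_triangle[of f g 1 "-1"] by simp

lemma H_cong:
  assumes f: "f \<in> H" and fg: "ae_eq a b f g"
  shows "g \<in> H"
proof -
  have ae: "AE x in lebesgue. phi f x = phi g x"
    using fg[unfolded ae_eq_def] by eventually_elim (auto simp: phi_def wt_def indicator_def)
  have "AE x in lebesgue. indicator E x *\<^sub>R f x = indicator E x *\<^sub>R g x"
    using fg[unfolded ae_eq_def] by eventually_elim (auto simp: indicator_def)
  then have m: "set_borel_measurable lebesgue E g"
    using H_set_measurable[OF f] unfolding set_borel_measurable_def by (rule borel_measurable_AE[rotated])
  have "integrable lebesgue (\<lambda>x. (cmod (phi g x))\<^sup>2)"
  proof (rule integrable_cong_AE_imp)
    show "integrable lebesgue (\<lambda>x. (cmod (phi f x))\<^sup>2)" using H_phi[OF f] by (simp add: sq_int_def)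
    show "(\<lambda>x. (cmod (phi g x))\<^sup>2) \<in> borel_measurable lebesgue"
      using set_borel_measurable_phi[OF m] by measurable
    show "AE x in lebesgue. (cmod (phi f x))\<^sup>2 = (cmod (phi g x))\<^sup>2" using ae by eventually_elim simp
  qed
  then show ?thesis using m set_borel_measurable_phi[OF m] by (simp add: H_iff sq_int_def)
qed

lemma ae_eq_sym: "ae_eq a b f g \<Longrightarrow> ae_eq a b g f"
  unfolding ae_eq_def by (auto elim: eventually_mono)

lemma ae_eq_trans:
  assumes "ae_eq a b f g" "ae_eq a b g h"
  shows "ae_eq a b f h"
  using assms unfolding ae_eq_def by eventually_elim simp

lemma ae_eq_combine:
  assumes "ae_eq a b f f'" "ae_eq a b g g'"
  shows "ae_eq a b (\<lambda>x. \<alpha> * f x + \<beta> * g x) (\<lambda>x. \<alpha> * f' x + \<beta> * g' x)"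
  using assms unfolding ae_eq_def by eventually_elim simp

lemma ip_cong:
  assumes "f \<in> H" "g \<in> H" "ae_eq a b f f'" "ae_eq a b g g'"
  shows "ip f g = ip f' g'"
proof -
  have f': "f' \<in> H" "g' \<in> H" using H_cong assms by blast+
  show ?thesis
    unfolding ip_integrable(2)[OF assms(1,2)] ip_integrable(2)[OF f']
  proof (rule integral_cong_AE)
    show "(\<lambda>x. phi f x * cnj (phi g x)) \<in> borel_measurable lebesgue"
      by (rule borel_measurable_integrable[OF sq_int_mult[OF H_phi[OF assms(1)] H_phi[OF assms(2)]]])
    show "(\<lambda>x. phi f' x * cnj (phi g' x)) \<in> borel_measurable lebesgue"
      by (rule borel_measurable_integrable[OF sq_int_mult[OF H_phi[OF f'(1)] H_phi[OF f'(2)]]])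
    show "AE x in lebesgue. phi f x * cnj (phi g x) = phi f' x * cnj (phi g' x)"
      using assms(3,4) unfolding ae_eq_def
      by eventually_elim (auto simp: phi_def wt_def indicator_def)
  qed
qed

lemma nm_cong: "f \<in> H \<Longrightarrow> ae_eq a b f g \<Longrightarrow> nm f = nm g"
  using ip_cong[of f f g g] by (simp add: norm_w_def)

lemma nm_zero_imp:
  assumes f: "f \<in> H" and z: "nm f = 0"
  shows "ae_eq a b f (\<lambda>x. 0)"
proof -
  have "(\<integral>x. (cmod (phi f x))\<^sup>2 \<partial>lebesgue) = 0" using ip_self(2)[OF f] z by simp
  moreover have "integrable lebesgue (\<lambda>x. (cmod (phi f x))\<^sup>2)" using H_phi[OF f] by (simp add: sq_int_def)
  ultimately have "AE x in lebesgue. (cmod (phi f x))\<^sup>2 = 0"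
    by (subst (asm) integral_nonneg_eq_0_iff_AE) auto
  then show ?thesis unfolding ae_eq_def using wt_sq
    by eventually_elim (auto simp: phi_def)
qed

lemma zero_H: "(\<lambda>x. 0) \<in> H"
  by (simp add: L2w_def set_borel_measurable_def set_integrable_def)

lemma nm_zero [simp]: "nm (\<lambda>x. 0) = 0"
  using nm_scale[OF zero_H, of 0] by simp

lemma H_complete:
  fixes f :: "nat \<Rightarrow> real \<Rightarrow> complex"
  assumes f: "\<And>n. f n \<in> H"
    and cau: "\<And>\<epsilon>. \<epsilon> > 0 \<Longrightarrow> \<exists>N. \<forall>m\<ge>N. \<forall>n\<ge>N. nm (\<lambda>x. f m x - f n x) \<le> \<epsilon>"
  shows "\<exists>g\<in>H. (\<lambda>n. nm (\<lambda>x. f n x - g x)) \<longlonglongrightarrow> 0"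
proof -
  have ph: "phi (\<lambda>x. f x - g x) = (\<lambda>x. phi f x - phi g x)" for f g using phi_combine[of 1 f "-1" g] by simp
  obtain G where G: "sq_int lebesgue G" "(\<lambda>n. \<integral>x. (cmod (phi (f n) x - G x))\<^sup>2 \<partial>lebesgue) \<longlonglongrightarrow> 0"
  proof (rule exE[OF sq_int_complete[of "\<lambda>n. phi (f n)"]])
    show "sq_int lebesgue (phi (f n))" for n by (rule H_phi[OF f])
    fix \<epsilon> :: real assume "\<epsilon> > 0"
    then obtain N where N: "\<And>m n. m \<ge> N \<Longrightarrow> n \<ge> N \<Longrightarrow> nm (\<lambda>x. f m x - f n x) \<le> sqrt \<epsilon>"
      using cau[of "sqrt \<epsilon>"] by auto
    have "(\<integral>x. (cmod (phi (f m) x - phi (f n) x))\<^sup>2 \<partial>lebesgue) \<le> \<epsilon>" if "m \<ge> N" "n \<ge> N" for m n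
    proof -
      have "(nm (\<lambda>x. f m x - f n x))\<^sup>2 \<le> (sqrt \<epsilon>)\<^sup>2" by (rule power_mono[OF N[OF that]]) simp
      then show ?thesis using ip_self(2)[OF H_diff[OF f f], of m n] \<open>\<epsilon> > 0\<close> by (simp add: ph)
    qed
    then show "\<exists>N. \<forall>m\<ge>N. \<forall>n\<ge>N. (\<integral>x. (cmod (phi (f m) x - phi (f n) x))\<^sup>2 \<partial>lebesgue) \<le> \<epsilon>" by blast
  qed (use that in blast)
  have Gm [measurable]: "G \<in> borel_measurable lebesgue" using G(1) by (simp add: sq_int_def)
  \<comment> \<open>Division by zero gives 0, so \<open>phi g\<close> is \<open>G\<close> where
    \<open>wt\<close> does not vanish and 0 elsewhere. Replacing \<open>G\<close> by
    \<open>phi g\<close> can only decrease distances to the \<open>phi (f n)\<close>, which vanish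
    there too.\<close>
  define g where "g x = G x / complex_of_real (wt x)" for x
  have gm [measurable]: "g \<in> borel_measurable lebesgue" unfolding g_def[abs_def] by measurable
  have pg: "cmod (phi g x) \<le> cmod (G x)" for x by (auto simp: phi_def g_def)
  have gH: "g \<in> H"
    unfolding H_iff
  proof
    show m: "set_borel_measurable lebesgue E g" unfolding set_borel_measurable_def by measurable
    have [measurable]: "phi g \<in> borel_measurable lebesgue" by (rule set_borel_measurable_phi[OF m])
    have "integrable lebesgue (\<lambda>x. (cmod (phi g x))\<^sup>2)"
      by (rule Bochner_Integration.integrable_bound[of _ "\<lambda>x. (cmod (G x))\<^sup>2"])
         (use G(1) pg in \<open>auto simp: sq_int_def intro!: power_mono\<close>)
    then show "sq_int lebesgue (phi g)" by (simp add: sq_int_def)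
  qed
  have le: "(nm (\<lambda>x. f n x - g x))\<^sup>2 \<le> (\<integral>x. (cmod (phi (f n) x - G x))\<^sup>2 \<partial>lebesgue)" for n
    unfolding ip_self(2)[OF H_diff[OF f gH]]
  proof (rule integral_mono_AE)
    show "integrable lebesgue (\<lambda>x. (cmod (phi (\<lambda>x. f n x - g x) x))\<^sup>2)"
      using H_phi[OF H_diff[OF f gH]] by (simp add: sq_int_def)
    show "integrable lebesgue (\<lambda>x. (cmod (phi (f n) x - G x))\<^sup>2)"
      using sq_int_combine[OF H_phi[OF f[of n]] G(1), of 1 "-1"] by (simp add: sq_int_def)
    show "AE x in lebesgue. (cmod (phi (\<lambda>x. f n x - g x) x))\<^sup>2 \<le> (cmod (phi (f n) x - G x))\<^sup>2"
    proof (rule AE_I2, rule power_mono)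
      fix x show "cmod (phi (\<lambda>x. f n x - g x) x) \<le> cmod (phi (f n) x - G x)"
        by (cases "wt x = 0") (auto simp: phi_def g_def algebra_simps)
    qed simp
  qed
  have "(\<lambda>n. (nm (\<lambda>x. f n x - g x))\<^sup>2) \<longlonglongrightarrow> 0"
    by (rule tendsto_sandwich[OF _ _ tendsto_const G(2)]) (use le in auto)
  then have "(\<lambda>n. sqrt ((nm (\<lambda>x. f n x - g x))\<^sup>2)) \<longlonglongrightarrow> sqrt 0" by (rule tendsto_real_sqrt)
  then have "(\<lambda>n. nm (\<lambda>x. f n x - g x)) \<longlonglongrightarrow> 0" by simp
  with gH show ?thesis by blast
qed

text \<open>The projection theorem for functions modulo null sets: a minimising sequence in
  \<open>M\<close> has a limit \<open>u\<close>, the residue \<open>f - u\<close> is orthogonal to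
  \<open>M\<close>, and so it has norm 0 by hypothesis.\<close>

lemma dense_if_orthogonal_trivial:
  assumes M: "M \<subseteq> H" "M \<noteq> {}" and lin: "\<And>\<alpha> \<beta> u v. u \<in> M \<Longrightarrow> v \<in> M \<Longrightarrow> (\<lambda>x. \<alpha> * u x + \<beta> * v x) \<in> M"
    and orth: "\<And>g. g \<in> H \<Longrightarrow> (\<And>m. m \<in> M \<Longrightarrow> ip m g = 0) \<Longrightarrow> nm g = 0"
    and f: "f \<in> H" and \<epsilon>: "\<epsilon> > 0"
  shows "\<exists>m\<in>M. nm (\<lambda>x. f x - m x) < \<epsilon>"
proof -
  define d where "d = (INF m\<in>M. nm (\<lambda>x. f x - m x))"
  have bdd: "bdd_below ((\<lambda>m. nm (\<lambda>x. f x - m x)) ` M)" by (rule bdd_belowI[of _ 0]) auto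
  have dle: "d \<le> nm (\<lambda>x. f x - m x)" if "m \<in> M" for m
    unfolding d_def by (rule cINF_lower[OF bdd that])
  have d0: "d \<ge> 0" unfolding d_def by (rule cINF_greatest[OF M(2)]) auto
  have near: "\<exists>m\<in>M. nm (\<lambda>x. f x - m x) < d + e" if "e > 0" for e
    using cINF_less_iff[OF M(2) bdd, of "d + e"] that by (simp add: d_def[symmetric])
  have MH: "m \<in> H" if "m \<in> M" for m using M(1) that by blast
  have "\<forall>n. \<exists>m. m \<in> M \<and> nm (\<lambda>x. f x - m x) < d + 1 / real (Suc n)"
    using near by (simp add: Bex_def del: of_nat_Suc)
  then obtain m where m: "\<And>n. m n \<in> M" "\<And>n. nm (\<lambda>x. f x - m n x) < d + 1 / real (Suc n)" by metis
  \<comment> \<open>The parallelogram law; the midpoint of \<open>m i\<close> and \<open>m j\<close>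
    lies in \<open>M\<close>, so its distance from \<open>f\<close> is at least \<open>d\<close>.
    This makes the minimising sequence Cauchy.\<close>
  have par: "(nm (\<lambda>x. m i x - m j x))\<^sup>2 \<le> 2 * (nm (\<lambda>x. f x - m i x))\<^sup>2 + 2 * (nm (\<lambda>x. f x - m j x))\<^sup>2 - 4 * d\<^sup>2" for i j
  proof -
    let ?u = "\<lambda>x. f x - m i x" and ?v = "\<lambda>x. f x - m j x"
    have uv: "?u \<in> H" "?v \<in> H" using H_diff f m(1) MH by auto
    have "(nm (\<lambda>x. (1/2) * ?u x + (1/2) * ?v x))\<^sup>2 = (nm ?u)\<^sup>2 / 4 + (nm ?v)\<^sup>2 / 4 + Re (ip ?u ?v) / 2"
      using nm_combine_sq[OF uv, of "1/2" "1/2"] by (simp add: power2_eq_square)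
    moreover have "(\<lambda>x. (1/2) * ?u x + (1/2) * ?v x) = (\<lambda>x. f x - ((1/2) * m i x + (1/2) * m j x))"
      by (auto simp: fun_eq_iff field_simps)
    moreover have "d \<le> nm (\<lambda>x. f x - ((1/2) * m i x + (1/2) * m j x))" by (rule dle[OF lin[OF m(1) m(1)]])
    ultimately have "d\<^sup>2 \<le> (nm ?u)\<^sup>2 / 4 + (nm ?v)\<^sup>2 / 4 + Re (ip ?u ?v) / 2"
      using power_mono[OF _ d0] by metis
    moreover have "(nm (\<lambda>x. (-1) * ?u x + 1 * ?v x))\<^sup>2 = (nm ?u)\<^sup>2 + (nm ?v)\<^sup>2 - 2 * Re (ip ?u ?v)"
      using nm_combine_sq[OF uv, of "-1" 1] by simp
    moreover have "(\<lambda>x. (-1) * ?u x + 1 * ?v x) = (\<lambda>x. m i x - m j x)" by (auto simp: fun_eq_iff)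
    ultimately show ?thesis by (simp only:)
  qed
  have "\<exists>u\<in>H. (\<lambda>n. nm (\<lambda>x. m n x - u x)) \<longlonglongrightarrow> 0"
  proof (rule H_complete)
    show "m n \<in> H" for n using MH m(1) by blast
    fix e :: real assume "e > 0"
    have "(\<lambda>n. 4 * (d + 1 / real (Suc n))\<^sup>2 - 4 * d\<^sup>2) \<longlonglongrightarrow> 4 * (d + 0)\<^sup>2 - 4 * d\<^sup>2"
      by (intro tendsto_intros lim_inverse_n'[THEN LIMSEQ_Suc])
    then have "(\<lambda>n. 4 * (d + 1 / real (Suc n))\<^sup>2 - 4 * d\<^sup>2) \<longlonglongrightarrow> 0" by simp
    from LIMSEQ_D[OF this, of "e\<^sup>2"] \<open>e > 0\<close>
    obtain N where "\<forall>n\<ge>N. norm (4 * (d + 1 / real (Suc n))\<^sup>2 - 4 * d\<^sup>2 - 0) < e\<^sup>2" by auto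
    then have N: "4 * (d + 1 / real (Suc N))\<^sup>2 - 4 * d\<^sup>2 < e\<^sup>2" by (simp add: abs_less_iff del: of_nat_Suc)
    have "nm (\<lambda>x. m i x - m j x) \<le> e" if ij: "i \<ge> N" "j \<ge> N" for i j
    proof (rule power2_le_imp_le)
      have b: "(nm (\<lambda>x. f x - m k x))\<^sup>2 \<le> (d + 1 / real (Suc N))\<^sup>2" if "k \<ge> N" for k
      proof (rule power_mono)
        have "1 / real (Suc k) \<le> 1 / real (Suc N)" using that by (intro divide_left_mono) auto
        then show "nm (\<lambda>x. f x - m k x) \<le> d + 1 / real (Suc N)" using m(2)[of k] by linarith
      qed simp
      show "(nm (\<lambda>x. m i x - m j x))\<^sup>2 \<le> e\<^sup>2" using par[of i j] b[OF ij(1)] b[OF ij(2)] N by linarith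
    qed (use \<open>e > 0\<close> in simp)
    then show "\<exists>N. \<forall>i\<ge>N. \<forall>j\<ge>N. nm (\<lambda>x. m i x - m j x) \<le> e" by blast
  qed
  then obtain u where u: "u \<in> H" "(\<lambda>n. nm (\<lambda>x. m n x - u x)) \<longlonglongrightarrow> 0" by blast
  define g where "g x = f x - u x" for x
  have gH: "g \<in> H" unfolding g_def by (rule H_diff[OF f u(1)])
  \<comment> \<open>\<open>u\<close> is only a limit of elements of \<open>M\<close>, so minimality
    of its residue is obtained in two limits, comparing both norms with \<open>d\<close>.\<close>
  have gle: "nm g \<le> nm (\<lambda>x. g x - k x)" if k: "k \<in> M" for k
  proof -
    have "(\<lambda>n. d + 1 / real (Suc n) + nm (\<lambda>x. m n x - u x)) \<longlonglongrightarrow> d + 0 + 0"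
      by (intro tendsto_intros u(2) lim_inverse_n'[THEN LIMSEQ_Suc])
    moreover have "nm g \<le> d + 1 / real (Suc n) + nm (\<lambda>x. m n x - u x)" for n
    proof -
      have "nm (\<lambda>x. (f x - m n x) + (m n x - u x)) \<le> nm (\<lambda>x. f x - m n x) + nm (\<lambda>x. m n x - u x)"
        using m(1) MH f u(1) by (intro nm_triangle_add H_diff) auto
      then show ?thesis using m(2)[of n] by (simp add: g_def[abs_def])
    qed
    ultimately have gd: "nm g \<le> d" by (intro LIMSEQ_le_const[where X = "\<lambda>n. d + 1 / real (Suc n) + nm (\<lambda>x. m n x - u x)"]) auto
    have "(\<lambda>n. nm (\<lambda>x. g x - k x) + nm (\<lambda>x. m n x - u x)) \<longlonglongrightarrow> nm (\<lambda>x. g x - k x) + 0"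
      by (intro tendsto_intros u(2))
    moreover have "d \<le> nm (\<lambda>x. g x - k x) + nm (\<lambda>x. m n x - u x)" for n
    proof -
      have "(\<lambda>x. 1 * m n x + 1 * k x) \<in> M" by (rule lin[OF m(1) k])
      from dle[OF this] have "d \<le> nm (\<lambda>x. (g x - k x) - (m n x - u x))" by (simp add: g_def algebra_simps)
      also have "\<dots> \<le> nm (\<lambda>x. g x - k x) + nm (\<lambda>x. m n x - u x)"
        using m(1) MH k gH u(1) by (intro nm_triangle_diff H_diff) auto
      finally show ?thesis .
    qed
    ultimately have "d \<le> nm (\<lambda>x. g x - k x)"
      by (intro LIMSEQ_le_const[where X = "\<lambda>n. nm (\<lambda>x. g x - k x) + nm (\<lambda>x. m n x - u x)"]) auto
    with gd show ?thesis by simp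
  qed
  have "ip k g = 0" if k: "k \<in> M" for k
  proof -
    have "0 \<le> 0 + 2 * Re (t * ip k g) + (cmod t)\<^sup>2 * (nm k)\<^sup>2" for t
    proof -
      have "(\<lambda>x. (-t) * k x + 0 * k x) \<in> M" by (rule lin[OF k k])
      from gle[OF this] have "(nm g)\<^sup>2 \<le> (nm (\<lambda>x. 1 * g x + t * k x))\<^sup>2" by (intro power_mono) auto
      also have "\<dots> = (nm g)\<^sup>2 + (cmod t)\<^sup>2 * (nm k)\<^sup>2 + 2 * Re (cnj t * ip g k)"
        using nm_combine_sq[OF gH MH[OF k], of 1 t] by simp
      also have "Re (cnj t * ip g k) = Re (t * ip k g)" by (simp add: ip_cnj[OF gH MH[OF k]])
      finally show ?thesis by simp
    qed
    from cauchy_schwarz_from_positivity[OF this] show ?thesis by simp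
  qed
  then have "nm g = 0" by (rule orth[OF gH])
  from LIMSEQ_D[OF u(2) \<epsilon>] obtain n where n: "norm (nm (\<lambda>x. m n x - u x) - 0) < \<epsilon>" by blast
  have "nm (\<lambda>x. f x - m n x) = nm (\<lambda>x. g x - (m n x - u x))" by (simp add: g_def)
  also have "\<dots> \<le> nm g + nm (\<lambda>x. m n x - u x)"
    using m(1) MH u(1) gH by (intro nm_triangle_diff H_diff) auto
  also have "\<dots> < \<epsilon>" using n \<open>nm g = 0\<close> by simp
  finally show ?thesis using m(1) by blast
qed

end

section \<open>Symmetric operators and approximate eigenvectors\<close>

locale weighted_operator = weighted_l2 +
  fixes D :: "(real \<Rightarrow> complex) set"
  assumes D_max: "D \<subseteq> D_max K a b" and D_ne: "D \<noteq> {}"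
    and D_combine: "\<And>\<alpha> \<beta> y z. y \<in> D \<Longrightarrow> z \<in> D \<Longrightarrow> (\<lambda>x. \<alpha> * y x + \<beta> * z x) \<in> D"
begin

definition sh :: "complex \<Rightarrow> (real \<Rightarrow> complex) \<Rightarrow> real \<Rightarrow> complex" where
  "sh z y x = L y x - z * y x"

lemma D_H: "y \<in> D \<Longrightarrow> y \<in> H" "y \<in> D \<Longrightarrow> L y \<in> H" "y \<in> D \<Longrightarrow> has_quasi_derivs K a b y"
  using D_max by (auto simp: D_max_def)

lemma sh_H: "y \<in> D \<Longrightarrow> sh z y \<in> H"
  using H_combine[of "L y" y 1 "- z"] D_H by (simp add: sh_def[abs_def])

text \<open>Linearity holds only almost everywhere, since \<open>ell\<close> differentiates a chosen
  representative pointwise.\<close>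

lemma L_combine: "y \<in> D \<Longrightarrow> z \<in> D \<Longrightarrow> ae_eq a b (L (\<lambda>x. \<alpha> * y x + \<beta> * z x)) (\<lambda>x. \<alpha> * L y x + \<beta> * L z x)"
  by (rule qd_combine(3)[OF adm D_H(3) D_H(3)])

lemma sh_combine:
  assumes "y \<in> D" "z \<in> D"
  shows "ae_eq a b (sh \<mu> (\<lambda>x. \<alpha> * y x + \<beta> * z x)) (\<lambda>x. \<alpha> * sh \<mu> y x + \<beta> * sh \<mu> z x)"
  using L_combine[OF assms, of \<alpha> \<beta>] unfolding ae_eq_def sh_def
  by eventually_elim (auto simp: algebra_simps)

lemma sh_ip_left:
  assumes "y \<in> D" "g \<in> H"
  shows "ip (sh z y) g = ip (L y) g - z * ip y g"
  using ip_combine_left[OF D_H(2)[OF assms(1)] D_H(1)[OF assms(1)] assms(2), of 1 "- z"]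
  by (simp add: sh_def[abs_def])

lemma sh_ip_right:
  assumes "y \<in> D" "g \<in> H"
  shows "ip g (sh z y) = ip g (L y) - cnj z * ip g y"
  using ip_combine_right[OF D_H(2)[OF assms(1)] D_H(1)[OF assms(1)] assms(2), of 1 "- z"]
  by (simp add: sh_def[abs_def])

lemma resolvent_iff:
  "z \<in> resolvent_set K a b D \<longleftrightarrow> (\<forall>f\<in>H. \<exists>y\<in>D. ae_eq a b (sh z y) f) \<and> (\<exists>C. \<forall>y\<in>D. nm y \<le> C * nm (sh z y))"
  by (simp add: resolvent_set_def sh_def[abs_def])

end

locale symmetric_operator = weighted_operator +
  assumes sym: "\<And>y z. y \<in> D \<Longrightarrow> z \<in> D \<Longrightarrow> ip (L y) z = ip y (L z)"
begin

lemma sh_sym: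
  assumes "y \<in> D" "z \<in> D"
  shows "ip (sh \<mu> y) z = ip y (sh (cnj \<mu>) z)"
  using sym[OF assms] by (simp add: sh_ip_left[OF assms(1) D_H(1)[OF assms(2)]] sh_ip_right[OF assms(2) D_H(1)[OF assms(1)]])

text \<open>Split off the imaginary part of \<open>z\<close>: the cross term drops out because
  \<open>ip ((L - Re z) y) y\<close> is real.\<close>

lemma sh_norm_sq:
  assumes y: "y \<in> D"
  shows "(nm (sh z y))\<^sup>2 = (nm (sh (complex_of_real (Re z)) y))\<^sup>2 + (Im z)\<^sup>2 * (nm y)\<^sup>2"
proof -
  let ?s = "sh (complex_of_real (Re z)) y"
  have eq: "sh z y = (\<lambda>x. 1 * ?s x + (- \<i> * complex_of_real (Im z)) * y x)"
  proof
    fix x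
    have "z * y x = complex_of_real (Re z) * y x + \<i> * complex_of_real (Im z) * y x"
      by (subst complex_eq[of z]) (rule distrib_right)
    then show "sh z y x = 1 * ?s x + (- \<i> * complex_of_real (Im z)) * y x" by (simp add: sh_def)
  qed
  have "ip ?s y = cnj (ip ?s y)"
    using sh_sym[OF y y, of "complex_of_real (Re z)"] ip_cnj[OF sh_H[OF y] D_H(1)[OF y], of "complex_of_real (Re z)"] by simp
  then have im: "Im (ip ?s y) = 0" by (metis cnj.simps(2) equal_neg_zero)
  have "cmod (- \<i> * complex_of_real (Im z)) ^ 2 = (Im z)\<^sup>2" by (simp add: norm_mult power_mult_distrib)
  moreover have "Re (1 * cnj (- \<i> * complex_of_real (Im z)) * ip ?s y) = 0" using im by simp
  ultimately show ?thesis
    unfolding eq nm_combine_sq[OF sh_H[OF y, of "complex_of_real (Re z)"] D_H(1)[OF y], of 1 "- \<i> * complex_of_real (Im z)"]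
    by simp
qed

text \<open>
  If \<open>\<delta>\<close> is the infimum of \<open>\<parallel>(L - \<rho>) y\<parallel> / \<parallel>y\<parallel>\<close> and \<open>y\<close> nearly attains it, then
  \<open>x = (L - \<rho>)\<^sup>-\<^sup>1 y\<close> satisfies \<open>\<delta>\<^sup>2 x \<approx> (L - \<rho>) y\<close>, so \<open>y \<plusminus> \<delta> x\<close> are
  approximate eigenvectors for \<open>\<rho> \<plusminus> \<delta>\<close> and they cannot both be small.
\<close>

lemma spectrum_near:
  assumes y0: "y0 \<in> D" "nm y0 > 0" "nm (sh (complex_of_real \<rho>) y0) \<le> \<epsilon> * nm y0"
  shows "\<exists>\<mu>\<in>Sp K a b D. cmod (\<mu> - complex_of_real \<rho>) \<le> \<epsilon>"
proof (rule ccontr)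
  assume no: "\<not> (\<exists>\<mu>\<in>Sp K a b D. cmod (\<mu> - complex_of_real \<rho>) \<le> \<epsilon>)"
  then have res: "\<mu> \<in> resolvent_set K a b D" if "cmod (\<mu> - complex_of_real \<rho>) \<le> \<epsilon>" for \<mu>
    using that unfolding Sp_def by blast
  have "0 \<le> \<epsilon> * nm y0" using y0(3) nm_nonneg order_trans by blast
  then have e0: "\<epsilon> \<ge> 0" using y0(2) by (simp add: zero_le_mult_iff)
  let ?l = "complex_of_real \<rho>"
  have l: "?l \<in> resolvent_set K a b D" by (rule res) (use e0 in simp)
  obtain C0 where C0: "\<And>y. y \<in> D \<Longrightarrow> nm y \<le> C0 * nm (sh ?l y)" using l unfolding resolvent_iff by blast
  define S where "S = {y \<in> D. nm y > 0}"
  have S0: "S \<noteq> {}" using y0 by (auto simp: S_def)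
  define \<delta> where "\<delta> = (INF y\<in>S. nm (sh ?l y) / nm y)"
  have bdd: "bdd_below ((\<lambda>y. nm (sh ?l y) / nm y) ` S)" by (rule bdd_belowI[of _ 0]) auto
  have dle: "\<delta> * nm y \<le> nm (sh ?l y)" if "y \<in> D" for y
  proof (cases "nm y = 0")
    case False
    then have "y \<in> S" using that nm_nonneg[of y] by (simp add: S_def less_le)
    then have "\<delta> \<le> nm (sh ?l y) / nm y" unfolding \<delta>_def by (rule cINF_lower[OF bdd])
    then show ?thesis using False nm_nonneg[of y] by (simp add: pos_le_divide_eq less_le)
  qed simp
  have C0p: "C0 > 0"
  proof (rule ccontr)
    assume "\<not> C0 > 0"
    then have "C0 * nm (sh ?l y0) \<le> 0" by (simp add: mult_nonpos_nonneg)
    with C0[OF y0(1)] y0(2) show False by simp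
  qed
  have "1 / C0 \<le> \<delta>" unfolding \<delta>_def
  proof (rule cINF_greatest[OF S0])
    fix y assume "y \<in> S"
    then show "1 / C0 \<le> nm (sh ?l y) / nm y" using C0[of y] C0p by (simp add: S_def field_simps)
  qed
  then have dpos: "\<delta> > 0" using C0p by (meson less_le_trans zero_less_divide_1_iff)
  have "\<delta> \<le> nm (sh ?l y0) / nm y0" unfolding \<delta>_def by (rule cINF_lower[OF bdd]) (use y0 in \<open>simp add: S_def\<close>)
  also have "\<dots> \<le> \<epsilon>" using y0 by (simp add: pos_divide_le_eq)
  finally have de: "\<delta> \<le> \<epsilon>" .
  \<comment> \<open>The bound \<open>\<delta> \<le> \<epsilon>\<close> places both points in the
    disc that is assumed to be free of spectrum.\<close>
  have r1: "?l + complex_of_real \<delta> \<in> resolvent_set K a b D" "?l - complex_of_real \<delta> \<in> resolvent_set K a b D"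
    using dpos de by (auto intro!: res)
  obtain C1 where C1: "\<And>y. y \<in> D \<Longrightarrow> nm y \<le> C1 * nm (sh (?l + complex_of_real \<delta>) y)"
    using r1(1) unfolding resolvent_iff by blast
  obtain C2 where C2: "\<And>y. y \<in> D \<Longrightarrow> nm y \<le> C2 * nm (sh (?l - complex_of_real \<delta>) y)"
    using r1(2) unfolding resolvent_iff by blast
  define C where "C = \<bar>C1\<bar> + \<bar>C2\<bar> + 1"
  have Cp: "C > 0" by (simp add: C_def)
  \<comment> \<open>With this \<open>\<eta>\<close> the error satisfies
    \<open>nm e \<le> nm y / C\<close>, whereas the two resolvent estimates add up to
    \<open>2 * nm y \<le> C * nm e\<close>.\<close>
  define \<eta> where "\<eta> = 1 / C\<^sup>2"
  have eta: "\<eta> > 0" using Cp by (simp add: \<eta>_def)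
  have "sqrt (\<delta>\<^sup>2 + \<eta>) > \<delta>" using eta dpos by (simp add: real_less_rsqrt)
  then obtain y where y: "y \<in> S" "nm (sh ?l y) / nm y < sqrt (\<delta>\<^sup>2 + \<eta>)"
    using cINF_less_iff[OF S0 bdd] unfolding \<delta>_def[symmetric] by blast
  have yD: "y \<in> D" and yp: "nm y > 0" using y(1) by (auto simp: S_def)
  define z where "z = sh ?l y"
  have zH: "z \<in> H" unfolding z_def by (rule sh_H[OF yD])
  have zle: "(nm z)\<^sup>2 \<le> (\<delta>\<^sup>2 + \<eta>) * (nm y)\<^sup>2"
  proof -
    have "nm z \<le> sqrt (\<delta>\<^sup>2 + \<eta>) * nm y" using y(2) yp by (simp add: z_def pos_divide_less_eq less_imp_le)
    then have "(nm z)\<^sup>2 \<le> (sqrt (\<delta>\<^sup>2 + \<eta>) * nm y)\<^sup>2" by (intro power_mono) auto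
    then show ?thesis using eta by (simp add: power_mult_distrib)
  qed
  obtain x where x: "x \<in> D" "ae_eq a b (sh ?l x) y" using l D_H(1)[OF yD] unfolding resolvent_iff by blast
  note xH = D_H(1)[OF x(1)] and yH = D_H(1)[OF yD]
  have nx: "\<delta> * nm x \<le> nm y" using dle[OF x(1)] nm_cong[OF sh_H[OF x(1)] x(2)] by simp
  have ipxz: "ip x z = complex_of_real ((nm y)\<^sup>2)"
  proof -
    have "ip x z = ip (sh ?l x) y" using sh_sym[OF x(1) yD, of ?l] by (simp add: z_def)
    also have "\<dots> = ip y y" by (rule ip_cong[OF sh_H[OF x(1)] yH x(2)]) (simp add: ae_eq_def)
    finally show ?thesis by (simp add: ip_self(1)[OF yH])
  qed
  \<comment> \<open>The defect in the approximate relation. In its squared norm the cross term is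
    known exactly from \<open>ip x z = ip y y\<close>, and \<open>\<delta> * nm x \<le> nm y\<close>
    bounds the first term, so the multiples of \<open>\<delta>^2\<close> cancel and only
    \<open>\<eta>\<close> is left.\<close>
  define e where "e t = complex_of_real (\<delta>\<^sup>2) * x t + (-1) * z t" for t
  have eH: "e \<in> H" unfolding e_def[abs_def] by (rule H_combine[OF xH zH])
  have ele: "(nm e)\<^sup>2 \<le> \<eta> * (nm y)\<^sup>2"
  proof -
    have "(nm e)\<^sup>2 = \<delta>\<^sup>2 * (\<delta> * nm x)\<^sup>2 + (nm z)\<^sup>2 - 2 * (\<delta>\<^sup>2 * (nm y)\<^sup>2)"
      unfolding e_def[abs_def] nm_combine_sq[OF xH zH] ipxz norm_of_real abs_power2
      by (simp add: power_mult_distrib power2_eq_square)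
    also have "\<dots> \<le> \<delta>\<^sup>2 * (nm y)\<^sup>2 + (\<delta>\<^sup>2 + \<eta>) * (nm y)\<^sup>2 - 2 * (\<delta>\<^sup>2 * (nm y)\<^sup>2)"
    proof -
      have "(\<delta> * nm x)\<^sup>2 \<le> (nm y)\<^sup>2" by (rule power_mono[OF nx]) (use dpos in simp)
      from mult_left_mono[OF this, of "\<delta>\<^sup>2"] zle show ?thesis by simp
    qed
    also have "\<dots> = \<eta> * (nm y)\<^sup>2" by (simp add: algebra_simps)
    finally show ?thesis .
  qed
  \<comment> \<open>The two signs are treated at once: \<open>(L - \<rho> - \<sigma> \<delta>) (y +
    \<sigma> \<delta> x) = z - \<delta>^2 x = - e\<close>, because
    \<open>\<sigma>^2 = 1\<close>.\<close>
  have main: "nm (sh (?l + complex_of_real (\<sigma> * \<delta>)) (\<lambda>t. 1 * y t + complex_of_real (\<sigma> * \<delta>) * x t)) = nm e"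
    if \<sigma>: "\<sigma>\<^sup>2 = 1" for \<sigma> :: real
  proof -
    let ?v = "\<lambda>t. 1 * y t + complex_of_real (\<sigma> * \<delta>) * x t"
    have v: "?v \<in> D" by (rule D_combine[OF yD x(1)])
    have "ae_eq a b (sh ?l ?v) (\<lambda>t. 1 * sh ?l y t + complex_of_real (\<sigma> * \<delta>) * sh ?l x t)"
      by (rule sh_combine[OF yD x(1)])
    then have "ae_eq a b (sh (?l + complex_of_real (\<sigma> * \<delta>)) ?v) (\<lambda>t. (-1) * e t)"
      using x(2) unfolding ae_eq_def
    proof eventually_elim
      case (elim t)
      show ?case
      proof
        assume "t \<in> E"
        with elim have 1: "sh ?l ?v t = z t + complex_of_real (\<sigma> * \<delta>) * y t" by (simp add: z_def)
        have "sh (?l + complex_of_real (\<sigma> * \<delta>)) ?v t = sh ?l ?v t - complex_of_real (\<sigma> * \<delta>) * ?v t"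
          by (simp add: sh_def algebra_simps)
        also have "\<dots> = z t - complex_of_real ((\<sigma> * \<delta>)\<^sup>2) * x t"
          unfolding 1 by (simp add: algebra_simps power2_eq_square)
        also have "\<dots> = (-1) * e t" using \<sigma> by (simp add: e_def power_mult_distrib)
        finally show "sh (?l + complex_of_real (\<sigma> * \<delta>)) ?v t = (-1) * e t" .
      qed
    qed
    from nm_cong[OF sh_H[OF v] this] show ?thesis using nm_scale[OF eH, of "-1"] by simp
  qed
  have 1: "nm (\<lambda>t. 1 * y t + complex_of_real \<delta> * x t) \<le> C1 * nm e"
    using C1[OF D_combine[OF yD x(1), of 1 "complex_of_real \<delta>"]] main[of 1] by simp
  have 2: "nm (\<lambda>t. 1 * y t + complex_of_real (- \<delta>) * x t) \<le> C2 * nm e"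
    using C2[OF D_combine[OF yD x(1), of 1 "complex_of_real (- \<delta>)"]] main[of "-1"] by simp
  have "2 * nm y = nm (\<lambda>t. 2 * y t)" using nm_scale[OF yH, of 2] by simp
  \<comment> \<open>The contributions of \<open>x\<close> cancel in the sum of the two approximate
    eigenvectors, so smallness of both contradicts \<open>nm y > 0\<close>.\<close>
  also have "(\<lambda>t. 2 * y t) = (\<lambda>t. (1 * y t + complex_of_real \<delta> * x t) + (1 * y t + complex_of_real (- \<delta>) * x t))"
    by (auto simp: fun_eq_iff)
  also have "nm \<dots> \<le> nm (\<lambda>t. 1 * y t + complex_of_real \<delta> * x t) + nm (\<lambda>t. 1 * y t + complex_of_real (- \<delta>) * x t)"
    by (rule nm_triangle_add[OF H_combine[OF yH xH] H_combine[OF yH xH]])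
  also have "\<dots> \<le> C1 * nm e + C2 * nm e" by (rule add_mono[OF 1 2])
  also have "\<dots> \<le> C * nm e"
    unfolding distrib_right[symmetric] by (rule mult_right_mono) (auto simp: C_def)
  also have "\<dots> \<le> C * (nm y / C)"
  proof (rule mult_left_mono)
    have "(nm e)\<^sup>2 \<le> (nm y / C)\<^sup>2" using ele by (simp add: \<eta>_def power_divide)
    then show "nm e \<le> nm y / C" by (rule power2_le_imp_le) (use Cp in simp)
  qed (use Cp in simp)
  also have "\<dots> = nm y" using Cp by simp
  finally show False using yp by simp
qed

end

section \<open>Resolvent and spectrum of a self-adjoint operator\<close>

context weighted_operator
begin

lemma self_adjoint_symmetric:
  assumes "self_adjoint K a b D"
  shows "symmetric_operator K a b D"
proof
  fix y z assume y: "y \<in> D" and z: "z \<in> D"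
  have "\<exists>z'\<in>D. ae_eq a b z' z \<and> ae_eq a b (L z') (L z)"
    using z by (intro bexI[of _ z]) (auto simp: ae_eq_def)
  then show "ip (L y) z = ip y (L z)"
    using assms D_H(1,2)[OF z] y unfolding self_adjoint_def by blast
qed

lemma self_adjoint_adjointD:
  assumes "self_adjoint K a b D" "f \<in> H" "g \<in> H" "\<And>y. y \<in> D \<Longrightarrow> ip (L y) f = ip y g"
  shows "\<exists>z\<in>D. ae_eq a b z f \<and> ae_eq a b (L z) g"
  using assms unfolding self_adjoint_def by blast

text \<open>A lower bound makes the range closed, and a vector orthogonal to it lies in the domain
  of the adjoint, which is L, as an eigenvector for \<open>cnj z\<close>; the lower bound holds for
  \<open>cnj z\<close> as well and kills it.\<close>

lemma self_adjoint_onto: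
  assumes sa: "self_adjoint K a b D" and C: "\<And>y. y \<in> D \<Longrightarrow> nm y \<le> C * nm (sh z y)" and f: "f \<in> H"
  shows "\<exists>y\<in>D. ae_eq a b (sh z y) f"
proof -
  interpret symmetric_operator K a b D by (rule self_adjoint_symmetric[OF sa])
  \<comment> \<open>The norm of \<open>(L - z) y\<close> depends on \<open>Im z\<close> only through
    its square.\<close>
  have Cc: "nm y \<le> C * nm (sh (cnj z) y)" if "y \<in> D" for y
  proof -
    have "(nm (sh (cnj z) y))\<^sup>2 = (nm (sh z y))\<^sup>2"
      using sh_norm_sq[OF that, of z] sh_norm_sq[OF that, of "cnj z"] by simp
    then have "nm (sh (cnj z) y) = nm (sh z y)" by (metis nm_nonneg power2_eq_imp_eq)
    with C[OF that] show ?thesis by simp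
  qed
  define M where "M = {g \<in> H. \<exists>y\<in>D. ae_eq a b (sh z y) g}"
  have dense: "\<exists>m\<in>M. nm (\<lambda>x. f x - m x) < \<epsilon>" if "\<epsilon> > 0" for \<epsilon>
  proof (rule dense_if_orthogonal_trivial[OF _ _ _ _ f that])
    show "M \<subseteq> H" by (auto simp: M_def)
    obtain y where "y \<in> D" using D_ne by blast
    then have "sh z y \<in> M" using sh_H by (auto simp: M_def ae_eq_def intro!: bexI[of _ y])
    then show "M \<noteq> {}" by blast
  next
    fix \<alpha> \<beta> u v assume u: "u \<in> M" and v: "v \<in> M"
    then obtain yu yv where y: "yu \<in> D" "ae_eq a b (sh z yu) u" "yv \<in> D" "ae_eq a b (sh z yv) v" by (auto simp: M_def)
    have "ae_eq a b (sh z (\<lambda>x. \<alpha> * yu x + \<beta> * yv x)) (\<lambda>x. \<alpha> * u x + \<beta> * v x)"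
      by (rule ae_eq_trans[OF sh_combine[OF y(1,3)] ae_eq_combine[OF y(2,4)]])
    then show "(\<lambda>x. \<alpha> * u x + \<beta> * v x) \<in> M"
      using u v D_combine[OF y(1,3)] by (auto simp: M_def intro!: H_combine)
  next
    fix g assume g: "g \<in> H" and o: "\<And>m. m \<in> M \<Longrightarrow> ip m g = 0"
    have "ip (L y) g = ip y (\<lambda>x. cnj z * g x)" if y: "y \<in> D" for y
    proof -
      have "sh z y \<in> M" using y sh_H by (auto simp: M_def ae_eq_def intro!: bexI[of _ y])
      from o[OF this] have "ip (L y) g = z * ip y g" by (simp add: sh_ip_left[OF y g])
      also have "\<dots> = ip y (\<lambda>x. cnj z * g x)" using ip_combine_right[OF g g D_H(1)[OF y], of "cnj z" 0] by simp
      finally show ?thesis .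
    qed
    from self_adjoint_adjointD[OF sa g H_scale[OF g] this]
    obtain y where y: "y \<in> D" "ae_eq a b y g" "ae_eq a b (L y) (\<lambda>x. cnj z * g x)" by blast
    have "ae_eq a b (sh (cnj z) y) (\<lambda>x. 0)"
      using y(2,3) unfolding ae_eq_def sh_def by eventually_elim auto
    then have "nm (sh (cnj z) y) = 0" using nm_cong[OF sh_H[OF y(1)]] by simp
    with Cc[OF y(1)] have "nm y = 0" using nm_nonneg[of y] by simp
    then show "nm g = 0" using nm_cong[OF D_H(1)[OF y(1)] y(2)] by simp
  qed
  have "\<exists>y. y \<in> D \<and> nm (\<lambda>x. f x - sh z y x) < 1 / real (Suc n)" for n
  proof -
    obtain m where m: "m \<in> M" "nm (\<lambda>x. f x - m x) < 1 / real (Suc n)" using dense[of "1 / real (Suc n)"] by auto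
    then obtain y where y: "y \<in> D" "ae_eq a b (sh z y) m" by (auto simp: M_def)
    have "ae_eq a b (\<lambda>x. f x - sh z y x) (\<lambda>x. f x - m x)" using y(2) unfolding ae_eq_def by eventually_elim auto
    with m(2) nm_cong[OF H_diff[OF f sh_H[OF y(1)]]] y(1) show ?thesis by auto
  qed
  then obtain y where y: "\<And>n. y n \<in> D" "\<And>n. nm (\<lambda>x. f x - sh z (y n) x) < 1 / real (Suc n)" by metis
  have lim: "(\<lambda>n. nm (\<lambda>x. f x - sh z (y n) x)) \<longlonglongrightarrow> 0"
  proof (rule tendsto_sandwich[OF _ _ tendsto_const lim_inverse_n'[THEN LIMSEQ_Suc]])
    show "\<forall>\<^sub>F n in sequentially. nm (\<lambda>x. f x - sh z (y n) x) \<le> 1 / real (Suc n)" using y(2) by (simp add: less_imp_le del: of_nat_Suc)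
  qed auto
  \<comment> \<open>\<open>C\<close> may be zero or negative; the Cauchy estimate divides by its
    replacement.\<close>
  define C' where "C' = \<bar>C\<bar> + 1"
  have C'p: "C' > 0" by (simp add: C'_def)
  have yd: "nm (\<lambda>x. y m x - y n x) \<le> C' * (nm (\<lambda>x. f x - sh z (y m) x) + nm (\<lambda>x. f x - sh z (y n) x))" for m n
  proof -
    have d: "(\<lambda>x. 1 * y m x + (-1) * y n x) \<in> D" by (rule D_combine[OF y(1) y(1)])
    have "nm (\<lambda>x. y m x - y n x) \<le> C * nm (sh z (\<lambda>x. 1 * y m x + (-1) * y n x))" using C[OF d] by simp
    also have "\<dots> \<le> C' * nm (sh z (\<lambda>x. 1 * y m x + (-1) * y n x))" by (rule mult_right_mono) (auto simp: C'_def)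
    also have "nm (sh z (\<lambda>x. 1 * y m x + (-1) * y n x)) = nm (\<lambda>x. 1 * sh z (y m) x + (-1) * sh z (y n) x)"
      by (rule nm_cong[OF sh_H[OF d] sh_combine[OF y(1) y(1)]])
    also have "(\<lambda>x. 1 * sh z (y m) x + (-1) * sh z (y n) x) = (\<lambda>x. (f x - sh z (y n) x) - (f x - sh z (y m) x))" by auto
    also have "nm \<dots> \<le> nm (\<lambda>x. f x - sh z (y n) x) + nm (\<lambda>x. f x - sh z (y m) x)"
      by (intro nm_triangle_diff H_diff f sh_H y(1))
    finally show ?thesis using C'p by (simp add: add.commute)
  qed
  have "\<exists>u\<in>H. (\<lambda>n. nm (\<lambda>x. y n x - u x)) \<longlonglongrightarrow> 0"
  proof (rule H_complete[OF D_H(1)[OF y(1)]])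
    fix e :: real assume "e > 0"
    then have "e / (2 * C') > 0" using C'p by simp
    from LIMSEQ_D[OF lim this] obtain N where N: "\<And>n. n \<ge> N \<Longrightarrow> nm (\<lambda>x. f x - sh z (y n) x) < e / (2 * C')" by auto
    have "nm (\<lambda>x. y m x - y n x) \<le> e" if "m \<ge> N" "n \<ge> N" for m n
    proof -
      have "nm (\<lambda>x. y m x - y n x) \<le> C' * (e / (2 * C') + e / (2 * C'))"
        by (rule order_trans[OF yd mult_left_mono]) (use N[OF that(1)] N[OF that(2)] C'p in auto)
      then show ?thesis using C'p by simp
    qed
    then show "\<exists>N. \<forall>m\<ge>N. \<forall>n\<ge>N. nm (\<lambda>x. y m x - y n x) \<le> e" by blast
  qed
  then obtain u where u: "u \<in> H" "(\<lambda>n. nm (\<lambda>x. y n x - u x)) \<longlonglongrightarrow> 0" by blast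
  have fzu: "(\<lambda>x. 1 * f x + z * u x) \<in> H" by (rule H_combine[OF f u(1)])
  have ip_lim: "(\<lambda>n. ip x (g n)) \<longlonglongrightarrow> ip x g'" if x: "x \<in> H" and g: "\<And>n. g n \<in> H" "g' \<in> H" and t: "(\<lambda>n. nm (\<lambda>t. g n t - g' t)) \<longlonglongrightarrow> 0" for x g g'
  proof (rule LIM_zero_cancel, rule Lim_null_comparison)
    show "(\<lambda>n. nm x * nm (\<lambda>t. g n t - g' t)) \<longlonglongrightarrow> 0" using tendsto_mult_left[OF t, of "nm x"] by simp
    show "\<forall>\<^sub>F n in sequentially. norm (ip x (g n) - ip x g') \<le> nm x * nm (\<lambda>t. g n t - g' t)"
    proof (rule always_eventually, rule allI)
      fix n
      have "ip x (g n) - ip x g' = ip x (\<lambda>t. g n t - g' t)"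
        using ip_combine_right[OF g(1)[of n] g(2) x, of 1 "-1"] by simp
      then show "norm (ip x (g n) - ip x g') \<le> nm x * nm (\<lambda>t. g n t - g' t)"
        using cauchy_schwarz[OF x H_diff[OF g(1)[of n] g(2)]] by simp
    qed
  qed
  \<comment> \<open>Closedness of L via the adjoint: the pair formed by \<open>u\<close> and
    \<open>f + z u\<close> satisfies the symmetry relation with every \<open>x\<close> of the
    domain, so self-adjointness puts \<open>u\<close> into it.\<close>
  have "ip (L x) u = ip x (\<lambda>t. 1 * f t + z * u t)" if x: "x \<in> D" for x
  proof -
    have "(\<lambda>n. ip x (\<lambda>t. 1 * sh z (y n) t + z * y n t)) \<longlonglongrightarrow> ip x (\<lambda>t. 1 * f t + z * u t)"
    proof (rule ip_lim[OF D_H(1)[OF x] H_combine[OF sh_H[OF y(1)] D_H(1)[OF y(1)]] fzu])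
      have b: "nm (\<lambda>t. (1 * sh z (y n) t + z * y n t) - (1 * f t + z * u t)) \<le> nm (\<lambda>t. f t - sh z (y n) t) + cmod z * nm (\<lambda>t. y n t - u t)" for n
      proof -
        have "(\<lambda>t. (1 * sh z (y n) t + z * y n t) - (1 * f t + z * u t)) = (\<lambda>t. (-1) * (f t - sh z (y n) t) + z * (y n t - u t))"
          by (auto simp: algebra_simps)
        then show ?thesis
          using nm_triangle[OF H_diff[OF f sh_H[OF y(1)]] H_diff[OF D_H(1)[OF y(1)] u(1)], where \<alpha> = "-1" and \<beta> = z] by simp
      qed
      have "(\<lambda>n. nm (\<lambda>t. f t - sh z (y n) t) + cmod z * nm (\<lambda>t. y n t - u t)) \<longlonglongrightarrow> 0 + cmod z * 0"
        by (intro tendsto_intros lim u(2))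
      then have lim0: "(\<lambda>n. nm (\<lambda>t. f t - sh z (y n) t) + cmod z * nm (\<lambda>t. y n t - u t)) \<longlonglongrightarrow> 0" by simp
      show "(\<lambda>n. nm (\<lambda>t. (1 * sh z (y n) t + z * y n t) - (1 * f t + z * u t))) \<longlonglongrightarrow> 0"
        by (rule tendsto_sandwich[OF _ _ tendsto_const lim0]) (use b in auto)
    qed
    moreover have "ip x (\<lambda>t. 1 * sh z (y n) t + z * y n t) = ip (L x) (y n)" for n
      using sym[OF x y(1)] by (simp add: sh_def)
    moreover have "(\<lambda>n. ip (L x) (y n)) \<longlonglongrightarrow> ip (L x) u"
      by (rule ip_lim[OF D_H(2)[OF x] D_H(1)[OF y(1)] u])
    ultimately show ?thesis using LIMSEQ_unique by fastforce
  qed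
  from self_adjoint_adjointD[OF sa u(1) fzu this]
  obtain v where v: "v \<in> D" "ae_eq a b v u" "ae_eq a b (L v) (\<lambda>t. 1 * f t + z * u t)" by blast
  have "ae_eq a b (sh z v) f"
    using v(2,3) unfolding ae_eq_def sh_def by eventually_elim auto
  with v(1) show ?thesis by blast
qed

text \<open>A lower bound would already put \<open>z\<close> in the resolvent set by surjectivity,
  so at a spectral point every lower bound fails. For nonreal \<open>z\<close> the imaginary part
  would supply one.\<close>

lemma self_adjoint_spectrum:
  assumes sa: "self_adjoint K a b D" and z: "z \<in> Sp K a b D"
  shows "Im z = 0" and "\<epsilon> > 0 \<Longrightarrow> \<exists>y\<in>D. nm y > 0 \<and> nm (sh z y) < \<epsilon> * nm y"
proof -
  interpret symmetric_operator K a b D by (rule self_adjoint_symmetric[OF sa])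
  have nb: "\<exists>y\<in>D. nm y > C * nm (sh z y)" for C
  proof (rule ccontr)
    assume "\<not> (\<exists>y\<in>D. nm y > C * nm (sh z y))"
    then have C: "\<And>y. y \<in> D \<Longrightarrow> nm y \<le> C * nm (sh z y)" by (simp add: not_less)
    then have "z \<in> resolvent_set K a b D"
      unfolding resolvent_iff using self_adjoint_onto[OF sa C] by blast
    with z show False by (simp add: Sp_def)
  qed
  show "Im z = 0"
  proof (rule ccontr)
    assume im: "Im z \<noteq> 0"
    obtain y where y: "y \<in> D" "nm y > 1 / \<bar>Im z\<bar> * nm (sh z y)" using nb by blast
    have "(\<bar>Im z\<bar> * nm y)\<^sup>2 \<le> (nm (sh z y))\<^sup>2" using sh_norm_sq[OF y(1), of z] by (simp add: power_mult_distrib)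
    then have "\<bar>Im z\<bar> * nm y \<le> nm (sh z y)" by (rule power2_le_imp_le) simp
    with y(2) im show False by (simp add: field_simps)
  qed
  assume \<epsilon>: "\<epsilon> > 0"
  obtain y where y: "y \<in> D" "nm y > 1 / \<epsilon> * nm (sh z y)" using nb by blast
  have "0 \<le> 1 / \<epsilon> * nm (sh z y)" using \<epsilon> by simp
  with y(2) have "nm y > 0" by linarith
  moreover have "nm (sh z y) < \<epsilon> * nm y" using y(2) \<epsilon> by (simp add: field_simps)
  ultimately show "\<exists>y\<in>D. nm y > 0 \<and> nm (sh z y) < \<epsilon> * nm y" using y(1) by blast
qed

end

section \<open>Endpoints and Green's formula\<close>

lemma eventually_lower_end:
  assumes "a < \<infinity>"
  shows "eventually P (lower_end a) \<longleftrightarrow> (\<exists>c. a < ereal c \<and> (\<forall>x. a < ereal x \<longrightarrow> x < c \<longrightarrow> P x))"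
  unfolding lower_end_def eventually_filtercomap
proof
  assume "\<exists>Q. eventually Q (at_right a) \<and> (\<forall>x. Q (ereal x) \<longrightarrow> P x)"
  then obtain Q where Q: "eventually Q (at_right a)" "\<And>x. Q (ereal x) \<Longrightarrow> P x" by blast
  then obtain e where e: "e > a" "\<And>y. a < y \<Longrightarrow> y < e \<Longrightarrow> Q y"
    using eventually_at_right[OF assms] by blast
  obtain c where c: "a < ereal c" "ereal c < e" using ereal_dense2[OF e(1)] by blast
  show "\<exists>c. a < ereal c \<and> (\<forall>x. a < ereal x \<longrightarrow> x < c \<longrightarrow> P x)"
    using c e(2) Q(2) by (meson ereal_less(3) less_ereal.simps(1) less_trans)
next
  assume "\<exists>c. a < ereal c \<and> (\<forall>x. a < ereal x \<longrightarrow> x < c \<longrightarrow> P x)"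
  then obtain c where c: "a < ereal c" "\<And>x. a < ereal x \<Longrightarrow> x < c \<Longrightarrow> P x" by blast
  have "eventually (\<lambda>y. a < y \<and> y < ereal c) (at_right a)"
    unfolding eventually_at_right[OF assms] using c(1) by blast
  then show "\<exists>Q. eventually Q (at_right a) \<and> (\<forall>x. Q (ereal x) \<longrightarrow> P x)"
    using c(2) by auto
qed

lemma eventually_upper_end:
  assumes "-\<infinity> < b"
  shows "eventually P (upper_end b) \<longleftrightarrow> (\<exists>c. ereal c < b \<and> (\<forall>x. ereal x < b \<longrightarrow> c < x \<longrightarrow> P x))"
  unfolding upper_end_def eventually_filtercomap
proof
  assume "\<exists>Q. eventually Q (at_left b) \<and> (\<forall>x. Q (ereal x) \<longrightarrow> P x)"
  then obtain Q where Q: "eventually Q (at_left b)" "\<And>x. Q (ereal x) \<Longrightarrow> P x" by blast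
  then obtain e where e: "e < b" "\<And>y. e < y \<Longrightarrow> y < b \<Longrightarrow> Q y"
    using eventually_at_left[OF assms] by blast
  obtain c where c: "e < ereal c" "ereal c < b" using ereal_dense2[OF e(1)] by blast
  show "\<exists>c. ereal c < b \<and> (\<forall>x. ereal x < b \<longrightarrow> c < x \<longrightarrow> P x)"
    using c e(2) Q(2) by (meson less_ereal.simps(1) less_trans)
next
  assume "\<exists>c. ereal c < b \<and> (\<forall>x. ereal x < b \<longrightarrow> c < x \<longrightarrow> P x)"
  then obtain c where c: "ereal c < b" "\<And>x. ereal x < b \<Longrightarrow> c < x \<Longrightarrow> P x" by blast
  have "eventually (\<lambda>y. ereal c < y \<and> y < b) (at_left b)"
    unfolding eventually_at_left[OF assms] using c(1) by blast
  then show "\<exists>Q. eventually Q (at_left b) \<and> (\<forall>x. Q (ereal x) \<longrightarrow> P x)"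
    using c(2) by auto
qed

lemma lower_end_ereal: "lower_end (ereal t) = at_right t"
proof (rule filter_eqI)
  fix P
  have "eventually P (at_right t) \<longleftrightarrow> (\<exists>b>t. \<forall>y>t. y < b \<longrightarrow> P y)"
    by (rule eventually_at_right[of t "t + 1"]) simp
  then show "eventually P (lower_end (ereal t)) \<longleftrightarrow> eventually P (at_right t)"
    by (subst eventually_lower_end) auto
qed

lemma upper_end_ereal: "upper_end (ereal t) = at_left t"
proof (rule filter_eqI)
  fix P
  have "eventually P (at_left t) \<longleftrightarrow> (\<exists>b<t. \<forall>y>b. y < t \<longrightarrow> P y)"
    by (rule eventually_at_left[of "t - 1"]) simp
  then show "eventually P (upper_end (ereal t)) \<longleftrightarrow> eventually P (at_left t)"
    by (subst eventually_upper_end) auto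
qed

lemma lower_end_not_bot: "a < b \<Longrightarrow> lower_end a \<noteq> bot"
proof
  assume ab: "a < b" and "lower_end a = bot"
  then have "eventually (\<lambda>x. False) (lower_end a)" by simp
  moreover have "a < \<infinity>" using ab by (cases a) auto
  ultimately obtain c where c: "a < ereal c" "\<And>x. a < ereal x \<Longrightarrow> x < c \<Longrightarrow> False"
    by (subst (asm) eventually_lower_end) auto
  obtain x where "a < ereal x" "ereal x < ereal c" using ereal_dense2[OF c(1)] by blast
  with c(2) show False by simp
qed

lemma upper_end_not_bot: "a < b \<Longrightarrow> upper_end b \<noteq> bot"
proof
  assume ab: "a < b" and "upper_end b = bot"
  then have "eventually (\<lambda>x. False) (upper_end b)" by simp
  moreover have "-\<infinity> < b" using ab by (cases b) auto
  ultimately obtain c where c: "ereal c < b" "\<And>x. ereal x < b \<Longrightarrow> c < x \<Longrightarrow> False"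
    by (subst (asm) eventually_upper_end) auto
  obtain x where "ereal c < ereal x" "ereal x < b" using ereal_dense2[OF c(1)] by blast
  with c(2) show False by simp
qed

lemma eventually_in_einterval:
  assumes "a < b"
  shows "eventually (\<lambda>x. x \<in> einterval a b) (lower_end a)" "eventually (\<lambda>x. x \<in> einterval a b) (upper_end b)"
proof -
  obtain c where c: "a < ereal c" "ereal c < b" using ereal_dense2[OF assms] by blast
  have "a < \<infinity>" "-\<infinity> < b" using assms by (cases a; cases b; auto)+
  then show "eventually (\<lambda>x. x \<in> einterval a b) (lower_end a)" "eventually (\<lambda>x. x \<in> einterval a b) (upper_end b)"
    using c by (auto simp: eventually_lower_end eventually_upper_end einterval_def intro!: exI[of _ c]
        intro: less_trans[of _ "ereal c"] dest: less_trans[of "ereal c" "ereal _"])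
qed

section \<open>Boundary values at regular points and tails of integrals\<close>

lemma L2w_subset:
  assumes sub: "einterval a' b' \<subseteq> einterval a b" and f: "f \<in> L2w K a b"
  shows "f \<in> L2w K a' b'"
proof -
  have m: "einterval a' b' \<in> sets lebesgue" by (simp add: borel_einterval)
  have "set_borel_measurable lebesgue (einterval a' b') f"
    using f m sub by (auto simp: L2w_def intro: set_borel_measurable_subset)
  moreover have "set_integrable lebesgue (einterval a' b') (\<lambda>x. (cmod (f x))\<^sup>2 * coef_w K x)"
    using f m sub by (auto simp: L2w_def intro: set_integrable_subset)
  ultimately show ?thesis by (simp add: L2w_def)
qed

lemma D_max_subset:
  assumes K: "admissible K a b" and ab: "a' < b'" and sub: "einterval a' b' \<subseteq> einterval a b" and y: "y \<in> D_max K a b"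
  shows "y \<in> D_max K a' b'"
proof -
  interpret weighted_l2 K a' b' by unfold_locales (rule admissible_subset[OF K ab sub])
  have h: "has_quasi_derivs K a b y" using y by (simp add: D_max_def)
  note r = qd_restrict[OF K ab sub h]
  have "ell K a b y \<in> L2w K a' b'" using y by (intro L2w_subset[OF sub]) (simp add: D_max_def)
  then have "ell K a' b' y \<in> L2w K a' b'" by (rule H_cong[OF _ ae_eq_sym[OF r(3)]])
  then show ?thesis using r(1) L2w_subset[OF sub, of y] y by (simp add: D_max_def)
qed

text \<open>The constant 1 has finite weighted norm since \<open>w\<close> is integrable up to both
  ends; pairing with it turns square integrable forcing into the integrable forcing that the initial
  value problem requires.\<close>

lemma weighted_absolutely_integrable:
  assumes K: "regular_on K c d" and adm: "admissible K (ereal c) (ereal d)" and f: "f \<in> L2w K (ereal c) (ereal d)"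
  shows "(\<lambda>t. coef_w K t *\<^sub>R f t) absolutely_integrable_on {c..d}"
proof -
  interpret weighted_l2 K "ereal c" "ereal d" by unfold_locales (rule adm)
  have E: "einterval (ereal c) (ereal d) = {c<..<d}" by (rule einterval_eq)
  have "coef_w K absolutely_integrable_on {c<..<d}"
    by (rule set_integrable_subset[of _ "{c..d}"]) (use K in \<open>auto simp: regular_on_def\<close>)
  then have "(\<lambda>x. 1) \<in> L2w K (ereal c) (ereal d)"
    by (simp add: L2w_def E set_borel_measurable_def borel_measurable_scaleR borel_measurable_indicator)
  from ip_integrable(1)[OF f this] have "(\<lambda>t. coef_w K t *\<^sub>R f t) absolutely_integrable_on {c<..<d}"
    by (simp add: E)
  then show ?thesis using absolutely_integrable_on_open_interval[of c d "\<lambda>t. coef_w K t *\<^sub>R f t"] by (simp add: box_real)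
qed

lemma regular_on_subinterval:
  assumes K: "regular_on K c d" and "c \<le> c'" "c' < d'" "d' \<le> d"
  shows "regular_on K c' d'"
proof -
  have sub: "{c'..d'} \<subseteq> {c..d}" using assms by auto
  have "AE x in lebesgue. x \<in> {c<..<d} \<longrightarrow> coef_p K x > 0 \<and> coef_w K x > 0"
    using K by (simp add: regular_on_def)
  then have "AE x in lebesgue. x \<in> {c'<..<d'} \<longrightarrow> coef_p K x > 0 \<and> coef_w K x > 0"
    by eventually_elim (use assms in auto)
  then show ?thesis
    using K \<open>c' < d'\<close> unfolding regular_on_def
    by (auto intro: absolutely_integrable_subinterval(1)[OF _ sub])
qed

text \<open>Solve the initial value problem on the closed interval with the data of \<open>Y\<close>
  at an interior point; uniqueness on compact subintervals identifies the solution with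
  \<open>Y\<close> inside.\<close>

lemma regular_extension:
  assumes K: "regular_on K c d" and w: "(\<lambda>t. coef_w K t *\<^sub>R f t) absolutely_integrable_on {c..d}"
    and Y: "qsys_on K (ereal c) (ereal d) f Y"
  shows "\<exists>W. qsys K c d f W \<and> (\<forall>x\<in>{c<..<d}. quad W x = quad Y x)"
proof -
  have cd: "c < d" using K by (simp add: regular_on_def)
  define m where "m = (c + d) / 2"
  have m: "c < m" "m < d" using cd by (auto simp: m_def)
  obtain W where W: "qsys K c d f W" "quad W m = quad Y m"
    using qsys_exists[OF K w, of m "quad Y m"] m by auto
  have "quad W x = quad Y x" if x: "x \<in> {c<..<d}" for x
  proof -
    define c' d' where "c' = min m x" and "d' = max m x"
    show ?thesis
    proof (cases "x = m")
      case False
      then have cd': "c' < d'" by (auto simp: c'_def d'_def)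
      have in': "c < c'" "d' < d" "m \<in> {c'..d'}" "x \<in> {c'..d'}" using m x by (auto simp: c'_def d'_def)
      have K': "regular_on K c' d'" by (rule regular_on_subinterval[OF K _ cd']) (use in' in auto)
      have w': "(\<lambda>t. coef_w K t *\<^sub>R f t) absolutely_integrable_on {c'..d'}"
        by (rule absolutely_integrable_subinterval(1)[OF w]) (use in' in auto)
      have Y': "qsys K c' d' f Y"
        by (rule qsys_onD[OF Y cd']) (use in' in \<open>auto simp: einterval_eq\<close>)
      have W': "qsys K c' d' f W" by (rule qsys_subinterval[OF W(1)]) (use in' in auto)
      have "quad W x = quad Y x"
        by (rule qsys_unique[OF K' w', of 0 W Y m x]) (use W' Y' in' W(2) in auto)
      then show ?thesis .
    qed (use W(2) in simp)
  qed
  with W(1) show ?thesis by blast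
qed

lemma qsys_continuous_quad: "qsys K c d f Y \<Longrightarrow> continuous_on {c..d} (quad Y)"
  unfolding quad_def[abs_def] by (intro continuous_on_Pair qsys_continuous_on)

lemma regular_limits:
  assumes K: "regular_on K c d" and w: "(\<lambda>t. coef_w K t *\<^sub>R f t) absolutely_integrable_on {c..d}"
    and Y: "qsys_on K (ereal c) (ereal d) f Y"
  shows "\<exists>u. (quad Y \<longlongrightarrow> u) (at_right c)" "\<exists>u. (quad Y \<longlongrightarrow> u) (at_left d)"
proof -
  obtain W where W: "qsys K c d f W" "\<And>x. x \<in> {c<..<d} \<Longrightarrow> quad W x = quad Y x"
    using regular_extension[OF assms] by blast
  have cd: "c < d" using K by (simp add: regular_on_def)
  note cont = qsys_continuous_quad[OF W(1)]
  have "(quad W \<longlongrightarrow> quad W c) (at_right c)"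
    using continuous_on_Icc_at_rightD[OF cont cd] .
  moreover have "eventually (\<lambda>x. quad W x = quad Y x) (at_right c)"
    using eventually_at_right[OF cd] W(2) cd by auto
  ultimately show "\<exists>u. (quad Y \<longlongrightarrow> u) (at_right c)" by (metis tendsto_cong)
  have "(quad W \<longlongrightarrow> quad W d) (at_left d)"
    using continuous_on_Icc_at_leftD[OF cont cd] .
  moreover have "eventually (\<lambda>x. quad W x = quad Y x) (at_left d)"
    using eventually_at_left[OF cd] W(2) cd by auto
  ultimately show "\<exists>u. (quad Y \<longlongrightarrow> u) (at_left d)" by (metis tendsto_cong)
qed

lemma set_integral_tail:
  fixes f :: "real \<Rightarrow> 'a::euclidean_space"
  assumes ab: "a < b" and f: "set_integrable lebesgue (einterval a b) f" and \<epsilon>: "\<epsilon> > 0"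
  shows "\<exists>c d. c < d \<and> {c..d} \<subseteq> einterval a b \<and> (\<forall>S\<in>sets lebesgue. {c..d} \<subseteq> S \<longrightarrow> S \<subseteq> einterval a b \<longrightarrow>
     norm (integral (einterval a b) f - integral S f) < \<epsilon>)"
proof -
  let ?E = "einterval a b"
  obtain l u :: "nat \<Rightarrow> real" where "?E = (\<Union>i. {l i..u i}) \<and> (\<forall>i. l i < u i) \<and> incseq u \<and> decseq l"
    using einterval_exhaustion[OF ab] by (elim exE)
  then have lu: "?E = (\<Union>i. {l i..u i})" "\<And>i. l i < u i" "incseq u" "decseq l" by simp_all
  have Es: "?E \<in> sets lebesgue" by (simp add: borel_einterval)
  have nf: "set_integrable lebesgue ?E (\<lambda>x. norm (f x))" by (rule set_integrable_norm[OF f])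
  have sub: "set_integrable lebesgue S (\<lambda>x. norm (f x))" if "S \<in> sets lebesgue" "S \<subseteq> ?E" for S
    by (rule set_integrable_subset[OF nf that])
  have "(\<lambda>i. \<integral>x. indicator (?E - {l i..u i}) x *\<^sub>R norm (f x) \<partial>lebesgue) \<longlonglongrightarrow> (\<integral>x. 0 \<partial>(lebesgue::real measure))"
  proof (rule integral_dominated_convergence[where w = "\<lambda>x. indicator ?E x *\<^sub>R norm (f x)"])
    show "integrable lebesgue (\<lambda>x. indicator ?E x *\<^sub>R norm (f x))" using nf by (simp add: set_integrable_def)
    show "(\<lambda>x. indicator (?E - {l i..u i}) x *\<^sub>R norm (f x)) \<in> borel_measurable lebesgue" for i
      using sub[of "?E - {l i..u i}"] Es by (auto simp: set_integrable_def)
    show "AE x in lebesgue. norm (indicator (?E - {l i..u i}) x *\<^sub>R norm (f x)) \<le> indicator ?E x *\<^sub>R norm (f x)" for i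
      by (auto simp: indicator_def)
    show "AE x in lebesgue. (\<lambda>i. indicator (?E - {l i..u i}) x *\<^sub>R norm (f x)) \<longlonglongrightarrow> 0"
    proof (rule AE_I2)
      fix x
      have "eventually (\<lambda>i. indicator (?E - {l i..u i}) x *\<^sub>R norm (f x) = 0) sequentially"
      proof (cases "x \<in> ?E")
        case True
        then obtain i where i: "x \<in> {l i..u i}" using lu(1) by blast
        have "x \<in> {l n..u n}" if "n \<ge> i" for n
          using i incseqD[OF lu(3) that] decseqD[OF lu(4) that] by auto
        then show ?thesis by (auto simp: eventually_sequentially indicator_def intro!: exI[of _ i])
      qed simp
      then show "(\<lambda>i. indicator (?E - {l i..u i}) x *\<^sub>R norm (f x)) \<longlonglongrightarrow> 0" by (rule tendsto_eventually)
    qed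
  qed simp
  then have "(\<lambda>i. set_lebesgue_integral lebesgue (?E - {l i..u i}) (\<lambda>x. norm (f x))) \<longlonglongrightarrow> 0"
    by (simp add: set_lebesgue_integral_def)
  from LIMSEQ_D[OF this \<epsilon>] obtain i where i: "norm (set_lebesgue_integral lebesgue (?E - {l i..u i}) (\<lambda>x. norm (f x)) - 0) < \<epsilon>" by blast
  have "norm (integral ?E f - integral S f) < \<epsilon>"
    if S: "S \<in> sets lebesgue" "{l i..u i} \<subseteq> S" "S \<subseteq> ?E" for S
  proof -
    have "set_lebesgue_integral lebesgue (S \<union> (?E - S)) f = set_lebesgue_integral lebesgue S f + set_lebesgue_integral lebesgue (?E - S) f"
      by (rule set_integral_Un) (use S Es in \<open>auto intro!: set_integrable_subset[OF f]\<close>)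
    moreover have "S \<union> (?E - S) = ?E" using S by blast
    ultimately have "norm (set_lebesgue_integral lebesgue ?E f - set_lebesgue_integral lebesgue S f) = norm (set_lebesgue_integral lebesgue (?E - S) f)"
      by simp
    also have "\<dots> \<le> set_lebesgue_integral lebesgue (?E - S) (\<lambda>x. norm (f x))"
      by (rule set_integral_norm_bound) (use S Es in \<open>auto intro!: set_integrable_subset[OF f]\<close>)
    also have "\<dots> \<le> set_lebesgue_integral lebesgue (?E - {l i..u i}) (\<lambda>x. norm (f x))"
      unfolding set_lebesgue_integral_def
    proof (rule integral_mono)
      show "integrable lebesgue (\<lambda>x. indicat_real (?E - S) x *\<^sub>R norm (f x))"
        using sub[of "?E - S"] S Es by (auto simp: set_integrable_def)
      show "integrable lebesgue (\<lambda>x. indicat_real (?E - {l i..u i}) x *\<^sub>R norm (f x))"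
        using sub[of "?E - {l i..u i}"] Es by (auto simp: set_integrable_def)
      fix x show "indicat_real (?E - S) x *\<^sub>R norm (f x) \<le> indicat_real (?E - {l i..u i}) x *\<^sub>R norm (f x)"
        using S(2) by (auto simp: indicator_def)
    qed
    finally show ?thesis
      using i set_lebesgue_integral_eq_integral(2)[OF f] set_lebesgue_integral_eq_integral(2)[OF set_integrable_subset[OF f S(1,3)]]
      by simp
  qed
  moreover have "{l i..u i} \<subseteq> ?E" using lu(1) by blast
  ultimately show ?thesis using lu(2)[of i] by blast
qed

section \<open>Green's formula\<close>

context weighted_l2
begin

lemma DmaxD: "y \<in> D_max K a b \<Longrightarrow> has_quasi_derivs K a b y" "y \<in> D_max K a b \<Longrightarrow> y \<in> H" "y \<in> D_max K a b \<Longrightarrow> L y \<in> H"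
  by (auto simp: D_max_def)

lemma ab: "a < b" by (rule admissible_less[OF adm])

text \<open>The integrand of the Lagrange identity is integrable on all of \<open>(a,b)\<close> by
  Cauchy-Schwarz. Starting from an interior point \<open>x0\<close>, the bracket at \<open>x\<close>
  differs from its value at \<open>x0\<close> by a partial integral, whose convergence gives each
  boundary limit.\<close>

lemma green:
  assumes y: "y \<in> D_max K a b" and z: "z \<in> D_max K a b"
  shows "\<exists>A B. (bracket (qd K a b y) (qd K a b z) \<longlongrightarrow> A) (lower_end a) \<and>
    (bracket (qd K a b y) (qd K a b z) \<longlongrightarrow> B) (upper_end b) \<and> ip (L y) z - ip y (L z) = B - A"
proof -
  define G where "G t = coef_w K t *\<^sub>R (L y t * cnj (z t)) - coef_w K t *\<^sub>R (y t * cnj (L z t))" for t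
  note iL = ip_integrable(1)[OF DmaxD(3)[OF y] DmaxD(2)[OF z]] and iR = ip_integrable(1)[OF DmaxD(2)[OF y] DmaxD(3)[OF z]]
  have Gi: "set_integrable lebesgue E G" unfolding G_def[abs_def] by (rule set_integral_diff(1)[OF iL iR])
  have "set_lebesgue_integral lebesgue E G = ip (L y) z - ip y (L z)"
    unfolding G_def[abs_def] inner_w_def by (rule set_integral_diff(2)[OF iL iR])
  then have GI: "integral E G = ip (L y) z - ip y (L z)"
    using set_lebesgue_integral_eq_integral(2)[OF Gi] by simp
  define Br where "Br = bracket (qd K a b y) (qd K a b z)"
  have BrG: "Br d - Br c = integral {c..d} G" if cd: "c \<le> d" "{c..d} \<subseteq> E" for c d
  proof (cases "c < d")
    case True
    note Y = qd_qsys_on[OF adm DmaxD(1)[OF y]] and Z = qd_qsys_on[OF adm DmaxD(1)[OF z]]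
    have "prim c d Br (\<lambda>t. coef_w K t *\<^sub>R (L y t * cnj (z t) - y t * cnj (L z t)))"
      using green_prim[OF True qsys_onD[OF Y(1) True cd(2)] qsys_onD[OF Z(1) True cd(2)]] by (simp add: Br_def Y(2) Z(2))
    then have "prim c d Br G" by (simp add: G_def[abs_def] scaleR_diff_right)
    from prim_diff_eq[OF this] show ?thesis using True by simp
  next
    case False
    then have "c = d" using cd by simp
    then show ?thesis by simp
  qed
  obtain x0 where x0: "a < ereal x0" "ereal x0 < b" using ereal_dense2[OF ab] by blast
  have fin: "a < \<infinity>" "-\<infinity> < b" using x0 by (cases a; cases b; auto)+
  define Eu where "Eu = einterval (ereal x0) b"
  define El where "El = einterval a (ereal x0)"
  have subs: "Eu \<subseteq> E" "El \<subseteq> E"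
    using x0 less_trans[of a "ereal x0" "ereal _"] less_trans[of "ereal _" "ereal x0" b]
    by (auto simp: Eu_def El_def einterval_def)
  have Gu: "set_integrable lebesgue Eu G" "set_integrable lebesgue El G"
    by (rule set_integrable_subset[OF Gi _ subs(1)], simp add: Eu_def borel_einterval)
       (rule set_integrable_subset[OF Gi _ subs(2)], simp add: El_def borel_einterval)
  note Gu' = Gu[THEN set_lebesgue_integral_eq_integral(1)]
  have "El \<inter> Eu = {}" by (auto simp: El_def Eu_def einterval_def)
  then have "integral (El \<union> Eu) G = integral El G + integral Eu G"
    by (intro Henstock_Kurzweil_Integration.integral_Un[OF Gu'(2,1)]) simp
  moreover have "integral (El \<union> Eu) G = integral E G"
  proof (rule integral_spike_set)
    show "negligible {x \<in> (El \<union> Eu) - E. G x \<noteq> 0}"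
      using subs by (intro negligible_subset[OF negligible_empty]) auto
    show "negligible {x \<in> E - (El \<union> Eu). G x \<noteq> 0}"
      by (rule negligible_subset[of "{x0}"]) (auto simp: El_def Eu_def einterval_def)
  qed
  ultimately have split: "integral E G = integral El G + integral Eu G" by simp
  have up: "(Br \<longlongrightarrow> Br x0 + integral Eu G) (upper_end b)"
  proof (rule tendstoI)
    fix \<epsilon> :: real assume "\<epsilon> > 0"
    from set_integral_tail[OF x0(2) Gu(1)[unfolded Eu_def] this]
    obtain c d where cd0: "c < d \<and> {c..d} \<subseteq> Eu \<and> (\<forall>S\<in>sets lebesgue. {c..d} \<subseteq> S \<longrightarrow> S \<subseteq> Eu \<longrightarrow>
        norm (integral Eu G - integral S G) < \<epsilon>)"
      unfolding Eu_def[symmetric] by (elim exE)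
    then have cd: "c < d" "{c..d} \<subseteq> Eu" by simp_all
    have cd3: "norm (integral Eu G - integral S G) < \<epsilon>" if "S \<in> sets lebesgue" "{c..d} \<subseteq> S" "S \<subseteq> Eu" for S
      using cd0 that by simp
    have cd': "x0 < c" "ereal d < b"
    proof -
      have "c \<in> Eu" "d \<in> Eu" using cd(1,2) by auto
      then show "x0 < c" "ereal d < b" by (auto simp: Eu_def einterval_def)
    qed
    have "dist (Br x) (Br x0 + integral Eu G) < \<epsilon>" if x: "ereal x < b" "d < x" for x
    proof -
      have "{x0..x} \<subseteq> E" using x0(1) x(1)
        by (auto simp: einterval_def intro: less_le_trans[of a "ereal x0"] le_less_trans[of _ "ereal x" b])
      moreover have "x0 \<le> x" using cd' cd(1) x(2) by simp
      ultimately have inc: "Br x - Br x0 = integral {x0..x} G" using BrG by blast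
      have "Br x = Br x0 + (Br x - Br x0)" by simp
      then have "Br x = Br x0 + integral {x0..x} G" unfolding inc .
      \<comment> \<open>\<open>Eu\<close> is an open interval without \<open>x0\<close>, so the
        point is removed before the tail estimate is applied.\<close>
      moreover have "integral {x0..x} G = integral {x0<..x} G"
        by (rule integral_spike_set) (rule negligible_subset[of "{x0}"], simp, force)+
      moreover have "norm (integral Eu G - integral {x0<..x} G) < \<epsilon>"
      proof (rule cd3[rotated])
        show "{c..d} \<subseteq> {x0<..x}" using cd' x by auto
        show "{x0<..x} \<subseteq> Eu" using x(1) by (auto simp: Eu_def einterval_def intro: le_less_trans[of _ "ereal x" b])
      qed simp
      ultimately show ?thesis by (simp add: dist_norm norm_minus_commute)
    qed
    then show "eventually (\<lambda>x. dist (Br x) (Br x0 + integral Eu G) < \<epsilon>) (upper_end b)"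
      unfolding eventually_upper_end[OF fin(2)] using cd' by blast
  qed
  have low: "(Br \<longlongrightarrow> Br x0 - integral El G) (lower_end a)"
  proof (rule tendstoI)
    fix \<epsilon> :: real assume "\<epsilon> > 0"
    from set_integral_tail[OF x0(1) Gu(2)[unfolded El_def] this]
    obtain c d where cd0: "c < d \<and> {c..d} \<subseteq> El \<and> (\<forall>S\<in>sets lebesgue. {c..d} \<subseteq> S \<longrightarrow> S \<subseteq> El \<longrightarrow>
        norm (integral El G - integral S G) < \<epsilon>)"
      unfolding El_def[symmetric] by (elim exE)
    then have cd: "c < d" "{c..d} \<subseteq> El" by simp_all
    have cd3: "norm (integral El G - integral S G) < \<epsilon>" if "S \<in> sets lebesgue" "{c..d} \<subseteq> S" "S \<subseteq> El" for S
      using cd0 that by simp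
    have cd': "d < x0" "a < ereal c"
    proof -
      have "c \<in> El" "d \<in> El" using cd(1,2) by auto
      then show "d < x0" "a < ereal c" by (auto simp: El_def einterval_def)
    qed
    have "dist (Br x) (Br x0 - integral El G) < \<epsilon>" if x: "a < ereal x" "x < c" for x
    proof -
      have "{x..x0} \<subseteq> E" using x0(2) x(1)
        by (auto simp: einterval_def intro: less_le_trans[of a "ereal x"] le_less_trans[of _ "ereal x0" b])
      moreover have "x \<le> x0" using cd' cd(1) x(2) by simp
      ultimately have inc: "Br x0 - Br x = integral {x..x0} G" using BrG by blast
      have "Br x = Br x0 - (Br x0 - Br x)" by simp
      then have "Br x = Br x0 - integral {x..x0} G" unfolding inc .
      moreover have "integral {x..x0} G = integral {x..<x0} G"
        by (rule integral_spike_set) (rule negligible_subset[of "{x0}"], simp, force)+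
      moreover have "norm (integral El G - integral {x..<x0} G) < \<epsilon>"
      proof (rule cd3[rotated])
        show "{c..d} \<subseteq> {x..<x0}" using cd' x by auto
        show "{x..<x0} \<subseteq> El" using x(1) by (auto simp: El_def einterval_def intro: less_le_trans[of a "ereal x"])
      qed simp
      ultimately show ?thesis by (simp add: dist_norm norm_minus_commute)
    qed
    then show "eventually (\<lambda>x. dist (Br x) (Br x0 - integral El G) < \<epsilon>) (lower_end a)"
      unfolding eventually_lower_end[OF fin(1)] using cd' by blast
  qed
  have "ip (L y) z - ip y (L z) = (Br x0 + integral Eu G) - (Br x0 - integral El G)"
    unfolding GI[symmetric] split by simp
  with up low show ?thesis unfolding Br_def by blast
qed

end

section \<open>Weak solutions\<close>

lemma weighted_square_zero:
  assumes K: "regular_on K c d" and i: "(\<lambda>t. coef_w K t *\<^sub>R (f t * cnj (f t))) absolutely_integrable_on {c..d}"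
    and z: "integral {c..d} (\<lambda>t. coef_w K t *\<^sub>R (f t * cnj (f t))) = 0"
  shows "AE t in lebesgue. t \<in> {c<..<d} \<longrightarrow> f t = 0"
proof -
  let ?g = "\<lambda>t. indicator {c..d} t * (coef_w K t * (cmod (f t))\<^sup>2)"
  have eq: "indicator {c..d} t *\<^sub>R (coef_w K t *\<^sub>R (f t * cnj (f t))) = complex_of_real (?g t)" for t
    by (simp only: complex_norm_square[symmetric] scaleR_conv_of_real of_real_mult)
  have gi: "integrable lebesgue (\<lambda>t. complex_of_real (?g t))" using i unfolding set_integrable_def eq .
  then have gi': "integrable lebesgue ?g" using integrable_Re[OF gi] by simp
  have "(\<integral>t. complex_of_real (?g t) \<partial>lebesgue) = 0"
    using z set_lebesgue_integral_eq_integral(2)[OF i] unfolding set_lebesgue_integral_def eq by simp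
  then have "(\<integral>t. ?g t \<partial>lebesgue) = 0" unfolding integral_complex_of_real by simp
  have w: "AE t in lebesgue. t \<in> {c<..<d} \<longrightarrow> coef_p K t > 0 \<and> coef_w K t > 0" using K by (simp add: regular_on_def)
  have ends: "AE t in lebesgue. t \<noteq> c \<and> t \<noteq> d"
    using AE_completion[OF AE_lborel_singleton[of c]] AE_completion[OF AE_lborel_singleton[of d]]
    by eventually_elim auto
  have "AE t in lebesgue. 0 \<le> ?g t" using w ends by eventually_elim (auto simp: indicator_def le_less)
  with \<open>(\<integral>t. ?g t \<partial>lebesgue) = 0\<close> have "AE t in lebesgue. ?g t = 0"
    using integral_nonneg_eq_0_iff_AE[OF gi'] by blast
  with w show ?thesis by eventually_elim (auto simp: indicator_def)
qed

section \<open>Steering between boundary data\<close>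

lemma qsys_weight_integrable:
  fixes f :: "real \<Rightarrow> complex"
  assumes K: "regular_on K c d" and Y: "continuous_on {c..d} f"
  shows "(\<lambda>t. coef_w K t *\<^sub>R f t) absolutely_integrable_on {c..d}"
  by (rule absolutely_integrable_scaleR_continuous[OF _ Y]) (use K in \<open>simp add: regular_on_def\<close>)

lemma quad_zero: "quad (\<lambda>k x. 0) x = 0"
  by (simp add: quad_def zero_prod_def)

lemma bracket_zero: "quad Y x = 0 \<Longrightarrow> bracket Y Z x = 0" "quad Z x = 0 \<Longrightarrow> bracket Y Z x = 0"
  by (auto simp: quad_def zero_prod_def bracket_eq)

text \<open>
  \<open>steers K c d \<gamma> \<eta>\<close>: the forcing by the solution \<open>u\<close> of \<open>\<ell> u = 0\<close> with data \<open>\<gamma>\<close> at \<open>d\<close>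
  steers the system from rest at \<open>c\<close> to \<open>\<eta>\<close> at \<open>d\<close>.
\<close>

definition steers :: "coeffs \<Rightarrow> real \<Rightarrow> real \<Rightarrow> quad \<Rightarrow> quad \<Rightarrow> bool" where
  "steers K c d \<gamma> \<eta> \<longleftrightarrow> (\<exists>U \<Psi>. qsys K c d (\<lambda>_. 0) U \<and> quad U d = \<gamma> \<and> qsys K c d (U 0) \<Psi> \<and> quad \<Psi> c = 0 \<and> quad \<Psi> d = \<eta>)"

lemma qsys_green_integral:
  assumes cd: "c < d" and Y: "qsys K c d f Y" and Z: "qsys K c d g Z"
  shows "(\<lambda>t. coef_w K t *\<^sub>R (f t * cnj (Z 0 t) - Y 0 t * cnj (g t))) absolutely_integrable_on {c..d}"
    and "integral {c..d} (\<lambda>t. coef_w K t *\<^sub>R (f t * cnj (Z 0 t) - Y 0 t * cnj (g t))) = bracket Y Z d - bracket Y Z c"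
  using prim_absolutely_integrable[OF green_prim[OF assms]] prim_diff_eq[OF green_prim[OF assms], of c d] cd by auto

lemma steers_exists: 
  assumes K: "regular_on K c d"
  shows "\<exists>\<eta>. steers K c d \<gamma> \<eta>"
proof -
  have cd: "c < d" using K by (simp add: regular_on_def)
  obtain U where U: "qsys K c d (\<lambda>_. 0) U" "quad U d = \<gamma>"
    using qsys_exists[OF K, of "\<lambda>_. 0" d \<gamma>] cd by auto
  obtain \<Psi> where "qsys K c d (U 0) \<Psi>" "quad \<Psi> c = 0"
    using qsys_exists[OF K qsys_weight_integrable[OF K qsys_continuous_on(1)[OF U(1)]], of c 0] cd by auto
  with U show ?thesis unfolding steers_def by blast
qed

text \<open>Real scalars suffice, since the dimension argument treats \<open>quad\<close> as a real
  vector space.\<close>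

lemma steers_combine:
  assumes "steers K c d \<gamma> \<eta>" "steers K c d \<gamma>' \<eta>'"
  shows "steers K c d (of_real r *\<^sub>R \<gamma> + of_real s *\<^sub>R \<gamma>') (of_real r *\<^sub>R \<eta> + of_real s *\<^sub>R \<eta>')"
proof -
  obtain U \<Psi> where 1: "qsys K c d (\<lambda>_. 0) U" "quad U d = \<gamma>" "qsys K c d (U 0) \<Psi>" "quad \<Psi> c = 0" "quad \<Psi> d = \<eta>"
    using assms(1) unfolding steers_def by blast
  obtain U' \<Psi>' where 2: "qsys K c d (\<lambda>_. 0) U'" "quad U' d = \<gamma>'" "qsys K c d (U' 0) \<Psi>'" "quad \<Psi>' c = 0" "quad \<Psi>' d = \<eta>'"
    using assms(2) unfolding steers_def by blast
  let ?r = "complex_of_real r" and ?s = "complex_of_real s"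
  let ?U = "\<lambda>k x. ?r * U k x + ?s * U' k x" and ?P = "\<lambda>k x. ?r * \<Psi> k x + ?s * \<Psi>' k x"
  have q: "quad (\<lambda>k x. ?r * Y k x + ?s * Z k x) x = of_real r *\<^sub>R quad Y x + of_real s *\<^sub>R quad Z x" for Y Z x
    by (simp add: quad_def scaleR_conv_of_real)
  have "qsys K c d (\<lambda>_. 0) ?U" using qsys_combine[OF 1(1) 2(1), of ?r ?s] by simp
  moreover have "qsys K c d (?U 0) ?P" by (rule qsys_combine[OF 1(3) 2(3)])
  moreover have "quad ?U d = of_real r *\<^sub>R \<gamma> + of_real s *\<^sub>R \<gamma>'" "quad ?P c = 0" "quad ?P d = of_real r *\<^sub>R \<eta> + of_real s *\<^sub>R \<eta>'"
    unfolding q using 1 2 by simp_all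
  ultimately show ?thesis unfolding steers_def by blast
qed

text \<open>If the steered function has zero data at both ends, Green's formula with
  \<open>U\<close> makes the weighted integral of the squared modulus of \<open>U 0\<close>
  vanish.\<close>

lemma steers_zero_imp:
  assumes K: "regular_on K c d" and s: "steers K c d \<gamma> 0"
  shows "\<gamma> = 0"
proof -
  have cd: "c < d" using K by (simp add: regular_on_def)
  obtain U \<Psi> where U: "qsys K c d (\<lambda>_. 0) U" "quad U d = \<gamma>" "qsys K c d (U 0) \<Psi>" "quad \<Psi> c = 0" "quad \<Psi> d = 0"
    using s unfolding steers_def by blast
  have "AE t in lebesgue. t \<in> {c<..<d} \<longrightarrow> U 0 t = 0"
    by (rule weighted_square_zero[OF K])
       (use qsys_green_integral[OF cd U(3) U(1)] bracket_zero(1)[OF U(4)] bracket_zero(1)[OF U(5)] in auto)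
  then have z: "U 0 t = 0" if "t \<in> {c..d}" for t
    by (rule continuous_AE_eq[OF qsys_continuous_on(1)[OF U(1)] continuous_on_const cd _ that])
  have "quad U d = quad (\<lambda>k x. 0) d"
    by (rule qsys_determined(1)[OF K U(1) qsys_zero]) (use z cd in auto)
  with U(2) show ?thesis by (simp add: quad_zero)
qed

lemma steers_unique:
  assumes K: "regular_on K c d" and "steers K c d \<gamma> \<eta>" "steers K c d \<gamma> \<eta>'"
  shows "\<eta> = \<eta>'"
proof -
  have cd: "c < d" using K by (simp add: regular_on_def)
  have "steers K c d 0 (\<eta> - \<eta>')" using steers_combine[OF assms(2,3), of 1 "-1"] by simp
  then obtain U \<Psi> where U: "qsys K c d (\<lambda>_. 0) U" "quad U d = 0" "qsys K c d (U 0) \<Psi>" "quad \<Psi> c = 0" "quad \<Psi> d = \<eta> - \<eta>'"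
    unfolding steers_def by blast
  have "quad U t = quad (\<lambda>k x. 0) t" if t: "t \<in> {c..d}" for t
    using U(1,2) cd t qsys_unique[OF K, of "\<lambda>_. 0" 0 U "\<lambda>k x. 0" d t] by (simp add: quad_zero qsys_zero)
  then have "U 0 t = 0" if "t \<in> {c..d}" for t using that by (simp add: quad_eq_iff)
  then have "qsys K c d (\<lambda>_. 0) \<Psi>"
    by (intro qsys_cong[OF U(3), of \<Psi> "\<lambda>_. 0"] AE_I2) auto
  then have "quad \<Psi> d = quad (\<lambda>k x. 0) d"
    using U(4) cd qsys_unique[OF K, of "\<lambda>_. 0" 0 \<Psi> "\<lambda>k x. 0" c d] by (simp add: quad_zero qsys_zero)
  then show ?thesis using U(5) by (simp add: quad_zero)
qed

text \<open>The relation is a linear injective map of a finite-dimensional space into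
  itself.\<close>

lemma steers_surj:
  assumes K: "regular_on K c d"
  shows "\<exists>\<gamma>. steers K c d \<gamma> \<eta>"
proof -
  obtain T where T: "\<And>\<gamma>. steers K c d \<gamma> (T \<gamma>)" using steers_exists[OF K] by metis
  have Teq: "T \<gamma> = \<eta>" if "steers K c d \<gamma> \<eta>" for \<gamma> \<eta> by (rule steers_unique[OF K T that])
  have lin: "linear T"
  proof (rule linearI)
    fix x y :: quad and r :: real
    show "T (x + y) = T x + T y" by (rule Teq) (use steers_combine[OF T T, of 1 x 1 y] in simp)
    show "T (r *\<^sub>R x) = r *\<^sub>R T x" by (rule Teq) (use steers_combine[OF T T, of r x 0 x] in simp)
  qed
  have "inj T"
    unfolding linear_injective_0[OF lin] using T steers_zero_imp[OF K] by metis
  with lin have "surj T" by (intro linear_injective_imp_surjective) auto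
  then show ?thesis using T by (metis surj_def)
qed

text \<open>Naimark's patching lemma: solve the homogeneous equation from the left data, then
  correct the right data by steering. Continuity of the forcing keeps the result in the weighted
  space.\<close>

lemma qsys_interpolation:
  assumes K: "regular_on K c d"
  shows "\<exists>f \<Phi>. qsys K c d f \<Phi> \<and> quad \<Phi> c = v0 \<and> quad \<Phi> d = v1 \<and> continuous_on {c..d} f"
proof -
  have cd: "c < d" using K by (simp add: regular_on_def)
  obtain Z where Z: "qsys K c d (\<lambda>_. 0) Z" "quad Z c = v0"
    using qsys_exists[OF K, of "\<lambda>_. 0" c v0] cd by auto
  obtain U \<Psi> where U: "qsys K c d (\<lambda>_. 0) U" "qsys K c d (U 0) \<Psi>" "quad \<Psi> c = 0" "quad \<Psi> d = v1 - quad Z d"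
    using steers_surj[OF K, of "v1 - quad Z d"] unfolding steers_def by blast
  have q: "quad (\<lambda>k x. 1 * Y k x + 1 * Z k x) x = quad Y x + quad Z x" for Y Z x by (simp add: quad_def)
  show ?thesis
  proof (intro exI conjI)
    show "qsys K c d (\<lambda>x. 1 * 0 + 1 * U 0 x) (\<lambda>k x. 1 * Z k x + 1 * \<Psi> k x)"
      by (rule qsys_combine[OF Z(1) U(2)])
    show "continuous_on {c..d} (\<lambda>x. 1 * 0 + 1 * U 0 x)" using qsys_continuous_on(1)[OF U(1)] by simp
    show "quad (\<lambda>k x. 1 * Z k x + 1 * \<Psi> k x) c = v0" "quad (\<lambda>k x. 1 * Z k x + 1 * \<Psi> k x) d = v1"
      unfolding q using Z U by simp_all
  qed
qed

text \<open>Solve from zero data at \<open>c\<close> and steer the error at \<open>d\<close> away.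
  In operator terms, forcings reached by functions with zero boundary data, together with the null
  solutions, exhaust everything.\<close>

lemma qsys_decomposition:
  assumes K: "regular_on K c d" and g: "(\<lambda>t. coef_w K t *\<^sub>R g t) absolutely_integrable_on {c..d}"
  shows "\<exists>U \<Phi>. qsys K c d (\<lambda>_. 0) U \<and> qsys K c d (\<lambda>t. g t - U 0 t) \<Phi> \<and> quad \<Phi> c = 0 \<and> quad \<Phi> d = 0"
proof -
  have cd: "c < d" using K by (simp add: regular_on_def)
  obtain Z where Z: "qsys K c d g Z" "quad Z c = 0"
    using qsys_exists[OF K g, of c 0] cd by auto
  obtain U \<Psi> where U: "qsys K c d (\<lambda>_. 0) U" "qsys K c d (U 0) \<Psi>" "quad \<Psi> c = 0" "quad \<Psi> d = quad Z d"
    using steers_surj[OF K, of "quad Z d"] unfolding steers_def by blast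
  have q: "quad (\<lambda>k x. 1 * Y k x + (-1) * Z k x) x = quad Y x - quad Z x" for Y Z x by (simp add: quad_def)
  have "qsys K c d (\<lambda>t. g t - U 0 t) (\<lambda>k x. 1 * Z k x + (-1) * \<Psi> k x)"
    using qsys_combine[OF Z(1) U(2), of 1 "-1"] by simp
  moreover have "quad (\<lambda>k x. 1 * Z k x + (-1) * \<Psi> k x) c = 0" "quad (\<lambda>k x. 1 * Z k x + (-1) * \<Psi> k x) d = 0"
    unfolding q using Z U by simp_all
  ultimately show ?thesis using U(1) by blast
qed

section \<open>Patching, cutting off and weak solutions\<close>

lemma qsys_on_glue:
  assumes Y1: "qsys_on K a b f1 Y1" and Y2: "qsys_on K a b f2 Y2" and \<Phi>: "qsys K c d f \<Phi>"
    and cd: "c < d" "{c..d} \<subseteq> einterval a b" and q: "quad \<Phi> c = quad Y1 c" "quad \<Phi> d = quad Y2 d"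
  shows "qsys_on K a b (\<lambda>x. if x < c then f1 x else if x \<le> d then f x else f2 x)
     (\<lambda>k x. if x < c then Y1 k x else if x \<le> d then \<Phi> k x else Y2 k x)" (is "qsys_on K a b ?f ?Y")
  unfolding qsys_on_def
proof (intro allI impI)
  fix c' d' assume cd': "c' < d'" "{c'..d'} \<subseteq> einterval a b"
  have in1: "a < ereal c" "ereal d < b" "a < ereal c'" "ereal d' < b"
    using cd cd' by (auto simp: Icc_subset_einterval)
  obtain c1 where c1: "a < ereal c1" "ereal c1 < ereal c" using ereal_dense2[OF in1(1)] by blast
  obtain d1 where d1: "ereal d < ereal d1" "ereal d1 < b" using ereal_dense2[OF in1(2)] by blast
  \<comment> \<open>The prescribed subinterval may miss some of the three pieces. It is enlarged
    until it meets all of them, glued there, and restricted again.\<close>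
  define c2 d2 where "c2 = min c' c1" and "d2 = max d' d1"
  have c2: "c2 < c" "c2 \<le> c'" "a < ereal c2" using c1 in1 by (auto simp: c2_def min_def)
  have d2: "d < d2" "d' \<le> d2" "ereal d2 < b" using d1 in1 by (auto simp: d2_def max_def)
  have "ereal c < b" "a < ereal d"
    using in1 cd(1) by (metis ereal_less_eq(3) le_less_trans less_imp_le) (metis in1(1) cd(1) ereal_less_eq(3) less_le_trans less_imp_le)
  then have subs: "{c2..c} \<subseteq> einterval a b" "{d..d2} \<subseteq> einterval a b"
    using c2 d2 by (auto simp: Icc_subset_einterval)
  have l: "qsys K c2 c ?f ?Y"
    by (rule qsys_cong[OF qsys_onD[OF Y1 c2(1) subs(1)]])
       (use q(1) cd(1) in \<open>auto simp: quad_def intro!: AE_I2\<close>)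
  have m: "qsys K c d ?f ?Y"
    by (rule qsys_cong[OF \<Phi>]) (auto simp: quad_def intro!: AE_I2)
  have r: "qsys K d d2 ?f ?Y"
    by (rule qsys_cong[OF qsys_onD[OF Y2 d2(1) subs(2)]])
       (use q(2) cd(1) in \<open>auto simp: quad_def intro!: AE_I2\<close>)
  have "qsys K c2 d2 ?f ?Y"
    by (rule qsys_join[OF qsys_join[OF l m] r]) (use c2 d2 cd in auto)
  then show "qsys K c' d' ?f ?Y" by (rule qsys_subinterval) (use c2 d2 in auto)
qed

context weighted_l2
begin

lemma H_indicator:
  assumes f: "f \<in> H" and S: "S \<in> sets lebesgue"
  shows "(\<lambda>x. indicator S x * f x) \<in> H"
proof -
  have m: "(\<lambda>x. indicator E x *\<^sub>R f x) \<in> borel_measurable lebesgue"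
    using H_set_measurable[OF f] by (simp add: set_borel_measurable_def)
  have Sm: "(\<lambda>x. indicator S x :: complex) \<in> borel_measurable lebesgue" using S by simp
  have eq: "indicator E x *\<^sub>R (indicator S x * f x) = indicator S x * (indicator E x *\<^sub>R f x)" for x
    by (simp add: indicator_def)
  have mm: "set_borel_measurable lebesgue E (\<lambda>x. indicator S x * f x)"
    unfolding set_borel_measurable_def eq by (rule borel_measurable_times[OF Sm m])
  have "integrable lebesgue (\<lambda>x. (cmod (phi (\<lambda>x. indicator S x * f x) x))\<^sup>2)"
  proof (rule Bochner_Integration.integrable_bound)
    show "integrable lebesgue (\<lambda>x. (cmod (phi f x))\<^sup>2)" using H_phi[OF f] by (simp add: sq_int_def)
    show "(\<lambda>x. (cmod (phi (\<lambda>x. indicator S x * f x) x))\<^sup>2) \<in> borel_measurable lebesgue"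
      using set_borel_measurable_phi[OF mm] by measurable
    show "AE x in lebesgue. norm ((cmod (phi (\<lambda>x. indicator S x * f x) x))\<^sup>2) \<le> norm ((cmod (phi f x))\<^sup>2)"
      by (rule AE_I2) (auto simp: phi_def indicator_def)
  qed
  then show ?thesis using mm set_borel_measurable_phi[OF mm] by (simp add: H_iff sq_int_def)
qed

lemma H_continuous:
  assumes f: "continuous_on {c..d} f" and cd: "{c..d} \<subseteq> E"
  shows "(\<lambda>x. indicator {c..d} x * f x) \<in> H"
proof -
  have "f \<in> borel_measurable (lebesgue_on {c..d})"
    by (rule continuous_imp_measurable_on_sets_lebesgue[OF f]) auto
  then have m: "(\<lambda>x. if x \<in> {c..d} then f x else 0) \<in> borel_measurable lebesgue"
    by (rule borel_measurable_if_I) auto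
  have eq: "indicator E x *\<^sub>R (indicator {c..d} x * f x) = (if x \<in> {c..d} then f x else 0)" for x
    using cd by (auto simp: indicator_def)
  have eq2: "indicator E x *\<^sub>R ((cmod (indicator {c..d} x * f x))\<^sup>2 * coef_w K x) = indicator {c..d} x *\<^sub>R ((cmod (f x))\<^sup>2 * coef_w K x)" for x
    using cd by (auto simp: indicator_def)
  have w: "coef_w K absolutely_integrable_on {c..d}"
    using adm cd unfolding admissible_def locally_integrable_def by blast
  have "continuous_on {c..d} (\<lambda>x. complex_of_real ((cmod (f x))\<^sup>2))" by (intro continuous_intros f)
  from absolutely_integrable_scaleR_continuous[OF w this]
  have "(\<lambda>x. Re (coef_w K x *\<^sub>R complex_of_real ((cmod (f x))\<^sup>2))) absolutely_integrable_on {c..d}"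
    by (rule absolutely_integrable_linear[OF _ bounded_linear_Re, unfolded o_def])
  then have "(\<lambda>x. (cmod (f x))\<^sup>2 * coef_w K x) absolutely_integrable_on {c..d}" by (simp add: mult.commute)
  then have "set_integrable lebesgue E (\<lambda>x. (cmod (indicator {c..d} x * f x))\<^sup>2 * coef_w K x)"
    unfolding set_integrable_def eq2 .
  moreover have "set_borel_measurable lebesgue E (\<lambda>x. indicator {c..d} x * f x)"
    using m unfolding set_borel_measurable_def eq .
  ultimately show ?thesis by (simp add: L2w_def)
qed

lemma H_piecewise:
  assumes f1: "f1 \<in> H" and f2: "f2 \<in> H" and f: "(\<lambda>x. indicator {c..d} x * f x) \<in> H" and cd: "c < d"
  shows "(\<lambda>x. if x < c then f1 x else if x \<le> d then f x else f2 x) \<in> H"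
proof -
  have "(\<lambda>x. (indicator {..<c} x * f1 x + indicator {c..d} x * f x) + indicator {d<..} x * f2 x) \<in> H"
    by (intro H_add H_indicator f1 f2 f) auto
  moreover have "(\<lambda>x. (indicator {..<c} x * f1 x + indicator {c..d} x * f x) + indicator {d<..} x * f2 x)
     = (\<lambda>x. if x < c then f1 x else if x \<le> d then f x else f2 x)"
    using cd by (auto simp: indicator_def fun_eq_iff)
  ultimately show ?thesis by simp
qed

lemma D_max_I:
  assumes Y: "qsys_on K a b f Y" and y: "Y 0 \<in> H" and f: "f \<in> H"
  shows "Y 0 \<in> D_max K a b" "ae_eq a b (L (Y 0)) f" "x \<in> E \<Longrightarrow> quad (qd K a b (Y 0)) x = quad Y x"
proof -
  note q = qd_eqI[OF adm Y, of "Y 0"]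
  show "ae_eq a b (L (Y 0)) f" by (rule q(3)) simp
  then have "L (Y 0) \<in> H" using H_cong[OF f] ae_eq_sym by blast
  then show "Y 0 \<in> D_max K a b" using q(1) y by (simp add: D_max_def)
  show "x \<in> E \<Longrightarrow> quad (qd K a b (Y 0)) x = quad Y x" by (rule q(2)) auto
qed

lemma D_max_combine:
  assumes "y \<in> D_max K a b" "z \<in> D_max K a b"
  shows "(\<lambda>x. \<alpha> * y x + \<beta> * z x) \<in> D_max K a b"
proof -
  note c = qd_combine[OF adm DmaxD(1)[OF assms(1)] DmaxD(1)[OF assms(2)], where \<alpha> = \<alpha> and \<beta> = \<beta>]
  have "(\<lambda>x. \<alpha> * L y x + \<beta> * L z x) \<in> H" by (rule H_combine[OF DmaxD(3)[OF assms(1)] DmaxD(3)[OF assms(2)]])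
  then have "L (\<lambda>x. \<alpha> * y x + \<beta> * z x) \<in> H" by (rule H_cong[OF _ ae_eq_sym[OF c(3)]])
  then show ?thesis using c(1) H_combine[OF DmaxD(2)[OF assms(1)] DmaxD(2)[OF assms(2)]] by (simp add: D_max_def)
qed

text \<open>\<open>y\<close> is joined to 0 by interpolation of quasi-derivatives. Multiplication by
  a smooth cutoff could leave \<open>D_max\<close>, since \<open>p\<close> times a smooth function
  need not be absolutely continuous.\<close>

lemma cutoff:
  assumes y: "y \<in> D_max K a b" and cd: "c < d" "{c..d} \<subseteq> E"
  shows "\<exists>y1\<in>D_max K a b. (\<forall>x. x < c \<longrightarrow> y1 x = y x) \<and> (\<forall>x. x > d \<longrightarrow> y1 x = 0)"
proof -
  note reg = admissible_regular_on[OF adm cd(2,1)]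
  note Y = qd_qsys_on[OF adm DmaxD(1)[OF y]]
  have Z: "qsys_on K a b (\<lambda>_. 0) (\<lambda>k x. 0)" by (simp add: qsys_on_def qsys_zero)
  obtain f \<Phi> where \<Phi>: "qsys K c d f \<Phi>" "quad \<Phi> c = quad (qd K a b y) c" "quad \<Phi> d = 0" "continuous_on {c..d} f"
    using qsys_interpolation[OF reg] by blast
  let ?f = "\<lambda>x. if x < c then L y x else if x \<le> d then f x else 0"
  let ?Y = "\<lambda>k x. if x < c then qd K a b y k x else if x \<le> d then \<Phi> k x else 0"
  have g: "qsys_on K a b ?f ?Y"
    by (rule qsys_on_glue[OF Y(1) Z \<Phi>(1) cd]) (use \<Phi> in \<open>simp_all add: quad_zero\<close>)
  have "?f \<in> H" by (rule H_piecewise[OF DmaxD(3)[OF y] zero_H H_continuous[OF \<Phi>(4) cd(2)] cd(1)])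
  moreover have "?Y 0 \<in> H" unfolding Y(2)
    by (rule H_piecewise[OF DmaxD(2)[OF y] zero_H H_continuous[OF qsys_continuous_on(1)[OF \<Phi>(1)] cd(2)] cd(1)])
  ultimately have "?Y 0 \<in> D_max K a b" using D_max_I(1)[OF g] by blast
  then show ?thesis using cd(1) Y(2) by (intro bexI[of _ "?Y 0"]) auto
qed

lemma ip_supported:
  assumes f: "f \<in> H" and g: "g \<in> H" and cd: "{c..d} \<subseteq> E" and f0: "\<And>x. x \<notin> {c..d} \<Longrightarrow> f x = 0"
  shows "(\<lambda>t. coef_w K t *\<^sub>R (f t * cnj (g t))) absolutely_integrable_on {c..d}"
    and "ip f g = integral {c..d} (\<lambda>t. coef_w K t *\<^sub>R (f t * cnj (g t)))"
proof -
  note i = ip_integrable(1)[OF f g]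
  show i2: "(\<lambda>t. coef_w K t *\<^sub>R (f t * cnj (g t))) absolutely_integrable_on {c..d}"
    by (rule set_integrable_subset[OF i _ cd]) simp
  have "ip f g = integral E (\<lambda>t. coef_w K t *\<^sub>R (f t * cnj (g t)))"
    unfolding inner_w_def by (rule set_lebesgue_integral_eq_integral(2)[OF i])
  also have "\<dots> = integral {c..d} (\<lambda>t. coef_w K t *\<^sub>R (f t * cnj (g t)))"
  proof -
    have "{x \<in> E - {c..d}. coef_w K x *\<^sub>R (f x * cnj (g x)) \<noteq> 0} = {}" using f0 by auto
    moreover have "{x \<in> {c..d} - E. coef_w K x *\<^sub>R (f x * cnj (g x)) \<noteq> 0} = {}" using cd by auto
    ultimately show ?thesis by (intro integral_spike_set) (simp_all only: negligible_empty)
  qed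
  finally show "ip f g = integral {c..d} (\<lambda>t. coef_w K t *\<^sub>R (f t * cnj (g t)))" .
qed

text \<open>Subtract a solution \<open>Z\<close> of \<open>\<ell> Z = h\<close> and a null solution
  \<open>U\<close> so that the remainder \<open>r\<close> equals \<open>\<ell> \<Phi>\<close> for
  some \<open>\<Phi>\<close> with zero data at both ends. Extended by zero, \<open>\<Phi>\<close> is
  an admissible test function, and testing with it shows \<open>r = 0\<close> almost
  everywhere.\<close>

lemma weak_solution_local:
  assumes g: "g \<in> H" and h: "h \<in> H"
    and weak: "\<And>\<phi>. \<phi> \<in> D_max K a b \<Longrightarrow> compactly_supported a b \<phi> \<Longrightarrow> ip (L \<phi>) g = ip \<phi> h"
    and cd: "c < d" "{c..d} \<subseteq> E"
  shows "\<exists>Y. qsys K c d h Y \<and> (AE x in lebesgue. x \<in> {c<..<d} \<longrightarrow> g x = Y 0 x)"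
proof -
  note reg = admissible_regular_on[OF adm cd(2,1)]
  have sub: "einterval (ereal c) (ereal d) \<subseteq> E" using cd(2) by (simp add: einterval_eq_Icc) (meson atLeastAtMost_iff greaterThanLessThan_subseteq_atLeastAtMost_iff order_refl order_trans)
  have admcd: "admissible K (ereal c) (ereal d)" by (rule admissible_subset[OF adm _ sub]) (use cd in simp)
  have wi: "(\<lambda>t. coef_w K t *\<^sub>R f t) absolutely_integrable_on {c..d}" if "f \<in> H" for f
    by (rule weighted_absolutely_integrable[OF reg admcd L2w_subset[OF sub that]])
  obtain Z where Z: "qsys K c d h Z" "quad Z c = 0"
    using qsys_exists[OF reg wi[OF h], of c 0] cd(1) by auto
  have G: "(\<lambda>t. coef_w K t *\<^sub>R (g t - Z 0 t)) absolutely_integrable_on {c..d}"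
    using set_integral_diff(1)[OF wi[OF g] qsys_weight_integrable[OF reg qsys_continuous_on(1)[OF Z(1)]]]
    by (simp add: scaleR_diff_right)
  obtain U \<Phi> where U: "qsys K c d (\<lambda>_. 0) U" "qsys K c d (\<lambda>t. (g t - Z 0 t) - U 0 t) \<Phi>" "quad \<Phi> c = 0" "quad \<Phi> d = 0"
    using qsys_decomposition[OF reg G] by blast
  define r where "r t = (g t - Z 0 t) - U 0 t" for t
  have U2: "qsys K c d r \<Phi>" using U(2) by (simp add: r_def[abs_def])
  have zs: "qsys_on K a b (\<lambda>_. 0) (\<lambda>k x. 0)" by (simp add: qsys_on_def qsys_zero)
  let ?f = "\<lambda>x. if x < c then 0 else if x \<le> d then r x else 0"
  let ?Y = "\<lambda>k x. if x < c then 0 else if x \<le> d then \<Phi> k x else 0"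
  have gl: "qsys_on K a b ?f ?Y"
    by (rule qsys_on_glue[OF zs zs U2 cd]) (use U in \<open>simp_all add: quad_zero\<close>)
  have "(\<lambda>x. (indicator {c..d} x * g x - indicator {c..d} x * Z 0 x) - indicator {c..d} x * U 0 x) \<in> H"
    by (intro H_diff H_indicator[OF g] H_continuous[OF qsys_continuous_on(1)[OF Z(1)] cd(2)] H_continuous[OF qsys_continuous_on(1)[OF U(1)] cd(2)]) auto
  moreover have "(\<lambda>x. (indicator {c..d} x * g x - indicator {c..d} x * Z 0 x) - indicator {c..d} x * U 0 x) = (\<lambda>x. indicator {c..d} x * r x)"
    by (auto simp: r_def algebra_simps)
  ultimately have fH: "?f \<in> H" by (intro H_piecewise zero_H cd(1)) simp
  have yH: "?Y 0 \<in> H" by (rule H_piecewise[OF zero_H zero_H H_continuous[OF qsys_continuous_on(1)[OF U2] cd(2)] cd(1)])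
  note phi = D_max_I[OF gl yH fH]
  have "compactly_supported a b (?Y 0)"
    unfolding compactly_supported_def by (rule exI[of _ "{c..d}"]) (use cd in auto)
  from weak[OF phi(1) this] have "ip (L (?Y 0)) g = ip (?Y 0) h" .
  moreover have "ip (L (?Y 0)) g = ip ?f g"
    by (rule ip_cong[OF DmaxD(3)[OF phi(1)] g phi(2)]) (simp add: ae_eq_def)
  moreover have "ip ?f g = integral {c..d} (\<lambda>t. coef_w K t *\<^sub>R (?f t * cnj (g t)))"
    by (rule ip_supported(2)[OF fH g cd(2)]) auto
  moreover have "ip (?Y 0) h = integral {c..d} (\<lambda>t. coef_w K t *\<^sub>R (?Y 0 t * cnj (h t)))"
    by (rule ip_supported(2)[OF yH h cd(2)]) auto
  moreover have "integral {c..d} (\<lambda>t. coef_w K t *\<^sub>R (?f t * cnj (g t))) = integral {c..d} (\<lambda>t. coef_w K t *\<^sub>R (r t * cnj (g t)))"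
    "integral {c..d} (\<lambda>t. coef_w K t *\<^sub>R (?Y 0 t * cnj (h t))) = integral {c..d} (\<lambda>t. coef_w K t *\<^sub>R (\<Phi> 0 t * cnj (h t)))"
    by (rule integral_cong, auto)+
  ultimately have w0: "integral {c..d} (\<lambda>t. coef_w K t *\<^sub>R (r t * cnj (g t))) = integral {c..d} (\<lambda>t. coef_w K t *\<^sub>R (\<Phi> 0 t * cnj (h t)))"
    by simp
  have i1: "(\<lambda>t. coef_w K t *\<^sub>R (r t * cnj (g t))) absolutely_integrable_on {c..d}"
    by (rule absolutely_integrable_spike[OF ip_supported(1)[OF fH g cd(2)] negligible_empty]) auto
  have i2: "(\<lambda>t. coef_w K t *\<^sub>R (\<Phi> 0 t * cnj (h t))) absolutely_integrable_on {c..d}"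
    by (rule absolutely_integrable_spike[OF ip_supported(1)[OF yH h cd(2)] negligible_empty]) auto
  note gZ = qsys_green_integral[OF cd(1) U2 Z(1)] and gU = qsys_green_integral[OF cd(1) U2 U(1)]
  \<comment> \<open>Expand the conjugated factor as \<open>g - Z - U\<close>. The weak equation
    removes the first two terms, and Green's formula with vanishing boundary data removes the parts
    with \<open>Z\<close> and \<open>U\<close>.\<close>
  have eq: "coef_w K t *\<^sub>R (r t * cnj (r t)) = coef_w K t *\<^sub>R (r t * cnj (g t)) - coef_w K t *\<^sub>R (\<Phi> 0 t * cnj (h t))
      - coef_w K t *\<^sub>R (r t * cnj (Z 0 t) - \<Phi> 0 t * cnj (h t)) - coef_w K t *\<^sub>R (r t * cnj (U 0 t) - \<Phi> 0 t * cnj 0)" for t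
    by (simp add: r_def scaleR_conv_of_real algebra_simps)
  note ints = set_integral_diff(1)[OF set_integral_diff(1)[OF set_integral_diff(1)[OF i1 i2] gZ(1)] gU(1)]
  have rr: "(\<lambda>t. coef_w K t *\<^sub>R (r t * cnj (r t))) absolutely_integrable_on {c..d}"
    unfolding eq by (rule ints)
  have "integral {c..d} (\<lambda>t. coef_w K t *\<^sub>R (r t * cnj (r t))) =
     integral {c..d} (\<lambda>t. coef_w K t *\<^sub>R (r t * cnj (g t))) - integral {c..d} (\<lambda>t. coef_w K t *\<^sub>R (\<Phi> 0 t * cnj (h t)))
     - integral {c..d} (\<lambda>t. coef_w K t *\<^sub>R (r t * cnj (Z 0 t) - \<Phi> 0 t * cnj (h t)))
     - integral {c..d} (\<lambda>t. coef_w K t *\<^sub>R (r t * cnj (U 0 t) - \<Phi> 0 t * cnj 0))"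
    unfolding eq
    by (rule integral_unique[OF has_integral_diff[OF has_integral_diff[OF has_integral_diff[OF
        i1[THEN set_lebesgue_integral_eq_integral(1), THEN integrable_integral]
        i2[THEN set_lebesgue_integral_eq_integral(1), THEN integrable_integral]]
        gZ(1)[THEN set_lebesgue_integral_eq_integral(1), THEN integrable_integral]]
        gU(1)[THEN set_lebesgue_integral_eq_integral(1), THEN integrable_integral]]])
  also have "\<dots> = 0" using w0 gZ(2) gU(2) bracket_zero(1)[OF U(3)] bracket_zero(1)[OF U(4)] by simp
  finally have "AE t in lebesgue. t \<in> {c<..<d} \<longrightarrow> r t = 0" by (rule weighted_square_zero[OF reg rr])
  then have "AE x in lebesgue. x \<in> {c<..<d} \<longrightarrow> g x = 1 * Z 0 x + 1 * U 0 x"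
    by eventually_elim (auto simp: r_def algebra_simps)
  moreover have "qsys K c d h (\<lambda>k x. 1 * Z k x + 1 * U k x)" using qsys_combine[OF Z(1) U(1), of 1 1] by simp
  ultimately show ?thesis by blast
qed

text \<open>The local solutions agree almost everywhere with \<open>g\<close>, hence by continuity
  with one another, with all quasi-derivatives, and glue along an exhaustion.\<close>

lemma weak_solution:
  assumes g: "g \<in> H" and h: "h \<in> H"
    and weak: "\<And>\<phi>. \<phi> \<in> D_max K a b \<Longrightarrow> compactly_supported a b \<phi> \<Longrightarrow> ip (L \<phi>) g = ip \<phi> h"
  shows "\<exists>z\<in>D_max K a b. ae_eq a b z g \<and> ae_eq a b (L z) h"
proof -
  obtain l u :: "nat \<Rightarrow> real" where "E = (\<Union>i. {l i..u i}) \<and> (\<forall>i. l i < u i) \<and> incseq u \<and> decseq l"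
    using einterval_exhaustion[OF ab] by (elim exE)
  then have lu: "E = (\<Union>i. {l i..u i})" "\<And>i. l i < u i" "incseq u" "decseq l" by simp_all
  have luE: "{l i..u i} \<subseteq> E" for i using lu(1) by blast
  have "\<exists>Y. qsys K (l n) (u n) h Y \<and> (AE x in lebesgue. x \<in> {l n<..<u n} \<longrightarrow> g x = Y 0 x)" for n
    by (rule weak_solution_local[OF g h weak lu(2) luE])
  then obtain Y where Y: "\<And>n. qsys K (l n) (u n) h (Y n)" "\<And>n. AE x in lebesgue. x \<in> {l n<..<u n} \<longrightarrow> g x = Y n 0 x"
    by metis
  have cons: "quad (Y n) x = quad (Y m) x" if nm: "n \<le> m" and x: "x \<in> {l n..u n}" for n m x
  proof -
    have le: "l m \<le> l n" "u n \<le> u m" using decseqD[OF lu(4) nm] incseqD[OF lu(3) nm] by auto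
    have Ym: "qsys K (l n) (u n) h (Y m)" by (rule qsys_subinterval[OF Y(1) le])
    have ae: "AE x in lebesgue. x \<in> {l n<..<u n} \<longrightarrow> Y n 0 x = Y m 0 x"
      using Y(2)[of n] Y(2)[of m] by eventually_elim (use le in auto)
    show ?thesis
      by (rule qsys_determined(1)[OF admissible_regular_on[OF adm luE lu(2)] Y(1) Ym _ x])
         (rule continuous_AE_eq[OF qsys_continuous_on(1)[OF Y(1)] qsys_continuous_on(1)[OF Ym] lu(2) ae])
  qed
  \<comment> \<open>Some interval of the exhaustion around \<open>x\<close>; consistency makes the
    choice immaterial.\<close>
  define i where "i x = (SOME n. x \<in> {l n..u n})" for x
  have i: "x \<in> {l (i x)..u (i x)}" if "x \<in> E" for x
    unfolding i_def by (rule someI_ex) (use that lu(1) in blast)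
  define Z where "Z k x = Y (i x) k x" for k x
  have ZY: "quad Z x = quad (Y n) x" if "x \<in> {l n..u n}" for n x
  proof -
    have "x \<in> E" using that luE by blast
    note ix = i[OF this]
    have "quad Z x = quad (Y (i x)) x" by (simp add: quad_def Z_def)
    also have "\<dots> = quad (Y (max n (i x))) x" by (rule cons[OF _ ix]) simp
    also have "\<dots> = quad (Y n) x" by (rule cons[symmetric, OF _ that]) simp
    finally show ?thesis .
  qed
  have "qsys_on K a b h Z"
    unfolding qsys_on_def
  proof (intro allI impI)
    fix c d :: real assume cd: "c < d" "{c..d} \<subseteq> E"
    then have "c \<in> E" "d \<in> E" by auto
    then obtain n m where nm: "c \<in> {l n..u n}" "d \<in> {l m..u m}" using lu(1) by blast
    define N where "N = max n m"
    have "l N \<le> l n" "u m \<le> u N" using decseqD[OF lu(4), of n N] incseqD[OF lu(3), of m N] by (auto simp: N_def)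
    then have N: "l N \<le> c" "d \<le> u N" using nm by auto
    show "qsys K c d h Z"
      by (rule qsys_cong[OF qsys_subinterval[OF Y(1) N]]) (use ZY[of _ N] N in auto)
  qed
  moreover have ae: "ae_eq a b (Z 0) g"
    unfolding ae_eq_def
  proof (rule AE_mp)
    show "AE x in lebesgue. \<forall>n. (x \<in> {l n<..<u n} \<longrightarrow> g x = Y n 0 x) \<and> x \<noteq> l n \<and> x \<noteq> u n"
      unfolding AE_all_countable
    proof
      fix n
      show "AE x in lebesgue. (x \<in> {l n<..<u n} \<longrightarrow> g x = Y n 0 x) \<and> x \<noteq> l n \<and> x \<noteq> u n"
        using Y(2)[of n] AE_completion[OF AE_lborel_singleton[of "l n"]] AE_completion[OF AE_lborel_singleton[of "u n"]]
        by eventually_elim auto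
    qed
    show "AE x in lebesgue. (\<forall>n. (x \<in> {l n<..<u n} \<longrightarrow> g x = Y n 0 x) \<and> x \<noteq> l n \<and> x \<noteq> u n) \<longrightarrow> x \<in> E \<longrightarrow> Z 0 x = g x"
    proof (rule AE_I2, intro impI)
      fix x assume a: "\<forall>n. (x \<in> {l n<..<u n} \<longrightarrow> g x = Y n 0 x) \<and> x \<noteq> l n \<and> x \<noteq> u n" and x: "x \<in> E"
      have "x \<noteq> l (i x)" "x \<noteq> u (i x)" using a by blast+
      with i[OF x] have "x \<in> {l (i x)<..<u (i x)}" by simp
      with a show "Z 0 x = g x" by (simp add: Z_def)
    qed
  qed
  moreover have "Z 0 \<in> H" by (rule H_cong[OF g ae_eq_sym[OF ae]])
  ultimately show ?thesis using D_max_I[OF _ _ h] by blast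
qed

end

section \<open>Boundary conditions as isotropic subspaces\<close>

text \<open>The nondegenerate skew-Hermitian form on C^4 whose value at the boundary vectors is the
  bracket.\<close>

definition sform :: "quad \<Rightarrow> quad \<Rightarrow> complex" where
  "sform y z = fst y * cnj (snd (snd (snd z))) + fst (snd y) * cnj (fst (snd (snd z)))
     - (snd (snd (snd y)) * cnj (fst z) + fst (snd (snd y)) * cnj (fst (snd z)))"

text \<open>Complex multiplication on C^4; the product type itself carries only real
  scalars.\<close>

definition qscale :: "complex \<Rightarrow> quad \<Rightarrow> quad" where
  "qscale c y = (c * fst y, c * fst (snd y), c * fst (snd (snd y)), c * snd (snd (snd y)))"

lemma bracket_sform: "bracket Y Z x = sform (quad Y x) (quad Z x)"
  by (simp add: bracket_eq sform_def quad_def)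

lemma sform_combine_left: "sform (qscale \<alpha> x + qscale \<beta> y) z = \<alpha> * sform x z + \<beta> * sform y z"
  by (simp add: sform_def qscale_def algebra_simps)

lemma sform_combine_right: "sform z (qscale \<alpha> x + qscale \<beta> y) = cnj \<alpha> * sform z x + cnj \<beta> * sform z y"
  by (simp add: sform_def qscale_def algebra_simps)

lemma sform_skew: "sform y z = - cnj (sform z y)"
  by (simp add: sform_def)

lemma quad_qscale: "quad (\<lambda>k x. \<alpha> * Y k x + \<beta> * Z k x) x = qscale \<alpha> (quad Y x) + qscale \<beta> (quad Z x)"
  by (simp add: quad_def qscale_def)

lemma tendsto_sform:
  assumes "(f \<longlongrightarrow> y) F" "(g \<longlongrightarrow> z) F"
  shows "((\<lambda>x. sform (f x) (g x)) \<longlongrightarrow> sform y z) F"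
  unfolding sform_def by (intro tendsto_intros assms)

lemma tendsto_qscale: "(f \<longlongrightarrow> y) F \<Longrightarrow> ((\<lambda>x. qscale c (f x)) \<longlongrightarrow> qscale c y) F"
  unfolding qscale_def by (intro tendsto_intros)

text \<open>
  The complex span of \<open>h1\<close> and \<open>h2\<close> and the \<open>sform\<close>-annihilator of \<open>h1\<close> and \<open>h2\<close> both have real
  dimension 4, so the inclusion of the first in the second is an equality.
\<close>

lemma sform_annihilator:
  assumes ind: "\<And>c1 c2. qscale c1 h1 + qscale c2 h2 = 0 \<Longrightarrow> c1 = 0 \<and> c2 = 0"
    and iso: "sform h1 h1 = 0" "sform h1 h2 = 0" "sform h2 h2 = 0"
    and y: "sform y h1 = 0" "sform y h2 = 0"
  shows "\<exists>c1 c2. y = qscale c1 h1 + qscale c2 h2"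
proof -
  define F where "F c = qscale (fst c) h1 + qscale (snd c) h2" for c :: "complex \<times> complex"
  \<comment> \<open>\<open>J\<close> expresses the form by the real inner product,
    \<open>inner (J h) v = Re (sform v h)\<close>. The annihilator therefore lies in the orthogonal
    complement of the image of \<open>J \<circ> F\<close>, which has real dimension 8 - 4 =
    4.\<close>
  define J where "J h = (snd (snd (snd h)), fst (snd (snd h)), - fst (snd h), - fst h)" for h :: quad
  have linF: "linear F"
    by (rule linearI) (simp_all add: F_def qscale_def algebra_simps scaleR_conv_of_real)
  have linJ: "linear J"
    by (rule linearI) (simp_all add: J_def)
  have injF: "inj F"
    unfolding linear_injective_0[OF linF]
  proof (intro allI impI)
    fix c assume "F c = 0"
    then have "fst c = 0 \<and> snd c = 0" unfolding F_def by (rule ind)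
    then show "c = 0" by (simp add: prod_eq_iff)
  qed
  have injJ: "inj J"
    unfolding linear_injective_0[OF linJ] by (auto simp: J_def zero_prod_def)
  have linJF: "linear (J \<circ> F)" by (rule linear_compose[OF linF linJ])
  have injJF: "inj (J \<circ> F)" by (rule inj_compose[OF injJ injF])
  have dimF: "dim (range F) = 4"
    using dim_image_eq[OF linF, of UNIV] injF by (simp add: dim_UNIV)
  have dimJF: "dim (range (J \<circ> F)) = 4"
    using dim_image_eq[OF linJF, of UNIV] injJF by (simp add: dim_UNIV)
  have inner_J: "inner (J h) v = Re (sform v h)" for h v
    by (simp add: J_def sform_def inner_prod_def inner_complex_def)
  define W where "W = {v::quad. \<forall>x\<in>range (J \<circ> F). orthogonal x v}"
  have sJF: "subspace (range (J \<circ> F))" by (rule linear_subspace_image[OF linJF subspace_UNIV])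
  have "W = {v \<in> UNIV. \<forall>x\<in>range (J \<circ> F). orthogonal x v}" unfolding W_def by blast
  then have "dim W + dim (range (J \<circ> F)) = dim (UNIV :: quad set)"
    using dim_subspace_orthogonal_to_vectors[OF sJF subspace_UNIV] by (metis subset_UNIV)
  moreover have "dim (UNIV :: quad set) = 8" by (simp add: dim_UNIV)
  ultimately have dimW: "dim W = 4" unfolding dimJF by linarith
  have subW: "subspace W" unfolding W_def by (rule subspace_orthogonal_to_vectors)
  have subF: "subspace (range F)" by (rule linear_subspace_image[OF linF subspace_UNIV])
  have iso': "sform h2 h1 = 0" using sform_skew[of h2 h1] iso(2) by simp
  have mem: "v \<in> W" if "sform v h1 = 0" "sform v h2 = 0" for v
  proof -
    have "sform v (F c) = 0" for c unfolding F_def sform_combine_right using that by simp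
    then show ?thesis by (simp add: W_def orthogonal_def inner_J)
  qed
  have "range F \<subseteq> W"
  proof
    fix v assume "v \<in> range F"
    then obtain c where "v = F c" by blast
    then show "v \<in> W" by (intro mem) (simp_all add: F_def sform_combine_left iso iso')
  qed
  then have "range F = W"
    by (rule subspace_dim_equal[OF subF subW]) (simp add: dimF dimW)
  with mem[OF y] obtain c where "y = F c" by blast
  then show ?thesis unfolding F_def by blast
qed

lemma sform_isotropic:
  assumes ind: "\<And>c1 c2. qscale c1 h1 + qscale c2 h2 = 0 \<Longrightarrow> c1 = 0 \<and> c2 = 0"
    and iso: "sform h1 h1 = 0" "sform h1 h2 = 0" "sform h2 h2 = 0"
    and y: "sform y h1 = 0" "sform y h2 = 0" and z: "sform z h1 = 0" "sform z h2 = 0"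
  shows "sform y z = 0"
proof -
  obtain c1 c2 where "z = qscale c1 h1 + qscale c2 h2"
    using sform_annihilator[OF ind iso z] by blast
  then show ?thesis using y by (simp add: sform_combine_right)
qed

section \<open>Boundary matrices as isotropic subspaces\<close>

definition bc_space :: "complex^2^2 \<Rightarrow> complex^2^2 \<Rightarrow> quad set" where
  "bc_space A1 A2 = {y. A1 *v vector [fst y, fst (snd y)] + A2 *v vector [snd (snd (snd y)), fst (snd (snd y))] = 0}"

text \<open>The vector whose \<open>sform\<close> pairing with a boundary vector is the left side of
  condition number \<open>i\<close>; the conjugates compensate for the conjugate-linear second
  slot.\<close>

definition bc_row :: "complex^2^2 \<Rightarrow> complex^2^2 \<Rightarrow> 2 \<Rightarrow> quad" where
  "bc_row A1 A2 i = (- cnj (A2 $ i $ 1), - cnj (A2 $ i $ 2), cnj (A1 $ i $ 2), cnj (A1 $ i $ 1))"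

lemma bc_space_iff: "y \<in> bc_space A1 A2 \<longleftrightarrow> sform y (bc_row A1 A2 1) = 0 \<and> sform y (bc_row A1 A2 2) = 0"
  by (simp add: bc_space_def bc_row_def sform_def vec_eq_iff forall_2 matrix_vector_mult_def sum_2 algebra_simps)

text \<open>A relation between the two vectors conjugates to a relation between the rows of the
  block matrix, whose row rank is 2.\<close>

lemma bc_rows_independent:
  assumes "self_adjoint_bc A1 A2" and z: "qscale c1 (bc_row A1 A2 1) + qscale c2 (bc_row A1 A2 2) = 0"
  shows "c1 = 0 \<and> c2 = 0"
proof -
  let ?B = "block_row A1 A2"
  have rk: "vec.dim (rows ?B) = 2" using assms(1) by (simp add: self_adjoint_bc_def row_rank_def_gen)
  have rows: "rows ?B = {row 1 ?B, row 2 ?B}" by (auto simp: rows_def) (metis exhaust_2)+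
  have comb: "cnj c1 *s row 1 ?B + cnj c2 *s row 2 ?B = 0"
  proof -
    have n: "x + y = 0" if "- x + - y = 0" for x y :: complex using that by (simp add: add_eq_0_iff)
    have "- (c1 * cnj (A2 $ 1 $ 1)) + - (c2 * cnj (A2 $ 2 $ 1)) = 0"
      using arg_cong[OF z, of fst] by (simp add: qscale_def bc_row_def)
    moreover have "- (c1 * cnj (A2 $ 1 $ 2)) + - (c2 * cnj (A2 $ 2 $ 2)) = 0"
      using arg_cong[OF z, of "\<lambda>q. fst (snd q)"] by (simp add: qscale_def bc_row_def)
    ultimately have e: "c1 * cnj (A2 $ 1 $ 1) + c2 * cnj (A2 $ 2 $ 1) = 0" "c1 * cnj (A2 $ 1 $ 2) + c2 * cnj (A2 $ 2 $ 2) = 0"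
      by (simp_all only: n)
    have e': "c1 * cnj (A1 $ 1 $ 1) + c2 * cnj (A1 $ 2 $ 1) = 0" "c1 * cnj (A1 $ 1 $ 2) + c2 * cnj (A1 $ 2 $ 2) = 0"
      using arg_cong[OF z, of "\<lambda>q. snd (snd (snd q))"] arg_cong[OF z, of "\<lambda>q. fst (snd (snd q))"]
      by (simp_all add: qscale_def bc_row_def)
    have "cnj c1 * A2 $ 1 $ 1 + cnj c2 * A2 $ 2 $ 1 = 0" "cnj c1 * A2 $ 1 $ 2 + cnj c2 * A2 $ 2 $ 2 = 0"
      "cnj c1 * A1 $ 1 $ 1 + cnj c2 * A1 $ 2 $ 1 = 0" "cnj c1 * A1 $ 1 $ 2 + cnj c2 * A1 $ 2 $ 2 = 0"
      using e[THEN arg_cong[where f = cnj]] e'[THEN arg_cong[where f = cnj]] by simp_all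
    then have "A2 $ 1 $ i * cnj c1 + A2 $ 2 $ i * cnj c2 = 0 \<and> A1 $ 1 $ i * cnj c1 + A1 $ 2 $ i * cnj c2 = 0" for i
      using exhaust_2[of i] by (auto simp: mult.commute)
    then show ?thesis
      by (auto simp: vec_eq_iff row_def block_row_def mult.commute split: sum.splits)
  qed
  \<comment> \<open>A nonzero coefficient makes one row a multiple of the other, so the row space
    would have dimension at most 1. Stated for abstract rows to be applied in both orders.\<close>
  have contra: False if c: "c \<noteq> 0" "c *s r + c' *s r' = 0" "rows ?B = {r, r'}" for c c' r r'
  proof -
    have "c *s r = - (c' *s r')" using c(2) by (simp add: eq_neg_iff_add_eq_0)
    then have "(1 / c) *s (c *s r) = (1 / c) *s (- (c' *s r'))" by simp
    then have "r = (- (c' / c)) *s r'" using c(1)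
      by (simp add: vec.scale_scale vec.scale_minus_right)
    then have "rows ?B \<subseteq> vec.span {r'}"
      using c(3) vec.span_scale[OF vec.span_base[of r' "{r'}"], of "- (c' / c)"] by (auto simp: vec.span_base)
    then have "vec.dim (rows ?B) \<le> card {r'}" by (rule vec.dim_le_card) simp
    then show False using rk by simp
  qed
  have "c1 = 0" using contra[of "cnj c1" "row 1 ?B" "cnj c2" "row 2 ?B"] comb rows by auto
  moreover have "c2 = 0" using contra[of "cnj c2" "row 2 ?B" "cnj c1" "row 1 ?B"] comb rows by (auto simp: add.commute)
  ultimately show ?thesis by simp
qed

text \<open>Entrywise, Hermitian symmetry of \<open>A1 ** conj_transpose A2\<close> is exactly the
  vanishing of the form on the rows.\<close>

lemma bc_rows_isotropic:
  assumes "self_adjoint_bc A1 A2"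
  shows "sform (bc_row A1 A2 i) (bc_row A1 A2 j) = 0"
proof -
  have "conj_transpose (A1 ** conj_transpose A2) $ i $ j = (A1 ** conj_transpose A2) $ i $ j"
    using assms by (simp add: self_adjoint_bc_def)
  then have "cnj (A1 $ j $ 1 * cnj (A2 $ i $ 1) + A1 $ j $ 2 * cnj (A2 $ i $ 2))
      = A1 $ i $ 1 * cnj (A2 $ j $ 1) + A1 $ i $ 2 * cnj (A2 $ j $ 2)"
    by (simp add: conj_transpose_def matrix_matrix_mult_def sum_2)
  from arg_cong[OF this, of cnj] show ?thesis
    by (simp add: sform_def bc_row_def algebra_simps)
qed

definition csubspace :: "quad set \<Rightarrow> bool" where
  "csubspace V \<longleftrightarrow> 0 \<in> V \<and> (\<forall>\<alpha> \<beta> x y. x \<in> V \<longrightarrow> y \<in> V \<longrightarrow> qscale \<alpha> x + qscale \<beta> y \<in> V)"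

definition isotropic :: "quad set \<Rightarrow> bool" where
  "isotropic V \<longleftrightarrow> csubspace V \<and> (\<forall>x\<in>V. \<forall>y\<in>V. sform x y = 0)"

lemma sform_zero: "sform 0 z = 0" "sform z 0 = 0"
  by (simp_all add: sform_def)

lemma csubspace_annihilator: "csubspace {y. sform y h1 = 0 \<and> sform y h2 = 0}"
  by (simp add: csubspace_def sform_zero sform_combine_left)

lemma isotropic_annihilator:
  assumes "\<And>c1 c2. qscale c1 h1 + qscale c2 h2 = 0 \<Longrightarrow> c1 = 0 \<and> c2 = 0"
    and "sform h1 h1 = 0" "sform h1 h2 = 0" "sform h2 h2 = 0"
  shows "isotropic {y. sform y h1 = 0 \<and> sform y h2 = 0}"
  using csubspace_annihilator sform_isotropic[OF assms] by (auto simp: isotropic_def)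

lemma bc_space_eq: "bc_space A1 A2 = {y. sform y (bc_row A1 A2 1) = 0 \<and> sform y (bc_row A1 A2 2) = 0}"
  using bc_space_iff by blast

lemma csubspace_bc_space: "csubspace (bc_space A1 A2)"
  unfolding bc_space_eq by (rule csubspace_annihilator)

lemma isotropic_bc_space:
  assumes "self_adjoint_bc A1 A2"
  shows "isotropic (bc_space A1 A2)"
  unfolding bc_space_eq
  by (rule isotropic_annihilator) (use bc_rows_independent[OF assms] bc_rows_isotropic[OF assms] in blast)+

lemma isotropic_dirichlet: "isotropic {y. fst y = 0 \<and> fst (snd y) = 0}"
  by (simp add: isotropic_def csubspace_def qscale_def sform_def)

lemma bc_matrix_iff:
  assumes lim: "(quad Y \<longlongrightarrow> q) F" and F: "F \<noteq> bot"
  shows "bc_matrix A1 A2 F Y \<longleftrightarrow> q \<in> bc_space A1 A2"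
proof -
  have l: "(Y 0 \<longlongrightarrow> fst q) F" "(Y 1 \<longlongrightarrow> fst (snd q)) F" "(Y 2 \<longlongrightarrow> fst (snd (snd q))) F" "(Y 3 \<longlongrightarrow> snd (snd (snd q))) F"
    using tendsto_fst[OF lim] tendsto_fst[OF tendsto_snd[OF lim]] tendsto_fst[OF tendsto_snd[OF tendsto_snd[OF lim]]]
      tendsto_snd[OF tendsto_snd[OF tendsto_snd[OF lim]]] by (simp_all add: quad_def[abs_def])
  have "(uvec Y \<longlongrightarrow> vector [fst q, fst (snd q)]) F"
  proof (rule vec_tendstoI)
    fix i :: 2
    show "((\<lambda>x. uvec Y x $ i) \<longlongrightarrow> vector [fst q, fst (snd q)] $ i) F"
      using exhaust_2[of i] l by (auto simp: uvec_def)
  qed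
  then have u: "Lim F (uvec Y) = vector [fst q, fst (snd q)]" by (rule tendsto_Lim[OF F])
  have "(vvec Y \<longlongrightarrow> vector [snd (snd (snd q)), fst (snd (snd q))]) F"
  proof (rule vec_tendstoI)
    fix i :: 2
    show "((\<lambda>x. vvec Y x $ i) \<longlongrightarrow> vector [snd (snd (snd q)), fst (snd (snd q))] $ i) F"
      using exhaust_2[of i] l by (auto simp: vvec_def)
  qed
  then have v: "Lim F (vvec Y) = vector [snd (snd (snd q)), fst (snd (snd q))]" by (rule tendsto_Lim[OF F])
  show ?thesis by (simp add: bc_matrix_def u v bc_space_def)
qed

section \<open>Germs of functions at one endpoint\<close>

context weighted_l2
begin

lemma zero_D_max: "(\<lambda>x. 0) \<in> D_max K a b" "ae_eq a b (L (\<lambda>x. 0)) (\<lambda>x. 0)" "x \<in> E \<Longrightarrow> quad (qd K a b (\<lambda>x. 0)) x = 0"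
proof -
  have "qsys_on K a b (\<lambda>x. 0) (\<lambda>k x. 0)" by (simp add: qsys_on_def qsys_zero)
  from D_max_I[OF this] show "(\<lambda>x. 0) \<in> D_max K a b" "ae_eq a b (L (\<lambda>x. 0)) (\<lambda>x. 0)" "x \<in> E \<Longrightarrow> quad (qd K a b (\<lambda>x. 0)) x = 0"
    using zero_H by (simp_all add: quad_zero)
qed

lemma quad_qd_combine:
  assumes "y \<in> D_max K a b" "z \<in> D_max K a b" "x \<in> E"
  shows "quad (qd K a b (\<lambda>x. \<alpha> * y x + \<beta> * z x)) x = qscale \<alpha> (quad (qd K a b y) x) + qscale \<beta> (quad (qd K a b z) x)"
  using qd_combine(2)[OF adm DmaxD(1)[OF assms(1)] DmaxD(1)[OF assms(2)] assms(3)] by (simp add: quad_qscale)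

lemma isCont_quad:
  assumes y: "y \<in> D_max K a b" and x: "x \<in> E"
  shows "isCont (quad (qd K a b y)) x"
proof -
  obtain c d where cd: "c < x" "x < d" "{c..d} \<subseteq> E" using einterval_nbhd[OF x] by blast
  have "qsys K c d (L y) (qd K a b y)"
    by (rule qsys_onD[OF qd_qsys_on(1)[OF adm DmaxD(1)[OF y]]]) (use cd in auto)
  then show ?thesis
    using qsys_continuous_quad cd by (intro continuous_on_interior[of "{c..d}"]) (auto simp: interior_atLeastAtMost_real)
qed

text \<open>The last clause makes membership depend only on the germ along \<open>F\<close>, so the
  requirements at the two ends can be met independently by cutting functions off.\<close>

definition germ_space :: "real filter \<Rightarrow> (real \<Rightarrow> complex) set \<Rightarrow> bool" where
  "germ_space F S \<longleftrightarrow> S \<subseteq> D_max K a b \<and> (\<lambda>x. 0) \<in> S \<and>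
     (\<forall>\<alpha> \<beta>. \<forall>y\<in>S. \<forall>z\<in>S. (\<lambda>x. \<alpha> * y x + \<beta> * z x) \<in> S) \<and>
     (\<forall>y\<in>S. \<forall>z\<in>D_max K a b. eventually (\<lambda>x. y x = z x) F \<longrightarrow> z \<in> S)"

end

text \<open>One locale serves both ends. \<open>G\<close> assigns to any point the filter on the
  same side as \<open>F\<close>; at a truncation point it is the approach from inside the truncated
  interval.\<close>

locale endpoint = weighted_l2 +
  fixes e :: ereal and F F' :: "real filter" and G :: "ereal \<Rightarrow> real filter"
  assumes ends: "e = a \<and> F = lower_end a \<and> F' = upper_end b \<and> G = lower_end \<or>
                 e = b \<and> F = upper_end b \<and> F' = lower_end a \<and> G = upper_end"
begin

abbreviation "Dm \<equiv> D_max K a b"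
abbreviation "Q y \<equiv> quad (qd K a b y)"

lemma F_ne: "F \<noteq> bot" "F' \<noteq> bot"
  using ends lower_end_not_bot[OF ab] upper_end_not_bot[OF ab] by auto

lemma ev_E: "eventually (\<lambda>x. x \<in> E) F" "eventually (\<lambda>x. x \<in> E) F'"
  using ends eventually_in_einterval[OF ab] by auto

lemma F_G: "F = G e" using ends by auto

lemma G_ne: "G (ereal x) \<noteq> bot"
  using ends by (auto simp: lower_end_ereal upper_end_ereal)

lemma G_le: "G (ereal x) \<le> at x"
  using ends at_le[of "{x<..}" UNIV x] at_le[of "{..<x}" UNIV x] by (auto simp: lower_end_ereal upper_end_ereal)

lemma eventually_lower: "eventually P (lower_end a) \<longleftrightarrow> (\<exists>c. a < ereal c \<and> (\<forall>x. a < ereal x \<longrightarrow> x < c \<longrightarrow> P x))"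
  by (rule eventually_lower_end) (use ab in auto)

lemma eventually_upper: "eventually P (upper_end b) \<longleftrightarrow> (\<exists>c. ereal c < b \<and> (\<forall>x. ereal x < b \<longrightarrow> c < x \<longrightarrow> P x))"
  by (rule eventually_upper_end) (use ab in auto)

lemma lower_open:
  assumes "eventually P (lower_end a)"
  shows "\<exists>S. open S \<and> S \<subseteq> E \<and> (\<forall>x\<in>S. P x) \<and> eventually (\<lambda>x. x \<in> S) (lower_end a)"
proof -
  obtain c where c: "a < ereal c" "\<And>x. a < ereal x \<Longrightarrow> x < c \<Longrightarrow> P x"
    using assms unfolding eventually_lower by blast
  have "eventually (\<lambda>x. x < c) (lower_end a)" unfolding eventually_lower using c(1) by blast
  then have "eventually (\<lambda>x. x \<in> E \<inter> {..<c}) (lower_end a)"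
    using eventually_in_einterval(1)[OF ab] by eventually_elim auto
  moreover have "\<forall>x\<in>E \<inter> {..<c}. P x" using c(2) by (auto simp: einterval_def)
  ultimately show ?thesis by (intro exI[of _ "E \<inter> {..<c}"]) (auto simp: open_Int)
qed

lemma upper_open:
  assumes "eventually P (upper_end b)"
  shows "\<exists>S. open S \<and> S \<subseteq> E \<and> (\<forall>x\<in>S. P x) \<and> eventually (\<lambda>x. x \<in> S) (upper_end b)"
proof -
  obtain c where c: "ereal c < b" "\<And>x. ereal x < b \<Longrightarrow> c < x \<Longrightarrow> P x"
    using assms unfolding eventually_upper by blast
  have "eventually (\<lambda>x. c < x) (upper_end b)" unfolding eventually_upper using c(1) by blast
  then have "eventually (\<lambda>x. x \<in> E \<inter> {c<..}) (upper_end b)"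
    using eventually_in_einterval(2)[OF ab] by eventually_elim auto
  moreover have "\<forall>x\<in>E \<inter> {c<..}. P x" using c(2) by (auto simp: einterval_def)
  ultimately show ?thesis by (intro exI[of _ "E \<inter> {c<..}"]) (auto simp: open_Int)
qed

lemma Q_germ:
  assumes y: "y \<in> Dm" and z: "z \<in> Dm"
  shows "eventually (\<lambda>x. y x = z x) F \<Longrightarrow> eventually (\<lambda>x. Q y x = Q z x) F"
    and "eventually (\<lambda>x. y x = z x) F' \<Longrightarrow> eventually (\<lambda>x. Q y x = Q z x) F'"
proof -
  have *: "eventually (\<lambda>x. Q y x = Q z x) A"
    if "eventually (\<lambda>x. y x = z x) A" "A = lower_end a \<or> A = upper_end b" for A
  proof -
    have "\<exists>S. open S \<and> S \<subseteq> E \<and> (\<forall>x\<in>S. y x = z x) \<and> eventually (\<lambda>x. x \<in> S) A"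
      using that(2)
    proof
      assume A: "A = lower_end a"
      show ?thesis by (rule lower_open[OF that(1)[unfolded A], folded A])
    next
      assume A: "A = upper_end b"
      show ?thesis by (rule upper_open[OF that(1)[unfolded A], folded A])
    qed
    then obtain S where S: "open S" "S \<subseteq> E" "\<And>x. x \<in> S \<Longrightarrow> y x = z x" "eventually (\<lambda>x. x \<in> S) A" by blast
    show ?thesis
      using S(4) by eventually_elim (rule qd_local[OF adm DmaxD(1)[OF y] DmaxD(1)[OF z] S(3) S(1) _ S(2)])
  qed
  show "eventually (\<lambda>x. Q y x = Q z x) F" if "eventually (\<lambda>x. y x = z x) F" by (rule *[OF that]) (use ends in blast)
  show "eventually (\<lambda>x. Q y x = Q z x) F'" if "eventually (\<lambda>x. y x = z x) F'" by (rule *[OF that]) (use ends in blast)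
qed

lemma Q_zero_germ:
  assumes y: "y \<in> Dm"
  shows "eventually (\<lambda>x. y x = 0) F \<Longrightarrow> eventually (\<lambda>x. Q y x = 0) F"
    and "eventually (\<lambda>x. y x = 0) F' \<Longrightarrow> eventually (\<lambda>x. Q y x = 0) F'"
proof -
  show "eventually (\<lambda>x. Q y x = 0) F" if "eventually (\<lambda>x. y x = 0) F"
    using Q_germ(1)[OF y zero_D_max(1) that] ev_E(1) by eventually_elim (simp add: zero_D_max(3))
  show "eventually (\<lambda>x. Q y x = 0) F'" if "eventually (\<lambda>x. y x = 0) F'"
    using Q_germ(2)[OF y zero_D_max(1) that] ev_E(2) by eventually_elim (simp add: zero_D_max(3))
qed

lemma localize:
  assumes y: "y \<in> Dm"
  shows "\<exists>y1\<in>Dm. eventually (\<lambda>x. y1 x = y x) F \<and> eventually (\<lambda>x. y1 x = 0) F'"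
proof -
  obtain c d where cd: "c < d" "{c..d} \<subseteq> E" using einterval_Icc[OF ab] by blast
  have c: "a < ereal c" "ereal d < b" using cd Icc_subset_einterval[of c d a b] by auto
  obtain y1 where y1: "y1 \<in> Dm" "\<forall>x. x < c \<longrightarrow> y1 x = y x" "\<forall>x. x > d \<longrightarrow> y1 x = 0"
    using cutoff[OF y cd] by blast
  have l: "eventually (\<lambda>x. y1 x = y x) (lower_end a)" unfolding eventually_lower using c(1) y1(2) by blast
  have u: "eventually (\<lambda>x. y1 x = 0) (upper_end b)" unfolding eventually_upper using c(2) y1(3) by blast
  \<comment> \<open>\<open>cutoff\<close> preserves the function near \<open>a\<close> only; near
    \<open>b\<close> the complementary part \<open>y - y1\<close> does the job.\<close>
  have d: "(\<lambda>x. 1 * y x + (- 1) * y1 x) \<in> Dm" by (rule D_max_combine[OF y y1(1)])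
  have l': "eventually (\<lambda>x. 1 * y x + (- 1) * y1 x = 0) (lower_end a)" using l by eventually_elim simp
  have u': "eventually (\<lambda>x. 1 * y x + (- 1) * y1 x = y x) (upper_end b)" using u by eventually_elim simp
  show ?thesis using ends
  proof
    assume "e = a \<and> F = lower_end a \<and> F' = upper_end b \<and> G = lower_end"
    then show ?thesis using y1(1) l u by auto
  next
    assume "e = b \<and> F = upper_end b \<and> F' = lower_end a \<and> G = upper_end"
    then show ?thesis using d l' u' by (intro bexI[OF _ d]) simp
  qed
qed

lemma compactly_supportedI:
  assumes "eventually (\<lambda>x. y x = 0) F" "eventually (\<lambda>x. y x = 0) F'"
  shows "compactly_supported a b y"
proof -
  have "eventually (\<lambda>x. y x = 0) (lower_end a)" "eventually (\<lambda>x. y x = 0) (upper_end b)" using assms ends by auto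
  then obtain c d where c: "a < ereal c" "\<And>x. a < ereal x \<Longrightarrow> x < c \<Longrightarrow> y x = 0"
    and d: "ereal d < b" "\<And>x. ereal x < b \<Longrightarrow> d < x \<Longrightarrow> y x = 0"
    unfolding eventually_lower eventually_upper by blast
  obtain c0 d0 where 0: "c0 < d0" "{c0..d0} \<subseteq> E" using einterval_Icc[OF ab] by blast
  have "a < ereal c0" "ereal d0 < b" using 0 Icc_subset_einterval[of c0 d0 a b] by auto
  then have "{min c c0..max d d0} \<subseteq> E"
    using 0(1) c(1) d(1) by (subst Icc_subset_einterval) (auto simp: min_def max_def)
  moreover have "\<forall>x\<in>E - {min c c0..max d d0}. y x = 0" using c(2) d(2) by (force simp: einterval_def)
  ultimately show ?thesis unfolding compactly_supported_def by (intro exI[of _ "{min c c0..max d d0}"]) simp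
qed

lemma bracket_limit:
  assumes "y \<in> Dm" "z \<in> Dm"
  shows "\<exists>A. (bracket (qd K a b y) (qd K a b z) \<longlongrightarrow> A) F"
  using green[OF assms] ends by auto

lemma bracket_zero_germ:
  assumes "eventually (\<lambda>x. Q y x = 0) A"
  shows "(bracket (qd K a b y) (qd K a b z) \<longlongrightarrow> 0) A"
proof (rule Lim_transform_eventually[OF tendsto_const])
  show "eventually (\<lambda>x. 0 = bracket (qd K a b y) (qd K a b z) x) A"
    using assms by eventually_elim (simp add: bracket_zero)
qed

text \<open>As \<open>y\<close> vanishes near the other end, Green's formula has no boundary term
  there, and symmetry of the pair makes the term at \<open>e\<close> vanish too.\<close>

lemma green_sym:
  assumes y: "y \<in> Dm" and z: "z \<in> Dm" and sym: "ip (L y) z = ip y (L z)" and 0: "eventually (\<lambda>x. y x = 0) F'"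
  shows "(bracket (qd K a b y) (qd K a b z) \<longlongrightarrow> 0) F"
proof -
  let ?b = "bracket (qd K a b y) (qd K a b z)"
  have 0: "(?b \<longlongrightarrow> 0) F'" by (rule bracket_zero_germ[OF Q_zero_germ(2)[OF y 0]])
  obtain A B where AB: "(?b \<longlongrightarrow> A) (lower_end a)" "(?b \<longlongrightarrow> B) (upper_end b)" "ip (L y) z - ip y (L z) = B - A"
    using green[OF y z] by blast
  have "A = B" using AB(3) sym by simp
  then have "(?b \<longlongrightarrow> A) F" "(?b \<longlongrightarrow> A) F'" using AB(1,2) ends by auto
  then show ?thesis using tendsto_unique[OF F_ne(2) 0] by auto
qed

lemma bracket_skew_limit: "(bracket Y Z \<longlongrightarrow> 0) A \<Longrightarrow> (bracket Z Y \<longlongrightarrow> 0) A"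
proof -
  assume "(bracket Y Z \<longlongrightarrow> 0) A"
  then have "((\<lambda>x. - cnj (bracket Y Z x)) \<longlongrightarrow> - cnj 0) A" by (intro tendsto_intros)
  then show ?thesis by (simp add: bracket_skew[symmetric])
qed

lemma Q_limit_interior:
  assumes "y \<in> Dm" "x \<in> E"
  shows "(Q y \<longlongrightarrow> Q y x) (G (ereal x))"
  using isCont_quad[OF assms] unfolding isCont_def by (rule tendsto_mono[OF G_le])

lemma truncation_filterlim:
  assumes t: "\<And>j. t j \<in> E" and lim: "(\<lambda>j. ereal (t j)) \<longlonglongrightarrow> e"
  shows "filterlim t F sequentially"
proof -
  have tj: "a < ereal (t j)" "ereal (t j) < b" for j using t[of j] by (auto simp: einterval_def)
  have "filterlim (\<lambda>j. ereal (t j)) (at_right a) sequentially" if "e = a"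
    unfolding filterlim_at using lim tj(1) that by (intro conjI always_eventually allI) (auto dest: less_imp_neq simp: less_imp_neq[OF tj(1), THEN not_sym])
  moreover have "filterlim (\<lambda>j. ereal (t j)) (at_left b) sequentially" if "e = b"
    unfolding filterlim_at using lim tj(2) that by (intro conjI always_eventually allI) (auto simp: less_imp_neq[OF tj(2)])
  ultimately show ?thesis using ends
    by (auto simp: lower_end_def upper_end_def filterlim_filtercomap_iff o_def)
qed

lemma germ_space_bracket:
  assumes h: "h \<in> Dm"
  shows "germ_space F {y \<in> Dm. (bracket (qd K a b y) (qd K a b h) \<longlongrightarrow> 0) F}"
  unfolding germ_space_def
proof (intro conjI allI ballI impI)
  show "(\<lambda>x. 0) \<in> {y \<in> Dm. (bracket (qd K a b y) (qd K a b h) \<longlongrightarrow> 0) F}"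
    using zero_D_max(1) bracket_zero_germ[OF Q_zero_germ(1)[OF zero_D_max(1)]] by simp
next
  fix \<alpha> \<beta> y z
  assume y: "y \<in> {y \<in> Dm. (bracket (qd K a b y) (qd K a b h) \<longlongrightarrow> 0) F}"
    and z: "z \<in> {y \<in> Dm. (bracket (qd K a b y) (qd K a b h) \<longlongrightarrow> 0) F}"
  let ?u = "\<lambda>x. \<alpha> * y x + \<beta> * z x"
  have u: "?u \<in> Dm" using y z by (intro D_max_combine) auto
  have "eventually (\<lambda>x. \<alpha> * bracket (qd K a b y) (qd K a b h) x + \<beta> * bracket (qd K a b z) (qd K a b h) x
      = bracket (qd K a b ?u) (qd K a b h) x) F"
    using ev_E(1)
  proof eventually_elim
    case (elim x)
    show ?case using y z quad_qd_combine[of y z x \<alpha> \<beta>] elim by (simp add: bracket_sform sform_combine_left)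
  qed
  moreover have "((\<lambda>x. \<alpha> * bracket (qd K a b y) (qd K a b h) x + \<beta> * bracket (qd K a b z) (qd K a b h) x) \<longlongrightarrow> \<alpha> * 0 + \<beta> * 0) F"
    using y z by (intro tendsto_intros) auto
  ultimately have "(bracket (qd K a b ?u) (qd K a b h) \<longlongrightarrow> \<alpha> * 0 + \<beta> * 0) F"
    using Lim_transform_eventually by fast
  then show "?u \<in> {y \<in> Dm. (bracket (qd K a b y) (qd K a b h) \<longlongrightarrow> 0) F}" using u by simp
next
  fix y z
  assume y: "y \<in> {y \<in> Dm. (bracket (qd K a b y) (qd K a b h) \<longlongrightarrow> 0) F}" and z: "z \<in> Dm"
    and eq: "eventually (\<lambda>x. y x = z x) F"
  have "eventually (\<lambda>x. bracket (qd K a b y) (qd K a b h) x = bracket (qd K a b z) (qd K a b h) x) F"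
    using Q_germ(1)[OF _ z eq] y by (auto simp: bracket_sform elim: eventually_mono)
  then have "(bracket (qd K a b z) (qd K a b h) \<longlongrightarrow> 0) F"
    using y Lim_transform_eventually by fast
  then show "z \<in> {y \<in> Dm. (bracket (qd K a b y) (qd K a b h) \<longlongrightarrow> 0) F}" using z by simp
qed auto

lemma germ_space_span:
  shows "germ_space F {y \<in> Dm. \<exists>c1 c2. eventually (\<lambda>x. y x = c1 * h1 x + c2 * h2 x) F}"
  unfolding germ_space_def
proof (intro conjI allI ballI impI)
  show "(\<lambda>x. 0) \<in> {y \<in> Dm. \<exists>c1 c2. eventually (\<lambda>x. y x = c1 * h1 x + c2 * h2 x) F}"
    using zero_D_max(1) by (auto intro!: exI[of _ 0])
next
  fix \<alpha> \<beta> y z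
  assume y: "y \<in> {y \<in> Dm. \<exists>c1 c2. eventually (\<lambda>x. y x = c1 * h1 x + c2 * h2 x) F}"
    and z: "z \<in> {y \<in> Dm. \<exists>c1 c2. eventually (\<lambda>x. y x = c1 * h1 x + c2 * h2 x) F}"
  then obtain c1 c2 d1 d2 where "eventually (\<lambda>x. y x = c1 * h1 x + c2 * h2 x) F" "eventually (\<lambda>x. z x = d1 * h1 x + d2 * h2 x) F"
    by blast
  then have "eventually (\<lambda>x. \<alpha> * y x + \<beta> * z x = (\<alpha> * c1 + \<beta> * d1) * h1 x + (\<alpha> * c2 + \<beta> * d2) * h2 x) F"
    by eventually_elim (simp add: algebra_simps)
  moreover have "(\<lambda>x. \<alpha> * y x + \<beta> * z x) \<in> Dm" using y z by (intro D_max_combine) auto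
  ultimately show "(\<lambda>x. \<alpha> * y x + \<beta> * z x) \<in> {y \<in> Dm. \<exists>c1 c2. eventually (\<lambda>x. y x = c1 * h1 x + c2 * h2 x) F}" by blast
next
  fix y z
  assume y: "y \<in> {y \<in> Dm. \<exists>c1 c2. eventually (\<lambda>x. y x = c1 * h1 x + c2 * h2 x) F}" and z: "z \<in> Dm"
    and eq: "eventually (\<lambda>x. y x = z x) F"
  then obtain c1 c2 where "eventually (\<lambda>x. y x = c1 * h1 x + c2 * h2 x) F" by blast
  then have "eventually (\<lambda>x. z x = c1 * h1 x + c2 * h2 x) F" using eq by eventually_elim simp
  then show "z \<in> {y \<in> Dm. \<exists>c1 c2. eventually (\<lambda>x. y x = c1 * h1 x + c2 * h2 x) F}" using z by blast
qed auto

lemma germ_space_limit: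
  assumes V: "csubspace V" and lim: "\<And>y. y \<in> Dm \<Longrightarrow> \<exists>q. (Q y \<longlongrightarrow> q) F"
  shows "germ_space F {y \<in> Dm. \<exists>q\<in>V. (Q y \<longlongrightarrow> q) F}"
  unfolding germ_space_def
proof (intro conjI allI ballI impI)
  have "eventually (\<lambda>x. 0 = Q (\<lambda>x. 0) x) F" using ev_E(1) by eventually_elim (simp add: zero_D_max(3))
  then have "(Q (\<lambda>x. 0) \<longlongrightarrow> 0) F" by (rule Lim_transform_eventually[OF tendsto_const])
  then show "(\<lambda>x. 0) \<in> {y \<in> Dm. \<exists>q\<in>V. (Q y \<longlongrightarrow> q) F}" using V zero_D_max(1) by (auto simp: csubspace_def)
next
  fix \<alpha> \<beta> y z
  assume y: "y \<in> {y \<in> Dm. \<exists>q\<in>V. (Q y \<longlongrightarrow> q) F}" and z: "z \<in> {y \<in> Dm. \<exists>q\<in>V. (Q y \<longlongrightarrow> q) F}"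
  then obtain q r where q: "q \<in> V" "(Q y \<longlongrightarrow> q) F" and r: "r \<in> V" "(Q z \<longlongrightarrow> r) F" by blast
  let ?u = "\<lambda>x. \<alpha> * y x + \<beta> * z x"
  have "((\<lambda>x. qscale \<alpha> (Q y x) + qscale \<beta> (Q z x)) \<longlongrightarrow> qscale \<alpha> q + qscale \<beta> r) F"
    using q(2) r(2) by (intro tendsto_add tendsto_qscale)
  moreover have "eventually (\<lambda>x. qscale \<alpha> (Q y x) + qscale \<beta> (Q z x) = Q ?u x) F"
    using ev_E(1)
  proof eventually_elim
    case (elim x)
    show ?case using y z quad_qd_combine[of y z x \<alpha> \<beta>] elim by simp
  qed
  ultimately have "(Q ?u \<longlongrightarrow> qscale \<alpha> q + qscale \<beta> r) F" by (rule Lim_transform_eventually)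
  moreover have "qscale \<alpha> q + qscale \<beta> r \<in> V" using V q(1) r(1) unfolding csubspace_def by blast
  moreover have "?u \<in> Dm" using y z by (intro D_max_combine) auto
  ultimately show "?u \<in> {y \<in> Dm. \<exists>q\<in>V. (Q y \<longlongrightarrow> q) F}" by blast
next
  fix y z
  assume y: "y \<in> {y \<in> Dm. \<exists>q\<in>V. (Q y \<longlongrightarrow> q) F}" and z: "z \<in> Dm" and eq: "eventually (\<lambda>x. y x = z x) F"
  then obtain q where q: "q \<in> V" "(Q y \<longlongrightarrow> q) F" by blast
  have "(Q z \<longlongrightarrow> q) F"
    by (rule Lim_transform_eventually[OF q(2) Q_germ(1)[OF _ z eq]]) (use y in simp)
  then show "z \<in> {y \<in> Dm. \<exists>q\<in>V. (Q y \<longlongrightarrow> q) F}" using q(1) z by blast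
qed auto

end

section \<open>Truncated boundary conditions\<close>

lemma absolutely_integrable_left:
  assumes f: "locally_integrable a b f" and c: "c \<in> einterval a b \<or> ereal c = a \<and> integrable_near (lower_end a) f"
    and cd: "c < d" "ereal d < b"
  shows "f absolutely_integrable_on {c..d}"
proof (cases "c \<in> einterval a b")
  case True
  then have "{c..d} \<subseteq> einterval a b" using cd by (subst Icc_subset_einterval) (auto simp: einterval_def)
  then show ?thesis using f by (simp add: locally_integrable_def)
next
  case False
  with c have a: "a = ereal c" and n: "integrable_near (lower_end a) f" by auto
  obtain S where S: "eventually (\<lambda>x. x \<in> S) (lower_end a)" "set_integrable lebesgue S f"
    using n unfolding integrable_near_def by blast
  obtain c1 where c1: "c < c1" "\<And>x. c < x \<Longrightarrow> x < c1 \<Longrightarrow> x \<in> S"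
    using S(1) eventually_lower_end[of a] unfolding a by auto
  \<comment> \<open>Chosen so that the part next to the endpoint lies in the integrability set
    \<open>S\<close>, while \<open>{m..d}\<close> is compact in \<open>(a,b)\<close>.\<close>
  define m where "m = (c + min c1 d) / 2"
  have m: "c < m" "m < c1" "m < d" using c1(1) cd(1) by (auto simp: m_def min_def)
  have "f absolutely_integrable_on {c<..m}"
    by (rule set_integrable_subset[OF S(2)]) (use c1(2) m(2) in auto)
  moreover have "{m..d} \<subseteq> einterval a b" using m cd(2) by (subst Icc_subset_einterval) (auto simp: a)
  then have "f absolutely_integrable_on {m..d}" using f by (simp add: locally_integrable_def)
  ultimately have "f absolutely_integrable_on {c<..m} \<union> {m..d}" by (intro set_integrable_Un) auto
  then show ?thesis
    by (rule absolutely_integrable_spike_set) (use m in \<open>auto intro: negligible_subset[of "{c}"]\<close>)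
qed

lemma absolutely_integrable_right:
  assumes f: "locally_integrable a b f" and d: "d \<in> einterval a b \<or> ereal d = b \<and> integrable_near (upper_end b) f"
    and cd: "c < d" "a < ereal c"
  shows "f absolutely_integrable_on {c..d}"
proof (cases "d \<in> einterval a b")
  case True
  then have "{c..d} \<subseteq> einterval a b" using cd by (subst Icc_subset_einterval) (auto simp: einterval_def)
  then show ?thesis using f by (simp add: locally_integrable_def)
next
  case False
  with d have b: "b = ereal d" and n: "integrable_near (upper_end b) f" by auto
  obtain S where S: "eventually (\<lambda>x. x \<in> S) (upper_end b)" "set_integrable lebesgue S f"
    using n unfolding integrable_near_def by blast
  obtain d1 where d1: "d1 < d" "\<And>x. x < d \<Longrightarrow> d1 < x \<Longrightarrow> x \<in> S"
    using S(1) eventually_upper_end[of b] unfolding b by auto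
  define m where "m = (d + max d1 c) / 2"
  have m: "m < d" "d1 < m" "c < m" using d1(1) cd(1) by (auto simp: m_def max_def)
  have "f absolutely_integrable_on {m..<d}"
    by (rule set_integrable_subset[OF S(2)]) (use d1(2) m(2) in auto)
  moreover have "{c..m} \<subseteq> einterval a b" using m cd(2) by (subst Icc_subset_einterval) (auto simp: b)
  then have "f absolutely_integrable_on {c..m}" using f by (simp add: locally_integrable_def)
  ultimately have "f absolutely_integrable_on {c..m} \<union> {m..<d}" by (intro set_integrable_Un) auto
  then show ?thesis
    by (rule absolutely_integrable_spike_set) (use m in \<open>auto intro: negligible_subset[of "{d}"]\<close>)
qed

text \<open>Cutting at the midpoint separates the two ends; each truncation point is either
  interior, where local integrability suffices, or a regular endpoint.\<close>

lemma regular_on_truncation: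
  assumes K: "admissible K a b" and cd: "c < d"
    and c: "c \<in> einterval a b \<or> ereal c = a \<and> regular_end K a (lower_end a)"
    and d: "d \<in> einterval a b \<or> ereal d = b \<and> regular_end K b (upper_end b)"
  shows "regular_on K c d" "einterval (ereal c) (ereal d) \<subseteq> einterval a b"
proof -
  have le: "a \<le> ereal c" "ereal d \<le> b" using c d by (auto simp: einterval_def)
  then show sub: "einterval (ereal c) (ereal d) \<subseteq> einterval a b"
    using le_less_trans[of a "ereal c"] less_le_trans[of _ "ereal d" b] by (auto simp: einterval_def)
  define m where "m = (c + d) / 2"
  have m: "c < m" "m < d" using cd by (auto simp: m_def)
  then have m': "a < ereal m" "ereal m < b" using le le_less_trans[of a "ereal c" "ereal m"] less_le_trans[of "ereal m" "ereal d" b] by auto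
  have ai: "f absolutely_integrable_on {c..d}"
    if "locally_integrable a b f" "regular_end K a (lower_end a) \<longrightarrow> integrable_near (lower_end a) f"
      "regular_end K b (upper_end b) \<longrightarrow> integrable_near (upper_end b) f" for f
  proof -
    have "f absolutely_integrable_on {c..m}"
      by (rule absolutely_integrable_left[OF that(1) _ m(1) m'(2)]) (use c that(2) in blast)
    moreover have "f absolutely_integrable_on {m..d}"
      by (rule absolutely_integrable_right[OF that(1) _ m(2) m'(1)]) (use d that(3) in blast)
    ultimately have "f absolutely_integrable_on {c..m} \<union> {m..d}" by (intro set_integrable_Un) auto
    moreover have "{c..m} \<union> {m..d} = {c..d}" using m by auto
    ultimately show ?thesis by simp
  qed
  have "AE x in lebesgue. x \<in> {c<..<d} \<longrightarrow> coef_p K x > 0 \<and> coef_w K x > 0"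
  proof -
    have "AE x in lebesgue. x \<in> einterval a b \<longrightarrow> coef_p K x > 0 \<and> coef_w K x > 0"
      using K by (simp add: admissible_def)
    then show ?thesis by eventually_elim (use sub in \<open>auto simp: einterval_def\<close>)
  qed
  moreover have "locally_integrable a b (\<lambda>x. 1 / coef_p K x)" "locally_integrable a b (coef_s K)"
    "locally_integrable a b (coef_q K)" "locally_integrable a b (coef_w K)"
    using K by (simp_all add: admissible_def)
  ultimately show "regular_on K c d"
    unfolding regular_on_def using cd by (intro conjI ai) (auto simp: regular_end_def)
qed

lemma D_max_limits:
  assumes K: "admissible K a b" and r: "regular_on K c d" and sub: "einterval (ereal c) (ereal d) \<subseteq> einterval a b"
    and y: "y \<in> D_max K a b"
  shows "\<exists>q. (quad (qd K a b y) \<longlongrightarrow> q) (at_right c)" "\<exists>q. (quad (qd K a b y) \<longlongrightarrow> q) (at_left d)"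
proof -
  interpret weighted_l2 K a b by unfold_locales (rule K)
  have cd: "ereal c < ereal d" using r by (simp add: regular_on_def)
  have Y: "qsys_on K (ereal c) (ereal d) (L y) (qd K a b y)"
    by (rule qsys_on_subset[OF qd_qsys_on(1)[OF K DmaxD(1)[OF y]] sub])
  have w: "(\<lambda>t. coef_w K t *\<^sub>R L y t) absolutely_integrable_on {c..d}"
    by (rule weighted_absolutely_integrable[OF r admissible_subset[OF K cd sub] L2w_subset[OF sub DmaxD(3)[OF y]]])
  show "\<exists>q. (quad (qd K a b y) \<longlongrightarrow> q) (at_right c)" "\<exists>q. (quad (qd K a b y) \<longlongrightarrow> q) (at_left d)"
    using regular_limits[OF r w Y] by blast+
qed

section \<open>Reduction of the boundary conditions by endpoint type\<close>

context endpoint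
begin

lemma Q_limit_regular:
  assumes r: "regular_end K e F" and y: "y \<in> Dm"
  shows "\<exists>q. (Q y \<longlongrightarrow> q) F"
proof -
  obtain c d where cd: "c < d" "{c..d} \<subseteq> E" using einterval_Icc[OF ab] by blast
  then have E: "c \<in> E" "d \<in> E" by auto
  obtain e0 where e0: "e = ereal e0" using r by (cases e) (auto simp: regular_end_def)
  show ?thesis using ends
  proof
    assume *: "e = a \<and> F = lower_end a \<and> F' = upper_end b \<and> G = lower_end"
    have ed: "e0 < d" using * E(2) e0 by (auto simp: einterval_def)
    have e0c: "e0 \<in> E \<or> ereal e0 = a \<and> regular_end K a (lower_end a)" using r * e0 by auto
    note reg = regular_on_truncation[OF adm ed e0c disjI1[OF E(2)]]
    have "F = at_right e0" using * e0 by (simp add: lower_end_ereal[symmetric])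
    then show ?thesis using D_max_limits(1)[OF adm reg y] by simp
  next
    assume *: "e = b \<and> F = upper_end b \<and> F' = lower_end a \<and> G = upper_end"
    have ce: "c < e0" using * E(1) e0 by (auto simp: einterval_def)
    have e0c: "e0 \<in> E \<or> ereal e0 = b \<and> regular_end K b (upper_end b)" using r * e0 by auto
    note reg = regular_on_truncation[OF adm ce disjI1[OF E(1)] e0c]
    have "F = at_left e0" using * e0 by (simp add: upper_end_ereal[symmetric])
    then show ?thesis using D_max_limits(2)[OF adm reg y] by simp
  qed
qed

text \<open>
  \<open>P\<close> consists of elements of the domain whose restrictions satisfy the truncated conditions, given
  by the isotropic spaces \<open>V j\<close> of boundary values, for all large \<open>j\<close>.  The alternative says that
  shrinking the domain to \<open>P\<close> loses no boundary condition of the adjoint: either \<open>P\<close> is everything,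
  or \<open>B\<close> can be recovered by testing with \<open>P\<close> in the bracket.
\<close>

definition reduces :: "(nat \<Rightarrow> real filter) \<Rightarrow> nat \<Rightarrow> ((nat \<Rightarrow> real \<Rightarrow> complex) \<Rightarrow> bool) \<Rightarrow>
    (nat \<Rightarrow> (nat \<Rightarrow> real \<Rightarrow> complex) \<Rightarrow> bool) \<Rightarrow> (real \<Rightarrow> complex) set \<Rightarrow> (nat \<Rightarrow> quad set) \<Rightarrow> bool" where
  "reduces Ft N B Bt P V \<longleftrightarrow>
     germ_space F {y \<in> Dm. B (qd K a b y)} \<and> germ_space F P \<and> P \<subseteq> {y \<in> Dm. B (qd K a b y)} \<and>
     ({y \<in> Dm. B (qd K a b y)} \<subseteq> P \<or>
       (\<forall>g\<in>Dm. (\<forall>c\<in>P. eventually (\<lambda>x. c x = 0) F' \<longrightarrow> (bracket (qd K a b c) (qd K a b g) \<longlongrightarrow> 0) F) \<longrightarrow> B (qd K a b g))) \<and>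
     (\<forall>j\<ge>N. isotropic (V j) \<and> (\<forall>Y q. (quad Y \<longlongrightarrow> q) (Ft j) \<longrightarrow> (Bt j Y \<longleftrightarrow> q \<in> V j))) \<and>
     (\<forall>y\<in>P. eventually (\<lambda>j. \<exists>q\<in>V j. (Q y \<longlongrightarrow> q) (Ft j)) sequentially)"

text \<open>Nothing is truncated, so \<open>P\<close> is the full set given by the condition and the
  first alternative holds.\<close>

lemma reduces_regular:
  assumes r: "regular_end K e F" and t: "\<And>j. ereal (t j) = e" and A: "self_adjoint_bc A1 A2"
  shows "\<exists>P V. reduces (\<lambda>j. G (ereal (t j))) N (bc_matrix A1 A2 F) (\<lambda>j. bc_matrix A1 A2 (G (ereal (t j)))) P V"
proof -
  let ?V = "bc_space A1 A2"
  have Ft: "G (ereal (t j)) = F" for j using t F_G by simp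
  have iff: "bc_matrix A1 A2 F (qd K a b y) \<longleftrightarrow> (\<exists>q\<in>?V. (Q y \<longlongrightarrow> q) F)" if y: "y \<in> Dm" for y
  proof -
    obtain q where q: "(Q y \<longlongrightarrow> q) F" using Q_limit_regular[OF r y] by blast
    show ?thesis using bc_matrix_iff[OF q F_ne(1)] q tendsto_unique[OF F_ne(1) q] by blast
  qed
  have eq: "{y \<in> Dm. bc_matrix A1 A2 F (qd K a b y)} = {y \<in> Dm. \<exists>q\<in>?V. (Q y \<longlongrightarrow> q) F}" using iff by blast
  have gs: "germ_space F {y \<in> Dm. \<exists>q\<in>?V. (Q y \<longlongrightarrow> q) F}"
    by (rule germ_space_limit[OF csubspace_bc_space Q_limit_regular[OF r]])
  have "reduces (\<lambda>j. G (ereal (t j))) N (bc_matrix A1 A2 F) (\<lambda>j. bc_matrix A1 A2 (G (ereal (t j))))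
      {y \<in> Dm. \<exists>q\<in>?V. (Q y \<longlongrightarrow> q) F} (\<lambda>j. ?V)"
    unfolding reduces_def eq Ft
  proof (intro conjI)
    show "\<forall>j\<ge>N. isotropic ?V \<and> (\<forall>Y q. (quad Y \<longlongrightarrow> q) F \<longrightarrow> bc_matrix A1 A2 F Y = (q \<in> ?V))"
      using isotropic_bc_space[OF A] bc_matrix_iff[OF _ F_ne(1)] by blast
  qed (use gs in auto)
  then show ?thesis by blast
qed

lemma tendsto_dirichlet:
  assumes q: "(quad Y \<longlongrightarrow> q) A" and A: "A \<noteq> bot"
  shows "Lim A (Y 0) = fst q" "Lim A (Y 1) = fst (snd q)"
  using tendsto_fst[OF q] tendsto_fst[OF tendsto_snd[OF q]] by (auto simp: quad_def intro!: tendsto_Lim[OF A])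

text \<open>Functions vanishing near \<open>e\<close> meet the homogeneous conditions at every late
  truncation point, and there is no condition of L to recover.\<close>

lemma reduces_lim2:
  assumes t: "\<And>j. t j \<in> E" and lim: "(\<lambda>j. ereal (t j)) \<longlonglongrightarrow> e"
  shows "\<exists>P V. reduces (\<lambda>j. G (ereal (t j))) N (\<lambda>Y. True)
    (\<lambda>j Y. Lim (G (ereal (t j))) (Y 0) = 0 \<and> Lim (G (ereal (t j))) (Y 1) = 0) P V"
proof -
  \<comment> \<open>Vanishing germs are written as a span of zero functions in order to reuse the
    lemma on two generators.\<close>
  define P where "P = {y \<in> Dm. \<exists>c1 c2. eventually (\<lambda>x. y x = c1 * (\<lambda>x. 0) x + c2 * (\<lambda>x. 0) x) F}"
  have P: "P = {y \<in> Dm. eventually (\<lambda>x. y x = 0) F}" by (simp add: P_def)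
  have gP: "germ_space F P" unfolding P_def by (rule germ_space_span)
  have gD: "germ_space F {y \<in> Dm. True}" using zero_D_max(1) D_max_combine by (auto simp: germ_space_def)
  have "reduces (\<lambda>j. G (ereal (t j))) N (\<lambda>Y. True)
    (\<lambda>j Y. Lim (G (ereal (t j))) (Y 0) = 0 \<and> Lim (G (ereal (t j))) (Y 1) = 0) P (\<lambda>j. {y. fst y = 0 \<and> fst (snd y) = 0})"
    unfolding reduces_def
  proof (intro conjI gP gD)
    show "P \<subseteq> {y \<in> Dm. True}" using P by blast
    show "\<forall>j\<ge>N. isotropic {y. fst y = 0 \<and> fst (snd y) = 0} \<and>
          (\<forall>Y q. (quad Y \<longlongrightarrow> q) (G (ereal (t j))) \<longrightarrow>
            (Lim (G (ereal (t j))) (Y 0) = 0 \<and> Lim (G (ereal (t j))) (Y 1) = 0) =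
            (q \<in> {y. fst y = 0 \<and> fst (snd y) = 0}))"
      using isotropic_dirichlet tendsto_dirichlet[OF _ G_ne] by auto
    show "\<forall>y\<in>P. eventually (\<lambda>j. \<exists>q\<in>{y. fst y = 0 \<and> fst (snd y) = 0}. (Q y \<longlongrightarrow> q) (G (ereal (t j)))) sequentially"
    proof
      fix y assume y: "y \<in> P"
      then have "eventually (\<lambda>x. Q y x = 0) F" using P Q_zero_germ(1) by blast
      then have "eventually (\<lambda>j. Q y (t j) = 0) sequentially"
        by (rule eventually_compose_filterlim[OF _ truncation_filterlim[OF t lim]])
      then show "eventually (\<lambda>j. \<exists>q\<in>{y. fst y = 0 \<and> fst (snd y) = 0}. (Q y \<longlongrightarrow> q) (G (ereal (t j)))) sequentially"
      proof eventually_elim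
        case (elim j)
        show ?case using Q_limit_interior[of y "t j"] y P t elim by (intro bexI[of _ 0]) auto
      qed
    qed
  qed simp
  then show ?thesis by blast
qed

lemma Q_span_germ:
  assumes y: "y \<in> Dm" and h: "h1 \<in> Dm" "h2 \<in> Dm" and eq: "eventually (\<lambda>x. y x = c1 * h1 x + c2 * h2 x) F"
  shows "eventually (\<lambda>x. Q y x = qscale c1 (Q h1 x) + qscale c2 (Q h2 x)) F"
  using Q_germ(1)[OF y D_max_combine[OF h] eq] ev_E(1)
  by eventually_elim (simp add: quad_qd_combine[OF h])

lemma bracket_span_limit:
  assumes y: "y \<in> Dm" and h: "h1 \<in> Dm" "h2 \<in> Dm" and eq: "eventually (\<lambda>x. y x = c1 * h1 x + c2 * h2 x) F"
    and l: "(bracket (qd K a b h1) (qd K a b h) \<longlongrightarrow> 0) F" "(bracket (qd K a b h2) (qd K a b h) \<longlongrightarrow> 0) F"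
  shows "(bracket (qd K a b y) (qd K a b h) \<longlongrightarrow> 0) F"
proof -
  have "((\<lambda>x. c1 * bracket (qd K a b h1) (qd K a b h) x + c2 * bracket (qd K a b h2) (qd K a b h) x) \<longlongrightarrow> c1 * 0 + c2 * 0) F"
    by (intro tendsto_intros l)
  moreover have "eventually (\<lambda>x. c1 * bracket (qd K a b h1) (qd K a b h) x + c2 * bracket (qd K a b h2) (qd K a b h) x
      = bracket (qd K a b y) (qd K a b h) x) F"
    using Q_span_germ[OF y h eq] by eventually_elim (simp add: bracket_sform sform_combine_left)
  ultimately show ?thesis using Lim_transform_eventually by fastforce
qed

text \<open>The first boundary row at \<open>t j\<close> is the boundary vector of \<open>h\<close>
  itself. Isotropy of the rows therefore says that \<open>h\<close> satisfies both truncated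
  conditions, whatever the second one is; testing an adjoint element with \<open>h\<close> recovers
  the condition of L.\<close>

lemma reduces_lim3:
  assumes t: "\<And>j. t j \<in> E" and lim: "(\<lambda>j. ereal (t j)) \<longlonglongrightarrow> e"
    and h: "h \<in> Dm" and h0: "eventually (\<lambda>x. h x = 0) F'"
    and A1: "\<And>j. A1 j = vector [row_u (qd K a b h) (t j), \<alpha> j]"
    and A2: "\<And>j. A2 j = vector [row_v (qd K a b h) (t j), \<beta> j]"
    and sa: "\<And>j. j \<ge> N \<Longrightarrow> self_adjoint_bc (A1 j) (A2 j)"
  shows "\<exists>P V. reduces (\<lambda>j. G (ereal (t j))) N (\<lambda>Y. (bracket Y (qd K a b h) \<longlongrightarrow> 0) F)
    (\<lambda>j. bc_matrix (A1 j) (A2 j) (G (ereal (t j)))) P V"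
proof -
  define P where "P = {y \<in> Dm. \<exists>c1 c2. eventually (\<lambda>x. y x = c1 * h x + c2 * h x) F}"
  note tF = truncation_filterlim[OF t lim]
  have row: "bc_row (A1 j) (A2 j) 1 = Q h (t j)" for j
    by (simp add: bc_row_def A1 A2 row_u_def row_v_def uvec_def vvec_def quad_def)
  have mem: "Q h (t j) \<in> bc_space (A1 j) (A2 j)" if "j \<ge> N" for j
    unfolding row[symmetric] bc_space_iff using bc_rows_isotropic[OF sa[OF that]] by simp
  \<comment> \<open>The limit of the bracket of \<open>h\<close> with itself exists by Green's
    formula, and along the truncation points the bracket is 0.\<close>
  have hh: "(bracket (qd K a b h) (qd K a b h) \<longlongrightarrow> 0) F"
  proof -
    obtain A where A: "(bracket (qd K a b h) (qd K a b h) \<longlongrightarrow> A) F" using bracket_limit[OF h h] by blast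
    have "bracket (qd K a b h) (qd K a b h) (t j) = 0" if "j \<ge> N" for j
      using bc_rows_isotropic[OF sa[OF that], of 1 1] unfolding row bracket_sform .
    then have "eventually (\<lambda>j. 0 = bracket (qd K a b h) (qd K a b h) (t j)) sequentially"
      unfolding eventually_sequentially by (intro exI[of _ N]) simp
    then have "(\<lambda>j. bracket (qd K a b h) (qd K a b h) (t j)) \<longlonglongrightarrow> 0"
      by (rule Lim_transform_eventually[OF tendsto_const])
    then have "A = 0" using LIMSEQ_unique[OF filterlim_compose[OF A tF]] by blast
    then show ?thesis using A by simp
  qed
  have "reduces (\<lambda>j. G (ereal (t j))) N (\<lambda>Y. (bracket Y (qd K a b h) \<longlongrightarrow> 0) F)
    (\<lambda>j. bc_matrix (A1 j) (A2 j) (G (ereal (t j)))) P (\<lambda>j. bc_space (A1 j) (A2 j))"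
    unfolding reduces_def
  proof (intro conjI germ_space_bracket[OF h] disjI2)
    show "germ_space F P" unfolding P_def by (rule germ_space_span)
    show "P \<subseteq> {y \<in> Dm. (bracket (qd K a b y) (qd K a b h) \<longlongrightarrow> 0) F}"
      unfolding P_def using bracket_span_limit[OF _ h h _ hh hh] by blast
    have "eventually (\<lambda>x. h x = 1 * h x + 0 * h x) F" by simp
    then have "h \<in> P" using h unfolding P_def by blast
    then show "\<forall>g\<in>Dm. (\<forall>c\<in>P. eventually (\<lambda>x. c x = 0) F' \<longrightarrow> (bracket (qd K a b c) (qd K a b g) \<longlongrightarrow> 0) F) \<longrightarrow>
        (bracket (qd K a b g) (qd K a b h) \<longlongrightarrow> 0) F"
      using h0 bracket_skew_limit by blast
    show "\<forall>j\<ge>N. isotropic (bc_space (A1 j) (A2 j)) \<and>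
          (\<forall>Y q. (quad Y \<longlongrightarrow> q) (G (ereal (t j))) \<longrightarrow>
            bc_matrix (A1 j) (A2 j) (G (ereal (t j))) Y = (q \<in> bc_space (A1 j) (A2 j)))"
      using isotropic_bc_space[OF sa] bc_matrix_iff[OF _ G_ne] by blast
    show "\<forall>y\<in>P. eventually (\<lambda>j. \<exists>q\<in>bc_space (A1 j) (A2 j). (Q y \<longlongrightarrow> q) (G (ereal (t j)))) sequentially"
    proof
      fix y assume y: "y \<in> P"
      then obtain c1 c2 where yD: "y \<in> Dm" and c: "eventually (\<lambda>x. y x = c1 * h x + c2 * h x) F" by (auto simp: P_def)
      have "eventually (\<lambda>j. Q y (t j) = qscale c1 (Q h (t j)) + qscale c2 (Q h (t j))) sequentially"
        by (rule eventually_compose_filterlim[OF Q_span_germ[OF yD h h c] tF])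
      then show "eventually (\<lambda>j. \<exists>q\<in>bc_space (A1 j) (A2 j). (Q y \<longlongrightarrow> q) (G (ereal (t j)))) sequentially"
        using eventually_ge_at_top[of N]
      proof eventually_elim
        case (elim j)
        have "Q y (t j) \<in> bc_space (A1 j) (A2 j)"
          using mem[OF elim(2)] csubspace_bc_space[of "A1 j" "A2 j"] unfolding elim(1) csubspace_def by blast
        then show ?case using Q_limit_interior[OF yD t] by blast
      qed
    qed
  qed
  then show ?thesis by blast
qed

lemma eigen_region:
  assumes U: "connected U" "U \<subseteq> E" and y: "y \<in> Dm" and ay: "AE x in lebesgue. x \<in> U \<longrightarrow> L y x = complex_of_real r * y x"
    and cd: "c < d" "c \<in> U" "d \<in> U"
  shows "qsys K c d (\<lambda>x. complex_of_real r * qd K a b y 0 x + 0) (qd K a b y)" "regular_on K c d" "{c..d} \<subseteq> U"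
proof -
  show sub: "{c..d} \<subseteq> U" using connected_contains_Icc[OF U(1) cd(2,3)] .
  then have E: "{c..d} \<subseteq> E" using U(2) by blast
  show "regular_on K c d" by (rule admissible_regular_on[OF adm E cd(1)])
  have Y: "qsys K c d (L y) (qd K a b y)" by (rule qsys_onD[OF qd_qsys_on(1)[OF adm DmaxD(1)[OF y]] cd(1) E])
  have "AE x in lebesgue. x \<in> {c<..<d} \<longrightarrow> L y x = complex_of_real r * qd K a b y 0 x + 0"
    using ay by eventually_elim (use sub in \<open>auto simp: subset_eq qd_qsys_on(2)[OF adm DmaxD(1)[OF y]]\<close>)
  then show "qsys K c d (\<lambda>x. complex_of_real r * qd K a b y 0 x + 0) (qd K a b y)"
    by (rule qsys_cong[OF Y refl])
qed

text \<open>For two solutions with the same real \<open>r\<close> the integrand in Green's formula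
  vanishes, so the bracket is constant on \<open>U\<close> and equals its limit.\<close>

lemma eigen_bracket_zero:
  assumes U: "connected U" "U \<subseteq> E" "eventually (\<lambda>x. x \<in> U) F" and y: "y \<in> Dm" and z: "z \<in> Dm"
    and ay: "AE x in lebesgue. x \<in> U \<longrightarrow> L y x = complex_of_real r * y x"
    and az: "AE x in lebesgue. x \<in> U \<longrightarrow> L z x = complex_of_real r * z x"
    and l: "(bracket (qd K a b y) (qd K a b z) \<longlongrightarrow> 0) F" and x: "x \<in> U"
  shows "bracket (qd K a b y) (qd K a b z) x = 0"
proof -
  let ?b = "bracket (qd K a b y) (qd K a b z)"
  have const: "?b d = ?b c" if cd: "c < d" "c \<in> U" "d \<in> U" for c d
    using qsys_green_integral(2)[OF cd(1) eigen_region(1)[OF U(1,2) y ay cd] eigen_region(1)[OF U(1,2) z az cd]]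
    by (simp add: mult.assoc mult.left_commute)
  have "?b u = ?b x" if "u \<in> U" for u
    using const[of u x] const[of x u] that x by (cases u x rule: linorder_cases) auto
  then have "eventually (\<lambda>u. ?b u = ?b x) F" using U(3) by (auto elim: eventually_mono)
  then have "(?b \<longlongrightarrow> ?b x) F" by (rule tendsto_eventually)
  then show ?thesis using tendsto_unique[OF F_ne(1) _ l] by blast
qed

lemma compactly_supported_D_min:
  assumes y: "y \<in> Dm" and c: "compactly_supported a b y"
  shows "y \<in> D_min K a b"
proof -
  have "nm (L (\<lambda>x. 0)) = 0"
    using nm_cong[OF DmaxD(3)[OF zero_D_max(1)] zero_D_max(2)] by simp
  then have "graph_norm K a b (\<lambda>x. y x - y x) = 0" by (simp add: graph_norm_def)
  then show ?thesis using y c unfolding D_min_def by (auto intro!: bexI[OF _ y])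
qed

text \<open>A combination with zero data at one point of \<open>U\<close> vanishes on
  \<open>U\<close> by uniqueness. It also vanishes near the other end, so it has compact support and
  belongs to \<open>D_min\<close>, where only the trivial combination is allowed.\<close>

lemma eigen_independent:
  assumes U: "connected U" "U \<subseteq> E" "eventually (\<lambda>x. x \<in> U) F" and h: "h1 \<in> Dm" "h2 \<in> Dm"
    and a1: "AE x in lebesgue. x \<in> U \<longrightarrow> L h1 x = complex_of_real r * h1 x"
    and a2: "AE x in lebesgue. x \<in> U \<longrightarrow> L h2 x = complex_of_real r * h2 x"
    and h0: "eventually (\<lambda>x. h1 x = 0 \<and> h2 x = 0) F'"
    and ind: "\<And>c1 c2. (\<lambda>x. c1 * h1 x + c2 * h2 x) \<in> D_min K a b \<Longrightarrow> c1 = 0 \<and> c2 = 0"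
    and x: "x \<in> U" and eq: "qscale c1 (Q h1 x) + qscale c2 (Q h2 x) = 0"
  shows "c1 = 0 \<and> c2 = 0"
proof -
  let ?y = "\<lambda>x. c1 * h1 x + c2 * h2 x"
  have y: "?y \<in> Dm" by (rule D_max_combine[OF h])
  have "ae_eq a b (L ?y) (\<lambda>x. c1 * L h1 x + c2 * L h2 x)"
    by (rule qd_combine(3)[OF adm DmaxD(1)[OF h(1)] DmaxD(1)[OF h(2)]])
  then have ay: "AE x in lebesgue. x \<in> U \<longrightarrow> L ?y x = complex_of_real r * ?y x"
    unfolding ae_eq_def using a1 a2 by eventually_elim (use U(2) in \<open>auto simp: algebra_simps\<close>)
  have Qx: "Q ?y x = 0" using quad_qd_combine[OF h, of x c1 c2] U(2) x eq by auto
  have Q0: "Q ?y u = 0" if u: "u \<in> {c..d}" and cd: "c < d" "c \<in> U" "d \<in> U" and xc: "x \<in> {c..d}" for u c d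
  proof -
    have "Q ?y u = quad (\<lambda>k x. 0) u"
      by (rule qsys_unique[OF eigen_region(2)[OF U(1,2) y ay cd] _ eigen_region(1)[OF U(1,2) y ay cd] _ xc _ u])
         (simp_all add: Qx quad_zero qsys_zero)
    then show ?thesis by (simp add: quad_zero)
  qed
  have "?y u = 0" if u: "u \<in> U" for u
  proof -
    have "Q ?y u = 0" using Q0[of u u x] Q0[of u x u] Qx u x by (cases u x rule: linorder_cases) auto
    then have "qd K a b ?y 0 u = 0" by (simp add: quad_def zero_prod_def)
    then show ?thesis using qd_qsys_on(2)[OF adm DmaxD(1)[OF y]] by simp
  qed
  then have "eventually (\<lambda>x. ?y x = 0) F" using U(3) by (auto elim: eventually_mono)
  moreover have "eventually (\<lambda>x. ?y x = 0) F'" using h0 by eventually_elim simp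
  ultimately show ?thesis by (intro ind compactly_supported_D_min[OF y] compactly_supportedI)
qed

text \<open>The truncated conditions are the \<open>sform\<close> annihilator of the boundary
  vectors of \<open>h1\<close> and \<open>h2\<close> at \<open>t j\<close>. These are independent
  and mutually isotropic there because both functions solve the same equation with real
  \<open>r\<close> on \<open>U\<close>.\<close>

lemma reduces_lim4:
  assumes t: "\<And>j. t j \<in> E" and lim: "(\<lambda>j. ereal (t j)) \<longlonglongrightarrow> e" and h: "h1 \<in> Dm" "h2 \<in> Dm"
    and h0: "eventually (\<lambda>x. h1 x = 0 \<and> h2 x = 0) F'"
    and ind: "\<And>c1 c2. (\<lambda>x. c1 * h1 x + c2 * h2 x) \<in> D_min K a b \<Longrightarrow> c1 = 0 \<and> c2 = 0"
    and l11: "(bracket (qd K a b h1) (qd K a b h1) \<longlongrightarrow> 0) F"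
    and l12: "(bracket (qd K a b h1) (qd K a b h2) \<longlongrightarrow> 0) F"
    and l22: "(bracket (qd K a b h2) (qd K a b h2) \<longlongrightarrow> 0) F"
    and U: "connected U" "U \<subseteq> E" "eventually (\<lambda>x. x \<in> U) F"
    and ae: "AE x in lebesgue. x \<in> U \<longrightarrow> L h1 x = complex_of_real r * h1 x \<and> L h2 x = complex_of_real r * h2 x"
    and tU: "\<And>j. j \<ge> N \<Longrightarrow> t j \<in> U"
  shows "\<exists>P V. reduces (\<lambda>j. G (ereal (t j))) N
    (\<lambda>Y. (bracket Y (qd K a b h1) \<longlongrightarrow> 0) F \<and> (bracket Y (qd K a b h2) \<longlongrightarrow> 0) F)
    (\<lambda>j Y. (bracket Y (qd K a b h1) \<longlongrightarrow> 0) (G (ereal (t j))) \<and> (bracket Y (qd K a b h2) \<longlongrightarrow> 0) (G (ereal (t j)))) P V"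
proof -
  define P where "P = {y \<in> Dm. \<exists>c1 c2. eventually (\<lambda>x. y x = c1 * h1 x + c2 * h2 x) F}"
  define V where "V j = {q. sform q (Q h1 (t j)) = 0 \<and> sform q (Q h2 (t j)) = 0}" for j
  note tF = truncation_filterlim[OF t lim]
  have a1: "AE x in lebesgue. x \<in> U \<longrightarrow> L h1 x = complex_of_real r * h1 x" using ae by eventually_elim simp
  have a2: "AE x in lebesgue. x \<in> U \<longrightarrow> L h2 x = complex_of_real r * h2 x" using ae by eventually_elim simp
  have l21: "(bracket (qd K a b h2) (qd K a b h1) \<longlongrightarrow> 0) F" by (rule bracket_skew_limit[OF l12])
  have z: "sform (Q h1 (t j)) (Q h1 (t j)) = 0" "sform (Q h1 (t j)) (Q h2 (t j)) = 0"
    "sform (Q h2 (t j)) (Q h2 (t j)) = 0" "sform (Q h2 (t j)) (Q h1 (t j)) = 0" if "j \<ge> N" for j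
    using eigen_bracket_zero[OF U h(1) h(1) a1 a1 l11 tU[OF that]] eigen_bracket_zero[OF U h(1) h(2) a1 a2 l12 tU[OF that]]
      eigen_bracket_zero[OF U h(2) h(2) a2 a2 l22 tU[OF that]] eigen_bracket_zero[OF U h(2) h(1) a2 a1 l21 tU[OF that]]
    by (simp_all add: bracket_sform)
  have iso: "isotropic (V j)" if "j \<ge> N" for j
    unfolding V_def
    by (rule isotropic_annihilator[OF eigen_independent[OF U h a1 a2 h0 ind tU[OF that]] z(1-3)[OF that]])
  \<comment> \<open>The functions \<open>h1\<close> and \<open>h2\<close> are continuous at
    \<open>t j\<close> with all quasi-derivatives, so the one-sided limit of the bracket is the form
    evaluated at the one-sided boundary vector of \<open>Y\<close>.\<close>
  have br: "(bracket Y (qd K a b u) \<longlongrightarrow> 0) (G (ereal (t j))) \<longleftrightarrow> sform q (Q u (t j)) = 0"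
    if q: "(quad Y \<longlongrightarrow> q) (G (ereal (t j)))" and u: "u \<in> Dm" for Y q u j
  proof -
    have "(bracket Y (qd K a b u) \<longlongrightarrow> sform q (Q u (t j))) (G (ereal (t j)))"
      using tendsto_sform[OF q Q_limit_interior[OF u t]] unfolding bracket_sform[abs_def] .
    then show ?thesis using tendsto_unique[OF G_ne] by metis
  qed
  have "reduces (\<lambda>j. G (ereal (t j))) N
    (\<lambda>Y. (bracket Y (qd K a b h1) \<longlongrightarrow> 0) F \<and> (bracket Y (qd K a b h2) \<longlongrightarrow> 0) F)
    (\<lambda>j Y. (bracket Y (qd K a b h1) \<longlongrightarrow> 0) (G (ereal (t j))) \<and> (bracket Y (qd K a b h2) \<longlongrightarrow> 0) (G (ereal (t j)))) P V"
    unfolding reduces_def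
  proof (intro conjI disjI2)
    show "germ_space F {y \<in> Dm. (bracket (qd K a b y) (qd K a b h1) \<longlongrightarrow> 0) F \<and> (bracket (qd K a b y) (qd K a b h2) \<longlongrightarrow> 0) F}"
      using germ_space_bracket[OF h(1)] germ_space_bracket[OF h(2)] unfolding germ_space_def by blast
    show "germ_space F P" unfolding P_def by (rule germ_space_span)
    show "P \<subseteq> {y \<in> Dm. (bracket (qd K a b y) (qd K a b h1) \<longlongrightarrow> 0) F \<and> (bracket (qd K a b y) (qd K a b h2) \<longlongrightarrow> 0) F}"
      unfolding P_def using bracket_span_limit[OF _ h _ l11 l21] bracket_span_limit[OF _ h _ l12 l22] by blast
    have "eventually (\<lambda>x. h1 x = 1 * h1 x + 0 * h2 x) F" "eventually (\<lambda>x. h2 x = 0 * h1 x + 1 * h2 x) F" by simp_all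
    then have "h1 \<in> P" "h2 \<in> P" using h unfolding P_def by blast+
    moreover have "eventually (\<lambda>x. h1 x = 0) F'" "eventually (\<lambda>x. h2 x = 0) F'"
      using h0 by (auto elim: eventually_mono)
    ultimately show "\<forall>g\<in>Dm. (\<forall>c\<in>P. eventually (\<lambda>x. c x = 0) F' \<longrightarrow> (bracket (qd K a b c) (qd K a b g) \<longlongrightarrow> 0) F) \<longrightarrow>
        (bracket (qd K a b g) (qd K a b h1) \<longlongrightarrow> 0) F \<and> (bracket (qd K a b g) (qd K a b h2) \<longlongrightarrow> 0) F"
      using bracket_skew_limit by blast
    show "\<forall>j\<ge>N. isotropic (V j) \<and> (\<forall>Y q. (quad Y \<longlongrightarrow> q) (G (ereal (t j))) \<longrightarrow>
            ((bracket Y (qd K a b h1) \<longlongrightarrow> 0) (G (ereal (t j))) \<and> (bracket Y (qd K a b h2) \<longlongrightarrow> 0) (G (ereal (t j)))) = (q \<in> V j))"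
      using iso br[OF _ h(1)] br[OF _ h(2)] by (auto simp: V_def)
    show "\<forall>y\<in>P. eventually (\<lambda>j. \<exists>q\<in>V j. (Q y \<longlongrightarrow> q) (G (ereal (t j)))) sequentially"
    proof
      fix y assume y: "y \<in> P"
      then obtain c1 c2 where yD: "y \<in> Dm" and c: "eventually (\<lambda>x. y x = c1 * h1 x + c2 * h2 x) F" by (auto simp: P_def)
      have "eventually (\<lambda>j. Q y (t j) = qscale c1 (Q h1 (t j)) + qscale c2 (Q h2 (t j))) sequentially"
        by (rule eventually_compose_filterlim[OF Q_span_germ[OF yD h c] tF])
      then show "eventually (\<lambda>j. \<exists>q\<in>V j. (Q y \<longlongrightarrow> q) (G (ereal (t j)))) sequentially"
        using eventually_ge_at_top[of N]
      proof eventually_elim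
        case (elim j)
        have "Q y (t j) \<in> V j"
          using z[OF elim(2)] by (simp add: V_def elim(1) sform_combine_left)
        then show ?case using Q_limit_interior[OF yD t] by blast
      qed
    qed
  qed
  then show ?thesis by blast
qed

lemma endpoint_setting_reduces:
  assumes "endpoint_setting K a b e F F' t (\<lambda>j. G (ereal (t j))) N B Bt"
  shows "\<exists>P V. reduces (\<lambda>j. G (ereal (t j))) N B Bt P V"
  using assms
proof cases
  case (regular A1 A2)
  show ?thesis unfolding regular(1,2) by (rule reduces_regular[OF regular(3-5)])
next
  case lim2
  show ?thesis unfolding lim2(1,2) by (rule reduces_lim2) (use lim2 in auto)
next
  case (lim3 h H A1 \<alpha> A2 \<beta>)
  show ?thesis unfolding lim3(1,2) \<open>H = _\<close>
    by (rule reduces_lim3[where \<alpha> = \<alpha> and \<beta> = \<beta>]) (use lim3 in auto)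
next
  case (lim4 h1 h2 H1 H2 U r)
  show ?thesis unfolding lim4(1,2) \<open>H1 = _\<close> \<open>H2 = _\<close>
    by (rule reduces_lim4[where U = U and r = r]) (use lim4 in blast)+
qed

lemma endpoint_setting_truncation:
  assumes "endpoint_setting K a b e F F' t Ft N B Bt"
  shows "t j \<in> E \<or> ereal (t j) = e \<and> regular_end K e F" "(\<lambda>j. ereal (t j)) \<longlonglongrightarrow> e"
  using assms by (cases; auto)+

end

section \<open>The core of the limit operator\<close>

lemma compactly_supported_ends:
  assumes ab: "a < b" and y: "compactly_supported a b y"
  shows "eventually (\<lambda>x. y x = 0) (lower_end a)" "eventually (\<lambda>x. y x = 0) (upper_end b)"
proof -
  obtain S where S: "compact S" "S \<subseteq> einterval a b" "\<And>x. x \<in> einterval a b \<Longrightarrow> x \<notin> S \<Longrightarrow> y x = 0"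
    using y unfolding compactly_supported_def by blast
  obtain x0 where x0: "x0 \<in> einterval a b" using eventually_happens[OF eventually_in_einterval(1)[OF ab]] lower_end_not_bot[OF ab] by blast
  obtain c where c: "c \<in> einterval a b" "\<And>x. x \<in> S \<Longrightarrow> c \<le> x"
    using compact_attains_inf[OF S(1)] S(2) x0 by (cases "S = {}") blast+
  obtain d where d: "d \<in> einterval a b" "\<And>x. x \<in> S \<Longrightarrow> x \<le> d"
    using compact_attains_sup[OF S(1)] S(2) x0 by (cases "S = {}") blast+
  have ab': "a < \<infinity>" "-\<infinity> < b" using ab by auto
  have "eventually (\<lambda>x. x < c) (lower_end a)"
    unfolding eventually_lower_end[OF ab'(1)] using c(1) by (auto simp: einterval_def)
  with eventually_in_einterval(1)[OF ab] show "eventually (\<lambda>x. y x = 0) (lower_end a)"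
    by eventually_elim (use S(3) c(2) in force)
  have "eventually (\<lambda>x. d < x) (upper_end b)"
    unfolding eventually_upper_end[OF ab'(2)] using d(1) by (auto simp: einterval_def)
  with eventually_in_einterval(2)[OF ab] show "eventually (\<lambda>x. y x = 0) (upper_end b)"
    by eventually_elim (use S(3) d(2) in force)
qed

context endpoint
begin

lemma bracket_germ_right:
  assumes "u \<in> Dm" "z \<in> Dm" "eventually (\<lambda>x. u x = z x) F"
    and l: "(bracket (qd K a b y) (qd K a b u) \<longlongrightarrow> 0) F"
  shows "(bracket (qd K a b y) (qd K a b z) \<longlongrightarrow> 0) F"
  by (rule Lim_transform_eventually[OF l])
     (use Q_germ(1)[OF assms(1-3)] in \<open>auto simp: bracket_sform elim: eventually_mono\<close>)

lemma germ_space_member: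
  "germ_space F S \<Longrightarrow> y \<in> S \<Longrightarrow> z \<in> Dm \<Longrightarrow> eventually (\<lambda>x. z x = y x) F \<Longrightarrow> z \<in> S"
  unfolding germ_space_def by (auto simp: eq_commute)

lemma germ_space_zero:
  "germ_space F S \<Longrightarrow> z \<in> Dm \<Longrightarrow> eventually (\<lambda>x. z x = 0) F \<Longrightarrow> z \<in> S"
  using germ_space_member[of S "\<lambda>x. 0" z] by (auto simp: germ_space_def)

text \<open>If \<open>S\<close> lies in \<open>P\<close>, the localised \<open>y\<close> is itself a
  legitimate test function against \<open>z\<close>. Otherwise the tests force \<open>z\<close> into
  \<open>S\<close>, and then symmetry of L on the localised \<open>z\<close> and \<open>y\<close>
  gives the same limit.\<close>

lemma bracket_limit_zero:
  assumes S: "germ_space F S" and P: "germ_space F P"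
    and alt: "S \<subseteq> P \<or> (\<forall>g\<in>Dm. (\<forall>c\<in>P. eventually (\<lambda>x. c x = 0) F' \<longrightarrow>
        (bracket (qd K a b c) (qd K a b g) \<longlongrightarrow> 0) F) \<longrightarrow> g \<in> S)"
    and core: "\<And>c. c \<in> P \<Longrightarrow> eventually (\<lambda>x. c x = 0) F' \<Longrightarrow> ip (L c) z = ip c (L z)"
    and dom: "\<And>u. u \<in> S \<Longrightarrow> eventually (\<lambda>x. u x = 0) F' \<Longrightarrow> ip (L u) y = ip u (L y)"
    and y: "y \<in> S" and z: "z \<in> Dm"
  shows "(bracket (qd K a b y) (qd K a b z) \<longlongrightarrow> 0) F"
proof -
  have SD: "S \<subseteq> Dm" "P \<subseteq> Dm" using S P by (auto simp: germ_space_def)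
  have yD: "y \<in> Dm" using y SD by blast
  have core': "(bracket (qd K a b c) (qd K a b z) \<longlongrightarrow> 0) F" if "c \<in> P" "eventually (\<lambda>x. c x = 0) F'" for c
    using green_sym[OF _ z core[OF that] that(2)] that(1) SD by blast
  from alt show ?thesis
  proof
    assume SP: "S \<subseteq> P"
    obtain y1 where y1: "y1 \<in> Dm" "eventually (\<lambda>x. y1 x = y x) F" "eventually (\<lambda>x. y1 x = 0) F'"
      using localize[OF yD] by blast
    have "y1 \<in> P" using germ_space_member[OF S y y1(1,2)] SP by blast
    then have "(bracket (qd K a b y1) (qd K a b z) \<longlongrightarrow> 0) F" using core' y1(3) by blast
    then have "(bracket (qd K a b z) (qd K a b y1) \<longlongrightarrow> 0) F" by (rule bracket_skew_limit)
    then have "(bracket (qd K a b z) (qd K a b y) \<longlongrightarrow> 0) F" by (rule bracket_germ_right[OF y1(1) yD y1(2)])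
    then show ?thesis by (rule bracket_skew_limit)
  next
    assume "\<forall>g\<in>Dm. (\<forall>c\<in>P. eventually (\<lambda>x. c x = 0) F' \<longrightarrow>
        (bracket (qd K a b c) (qd K a b g) \<longlongrightarrow> 0) F) \<longrightarrow> g \<in> S"
    then have zS: "z \<in> S" using z core' by blast
    obtain z1 where z1: "z1 \<in> Dm" "eventually (\<lambda>x. z1 x = z x) F" "eventually (\<lambda>x. z1 x = 0) F'"
      using localize[OF z] by blast
    have "z1 \<in> S" by (rule germ_space_member[OF S zS z1(1,2)])
    then have "(bracket (qd K a b z1) (qd K a b y) \<longlongrightarrow> 0) F"
      by (intro green_sym[OF z1(1) yD dom z1(3)] z1(3))
    then have "(bracket (qd K a b y) (qd K a b z1) \<longlongrightarrow> 0) F" by (rule bracket_skew_limit)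
    then show ?thesis by (rule bracket_germ_right[OF z1(1) z z1(2)])
  qed
qed

end

text \<open>\<open>Sa\<close> and \<open>Sb\<close> are the conditions of L at the two ends,
  \<open>Pa\<close> and \<open>Pb\<close> the smaller germ spaces; the core is
  \<open>Pa \<inter> Pb\<close>.\<close>

locale core_setting = weighted_l2 +
  fixes Sa Sb Pa Pb :: "(real \<Rightarrow> complex) set"
  assumes gSa: "germ_space (lower_end a) Sa" and gPa: "germ_space (lower_end a) Pa" and PSa: "Pa \<subseteq> Sa"
    and alta: "Sa \<subseteq> Pa \<or> (\<forall>g\<in>D_max K a b. (\<forall>c\<in>Pa. eventually (\<lambda>x. c x = 0) (upper_end b) \<longrightarrow>
        (bracket (qd K a b c) (qd K a b g) \<longlongrightarrow> 0) (lower_end a)) \<longrightarrow> g \<in> Sa)"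
    and gSb: "germ_space (upper_end b) Sb" and gPb: "germ_space (upper_end b) Pb" and PSb: "Pb \<subseteq> Sb"
    and altb: "Sb \<subseteq> Pb \<or> (\<forall>g\<in>D_max K a b. (\<forall>c\<in>Pb. eventually (\<lambda>x. c x = 0) (lower_end a) \<longrightarrow>
        (bracket (qd K a b c) (qd K a b g) \<longlongrightarrow> 0) (upper_end b)) \<longrightarrow> g \<in> Sb)"
    and sa: "self_adjoint K a b (Sa \<inter> Sb)"
begin

sublocale lo: endpoint K a b a "lower_end a" "upper_end b" lower_end by unfold_locales simp
sublocale up: endpoint K a b b "upper_end b" "lower_end a" upper_end by unfold_locales simp

sublocale W: weighted_operator K a b "Sa \<inter> Sb"
proof unfold_locales
  show "Sa \<inter> Sb \<subseteq> D_max K a b" using gSa by (auto simp: germ_space_def)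
  show "Sa \<inter> Sb \<noteq> {}" using gSa gSb by (auto simp: germ_space_def)
  show "\<And>\<alpha> \<beta> y z. y \<in> Sa \<inter> Sb \<Longrightarrow> z \<in> Sa \<inter> Sb \<Longrightarrow> (\<lambda>x. \<alpha> * y x + \<beta> * z x) \<in> Sa \<inter> Sb"
    using gSa gSb unfolding germ_space_def by blast
qed

sublocale W: symmetric_operator K a b "Sa \<inter> Sb" by (rule W.self_adjoint_symmetric[OF sa])

lemma PS: "Pa \<inter> Pb \<subseteq> Sa \<inter> Sb" using PSa PSb by blast

text \<open>The restriction of L to the core has no larger adjoint than L: a weak relation on the
  core gives a solution in \<open>D_max\<close> whose brackets with the domain of L vanish at both
  ends.\<close>

lemma core_adjoint:
  assumes g: "g \<in> H" and k: "k \<in> H" and weak: "\<And>c. c \<in> Pa \<inter> Pb \<Longrightarrow> ip (L c) g = ip c k"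
  shows "\<exists>z\<in>Sa \<inter> Sb. ae_eq a b z g \<and> ae_eq a b (L z) k"
proof -
  \<comment> \<open>Zero germs belong to every germ space, so compactly supported functions are in
    the core.\<close>
  have "ip (L \<phi>) g = ip \<phi> k" if \<phi>: "\<phi> \<in> D_max K a b" "compactly_supported a b \<phi>" for \<phi>
    by (rule weak) (use lo.germ_space_zero[OF gPa \<phi>(1)] up.germ_space_zero[OF gPb \<phi>(1)]
        compactly_supported_ends[OF ab \<phi>(2)] in blast)
  from weak_solution[OF g k this] obtain z where z: "z \<in> D_max K a b" "ae_eq a b z g" "ae_eq a b (L z) k" by blast
  have PD: "c \<in> D_max K a b" if "c \<in> Pa \<or> c \<in> Pb" for c using that gPa gPb by (auto simp: germ_space_def)
  have SD: "c \<in> D_max K a b" if "c \<in> Sa \<or> c \<in> Sb" for c using that gSa gSb by (auto simp: germ_space_def)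
  have core: "ip (L c) z = ip c (L z)" if c: "c \<in> Pa \<inter> Pb" for c
  proof -
    have cD: "c \<in> D_max K a b" using c PD by blast
    have "ip (L c) z = ip (L c) g" "ip c (L z) = ip c k"
      using ip_cong[OF DmaxD(3)[OF cD] DmaxD(2)[OF z(1)] _ z(2), of "L c"] ip_cong[OF DmaxD(2)[OF cD] DmaxD(3)[OF z(1)] _ z(3), of c]
      by (simp_all add: ae_eq_def)
    then show ?thesis using weak[OF c] by simp
  qed
  have "ip (L y) z = ip y (L z)" if y: "y \<in> Sa \<inter> Sb" for y
  proof -
    have yD: "y \<in> D_max K a b" using y SD by blast
    have "(bracket (qd K a b y) (qd K a b z) \<longlongrightarrow> 0) (lower_end a)"
    proof (rule lo.bracket_limit_zero[OF gSa gPa alta _ _ _ z(1)])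
      show "ip (L c) z = ip c (L z)" if "c \<in> Pa" "eventually (\<lambda>x. c x = 0) (upper_end b)" for c
        using core up.germ_space_zero[OF gPb _ that(2)] PD that(1) by blast
      show "ip (L u) y = ip u (L y)" if "u \<in> Sa" "eventually (\<lambda>x. u x = 0) (upper_end b)" for u
        using W.sym[OF _ y] up.germ_space_zero[OF gSb _ that(2)] SD that(1) by blast
    qed (use y in simp)
    moreover have "(bracket (qd K a b y) (qd K a b z) \<longlongrightarrow> 0) (upper_end b)"
    proof (rule up.bracket_limit_zero[OF gSb gPb altb _ _ _ z(1)])
      show "ip (L c) z = ip c (L z)" if "c \<in> Pb" "eventually (\<lambda>x. c x = 0) (lower_end a)" for c
        using core lo.germ_space_zero[OF gPa _ that(2)] PD that(1) by blast
      show "ip (L u) y = ip u (L y)" if "u \<in> Sb" "eventually (\<lambda>x. u x = 0) (lower_end a)" for u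
        using W.sym[OF _ y] lo.germ_space_zero[OF gSa _ that(2)] SD that(1) by blast
    qed (use y in simp)
    ultimately show ?thesis
      using green[OF yD z(1)] tendsto_unique[OF lower_end_not_bot[OF ab]] tendsto_unique[OF upper_end_not_bot[OF ab]]
      by (metis diff_self eq_iff_diff_eq_0)
  qed
  from W.self_adjoint_adjointD[OF sa DmaxD(2,3)[OF z(1)] this]
  obtain u where "u \<in> Sa \<inter> Sb" "ae_eq a b u z" "ae_eq a b (L u) (L z)" by blast
  then show ?thesis using ae_eq_trans z(2,3) by blast
qed

text \<open>The range of \<open>L - \<i>\<close> on the core is dense, since an orthogonal vector
  would be an eigenvector of L for \<open>- \<i>\<close>. The estimate
  \<open>nm u \<le> nm ((L - \<i>) u)\<close> then turns closeness in the range into closeness of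
  the functions.\<close>

lemma core_dense:
  assumes y: "y \<in> Sa \<inter> Sb" and \<delta>: "\<delta> > 0"
  shows "\<exists>c\<in>Pa \<inter> Pb. nm (\<lambda>x. y x - c x) < \<delta> \<and> nm (W.sh z (\<lambda>x. y x - c x)) \<le> (1 + cmod (\<i> - z)) * \<delta>"
proof -
  define M where "M = {m \<in> H. \<exists>c\<in>Pa \<inter> Pb. ae_eq a b (W.sh \<i> c) m}"
  have PC: "(\<lambda>x. \<alpha> * c x + \<beta> * d x) \<in> Pa \<inter> Pb" if "c \<in> Pa \<inter> Pb" "d \<in> Pa \<inter> Pb" for \<alpha> \<beta> c d
    using that gPa gPb unfolding germ_space_def by blast
  have refl: "ae_eq a b f f" for f by (simp add: ae_eq_def)
  have shM: "W.sh \<i> c \<in> M" if "c \<in> Pa \<inter> Pb" for c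
    using that W.sh_H PS refl unfolding M_def by blast
  have "\<exists>m\<in>M. nm (\<lambda>x. W.sh \<i> y x - m x) < \<delta>"
  proof (rule dense_if_orthogonal_trivial[OF _ _ _ _ W.sh_H[OF y] \<delta>])
    show "M \<subseteq> H" by (auto simp: M_def)
    have "(\<lambda>x. 0) \<in> Pa \<inter> Pb" using gPa gPb by (simp add: germ_space_def)
    then show "M \<noteq> {}" using shM by blast
    fix \<alpha> \<beta> u v assume "u \<in> M" "v \<in> M"
    then obtain c d where c: "c \<in> Pa \<inter> Pb" "ae_eq a b (W.sh \<i> c) u" "u \<in> H" and d: "d \<in> Pa \<inter> Pb" "ae_eq a b (W.sh \<i> d) v" "v \<in> H"
      by (auto simp: M_def)
    have "ae_eq a b (W.sh \<i> (\<lambda>x. \<alpha> * c x + \<beta> * d x)) (\<lambda>x. \<alpha> * u x + \<beta> * v x)"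
      by (rule ae_eq_trans[OF W.sh_combine ae_eq_combine[OF c(2) d(2)]]) (use c d PS in blast)+
    then show "(\<lambda>x. \<alpha> * u x + \<beta> * v x) \<in> M"
      unfolding M_def using PC[OF c(1) d(1)] H_combine[OF c(3) d(3)] by blast
  next
    fix g assume g: "g \<in> H" and orth: "\<And>m. m \<in> M \<Longrightarrow> ip m g = 0"
    have "ip (L c) g = ip c (\<lambda>x. (- \<i>) * g x + 0 * g x)" if c: "c \<in> Pa \<inter> Pb" for c
    proof -
      have cD: "c \<in> Sa \<inter> Sb" using c PS by blast
      have "ip (L c) g - \<i> * ip c g = 0" using orth[OF shM[OF c]] W.sh_ip_left[OF cD g, of \<i>] by simp
      then show ?thesis using ip_combine_right[OF g g W.D_H(1)[OF cD], of "- \<i>" 0] by simp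
    qed
    from core_adjoint[OF g H_combine[OF g g] this] obtain u where u: "u \<in> Sa \<inter> Sb" "ae_eq a b u g"
      "ae_eq a b (L u) (\<lambda>x. (- \<i>) * g x + 0 * g x)" by blast
    have "ae_eq a b (W.sh (- \<i>) u) (\<lambda>x. 0)"
      using u(2,3) unfolding ae_eq_def by eventually_elim (simp add: W.sh_def)
    then have "nm (W.sh (- \<i>) u) = 0" using nm_cong[OF W.sh_H[OF u(1)]] by fastforce
    then have "(nm u)\<^sup>2 = 0" using W.sh_norm_sq[OF u(1), of "- \<i>"] by (simp add: add_nonneg_eq_0_iff)
    then show "nm g = 0" using nm_cong[OF W.D_H(1)[OF u(1)] u(2)] by simp
  qed
  then obtain m where "m \<in> M" and m: "nm (\<lambda>x. W.sh \<i> y x - m x) < \<delta>" by blast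
  then obtain c where c: "c \<in> Pa \<inter> Pb" "ae_eq a b (W.sh \<i> c) m" and mH: "m \<in> H" by (auto simp: M_def)
  have cD: "c \<in> Sa \<inter> Sb" using c(1) PS by blast
  let ?u = "\<lambda>x. 1 * y x + (- 1) * c x"
  have u: "?u \<in> Sa \<inter> Sb" by (rule W.D_combine[OF y cD])
  have ae: "ae_eq a b (W.sh \<i> ?u) (\<lambda>x. 1 * W.sh \<i> y x + (- 1) * m x)"
    by (rule ae_eq_trans[OF W.sh_combine[OF y cD] ae_eq_combine[OF refl c(2)]])
  have n: "nm (W.sh \<i> ?u) < \<delta>" using nm_cong[OF W.sh_H[OF u] ae] m by simp
  have "(nm ?u)\<^sup>2 \<le> (nm (W.sh \<i> ?u))\<^sup>2" using W.sh_norm_sq[OF u, of \<i>] by simp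
  then have nu: "nm ?u \<le> nm (W.sh \<i> ?u)" using power2_le_imp_le nm_nonneg by blast
  \<comment> \<open>Writing \<open>L - z\<close> as \<open>(L - \<i>) + (\<i> - z)\<close> produces
    the factor \<open>1 + cmod (\<i> - z)\<close>.\<close>
  have "W.sh z ?u = (\<lambda>x. 1 * W.sh \<i> ?u x + (\<i> - z) * ?u x)" by (auto simp: W.sh_def algebra_simps)
  then have "nm (W.sh z ?u) \<le> nm (W.sh \<i> ?u) + cmod (\<i> - z) * nm ?u"
    using nm_triangle[OF W.sh_H[OF u] W.D_H(1)[OF u], of 1 \<i> "\<i> - z"] by simp
  also have "\<dots> \<le> \<delta> + cmod (\<i> - z) * \<delta>"
    by (intro add_mono mult_left_mono) (use n nu in auto)
  finally have "nm (W.sh z ?u) \<le> (1 + cmod (\<i> - z)) * \<delta>" by (simp add: algebra_simps)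
  then show ?thesis using c(1) n nu by (intro bexI[OF _ c(1)]) auto
qed

lemma core_approximation:
  assumes z: "z \<in> Sp K a b (Sa \<inter> Sb)" and \<epsilon>: "\<epsilon> > 0"
  shows "\<exists>c\<in>Pa \<inter> Pb. nm c > 0 \<and> nm (W.sh z c) < \<epsilon> * nm c"
proof -
  obtain y where y: "y \<in> Sa \<inter> Sb" "nm y > 0" "nm (W.sh z y) < (\<epsilon> / 2) * nm y"
    using W.self_adjoint_spectrum(2)[OF sa z, of "\<epsilon> / 2"] \<epsilon> by auto
  define M where "M = 1 + cmod (\<i> - z)"
  have M: "M \<ge> 1" by (simp add: M_def)
  \<comment> \<open>Solves \<open>\<epsilon> / 2 * nm y + M * \<delta> = \<epsilon> * (nm y -
    \<delta>)\<close>: the perturbed residual stays below \<open>\<epsilon>\<close> times the lower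
    bound for \<open>nm c\<close>.\<close>
  define \<delta> where "\<delta> = \<epsilon> * nm y / (2 * (M + \<epsilon>))"
  have \<delta>: "\<delta> > 0" using \<epsilon> y(2) M by (simp add: \<delta>_def)
  have \<delta>M: "\<delta> * (M + \<epsilon>) = \<epsilon> / 2 * nm y" using \<epsilon> M by (simp add: \<delta>_def field_simps)
  obtain c where c: "c \<in> Pa \<inter> Pb" "nm (\<lambda>x. y x - c x) < \<delta>" "nm (W.sh z (\<lambda>x. y x - c x)) \<le> M * \<delta>"
    using core_dense[OF y(1) \<delta>, of z] unfolding M_def by blast
  have cD: "c \<in> Sa \<inter> Sb" using c(1) PS by blast
  have u: "(\<lambda>x. y x - c x) \<in> Sa \<inter> Sb" using W.D_combine[OF y(1) cD, of 1 "- 1"] by simp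
  have "y = (\<lambda>x. (y x - c x) + c x)" by simp
  then have ny: "nm y \<le> nm (\<lambda>x. y x - c x) + nm c"
    using nm_triangle_add[OF W.D_H(1)[OF u] W.D_H(1)[OF cD]] by simp
  then have nc: "nm c > nm y - \<delta>" using c(2) by linarith
  have ae: "ae_eq a b (W.sh z (\<lambda>x. 1 * y x + (- 1) * (y x - c x))) (\<lambda>x. 1 * W.sh z y x + (- 1) * W.sh z (\<lambda>x. y x - c x) x)"
    by (rule W.sh_combine[OF y(1) u])
  have "nm (W.sh z c) = nm (\<lambda>x. 1 * W.sh z y x + (- 1) * W.sh z (\<lambda>x. y x - c x) x)"
    using nm_cong[OF _ ae] W.sh_H[OF cD] by simp
  also have "\<dots> \<le> nm (W.sh z y) + nm (W.sh z (\<lambda>x. y x - c x))"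
    using nm_triangle[OF W.sh_H[OF y(1)] W.sh_H[OF u], of 1 z "- 1" z] by simp
  also have "\<dots> < \<epsilon> / 2 * nm y + M * \<delta>" using y(3) c(3) by linarith
  also have "\<dots> = \<epsilon> * (nm y - \<delta>)" using \<delta>M by (simp add: algebra_simps)
  also have "\<dots> \<le> \<epsilon> * nm c" using nc \<epsilon> by simp
  finally have lt: "nm (W.sh z c) < \<epsilon> * nm c" .
  have "0 < \<epsilon> * nm c" using le_less_trans[OF nm_nonneg lt] .
  then have "nm c > 0" using \<epsilon> by (simp add: zero_less_mult_iff)
  then show ?thesis using lt c(1) by blast
qed

end

section \<open>Spectral inclusion\<close>

context weighted_l2
begin

lemma nm_sq_integral:
  assumes f: "f \<in> H"
  shows "(nm f)\<^sup>2 = set_lebesgue_integral lebesgue E (\<lambda>x. (cmod (f x))\<^sup>2 * coef_w K x)"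
proof -
  have "coef_w K x *\<^sub>R (f x * cnj (f x)) = complex_of_real ((cmod (f x))\<^sup>2 * coef_w K x)" for x
    by (simp only: complex_norm_square[symmetric] scaleR_conv_of_real of_real_mult mult.commute)
  then have "ip f f = set_lebesgue_integral lebesgue E (\<lambda>x. complex_of_real ((cmod (f x))\<^sup>2 * coef_w K x))"
    unfolding inner_w_def by presburger
  also have "\<dots> = complex_of_real (set_lebesgue_integral lebesgue E (\<lambda>x. (cmod (f x))\<^sup>2 * coef_w K x))"
    by (rule set_integral_complex_of_real)
  finally have "complex_of_real ((nm f)\<^sup>2) = complex_of_real (set_lebesgue_integral lebesgue E (\<lambda>x. (cmod (f x))\<^sup>2 * coef_w K x))"
    using ip_self(1)[OF f] by argo
  then show ?thesis unfolding of_real_eq_iff .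
qed

lemma nm_restrict:
  assumes f: "f \<in> H" and ab': "a' < b'" and sub: "einterval a' b' \<subseteq> E"
  shows "norm_w K a' b' f \<le> nm f"
proof -
  interpret T: weighted_l2 K a' b' by unfold_locales (rule admissible_subset[OF adm ab' sub])
  have f': "f \<in> T.H" by (rule L2w_subset[OF sub f])
  have "set_lebesgue_integral lebesgue T.E (\<lambda>x. (cmod (f x))\<^sup>2 * coef_w K x) \<le> set_lebesgue_integral lebesgue E (\<lambda>x. (cmod (f x))\<^sup>2 * coef_w K x)"
    unfolding set_lebesgue_integral_def
  proof (rule integral_mono_AE)
    show "integrable lebesgue (\<lambda>x. indicat_real T.E x *\<^sub>R ((cmod (f x))\<^sup>2 * coef_w K x))"
      using f' by (simp add: L2w_def set_integrable_def)
    show "integrable lebesgue (\<lambda>x. indicat_real E x *\<^sub>R ((cmod (f x))\<^sup>2 * coef_w K x))"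
      using f by (simp add: L2w_def set_integrable_def)
    show "AE x in lebesgue. indicat_real T.E x *\<^sub>R ((cmod (f x))\<^sup>2 * coef_w K x) \<le> indicat_real E x *\<^sub>R ((cmod (f x))\<^sup>2 * coef_w K x)"
      using w_pos by eventually_elim (use sub in \<open>auto simp: indicator_def\<close>)
  qed
  then have "(T.nm f)\<^sup>2 \<le> (nm f)\<^sup>2" using nm_sq_integral[OF f] T.nm_sq_integral[OF f'] by simp
  then show ?thesis using power2_le_imp_le nm_nonneg by blast
qed

text \<open>A single compact interval works for all larger truncations, so the loss of norm can be
  controlled before the index \<open>j\<close> is chosen.\<close>

lemma nm_restrict_tail:
  assumes f: "f \<in> H" and \<eta>: "\<eta> > 0"
  shows "\<exists>c d. c < d \<and> {c..d} \<subseteq> E \<and> (\<forall>a' b'. a' < b' \<longrightarrow> {c..d} \<subseteq> einterval a' b' \<longrightarrow> einterval a' b' \<subseteq> E \<longrightarrow>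
    (norm_w K a' b' f)\<^sup>2 > (nm f)\<^sup>2 - \<eta>)"
proof -
  let ?g = "\<lambda>x. (cmod (f x))\<^sup>2 * coef_w K x"
  have g: "set_integrable lebesgue E ?g" using f by (simp add: L2w_def)
  obtain c d where "c < d \<and> {c..d} \<subseteq> E \<and> (\<forall>S\<in>sets lebesgue. {c..d} \<subseteq> S \<longrightarrow> S \<subseteq> E \<longrightarrow>
      norm (integral E ?g - integral S ?g) < \<eta>)"
    using set_integral_tail[OF ab g \<eta>] by (elim exE)
  then have cd: "c < d" "{c..d} \<subseteq> E"
    and tail: "\<And>S. S \<in> sets lebesgue \<Longrightarrow> {c..d} \<subseteq> S \<Longrightarrow> S \<subseteq> E \<Longrightarrow> norm (integral E ?g - integral S ?g) < \<eta>"
    by simp_all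
  have "(norm_w K a' b' f)\<^sup>2 > (nm f)\<^sup>2 - \<eta>"
    if ab': "a' < b'" and sub: "{c..d} \<subseteq> einterval a' b'" "einterval a' b' \<subseteq> E" for a' b'
  proof -
    interpret T: weighted_l2 K a' b' by unfold_locales (rule admissible_subset[OF adm ab' sub(2)])
    have f': "f \<in> T.H" by (rule L2w_subset[OF sub(2) f])
    then have g': "set_integrable lebesgue T.E ?g" by (simp add: L2w_def)
    have "norm (integral E ?g - integral T.E ?g) < \<eta>" by (rule tail[OF T.E_sets sub])
    then show ?thesis
      using nm_sq_integral[OF f] T.nm_sq_integral[OF f'] set_lebesgue_integral_eq_integral(2)[OF g]
        set_lebesgue_integral_eq_integral(2)[OF g'] by (simp add: abs_less_iff)
  qed
  then show ?thesis using cd by blast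
qed

text \<open>An element of \<open>D_max\<close> is continuous, so vanishing almost everywhere means
  vanishing on \<open>(a,b)\<close>, and then its system is the zero system.\<close>

lemma D_max_zero:
  assumes y: "y \<in> D_max K a b" and 0: "ae_eq a b y (\<lambda>x. 0)"
  shows "ae_eq a b (L y) (\<lambda>x. 0)"
proof -
  have y0: "qd K a b y 0 = y" by (rule qd_qsys_on(2)[OF adm DmaxD(1)[OF y]])
  have Y: "qsys_on K a b (L y) (qd K a b y)" by (rule qd_qsys_on(1)[OF adm DmaxD(1)[OF y]])
  have "y x = 0" if x: "x \<in> E" for x
  proof -
    obtain c d where cd: "c < x" "x < d" "{c..d} \<subseteq> E" using einterval_nbhd[OF x] by blast
    have "continuous_on {c..d} y"
      using qsys_continuous_on(1)[OF qsys_onD[OF Y _ cd(3)]] cd y0 by simp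
    moreover have "AE x in lebesgue. x \<in> {c<..<d} \<longrightarrow> y x = (\<lambda>x. 0) x"
      using 0 unfolding ae_eq_def by eventually_elim (use cd(3) in \<open>auto simp: subset_eq\<close>)
    ultimately show ?thesis
      using continuous_AE_eq[of c d y "\<lambda>x. 0" x] cd by simp
  qed
  then have "AE x in lebesgue. x \<in> E \<longrightarrow> L y x = (\<lambda>x. 0) x"
    by (intro qsys_on_determined(2)[OF adm Y, of "\<lambda>x. 0" "\<lambda>k x. 0"]) (simp_all add: qsys_on_def qsys_zero y0)
  then show ?thesis by (simp add: ae_eq_def)
qed

end

section \<open>The truncated operators\<close>

lemma regular_on_admissible:
  assumes r: "regular_on K c d"
  shows "admissible K (ereal c) (ereal d)"
proof -
  have "locally_integrable (ereal c) (ereal d) f" if f: "f absolutely_integrable_on {c..d}" for f :: "real \<Rightarrow> real"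
    unfolding locally_integrable_def
  proof (intro allI impI)
    fix u v assume uv: "{u..v} \<subseteq> einterval (ereal c) (ereal d)"
    show "f absolutely_integrable_on {u..v}"
      by (rule set_integrable_subset[OF f]) (use uv in \<open>auto simp: einterval_def subset_eq less_imp_le\<close>)
  qed
  moreover have "einterval (ereal c) (ereal d) = {c<..<d}" by (auto simp: einterval_def)
  ultimately show ?thesis using r by (simp add: regular_on_def admissible_def)
qed

text \<open>All four kinds of endpoint are reduced to one datum: an isotropic space of boundary
  values at each end of a regular interval.\<close>

locale truncated =
  fixes K :: coeffs and c d :: real and Ba Bb :: "(nat \<Rightarrow> real \<Rightarrow> complex) \<Rightarrow> bool" and Va Vb :: "quad set"
  assumes reg: "regular_on K c d" and Va: "isotropic Va" and Vb: "isotropic Vb"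
    and Ba: "\<And>Y q. (quad Y \<longlongrightarrow> q) (lower_end (ereal c)) \<Longrightarrow> Ba Y \<longleftrightarrow> q \<in> Va"
    and Bb: "\<And>Y q. (quad Y \<longlongrightarrow> q) (upper_end (ereal d)) \<Longrightarrow> Bb Y \<longleftrightarrow> q \<in> Vb"
begin

sublocale weighted_l2 K "ereal c" "ereal d" by unfold_locales (rule regular_on_admissible[OF reg])
sublocale lo: endpoint K "ereal c" "ereal d" "ereal c" "lower_end (ereal c)" "upper_end (ereal d)" lower_end by unfold_locales simp
sublocale up: endpoint K "ereal c" "ereal d" "ereal d" "upper_end (ereal d)" "lower_end (ereal c)" upper_end by unfold_locales simp

abbreviation "Dt \<equiv> op_domain K (ereal c) (ereal d) Ba Bb"

lemma limits:
  assumes "y \<in> D_max K (ereal c) (ereal d)"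
  shows "\<exists>q. (lo.Q y \<longlongrightarrow> q) (lower_end (ereal c))" "\<exists>q. (lo.Q y \<longlongrightarrow> q) (upper_end (ereal d))"
  using D_max_limits[OF adm reg subset_refl assms] by (simp_all add: lower_end_ereal upper_end_ereal)

lemma domain_eq:
  "Dt = {y \<in> D_max K (ereal c) (ereal d). \<exists>q\<in>Va. (lo.Q y \<longlongrightarrow> q) (lower_end (ereal c))}
      \<inter> {y \<in> D_max K (ereal c) (ereal d). \<exists>q\<in>Vb. (lo.Q y \<longlongrightarrow> q) (upper_end (ereal d))}"
proof -
  have "Ba (qd K (ereal c) (ereal d) y) \<longleftrightarrow> (\<exists>q\<in>Va. (lo.Q y \<longlongrightarrow> q) (lower_end (ereal c)))"
    "Bb (qd K (ereal c) (ereal d) y) \<longleftrightarrow> (\<exists>q\<in>Vb. (lo.Q y \<longlongrightarrow> q) (upper_end (ereal d)))"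
    if y: "y \<in> D_max K (ereal c) (ereal d)" for y
    using limits[OF y] Ba Bb by blast+
  then show ?thesis unfolding op_domain_def by blast
qed

text \<open>Boundary limits of any two domain elements lie in a common isotropic space, so both
  boundary terms in Green's formula vanish.\<close>

sublocale S: symmetric_operator K "ereal c" "ereal d" Dt
proof unfold_locales
  have g: "germ_space (lower_end (ereal c)) {y \<in> D_max K (ereal c) (ereal d). \<exists>q\<in>Va. (lo.Q y \<longlongrightarrow> q) (lower_end (ereal c))}"
    "germ_space (upper_end (ereal d)) {y \<in> D_max K (ereal c) (ereal d). \<exists>q\<in>Vb. (lo.Q y \<longlongrightarrow> q) (upper_end (ereal d))}"
    using lo.germ_space_limit[OF _ limits(1)] up.germ_space_limit[OF _ limits(2)] Va Vb by (simp_all add: isotropic_def)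
  show "Dt \<subseteq> D_max K (ereal c) (ereal d)" by (auto simp: op_domain_def)
  have "(\<lambda>x. 0) \<in> Dt" unfolding domain_eq using g unfolding germ_space_def by (elim conjE) (rule IntI)
  then show "Dt \<noteq> {}" by blast
  show "(\<lambda>x. \<alpha> * y x + \<beta> * z x) \<in> Dt" if "y \<in> Dt" "z \<in> Dt" for \<alpha> \<beta> y z
    using that g unfolding domain_eq germ_space_def by (elim conjE IntE) (intro IntI; simp only:)
  show "ip (L y) z = ip y (L z)" if yz: "y \<in> Dt" "z \<in> Dt" for y z
  proof -
    have D: "y \<in> D_max K (ereal c) (ereal d)" "z \<in> D_max K (ereal c) (ereal d)" using yz by (simp_all add: op_domain_def)
    obtain q q' where q: "q \<in> Va" "(lo.Q y \<longlongrightarrow> q) (lower_end (ereal c))" "q' \<in> Va" "(lo.Q z \<longlongrightarrow> q') (lower_end (ereal c))"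
      using yz unfolding domain_eq by blast
    obtain r r' where r: "r \<in> Vb" "(lo.Q y \<longlongrightarrow> r) (upper_end (ereal d))" "r' \<in> Vb" "(lo.Q z \<longlongrightarrow> r') (upper_end (ereal d))"
      using yz unfolding domain_eq by blast
    let ?b = "bracket (qd K (ereal c) (ereal d) y) (qd K (ereal c) (ereal d) z)"
    have "sform q q' = 0" "sform r r' = 0" using q(1,3) r(1,3) Va Vb by (auto simp: isotropic_def)
    then have "(?b \<longlongrightarrow> 0) (lower_end (ereal c))" "(?b \<longlongrightarrow> 0) (upper_end (ereal d))"
      using tendsto_sform[OF q(2,4)] tendsto_sform[OF r(2,4)] by (simp_all add: bracket_sform[abs_def])
    moreover obtain A B where "(?b \<longlongrightarrow> A) (lower_end (ereal c))" "(?b \<longlongrightarrow> B) (upper_end (ereal d))"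
      "ip (L y) z - ip y (L z) = B - A" using green[OF D] by blast
    ultimately show ?thesis
      using tendsto_unique[OF lo.F_ne(1)] tendsto_unique[OF lo.F_ne(2)] by (metis diff_self eq_iff_diff_eq_0)
  qed
qed

lemma one_H: "(\<lambda>x. 1) \<in> H"
proof -
  have "set_integrable lebesgue E (coef_w K)"
    using reg unfolding regular_on_def
    by (elim conjE) (rule set_integrable_subset[of _ "{c..d}"], auto simp: einterval_def)
  moreover have "(\<lambda>x. indicat_real E x *\<^sub>R (1::complex)) \<in> borel_measurable lebesgue"
    by (intro borel_measurable_scaleR borel_measurable_indicator E_sets borel_measurable_const)
  ultimately show ?thesis by (simp add: L2w_def set_borel_measurable_def)
qed

text \<open>If 0 is in the resolvent set, solve \<open>\<ell> y = 1\<close>. This \<open>y\<close>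
  is nonzero, so it is an approximate eigenvector for 0 with some finite error, and a point of the
  spectrum lies within that error. The result provides values for the early indices of the
  sequence.\<close>

lemma spectrum_nonempty: "Sp K (ereal c) (ereal d) Dt \<noteq> {}"
proof (cases "0 \<in> resolvent_set K (ereal c) (ereal d) Dt")
  case True
  obtain y where y: "y \<in> Dt" "ae_eq (ereal c) (ereal d) (S.sh 0 y) (\<lambda>x. 1)"
    using True one_H unfolding S.resolvent_iff by blast
  have "nm y \<noteq> 0"
  proof
    assume "nm y = 0"
    from D_max_zero[OF _ nm_zero_imp[OF S.D_H(1)[OF y(1)] this]] y(1)
    have "ae_eq (ereal c) (ereal d) (L y) (\<lambda>x. 0)" by (simp add: op_domain_def)
    then have "AE x in lebesgue. x \<in> {c<..<d} \<longrightarrow> (1::complex) = 0"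
      using y(2) unfolding ae_eq_def by eventually_elim (auto simp: S.sh_def einterval_def)
    moreover have "c < d" using reg by (simp add: regular_on_def)
    ultimately have "(1::complex) = 0"
      using continuous_AE_eq[of c d "\<lambda>_. 1" "\<lambda>_. 0" c] by simp
    then show False by simp
  qed
  then have "nm y > 0" using nm_nonneg[of y] by linarith
  then show ?thesis using S.spectrum_near[OF y(1), of 0 "nm (S.sh 0 y) / nm y"] by auto
next
  case False
  then show ?thesis by (auto simp: Sp_def)
qed

end

text \<open>One sequence has to serve every \<open>\<epsilon>\<close>, so \<open>\<mu> j\<close> is
  chosen almost nearest to \<open>z\<close> in \<open>S j\<close>, with an excess that tends to
  0.\<close>

lemma nearest_sequence:
  fixes S :: "nat \<Rightarrow> complex set"
  assumes ne: "\<And>j. j \<ge> N \<Longrightarrow> S j \<noteq> {}"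
    and near: "\<And>\<epsilon>. \<epsilon> > 0 \<Longrightarrow> eventually (\<lambda>j. \<exists>\<mu>\<in>S j. dist z \<mu> \<le> \<epsilon>) sequentially"
  shows "\<exists>\<mu>. (\<forall>j\<ge>N. \<mu> j \<in> S j) \<and> \<mu> \<longlonglongrightarrow> z"
proof -
  have "\<exists>\<mu>\<in>S j. dist z \<mu> < infdist z (S j) + inverse (real (Suc j))" if "j \<ge> N" for j
  proof -
    have "(INF x\<in>S j. dist z x) < infdist z (S j) + inverse (real (Suc j))"
      using infdist_notempty[OF ne[OF that]] by simp
    then show ?thesis using ne[OF that] by (subst (asm) cINF_less_iff) auto
  qed
  then obtain \<mu> where \<mu>: "\<And>j. j \<ge> N \<Longrightarrow> \<mu> j \<in> S j \<and> dist z (\<mu> j) < infdist z (S j) + inverse (real (Suc j))" by metis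
  have "\<mu> \<longlonglongrightarrow> z"
  proof (rule tendstoI)
    fix \<epsilon> :: real assume \<epsilon>: "\<epsilon> > 0"
    have "eventually (\<lambda>j. inverse (real (Suc j)) < \<epsilon> / 2) sequentially"
      by (rule order_tendstoD(2)[OF LIMSEQ_inverse_real_of_nat]) (use \<epsilon> in simp)
    moreover have "eventually (\<lambda>j. \<exists>\<mu>\<in>S j. dist z \<mu> \<le> \<epsilon> / 2) sequentially" by (rule near) (use \<epsilon> in simp)
    ultimately show "eventually (\<lambda>j. dist (\<mu> j) z < \<epsilon>) sequentially"
      using eventually_ge_at_top[of N]
    proof eventually_elim
      case (elim j)
      have "infdist z (S j) \<le> \<epsilon> / 2" using elim(2) infdist_le by (meson order_trans)
      then show ?case using \<mu>[OF elim(3)] elim(1) by (simp add: dist_commute)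
    qed
  qed
  then show ?thesis using \<mu> by blast
qed

theorem corollary1:
  fixes K :: coeffs and a b :: ereal and ta tb :: "nat \<Rightarrow> real" and N :: nat
    and Ba Bb :: "(nat \<Rightarrow> real \<Rightarrow> complex) \<Rightarrow> bool"
    and Bat Bbt :: "nat \<Rightarrow> (nat \<Rightarrow> real \<Rightarrow> complex) \<Rightarrow> bool"
  assumes "admissible K a b"
    and "\<And>j. ta j < tb j"
    and "endpoint_setting K a b a (lower_end a) (upper_end b) ta (\<lambda>j. lower_end (ereal (ta j))) N Ba Bat"
    and "endpoint_setting K a b b (upper_end b) (lower_end a) tb (\<lambda>j. upper_end (ereal (tb j))) N Bb Bbt"
    and "self_adjoint K a b (op_domain K a b Ba Bb)"
  shows "\<forall>z \<in> Sp K a b (op_domain K a b Ba Bb).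
           \<exists>\<mu> :: nat \<Rightarrow> complex.
             (\<forall>j\<ge>N. \<mu> j \<in> Sp K (ereal (ta j)) (ereal (tb j))
                            (op_domain K (ereal (ta j)) (ereal (tb j)) (Bat j) (Bbt j))) \<and>
             \<mu> \<longlonglongrightarrow> z"
proof
  fix z assume z: "z \<in> Sp K a b (op_domain K a b Ba Bb)"
  interpret weighted_l2 K a b by unfold_locales (rule assms(1))
  interpret lo: endpoint K a b a "lower_end a" "upper_end b" lower_end by unfold_locales simp
  interpret up: endpoint K a b b "upper_end b" "lower_end a" upper_end by unfold_locales simp
  let ?Sa = "{y \<in> D_max K a b. Ba (qd K a b y)}" and ?Sb = "{y \<in> D_max K a b. Bb (qd K a b y)}"
  obtain Pa Va where "lo.reduces (\<lambda>j. lower_end (ereal (ta j))) N Ba Bat Pa Va"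
    using lo.endpoint_setting_reduces[OF assms(3)] by blast
  then have gSa: "germ_space (lower_end a) ?Sa" and gPa: "germ_space (lower_end a) Pa" and PSa: "Pa \<subseteq> ?Sa"
    and alta: "?Sa \<subseteq> Pa \<or> (\<forall>g\<in>D_max K a b. (\<forall>c\<in>Pa. eventually (\<lambda>x. c x = 0) (upper_end b) \<longrightarrow>
        (bracket (qd K a b c) (qd K a b g) \<longlongrightarrow> 0) (lower_end a)) \<longrightarrow> Ba (qd K a b g))"
    and isoa: "\<And>j. j \<ge> N \<Longrightarrow> isotropic (Va j)"
    and Va: "\<And>j Y q. j \<ge> N \<Longrightarrow> (quad Y \<longlongrightarrow> q) (lower_end (ereal (ta j))) \<Longrightarrow> Bat j Y \<longleftrightarrow> q \<in> Va j"
    and Pa: "\<And>y. y \<in> Pa \<Longrightarrow> eventually (\<lambda>j. \<exists>q\<in>Va j. (lo.Q y \<longlongrightarrow> q) (lower_end (ereal (ta j)))) sequentially"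
    unfolding lo.reduces_def by (elim conjE; simp only:; fail)+
  obtain Pb Vb where "up.reduces (\<lambda>j. upper_end (ereal (tb j))) N Bb Bbt Pb Vb"
    using up.endpoint_setting_reduces[OF assms(4)] by blast
  then have gSb: "germ_space (upper_end b) ?Sb" and gPb: "germ_space (upper_end b) Pb" and PSb: "Pb \<subseteq> ?Sb"
    and altb: "?Sb \<subseteq> Pb \<or> (\<forall>g\<in>D_max K a b. (\<forall>c\<in>Pb. eventually (\<lambda>x. c x = 0) (lower_end a) \<longrightarrow>
        (bracket (qd K a b c) (qd K a b g) \<longlongrightarrow> 0) (upper_end b)) \<longrightarrow> Bb (qd K a b g))"
    and isob: "\<And>j. j \<ge> N \<Longrightarrow> isotropic (Vb j)"
    and Vb: "\<And>j Y q. j \<ge> N \<Longrightarrow> (quad Y \<longlongrightarrow> q) (upper_end (ereal (tb j))) \<Longrightarrow> Bbt j Y \<longleftrightarrow> q \<in> Vb j"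
    and Pb: "\<And>y. y \<in> Pb \<Longrightarrow> eventually (\<lambda>j. \<exists>q\<in>Vb j. (lo.Q y \<longlongrightarrow> q) (upper_end (ereal (tb j)))) sequentially"
    unfolding up.reduces_def by (elim conjE; simp only:; fail)+
  have dom: "op_domain K a b Ba Bb = ?Sa \<inter> ?Sb" by (auto simp: op_domain_def)
  interpret C: core_setting K a b ?Sa ?Sb Pa Pb
  proof unfold_locales
    show "?Sa \<subseteq> Pa \<or> (\<forall>g\<in>D_max K a b. (\<forall>c\<in>Pa. eventually (\<lambda>x. c x = 0) (upper_end b) \<longrightarrow>
        (bracket (qd K a b c) (qd K a b g) \<longlongrightarrow> 0) (lower_end a)) \<longrightarrow> g \<in> ?Sa)" using alta by simp
    show "?Sb \<subseteq> Pb \<or> (\<forall>g\<in>D_max K a b. (\<forall>c\<in>Pb. eventually (\<lambda>x. c x = 0) (lower_end a) \<longrightarrow>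
        (bracket (qd K a b c) (qd K a b g) \<longlongrightarrow> 0) (upper_end b)) \<longrightarrow> g \<in> ?Sb)" using altb by simp
    show "self_adjoint K a b (?Sa \<inter> ?Sb)" using assms(5) unfolding dom .
  qed (fact gSa gPa PSa gSb gPb PSb)+
  have z': "z \<in> Sp K a b (?Sa \<inter> ?Sb)" using z unfolding dom .
  \<comment> \<open>The spectrum of the self-adjoint L is real, as required for the search near a
    real point in the symmetric truncated operators.\<close>
  have zR: "z = complex_of_real (Re z)" using C.W.self_adjoint_spectrum(1)[OF C.sa z'] by (simp add: complex_eq_iff)
  have reg: "regular_on K (ta j) (tb j)" "einterval (ereal (ta j)) (ereal (tb j)) \<subseteq> E" for j
    using regular_on_truncation[OF adm assms(2) lo.endpoint_setting_truncation(1)[OF assms(3)] up.endpoint_setting_truncation(1)[OF assms(4)]] .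
  have trunc: "truncated K (ta j) (tb j) (Bat j) (Bbt j) (Va j) (Vb j)" if "j \<ge> N" for j
    by unfold_locales (use reg(1) isoa isob Va Vb that in auto)
  let ?S = "\<lambda>j. Sp K (ereal (ta j)) (ereal (tb j)) (op_domain K (ereal (ta j)) (ereal (tb j)) (Bat j) (Bbt j))"
  show "\<exists>\<mu>. (\<forall>j\<ge>N. \<mu> j \<in> ?S j) \<and> \<mu> \<longlonglongrightarrow> z"
  proof (rule nearest_sequence)
    show "?S j \<noteq> {}" if "j \<ge> N" for j using truncated.spectrum_nonempty[OF trunc[OF that]] .
    fix \<epsilon> :: real assume \<epsilon>: "\<epsilon> > 0"
    \<comment> \<open>Half of \<open>\<epsilon>\<close> is kept in reserve, because restricting
      \<open>y\<close> may cost half of its norm.\<close>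
    obtain y where y: "y \<in> Pa" "y \<in> Pb" and ny: "nm y > 0" and sy: "nm (C.W.sh z y) < \<epsilon> / 2 * nm y"
      using C.core_approximation[OF z', of "\<epsilon> / 2"] \<epsilon> by auto
    have yD: "y \<in> D_max K a b" using y PSa by blast
    have yS: "y \<in> ?Sa \<inter> ?Sb" using y PSa PSb by blast
    \<comment> \<open>Losing at most three quarters of the squared norm leaves at least half of the
      norm on every late truncated interval.\<close>
    obtain c d where cd: "c < d" "{c..d} \<subseteq> E"
      and tail: "\<And>a' b'. a' < b' \<Longrightarrow> {c..d} \<subseteq> einterval a' b' \<Longrightarrow> einterval a' b' \<subseteq> E \<Longrightarrow>
        (norm_w K a' b' y)\<^sup>2 > (nm y)\<^sup>2 - 3 / 4 * (nm y)\<^sup>2"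
      using nm_restrict_tail[OF DmaxD(2)[OF yD], of "3 / 4 * (nm y)\<^sup>2"] ny by auto
    have ac: "a < ereal c" "ereal d < b" using cd Icc_subset_einterval[of c d a b] by auto
    have ev: "eventually (\<lambda>j. ereal (ta j) < ereal c) sequentially" "eventually (\<lambda>j. ereal d < ereal (tb j)) sequentially"
      using order_tendstoD(2)[OF lo.endpoint_setting_truncation(2)[OF assms(3)] ac(1)]
        order_tendstoD(1)[OF up.endpoint_setting_truncation(2)[OF assms(4)] ac(2)] .
    show "eventually (\<lambda>j. \<exists>\<mu>\<in>?S j. dist z \<mu> \<le> \<epsilon>) sequentially"
      using ev Pa[OF y(1)] Pb[OF y(2)] eventually_ge_at_top[of N]
    proof eventually_elim
      case (elim j)
      interpret T: truncated K "ta j" "tb j" "Bat j" "Bbt j" "Va j" "Vb j" by (rule trunc[OF elim(5)])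
      have less: "ereal (ta j) < ereal (tb j)" using assms(2) by simp
      note restrict = qd_restrict[OF adm less reg(2) DmaxD(1)[OF yD]]
      have yT: "y \<in> D_max K (ereal (ta j)) (ereal (tb j))" by (rule D_max_subset[OF adm less reg(2) yD])
      \<comment> \<open>The core controls the quasi-derivatives chosen on \<open>(a,b)\<close>, the
        domain of the truncated operator those chosen on the smaller interval. They agree inside it,
        so the boundary limits carry over.\<close>
      have eq: "eventually (\<lambda>x. lo.Q y x = T.lo.Q y x) (lower_end (ereal (ta j)))"
        "eventually (\<lambda>x. lo.Q y x = T.lo.Q y x) (upper_end (ereal (tb j)))"
        using T.lo.ev_E restrict(2) by (auto elim: eventually_mono)
      obtain qa qb where q: "qa \<in> Va j" "(lo.Q y \<longlongrightarrow> qa) (lower_end (ereal (ta j)))"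
        "qb \<in> Vb j" "(lo.Q y \<longlongrightarrow> qb) (upper_end (ereal (tb j)))" using elim(3,4) by blast
      have "y \<in> T.Dt"
        unfolding T.domain_eq using yT q Lim_transform_eventually[OF q(2) eq(1)] Lim_transform_eventually[OF q(4) eq(2)] by blast
      moreover have half: "T.nm y \<ge> nm y / 2"
      proof -
        have "{c..d} \<subseteq> T.E" using elim(1,2) by (auto simp: einterval_def)
        from tail[OF less this reg(2)] have "(nm y / 2)\<^sup>2 \<le> (T.nm y)\<^sup>2" by (simp add: power_divide)
        then show ?thesis by (rule power2_le_imp_le) simp
      qed
      moreover have "T.nm (T.S.sh (complex_of_real (Re z)) y) \<le> \<epsilon> * T.nm y"
      proof -
        have "ae_eq (ereal (ta j)) (ereal (tb j)) (T.S.sh z y) (C.W.sh z y)"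
          using restrict(3) unfolding ae_eq_def by eventually_elim (simp add: T.S.sh_def C.W.sh_def)
        then have "T.nm (T.S.sh z y) = T.nm (C.W.sh z y)" by (rule T.nm_cong[OF T.S.sh_H[OF \<open>y \<in> T.Dt\<close>]])
        \<comment> \<open>Restriction can only decrease the residual, while \<open>half\<close>
          bounds the norm of \<open>y\<close> from below.\<close>
        also have "\<dots> \<le> nm (C.W.sh z y)" by (rule nm_restrict[OF C.W.sh_H[OF yS] less reg(2)])
        also have "\<dots> \<le> \<epsilon> / 2 * nm y" using sy by simp
        also have "\<dots> \<le> \<epsilon> * T.nm y" using mult_left_mono[OF half, of \<epsilon>] \<epsilon> by simp
        finally show ?thesis using zR by simp
      qed
      ultimately obtain \<mu> where "\<mu> \<in> ?S j" "cmod (\<mu> - complex_of_real (Re z)) \<le> \<epsilon>"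
        using T.S.spectrum_near[of y "Re z" \<epsilon>] ny by auto
      then show ?case using zR by (intro bexI[of _ \<mu>]) (simp_all add: dist_norm norm_minus_commute)
    qed
  qed
qed

end
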